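(* Let Assumption AC, Assumption B and the embedding chain $V_A \hookrightarrow V_B \hookrightarrow H = H^* \hookrightarrow V_B^* \hookrightarrow V_A^*$ (all stated in the context) hold. Let $u_0\in L^2(\Omega;V_B)$ and $v_0\in L^2(\Omega;H)$ be $\mathcal{F}_0$-measurable and $f\in\mathcal{L}^q(V_A^* )$. Let $v_1$ and $v_2$ be two solutions (in the sense defined in the context) of $$v(t) + \int_0^t \big[Av(s) + B\big(u_0 + (Kv)(s)\big)\big]ds = v_0 + \int_0^t f(s)\,ds + \int_0^t C\big(u_0+(Kv)(s),v(s)\big)\,dW(s),\quad t\in[0,T].$$ Then $$\mathbb{P}\Big(\max_{t\in[0,T]}|v_1(t)-v_2(t)|=0\Big)=1,$$ i.e. $v_1$ and $v_2$ are indistinguishable. Moreover, if $u_1=u_0+Kv_1$ and $u_2=u_0+Kv_2$, then $$\mathbb{P}\Big(\max_{t\in[0,T]}\|u_1(t)-u_2(t)\|_{V_B}=0\Big)=1,$$ i.e. $u_1$ and $u_2$ are also indistinguishable.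
   Context: Spaces. $T>0$, $p\in[2,\infty)$, $q=p/(p-1)$. $(H,(\cdot,\cdot),|\cdot|)$ is a real separable Hilbert space identified with its dual; $(V_A,\|\cdot\|_{V_A})$ and $(V_B,\|\cdot\|_{V_B})$ are real, reflexive, separable Banach spaces densely and continuously embedded in $H$; $\hookrightarrow$ denotes dense continuous embedding; $\langle\cdot,\cdot\rangle$ denotes the duality pairing between a Banach space and its dual. $l^2(H)$ is the Hilbert space of sequences $h=(h_j)_{j\in\mathbb{N}}$ in $H$ with $\sum_j|h_j|^2<\infty$, with $(g,h)_{l^2(H)}=\sum_j(g_j,h_j)$ and norm $|\cdot|_{l^2(H)}$. Probability. $(\Omega,\mathcal{F},(\mathcal{F}_t)_{t\in[0,T]},\mathbb{P})$ is a stochastic basis: complete probability space, $\mathcal{F}_0$ contains all null sets of $\mathcal{F}$, the filtration is right-continuous. $W=(W_j)_{j\in\mathbb{N}}$ is an infinite dimensional Wiener process (independent standard real Wiener processes $W_j$) adapted to $(\mathcal{F}_t)$ with $W(t+h)-W(t)$ independent of $\mathcal{F}_t$ for all $t,h\ge0$. For $l^2(H)$-valued integrands $\int_0^t g(s)\,dW(s)=\sum_j\int_0^t g_j(s)\,dW_j(s)$ (It\^o); for an $H$-valued $x$, $\int_0^t(x(s),y(s)dW(s))=\sum_j\int_0^t(x(s),y_j(s))\,dW_j(s)$. $\mathcal{L}^\gamma(X)$ is the subspace of $L^\gamma((0,T)\times\Omega;X)$ of (classes of) progressively measurable processes. $(Kw)(t)=\int_0^t w(s)\,ds$. Weak measurability: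 $D:X\times\Omega\to X^*$ is weakly $\mathcal{G}$-measurable if $\langle Dw,z\rangle$ is $\mathcal{G}$-measurable for all $w,z\in X$; analogously for $C$ below, via the pairing of $C(u,w)$ with fixed elements of $l^2(H)$. Assumption B. $B:V_B\times\Omega\to V_B^*$ is weakly $\mathcal{F}_0$-measurable and, almost surely, linear and symmetric, and there are constants $\mu_B,c_B>0$ such that, almost surely, $\langle Bw,w\rangle\ge\mu_B\|w\|_{V_B}^2$ and $\|Bw\|_{V_B^*}\le c_B\|w\|_{V_B}$ for all $w\in V_B$. Put $(w,z)_B=\langle Bw,z\rangle$, $|w|_B=(w,w)_B^{1/2}$. Assumption AC. $A:V_A\times\Omega\to V_A^*$ and $C=(C_j)_{j\in\mathbb{N}}:V_B\times V_A\times\Omega\to l^2(H)$ are weakly $\mathcal{F}_0$-measurable. Almost surely $A$ is hemicontinuous: outside a null set, $\epsilon\mapsto\langle A(w+\epsilon z,\omega),v\rangle$ is continuous on $[0,1]$ for all $v,w,z\in V_A$. There is $c_A>0$ with, almost surely, $\|Aw\|_{V_A^*}\le c_A(1+\|w\|_{V_A})^{p-1}$ for all $w\in V_A$. There are $\mu_A>0$, $\lambda_A,\lambda_B,\kappa\ge0$ such that, almost surely, for all $w,z\in V_A$ and $u,v\in V_B$, $$\langle Aw-Az,w-z\rangle+\lambda_A|w-z|^2\ge\tfrac12|C(u,w)-C(v,z)|_{l^2(H)}^2-\lambda_B|u-v|_B^2,$$ $$\langle Aw,w\rangle+\lambda_A|w|^2\ge\mu_A\|w\|_{V_A}^p+\tfrac12|C(u,w)|_{l^2(H)}^2-\lambda_B|u|_B^2-\kappa.$$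 Solution. $v\in\mathcal{L}^p(V_A)$ is a solution if $u_0+Kv\in\mathcal{L}^2(V_B)$, $v$ has an $H$-valued continuous modification (i.e. a process equal to $v$ for $dt\times d\mathbb{P}$-almost all $(t,\omega)$ with almost all paths continuous from $[0,T]$ into $H$), again denoted $v$ (in particular in pointwise-in-time statements about $v$), and $\mathbb{P}$-almost everywhere, for all $t\in[0,T]$ and all $z\in V_A$, $$(v(t),z)+\int_0^t\langle Av(s)+B(u_0+(Kv)(s)),z\rangle ds=(v_0,z)+\int_0^t\langle f(s),z\rangle ds+\int_0^t\big(z,C(u_0+(Kv)(s),v(s))\,dW(s)\big),$$ where inside the integrals $v$ is the $V_A$-valued process. *)

theory Defs
  imports "HOL-Probability.Probability"
begin

section \<open>Spaces\<close>

text \<open>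
  A real separable Hilbert space is a type of sort
  \<open>{real_inner, complete_space, second_countable_topology}\<close>, a real separable Banach space one of
  sort \<open>{banach, second_countable_topology}\<close> (for metric spaces, second countable means separable).
  The dual of \<open>'a\<close> is \<open>'a \<Rightarrow>\<^sub>L real\<close> with the operator norm, and the duality pairing of \<open>\<phi>\<close>
  with \<open>z\<close> is \<open>blinfun_apply \<phi> z\<close>, where \<open>blinfun_apply\<close> is an implicit coercion.
\<close>

definition reflexive_space :: "'a::real_normed_vector itself \<Rightarrow> bool" where
  "reflexive_space _ \<longleftrightarrow>
    (\<forall>\<Phi> :: ('a \<Rightarrow>\<^sub>L real) \<Rightarrow>\<^sub>L real. \<exists>x. \<forall>\<phi>. blinfun_apply \<Phi> \<phi> = blinfun_apply \<phi> x)"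

definition dense_embedding :: "('a::real_normed_vector \<Rightarrow> 'b::real_normed_vector) \<Rightarrow> bool" where
  "dense_embedding e \<longleftrightarrow> bounded_linear e \<and> inj e \<and> closure (range e) = UNIV"

text \<open>
  The chain \<open>V\<^sub>A \<hookrightarrow> V\<^sub>B \<hookrightarrow> H = H\<^sup>* \<hookrightarrow> V\<^sub>B\<^sup>* \<hookrightarrow> V\<^sub>A\<^sup>*\<close> with explicit embeddings
  \<open>eA\<close> of \<open>V\<^sub>A\<close> into \<open>V\<^sub>B\<close> and \<open>eB\<close> of \<open>V\<^sub>B\<close> into \<open>H\<close>. The last two embeddings are their
  transposes, where \<open>h\<close> in \<open>H\<close> is identified with the functional \<open>inner h\<close>.
\<close>

definition embedding_chain ::
    "('va::real_normed_vector \<Rightarrow>\<^sub>L 'vb::real_normed_vector) \<Rightarrow> ('vb \<Rightarrow>\<^sub>L 'h::real_inner) \<Rightarrow> bool" where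
  "embedding_chain eA eB \<longleftrightarrow>
     dense_embedding (blinfun_apply eA) \<and>
     dense_embedding (blinfun_apply eB) \<and>
     dense_embedding (\<lambda>h. blinfun_inner_right h o\<^sub>L eB) \<and>
     dense_embedding (\<lambda>\<phi> :: 'vb \<Rightarrow>\<^sub>L real. \<phi> o\<^sub>L eA)"

definition ell2 :: "(nat \<Rightarrow> 'h::real_inner) set" where
  "ell2 = {h. summable (\<lambda>j. (norm (h j))\<^sup>2)}"

definition ell2_inner :: "(nat \<Rightarrow> 'h::real_inner) \<Rightarrow> (nat \<Rightarrow> 'h) \<Rightarrow> real" where
  "ell2_inner g h = (\<Sum>j. inner (g j) (h j))"

definition ell2_norm :: "(nat \<Rightarrow> 'h::real_inner) \<Rightarrow> real" where
  "ell2_norm h = sqrt (\<Sum>j. (norm (h j))\<^sup>2)"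


section \<open>Stochastic basis, Wiener process, process spaces\<close>

text \<open>Only the values \<open>F t\<close>, \<open>t \<in> [0,T]\<close>, of the filtration are relevant.\<close>

locale stochastic_basis = prob_space M + complete_measure M
  for M :: "'w measure" +
  fixes F :: "real \<Rightarrow> 'w measure" and T :: real
  assumes subalgebra_F: "\<And>t. t \<in> {0..T} \<Longrightarrow> subalgebra M (F t)"
    and F_mono: "\<And>s t. 0 \<le> s \<Longrightarrow> s \<le> t \<Longrightarrow> t \<le> T \<Longrightarrow> sets (F s) \<subseteq> sets (F t)"
    and null_sets_F0: "null_sets M \<subseteq> sets (F 0)"
    and F_right_continuous: "\<And>t. 0 \<le> t \<Longrightarrow> t < T \<Longrightarrow> sets (F t) = (\<Inter>s\<in>{t<..T}. sets (F s))"

definition standard_wiener :: "'w measure \<Rightarrow> real \<Rightarrow> (real \<Rightarrow> 'w \<Rightarrow> real) \<Rightarrow> bool" where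
  "standard_wiener M T w \<longleftrightarrow>
     (\<forall>t\<in>{0..T}. w t \<in> borel_measurable M) \<and>
     (AE \<omega> in M. w 0 \<omega> = 0) \<and>
     (AE \<omega> in M. continuous_on {0..T} (\<lambda>t. w t \<omega>)) \<and>
     (\<forall>s t. 0 \<le> s \<and> s < t \<and> t \<le> T \<longrightarrow>
        distributed M lborel (\<lambda>\<omega>. w t \<omega> - w s \<omega>) (normal_density 0 (sqrt (t - s)))) \<and>
     (\<forall>n \<tau>. (\<forall>i\<le>n. \<tau> i \<in> {0..T}) \<and> (\<forall>i<n. \<tau> i < \<tau> (Suc i)) \<longrightarrow>
        prob_space.indep_vars M (\<lambda>_. borel) (\<lambda>i \<omega>. w (\<tau> (Suc i)) \<omega> - w (\<tau> i) \<omega>) {..<n::nat})"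

text \<open>
  The components are independent as random paths on \<open>[0,T]\<close>; the increments over \<open>[t,t+h]\<close>
  are independent of \<open>F t\<close> jointly in all components.
\<close>

definition wiener_process ::
    "'w measure \<Rightarrow> (real \<Rightarrow> 'w measure) \<Rightarrow> real \<Rightarrow> (nat \<Rightarrow> real \<Rightarrow> 'w \<Rightarrow> real) \<Rightarrow> bool" where
  "wiener_process M F T W \<longleftrightarrow>
     (\<forall>j. standard_wiener M T (W j)) \<and>
     prob_space.indep_vars M (\<lambda>_. Pi\<^sub>M {0..T} (\<lambda>_. borel)) (\<lambda>j \<omega>. \<lambda>t\<in>{0..T}. W j t \<omega>) UNIV \<and>
     (\<forall>j. \<forall>t\<in>{0..T}. W j t \<in> borel_measurable (F t)) \<and>
     (\<forall>t h. 0 \<le> t \<and> 0 \<le> h \<and> t + h \<le> T \<longrightarrow>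
        prob_space.indep_set M (sets (F t))
          (sets (vimage_algebra (space M) (\<lambda>\<omega> j. W j (t + h) \<omega> - W j t \<omega>)
             (Pi\<^sub>M UNIV (\<lambda>_. borel)))))"

definition progressive ::
    "(real \<Rightarrow> 'w measure) \<Rightarrow> real \<Rightarrow> (real \<Rightarrow> 'w \<Rightarrow> 'x::topological_space) \<Rightarrow> bool" where
  "progressive F T X \<longleftrightarrow>
     (\<forall>t\<in>{0..T}. (\<lambda>(s, \<omega>). X s \<omega>) \<in> borel_measurable (restrict_space borel {0..t} \<Otimes>\<^sub>M F t))"

definition time_prob :: "'w measure \<Rightarrow> real \<Rightarrow> (real \<times> 'w) measure" where
  "time_prob M T = restrict_space lborel {0..T} \<Otimes>\<^sub>M M"

definition versions ::
    "'w measure \<Rightarrow> real \<Rightarrow> (real \<Rightarrow> 'w \<Rightarrow> 'x) \<Rightarrow> (real \<Rightarrow> 'w \<Rightarrow> 'x) \<Rightarrow> bool" where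
  "versions M T X Y \<longleftrightarrow> (AE (s, \<omega>) in time_prob M T. X s \<omega> = Y s \<omega>)"

text \<open>
  The space \<open>\<L>\<^sup>\<gamma>\<close>. Its elements are equivalence classes, so \<open>X\<close> may be any representative
  of the class of a progressively measurable process \<open>Y\<close>.
\<close>

definition Lproc ::
    "'w measure \<Rightarrow> (real \<Rightarrow> 'w measure) \<Rightarrow> real \<Rightarrow> real \<Rightarrow> (real \<Rightarrow> 'w \<Rightarrow> 'x::real_normed_vector) set" where
  "Lproc M F T \<gamma> = {X. \<exists>Y. progressive F T Y \<and> versions M T X Y \<and>
     (\<integral>\<^sup>+ (s, \<omega>). ennreal (norm (Y s \<omega>) powr \<gamma>) \<partial>time_prob M T) < \<infinity>}"


section \<open>Ito integral\<close>

text \<open>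
  The elementary process with value \<open>\<xi> i\<close> on the interval \<open>(\<tau> i, \<tau> (i + 1)]\<close>, for \<open>i < n\<close>,
  and its integral with respect to a scalar process \<open>w\<close>.
\<close>

definition elementary ::
    "'w measure \<Rightarrow> (real \<Rightarrow> 'w measure) \<Rightarrow> real \<Rightarrow> nat \<Rightarrow> (nat \<Rightarrow> real) \<Rightarrow> (nat \<Rightarrow> 'w \<Rightarrow> real) \<Rightarrow> bool" where
  "elementary M F T n \<tau> \<xi> \<longleftrightarrow>
     (\<forall>i\<le>n. \<tau> i \<in> {0..T}) \<and> (\<forall>i<n. \<tau> i \<le> \<tau> (Suc i)) \<and>
     (\<forall>i<n. \<xi> i \<in> borel_measurable (F (\<tau> i)) \<and> bounded (\<xi> i ` space M))"

definition elem_process ::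
    "nat \<Rightarrow> (nat \<Rightarrow> real) \<Rightarrow> (nat \<Rightarrow> 'w \<Rightarrow> real) \<Rightarrow> real \<Rightarrow> 'w \<Rightarrow> real" where
  "elem_process n \<tau> \<xi> s \<omega> = (\<Sum>i<n. \<xi> i \<omega> * indicator {\<tau> i<..\<tau> (Suc i)} s)"

definition elem_integral ::
    "(real \<Rightarrow> 'w \<Rightarrow> real) \<Rightarrow> nat \<Rightarrow> (nat \<Rightarrow> real) \<Rightarrow> (nat \<Rightarrow> 'w \<Rightarrow> real) \<Rightarrow> real \<Rightarrow> 'w \<Rightarrow> real" where
  "elem_integral w n \<tau> \<xi> t \<omega> = (\<Sum>i<n. \<xi> i \<omega> * (w (min t (\<tau> (Suc i))) \<omega> - w (min t (\<tau> i)) \<omega>))"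

definition continuous_process ::
    "'w measure \<Rightarrow> real \<Rightarrow> (real \<Rightarrow> 'w \<Rightarrow> 'x::topological_space) \<Rightarrow> bool" where
  "continuous_process M T X \<longleftrightarrow>
     (\<forall>t\<in>{0..T}. X t \<in> borel_measurable M) \<and>
     (AE \<omega> in M. continuous_on {0..T} (\<lambda>t. X t \<omega>))"

text \<open>
  \<open>ito_integral M F T w g I\<close>: the process \<open>I\<close> is a continuous version of the process
  \<open>t \<mapsto> \<integral>\<^sub>0\<^sup>t g dw\<close>, the \<open>L\<^sup>2\<close>-limit of the integrals of elementary processes
  approximating \<open>g\<close> in \<open>L\<^sup>2((0,T) \<times> \<Omega>)\<close>. A stochastic integral is determined up to
  indistinguishability only, hence a relation and not a function.
\<close>

definition ito_integral ::
    "'w measure \<Rightarrow> (real \<Rightarrow> 'w measure) \<Rightarrow> real \<Rightarrow> (real \<Rightarrow> 'w \<Rightarrow> real) \<Rightarrow>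
     (real \<Rightarrow> 'w \<Rightarrow> real) \<Rightarrow> (real \<Rightarrow> 'w \<Rightarrow> real) \<Rightarrow> bool" where
  "ito_integral M F T w g I \<longleftrightarrow>
     continuous_process M T I \<and>
     (\<exists>Y n \<tau> \<xi>.
        progressive F T Y \<and> versions M T g Y \<and>
        (\<forall>k::nat. elementary M F T (n k) (\<tau> k) (\<xi> k)) \<and>
        (\<lambda>k. \<integral>\<^sup>+ (s, \<omega>). ennreal ((elem_process (n k) (\<tau> k) (\<xi> k) s \<omega> - Y s \<omega>)\<^sup>2) \<partial>time_prob M T)
           \<longlonglongrightarrow> 0 \<and>
        (\<forall>t\<in>{0..T}.
           (\<lambda>k. \<integral>\<^sup>+ \<omega>. ennreal ((elem_integral w (n k) (\<tau> k) (\<xi> k) t \<omega> - I t \<omega>)\<^sup>2) \<partial>M)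
             \<longlonglongrightarrow> 0))"

text \<open>
  The integral \<open>\<Sum>\<^sub>j \<integral>\<^sub>0\<^sup>t g\<^sub>j dW\<^sub>j\<close> of an \<open>l\<^sup>2\<close>-valued integrand, the series converging
  in \<open>L\<^sup>2(\<Omega>)\<close>; by the Ito isometry this convergence at \<open>t = T\<close> amounts to
  \<open>\<Sum>\<^sub>j E \<integral>\<^sub>0\<^sup>T g\<^sub>j\<^sup>2 ds < \<infinity>\<close>.
\<close>

definition ito_series ::
    "'w measure \<Rightarrow> (real \<Rightarrow> 'w measure) \<Rightarrow> real \<Rightarrow> (nat \<Rightarrow> real \<Rightarrow> 'w \<Rightarrow> real) \<Rightarrow>
     (nat \<Rightarrow> real \<Rightarrow> 'w \<Rightarrow> real) \<Rightarrow> (real \<Rightarrow> 'w \<Rightarrow> real) \<Rightarrow> bool" where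
  "ito_series M F T W g J \<longleftrightarrow>
     continuous_process M T J \<and>
     (\<exists>I. (\<forall>j. ito_integral M F T (W j) (g j) (I j)) \<and>
        (\<forall>t\<in>{0..T}. (\<lambda>m. \<integral>\<^sup>+ \<omega>. ennreal (((\<Sum>j<m. I j t \<omega>) - J t \<omega>)\<^sup>2) \<partial>M) \<longlonglongrightarrow> 0))"


section \<open>Assumptions on the operators\<close>

definition weakly_measurable :: "'w measure \<Rightarrow> ('x::real_normed_vector \<Rightarrow> 'w \<Rightarrow> 'x \<Rightarrow>\<^sub>L real) \<Rightarrow> bool" where
  "weakly_measurable G D \<longleftrightarrow> (\<forall>w z. (\<lambda>\<omega>. blinfun_apply (D w \<omega>) z) \<in> borel_measurable G)"

definition weakly_measurable_ell2 ::
    "'w measure \<Rightarrow> ('x \<Rightarrow> 'y \<Rightarrow> 'w \<Rightarrow> nat \<Rightarrow> 'h::real_inner) \<Rightarrow> bool" where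
  "weakly_measurable_ell2 G C \<longleftrightarrow>
     (\<forall>u w. \<forall>h\<in>ell2. (\<lambda>\<omega>. ell2_inner (C u w \<omega>) h) \<in> borel_measurable G)"

definition B_norm :: "('vb::real_normed_vector \<Rightarrow> 'w \<Rightarrow> 'vb \<Rightarrow>\<^sub>L real) \<Rightarrow> 'w \<Rightarrow> 'vb \<Rightarrow> real" where
  "B_norm B \<omega> w = sqrt (blinfun_apply (B w \<omega>) w)"

definition assumption_B ::
    "'w measure \<Rightarrow> 'w measure \<Rightarrow> ('vb::real_normed_vector \<Rightarrow> 'w \<Rightarrow> 'vb \<Rightarrow>\<^sub>L real) \<Rightarrow> bool" where
  "assumption_B M F0 B \<longleftrightarrow>
     weakly_measurable F0 B \<and>
     (AE \<omega> in M. linear (\<lambda>w. B w \<omega>) \<and> (\<forall>w z. blinfun_apply (B w \<omega>) z = blinfun_apply (B z \<omega>) w)) \<and>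
     (\<exists>\<mu>B>0. \<exists>cB>0. AE \<omega> in M. \<forall>w.
        blinfun_apply (B w \<omega>) w \<ge> \<mu>B * (norm w)\<^sup>2 \<and> norm (B w \<omega>) \<le> cB * norm w)"

definition hemicontinuous :: "('x::real_normed_vector \<Rightarrow> 'x \<Rightarrow>\<^sub>L real) \<Rightarrow> bool" where
  "hemicontinuous a \<longleftrightarrow>
     (\<forall>v w z. continuous_on {0..1::real} (\<lambda>\<epsilon>. blinfun_apply (a (w + \<epsilon> *\<^sub>R z)) v))"

definition assumption_AC ::
    "'w measure \<Rightarrow> 'w measure \<Rightarrow> real \<Rightarrow>
     ('va::real_normed_vector \<Rightarrow>\<^sub>L 'vb::real_normed_vector) \<Rightarrow> ('vb \<Rightarrow>\<^sub>L 'h::real_inner) \<Rightarrow>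
     ('va \<Rightarrow> 'w \<Rightarrow> 'va \<Rightarrow>\<^sub>L real) \<Rightarrow> ('vb \<Rightarrow> 'w \<Rightarrow> 'vb \<Rightarrow>\<^sub>L real) \<Rightarrow>
     ('vb \<Rightarrow> 'va \<Rightarrow> 'w \<Rightarrow> nat \<Rightarrow> 'h) \<Rightarrow> bool" where
  "assumption_AC M F0 p eA eB A B C \<longleftrightarrow>
     weakly_measurable F0 A \<and>
     (\<forall>u w. \<forall>\<omega>\<in>space M. C u w \<omega> \<in> ell2) \<and>
     weakly_measurable_ell2 F0 C \<and>
     (AE \<omega> in M. hemicontinuous (\<lambda>w. A w \<omega>)) \<and>
     (\<exists>cA>0. AE \<omega> in M. \<forall>w. norm (A w \<omega>) \<le> cA * (1 + norm w) powr (p - 1)) \<and>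
     (\<exists>\<mu>A>0. \<exists>lA\<ge>0. \<exists>lB\<ge>0. \<exists>\<kappa>\<ge>0. AE \<omega> in M. \<forall>w z u v.
        blinfun_apply (A w \<omega> - A z \<omega>) (w - z) + lA * (norm (eB (eA (w - z))))\<^sup>2
          \<ge> 1/2 * (ell2_norm (\<lambda>j. C u w \<omega> j - C v z \<omega> j))\<^sup>2 - lB * (B_norm B \<omega> (u - v))\<^sup>2 \<and>
        blinfun_apply (A w \<omega>) w + lA * (norm (eB (eA w)))\<^sup>2
          \<ge> \<mu>A * norm w powr p + 1/2 * (ell2_norm (C u w \<omega>))\<^sup>2
             - lB * (B_norm B \<omega> u)\<^sup>2 - \<kappa>)"


section \<open>Solutions\<close>

text \<open>
  Integrals over time are taken with respect to the completed Lebesgue measure because the paths of a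
  representative of a class in \<open>Lproc\<close> are, almost surely, only almost everywhere equal to Borel functions.
\<close>

definition Kop :: "(real \<Rightarrow> 'x::{banach, second_countable_topology}) \<Rightarrow> real \<Rightarrow> 'x" where
  "Kop w t = (LINT s:{0..t}|lebesgue. w s)"

definition u_of ::
    "('va::{banach, second_countable_topology} \<Rightarrow>\<^sub>L 'vb::real_normed_vector) \<Rightarrow> ('w \<Rightarrow> 'vb) \<Rightarrow>
     (real \<Rightarrow> 'w \<Rightarrow> 'va) \<Rightarrow> real \<Rightarrow> 'w \<Rightarrow> 'vb" where
  "u_of eA u0 v t \<omega> = u0 \<omega> + eA (Kop (\<lambda>s. v s \<omega>) t)"

text \<open>
  A solution is the \<open>V\<^sub>A\<close>-valued process \<open>v\<close> together with its \<open>H\<close>-valued continuous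
  modification \<open>vt\<close>, which is unique up to indistinguishability. For each \<open>z\<close>, the process \<open>J z\<close> is
  a version of the stochastic integral of \<open>(z, C(u,v) dW)\<close>; choosing the versions suitably is what gives
  meaning to an equation that holds almost surely for all (uncountably many) \<open>z\<close> simultaneously.
\<close>

definition solution ::
    "'w measure \<Rightarrow> (real \<Rightarrow> 'w measure) \<Rightarrow> real \<Rightarrow> (nat \<Rightarrow> real \<Rightarrow> 'w \<Rightarrow> real) \<Rightarrow> real \<Rightarrow>
     ('va::{banach, second_countable_topology} \<Rightarrow>\<^sub>L 'vb::real_normed_vector) \<Rightarrow> ('vb \<Rightarrow>\<^sub>L 'h::real_inner) \<Rightarrow>
     ('va \<Rightarrow> 'w \<Rightarrow> 'va \<Rightarrow>\<^sub>L real) \<Rightarrow> ('vb \<Rightarrow> 'w \<Rightarrow> 'vb \<Rightarrow>\<^sub>L real) \<Rightarrow>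
     ('vb \<Rightarrow> 'va \<Rightarrow> 'w \<Rightarrow> nat \<Rightarrow> 'h) \<Rightarrow>
     ('w \<Rightarrow> 'vb) \<Rightarrow> ('w \<Rightarrow> 'h) \<Rightarrow> (real \<Rightarrow> 'w \<Rightarrow> 'va \<Rightarrow>\<^sub>L real) \<Rightarrow>
     (real \<Rightarrow> 'w \<Rightarrow> 'va) \<Rightarrow> (real \<Rightarrow> 'w \<Rightarrow> 'h) \<Rightarrow> bool" where
  "solution M F T W p eA eB A B C u0 v0 f v vt \<longleftrightarrow>
     v \<in> Lproc M F T p \<and>
     u_of eA u0 v \<in> Lproc M F T 2 \<and>
     continuous_process M T vt \<and>
     versions M T vt (\<lambda>t \<omega>. eB (eA (v t \<omega>))) \<and>
     (\<exists>J.
        (\<forall>z. ito_series M F T W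
               (\<lambda>j s \<omega>. inner (eB (eA z)) (C (u_of eA u0 v s \<omega>) (v s \<omega>) \<omega> j)) (J z)) \<and>
        (AE \<omega> in M. \<forall>t\<in>{0..T}. \<forall>z.
           inner (vt t \<omega>) (eB (eA z))
             + (LINT s:{0..t}|lebesgue. blinfun_apply (A (v s \<omega>) \<omega>) z
                   + blinfun_apply (B (u_of eA u0 v s \<omega>) \<omega>) (eA z))
           = inner (v0 \<omega>) (eB (eA z))
             + (LINT s:{0..t}|lebesgue. blinfun_apply (f s \<omega>) z)
             + J z t \<omega>))"

end

theory Submission
  imports Defs
begin

text \<open>
  Let \<open>v = v1 - v2\<close> and \<open>u = u1 - u2\<close>, so that \<open>u\<close> is the time integral of \<open>v\<close>, and let
  \<open>g = A v1 - A v2 + B u\<close>. The proof shows that the energy \<open>E (\<bar>v\<bar>\<^sup>2 + \<bar>u\<bar>\<^sub>B\<^sup>2)\<close> vanishes for almost every time. The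
  usual tool is the Ito formula for \<open>\<bar>v\<bar>\<^sup>2\<close>. For uniqueness an inequality between expectations is enough,
  and this inequality is elementary.

  For \<open>s \<le> t\<close> and \<open>\<Delta> = v(t) - v(s)\<close> we have \<open>\<bar>v(t)\<bar>\<^sup>2 - \<bar>v(s)\<bar>\<^sup>2 = 2 (\<Delta>, v(t)) - \<bar>\<Delta>\<bar>\<^sup>2\<close>. For almost all \<open>t\<close> the vector \<open>v(t)\<close> is in
  \<open>V\<^sub>A\<close>, so the difference of the two equations may be tested with it, and \<open>(\<Delta>, v(t))\<close> becomes
  \<open>- \<integral>\<^sub>s\<^sup>t \<langle>g(r), v(t)\<rangle> dr + N (v(t))\<close>, where \<open>N\<close> is the increment over \<open>[s,t]\<close> of the stochastic integrals, a random
  functional. Write \<open>N (v(t)) = N (v(s)) + N \<Delta>\<close>. The first term has mean zero, since \<open>v(s)\<close> is known at time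
  \<open>s\<close>. For the second, \<open>2 N \<Delta> \<le> S + \<bar>\<Delta>\<bar>\<^sup>2\<close>, where \<open>S\<close> is the squared norm of \<open>N\<close> as a functional on \<open>H\<close>, and the
  square is absorbed. By the Ito isometry the expectation of \<open>S\<close> is at most that of the integral of
  \<open>\<bar>C1 - C2\<bar>\<^sup>2\<close>, and the assumption on \<open>A\<close> and \<open>C\<close> bounds \<open>\<bar>C1 - C2\<bar>\<^sup>2\<close> by
  \<open>R = 2 \<langle>A v1 - A v2, v\<rangle> + 2 \<lambda>\<^sub>A \<bar>v\<bar>\<^sup>2 + 2 \<lambda>\<^sub>B \<bar>u\<bar>\<^sub>B\<^sup>2\<close>. This gives \<open>energy_increment\<close>:
  \<open>E \<bar>v(t)\<bar>\<^sup>2 - E \<bar>v(s)\<bar>\<^sup>2 \<le> E \<integral>\<^sub>s\<^sup>t (R(r) - 2 \<langle>g(r), v(t)\<rangle>) dr\<close>. About stochastic integrals it uses only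
  \<open>ito_series_difference\<close>. That \<open>N\<close> extends to \<open>H\<close> is \<open>gram_schmidt_functional_bound\<close>. For the displacement,
  convexity gives \<open>\<bar>u(t)\<bar>\<^sub>B\<^sup>2 - \<bar>u(s)\<bar>\<^sub>B\<^sup>2 \<le> 2 \<integral>\<^sub>s\<^sup>t \<langle>B u(t), v(r)\<rangle> dr\<close>.

  Take \<open>s = t - h\<close>, multiply by \<open>exp (- c t)\<close>, integrate over \<open>t\<close>, divide by \<open>h\<close> and let \<open>h\<close> tend to \<open>0\<close>. The times \<open>r\<close> and
  \<open>t\<close> in the pairings coalesce by the continuity of translations (\<open>TM_bilinear_tendsto\<close>), and
  the terms with \<open>B\<close> and with \<open>A\<close> cancel. There remains
  \<open>c \<integral> exp (- c t) E (\<bar>v\<bar>\<^sup>2 + \<bar>u\<bar>\<^sub>B\<^sup>2) dt \<le> \<integral> exp (- c t) E (2 \<lambda>\<^sub>A \<bar>v\<bar>\<^sup>2 + 2 \<lambda>\<^sub>B \<bar>u\<bar>\<^sub>B\<^sup>2) dt\<close>, and both sides vanish when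
  \<open>c > 2 \<lambda>\<^sub>A + 2 \<lambda>\<^sub>B\<close>. Hence \<open>v = 0\<close> almost everywhere (\<open>y_zero\<close>), so \<open>u = 0\<close> at all times, and the continuous
  modifications agree at all times.

  All this requires \<open>\<langle>A v1, z\<rangle>\<close> to be jointly measurable in time and \<open>\<omega>\<close>, although \<open>A\<close> is only hemicontinuous and weakly
  measurable. Monotonicity up to a multiple of the norm of \<open>H\<close> makes \<open>A\<close> demicontinuous
  (\<open>monotone_hemicontinuous_imp_demicontinuous\<close>), and \<open>Caratheodory_measurable\<close> applies.
\<close>

section \<open>Square integrable functions\<close>

definition sq_integrable :: "'w measure \<Rightarrow> ('w \<Rightarrow> real) \<Rightarrow> bool" where
  "sq_integrable M f \<longleftrightarrow> f \<in> borel_measurable M \<and> integrable M (\<lambda>x. (f x)\<^sup>2)"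

definition L2_tendsto :: "'w measure \<Rightarrow> (nat \<Rightarrow> 'w \<Rightarrow> real) \<Rightarrow> ('w \<Rightarrow> real) \<Rightarrow> bool" where
  "L2_tendsto M f g \<longleftrightarrow> (\<lambda>k. \<integral>\<^sup>+ x. ennreal ((f k x - g x)\<^sup>2) \<partial>M) \<longlonglongrightarrow> 0"

lemma sq_integrable_mult:
  assumes "sq_integrable M f" "sq_integrable M g"
  shows "integrable M (\<lambda>x. f x * g x)"
proof (rule Bochner_Integration.integrable_bound)
  show "integrable M (\<lambda>x. (f x)\<^sup>2 + (g x)\<^sup>2)"
    using assms by (auto simp: sq_integrable_def)
  show "(\<lambda>x. f x * g x) \<in> borel_measurable M"
    using assms by (auto simp: sq_integrable_def)
  show "AE x in M. norm (f x * g x) \<le> norm ((f x)\<^sup>2 + (g x)\<^sup>2)"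
  proof (intro AE_I2)
    fix x
    have "2 * \<bar>f x\<bar> * \<bar>g x\<bar> \<le> (f x)\<^sup>2 + (g x)\<^sup>2"
      using sum_squares_bound[of "\<bar>f x\<bar>" "\<bar>g x\<bar>"] by simp
    moreover have "0 \<le> \<bar>f x\<bar> * \<bar>g x\<bar>" by simp
    ultimately show "norm (f x * g x) \<le> norm ((f x)\<^sup>2 + (g x)\<^sup>2)"
      by (simp only: real_norm_def abs_mult)
  qed
qed

lemma sq_integrable_add:
  assumes "sq_integrable M f" "sq_integrable M g"
  shows "sq_integrable M (\<lambda>x. f x + g x)"
proof -
  have "integrable M (\<lambda>x. (f x)\<^sup>2 + (g x)\<^sup>2 + 2 * (f x * g x))"
    using assms sq_integrable_mult[OF assms] by (auto simp: sq_integrable_def)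
  then show ?thesis
    using assms by (auto simp add: sq_integrable_def power2_sum mult.assoc intro!: borel_measurable_add)
qed

lemma sq_integrable_cmult:
  assumes "sq_integrable M f"
  shows "sq_integrable M (\<lambda>x. c * f x)"
  using assms by (auto simp: sq_integrable_def power_mult_distrib)

lemma sq_integrable_diff:
  assumes "sq_integrable M f" "sq_integrable M g"
  shows "sq_integrable M (\<lambda>x. f x - g x)"
  using sq_integrable_add[OF assms(1) sq_integrable_cmult[OF assms(2), of "-1"]] by simp

lemma sq_integrable_zero: "sq_integrable M (\<lambda>x. 0)"
  by (simp add: sq_integrable_def)

lemma sq_integrable_sum:
  assumes "\<And>i. i \<in> I \<Longrightarrow> sq_integrable M (f i)"
  shows "sq_integrable M (\<lambda>x. \<Sum>i\<in>I. f i x)"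
  using assms
  by (induction I rule: infinite_finite_induct)
     (auto simp: sq_integrable_zero intro!: sq_integrable_add)

lemma sq_integrable_bounded_mult:
  assumes "sq_integrable M f" "g \<in> borel_measurable M" "\<And>x. x \<in> space M \<Longrightarrow> \<bar>g x\<bar> \<le> c"
  shows "sq_integrable M (\<lambda>x. g x * f x)"
  unfolding sq_integrable_def
proof
  show m: "(\<lambda>x. g x * f x) \<in> borel_measurable M"
    using assms by (auto simp: sq_integrable_def)
  show "integrable M (\<lambda>x. (g x * f x)\<^sup>2)"
  proof (rule Bochner_Integration.integrable_bound)
    show "integrable M (\<lambda>x. c\<^sup>2 * (f x)\<^sup>2)" using assms by (auto simp: sq_integrable_def)
    show "(\<lambda>x. (g x * f x)\<^sup>2) \<in> borel_measurable M" using m by simp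
    have "(g x)\<^sup>2 \<le> c\<^sup>2" if "x \<in> space M" for x
      using assms(3)[OF that] by (metis abs_ge_zero power2_abs power_mono)
    then show "AE x in M. norm ((g x * f x)\<^sup>2) \<le> norm (c\<^sup>2 * (f x)\<^sup>2)"
      by (intro AE_I2) (auto simp: power_mult_distrib intro!: mult_right_mono)
  qed
qed

text \<open>
This turns the limits in the definition of the Ito integral, which are stated with nonnegative
integrals, into statements about square integrability.
\<close>

lemma sq_integrable_iff_nn_integral:
  assumes "f \<in> borel_measurable M"
  shows "sq_integrable M f \<longleftrightarrow> (\<integral>\<^sup>+ x. ennreal ((f x)\<^sup>2) \<partial>M) < \<infinity>"
  using assms by (simp add: sq_integrable_def integrable_iff_bounded)

lemma integral_Cauchy_Schwarz:
  assumes "sq_integrable M f" "sq_integrable M g"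
  shows "\<bar>\<integral>x. f x * g x \<partial>M\<bar> \<le> sqrt (\<integral>x. (f x)\<^sup>2 \<partial>M) * sqrt (\<integral>x. (g x)\<^sup>2 \<partial>M)"
proof -
  let ?a = "\<integral>x. (f x)\<^sup>2 \<partial>M" and ?b = "\<integral>x. (g x)\<^sup>2 \<partial>M"
  have fm: "f \<in> borel_measurable M" "g \<in> borel_measurable M"
    and fi: "integrable M (\<lambda>x. (f x)\<^sup>2)" "integrable M (\<lambda>x. (g x)\<^sup>2)"
    using assms by (auto simp: sq_integrable_def)
  note i = sq_integrable_mult[OF assms]
  have "(\<integral>\<^sup>+ x. ennreal \<bar>f x\<bar> * ennreal \<bar>g x\<bar> \<partial>M)\<^sup>2
      \<le> (\<integral>\<^sup>+ x. (ennreal \<bar>f x\<bar>)\<^sup>2 \<partial>M) * (\<integral>\<^sup>+ x. (ennreal \<bar>g x\<bar>)\<^sup>2 \<partial>M)"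
    using fm by (intro Cauchy_Schwarz_nn_integral) auto
  also have "(\<integral>\<^sup>+ x. ennreal \<bar>f x\<bar> * ennreal \<bar>g x\<bar> \<partial>M) = (\<integral>\<^sup>+ x. ennreal \<bar>f x * g x\<bar> \<partial>M)"
    by (simp add: ennreal_mult' abs_mult)
  also have "\<dots> = ennreal (\<integral>x. \<bar>f x * g x\<bar> \<partial>M)"
    using i by (intro nn_integral_eq_integral) auto
  also have "(\<integral>\<^sup>+ x. (ennreal \<bar>f x\<bar>)\<^sup>2 \<partial>M) = ennreal ?a"
    using fi by (subst nn_integral_eq_integral[symmetric]) (auto simp: ennreal_power)
  also have "(\<integral>\<^sup>+ x. (ennreal \<bar>g x\<bar>)\<^sup>2 \<partial>M) = ennreal ?b"
    using fi by (subst nn_integral_eq_integral[symmetric]) (auto simp: ennreal_power)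
  finally have "(\<integral>x. \<bar>f x * g x\<bar> \<partial>M)\<^sup>2 \<le> ?a * ?b"
    by (simp add: ennreal_power ennreal_mult[symmetric])
  then have "(\<integral>x. \<bar>f x * g x\<bar> \<partial>M) \<le> sqrt (?a * ?b)"
    by (simp add: real_le_rsqrt)
  moreover have "\<bar>\<integral>x. f x * g x \<partial>M\<bar> \<le> (\<integral>x. \<bar>f x * g x\<bar> \<partial>M)"
    using integral_norm_bound[of M "\<lambda>x. f x * g x"] by simp
  ultimately show ?thesis by (simp only: real_sqrt_mult)
qed

lemma L2_tendsto_sq_integrable:
  assumes "L2_tendsto M f g" "g \<in> borel_measurable M" "\<And>k. sq_integrable M (f k)"
  shows "sq_integrable M g"
proof -
  have "eventually (\<lambda>k. (\<integral>\<^sup>+ x. ennreal ((f k x - g x)\<^sup>2) \<partial>M) < 1) sequentially"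
    using assms(1) unfolding L2_tendsto_def by (rule order_tendstoD) simp
  then obtain k where "(\<integral>\<^sup>+ x. ennreal ((f k x - g x)\<^sup>2) \<partial>M) < 1"
    by (auto simp: eventually_sequentially)
  then have "sq_integrable M (\<lambda>x. f k x - g x)"
    using assms(2,3) by (subst sq_integrable_iff_nn_integral)
      (auto simp: sq_integrable_def intro: less_trans intro!: borel_measurable_diff)
  from sq_integrable_diff[OF assms(3)[of k] this] show ?thesis by simp
qed

lemma L2_tendsto_iff:
  assumes "sq_integrable M g" "\<And>k. sq_integrable M (f k)"
  shows "L2_tendsto M f g \<longleftrightarrow> (\<lambda>k. \<integral>x. (f k x - g x)\<^sup>2 \<partial>M) \<longlonglongrightarrow> 0"
proof -
  have "(\<integral>\<^sup>+ x. ennreal ((f k x - g x)\<^sup>2) \<partial>M) = ennreal (\<integral>x. (f k x - g x)\<^sup>2 \<partial>M)" for k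
    using sq_integrable_diff[OF assms(2) assms(1)]
    by (intro nn_integral_eq_integral) (auto simp: sq_integrable_def)
  then show ?thesis
    by (simp add: L2_tendsto_def tendsto_ennreal_iff flip: ennreal_0)
qed

text \<open>
Continuity of the inner product of \<open>L\<^sup>2\<close> in both arguments. All isometries and orthogonality
relations for stochastic integrals pass through it from elementary processes to general ones.
\<close>

lemma L2_tendsto_integral_mult:
  assumes f: "L2_tendsto M f f'" "sq_integrable M f'" "\<And>k. sq_integrable M (f k)"
    and g: "L2_tendsto M g g'" "sq_integrable M g'" "\<And>k. sq_integrable M (g k)"
  shows "(\<lambda>k. \<integral>x. f k x * g k x \<partial>M) \<longlonglongrightarrow> (\<integral>x. f' x * g' x \<partial>M)"
proof -
  let ?n = "\<lambda>h. sqrt (\<integral>x. (h x)\<^sup>2 \<partial>M)"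
  let ?df = "\<lambda>k x. f k x - f' x" and ?dg = "\<lambda>k x. g k x - g' x"
  have sf: "sq_integrable M (?df k)" and sg: "sq_integrable M (?dg k)" for k
    using f g by (auto intro: sq_integrable_diff)
  have f0: "(\<lambda>k. ?n (?df k)) \<longlonglongrightarrow> 0" and g0: "(\<lambda>k. ?n (?dg k)) \<longlonglongrightarrow> 0"
    using f g tendsto_real_sqrt[of _ 0] by (auto simp: L2_tendsto_iff)
  have eq: "(\<integral>x. f k x * g k x \<partial>M) - (\<integral>x. f' x * g' x \<partial>M) =
      (\<integral>x. ?df k x * ?dg k x \<partial>M) + (\<integral>x. ?df k x * g' x \<partial>M) + (\<integral>x. f' x * ?dg k x \<partial>M)" for k
  proof -
    have "(\<integral>x. f k x * g k x \<partial>M) =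
        (\<integral>x. ?df k x * ?dg k x + ?df k x * g' x + f' x * ?dg k x + f' x * g' x \<partial>M)"
      by (intro Bochner_Integration.integral_cong) (auto simp: algebra_simps)
    then show ?thesis
      using sq_integrable_mult[OF sf[of k] sg[of k]] sq_integrable_mult[OF sf[of k] g(2)]
        sq_integrable_mult[OF f(2) sg[of k]] sq_integrable_mult[OF f(2) g(2)]
      by simp
  qed
  have "(\<lambda>k. ?n (?df k) * ?n (?dg k) + ?n (?df k) * ?n g' + ?n f' * ?n (?dg k)) \<longlonglongrightarrow> 0 * 0 + 0 * ?n g' + ?n f' * 0"
    by (intro tendsto_intros f0 g0)
  then have lim: "(\<lambda>k. ?n (?df k) * ?n (?dg k) + ?n (?df k) * ?n g' + ?n f' * ?n (?dg k)) \<longlonglongrightarrow> 0"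
    by simp
  have "(\<lambda>k. (\<integral>x. f k x * g k x \<partial>M) - (\<integral>x. f' x * g' x \<partial>M)) \<longlonglongrightarrow> 0"
  proof (rule Lim_null_comparison[OF _ lim], intro always_eventually allI)
    fix k
    show "norm ((\<integral>x. f k x * g k x \<partial>M) - (\<integral>x. f' x * g' x \<partial>M))
       \<le> ?n (?df k) * ?n (?dg k) + ?n (?df k) * ?n g' + ?n f' * ?n (?dg k)"
      unfolding eq
      using integral_Cauchy_Schwarz[OF sf[of k] sg[of k]] integral_Cauchy_Schwarz[OF sf[of k] g(2)]
        integral_Cauchy_Schwarz[OF f(2) sg[of k]] by (simp only: real_norm_def)
  qed
  then show ?thesis by (simp add: LIM_zero_iff)
qed

lemma L2_tendsto_add:
  assumes f: "L2_tendsto M f f'" "sq_integrable M f'" "\<And>k. sq_integrable M (f k)"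
    and g: "L2_tendsto M g g'" "sq_integrable M g'" "\<And>k. sq_integrable M (g k)"
  shows "L2_tendsto M (\<lambda>k x. f k x + g k x) (\<lambda>x. f' x + g' x)"
proof -
  have s: "sq_integrable M (\<lambda>x. f k x - f' x)" "sq_integrable M (\<lambda>x. g k x - g' x)" for k
    using f g by (auto intro: sq_integrable_diff)
  have "(\<lambda>k. 2 * (\<integral>x. (f k x - f' x)\<^sup>2 \<partial>M) + 2 * (\<integral>x. (g k x - g' x)\<^sup>2 \<partial>M)) \<longlonglongrightarrow> 2 * 0 + 2 * 0"
    using f g by (intro tendsto_intros) (auto simp: L2_tendsto_iff)
  then have lim: "(\<lambda>k. 2 * (\<integral>x. (f k x - f' x)\<^sup>2 \<partial>M) + 2 * (\<integral>x. (g k x - g' x)\<^sup>2 \<partial>M)) \<longlonglongrightarrow> 0"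
    by simp
  have "(\<lambda>k. \<integral>x. (f k x + g k x - (f' x + g' x))\<^sup>2 \<partial>M) \<longlonglongrightarrow> 0"
  proof (rule Lim_null_comparison[OF _ lim], intro always_eventually allI)
    fix k
    have "(\<integral>x. (f k x + g k x - (f' x + g' x))\<^sup>2 \<partial>M)
        \<le> (\<integral>x. 2 * (f k x - f' x)\<^sup>2 + 2 * (g k x - g' x)\<^sup>2 \<partial>M)"
    proof (rule integral_mono)
      have "sq_integrable M (\<lambda>x. (f k x - f' x) + (g k x - g' x))"
        by (intro sq_integrable_add s)
      then show "integrable M (\<lambda>x. (f k x + g k x - (f' x + g' x))\<^sup>2)"
        by (simp add: sq_integrable_def algebra_simps)
      show "integrable M (\<lambda>x. 2 * (f k x - f' x)\<^sup>2 + 2 * (g k x - g' x)\<^sup>2)"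
        using s[of k] by (auto simp: sq_integrable_def)
      fix x
      show "(f k x + g k x - (f' x + g' x))\<^sup>2 \<le> 2 * (f k x - f' x)\<^sup>2 + 2 * (g k x - g' x)\<^sup>2"
        using zero_le_power2[of "(f k x - f' x) - (g k x - g' x)"]
        by (simp add: power2_eq_square algebra_simps)
    qed
    also have "\<dots> = 2 * (\<integral>x. (f k x - f' x)\<^sup>2 \<partial>M) + 2 * (\<integral>x. (g k x - g' x)\<^sup>2 \<partial>M)"
      using s[of k] by (simp add: sq_integrable_def)
    finally show "norm (\<integral>x. (f k x + g k x - (f' x + g' x))\<^sup>2 \<partial>M)
        \<le> 2 * (\<integral>x. (f k x - f' x)\<^sup>2 \<partial>M) + 2 * (\<integral>x. (g k x - g' x)\<^sup>2 \<partial>M)" by simp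
  qed
  moreover have "L2_tendsto M (\<lambda>k x. f k x + g k x) (\<lambda>x. f' x + g' x) \<longleftrightarrow>
     (\<lambda>k. \<integral>x. (f k x + g k x - (f' x + g' x))\<^sup>2 \<partial>M) \<longlonglongrightarrow> 0"
    by (rule L2_tendsto_iff) (use f g in \<open>auto intro: sq_integrable_add\<close>)
  ultimately show ?thesis by simp
qed

lemma L2_tendsto_uminus:
  "L2_tendsto M f g \<Longrightarrow> L2_tendsto M (\<lambda>k x. - f k x) (\<lambda>x. - g x)"
  by (simp add: L2_tendsto_def power2_commute)

lemma L2_tendsto_diff:
  assumes f: "L2_tendsto M f f'" "sq_integrable M f'" "\<And>k. sq_integrable M (f k)"
    and g: "L2_tendsto M g g'" "sq_integrable M g'" "\<And>k. sq_integrable M (g k)"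
  shows "L2_tendsto M (\<lambda>k x. f k x - g k x) (\<lambda>x. f' x - g' x)"
  using L2_tendsto_add[OF f L2_tendsto_uminus[OF g(1)]] sq_integrable_cmult[OF g(2), of "-1"]
    sq_integrable_cmult[OF g(3), of "-1"] by simp

section \<open>Increments of the Wiener process\<close>

locale wiener_basis = stochastic_basis M F T for M :: "'w measure" and F T +
  fixes W :: "nat \<Rightarrow> real \<Rightarrow> 'w \<Rightarrow> real"
  assumes wiener: "wiener_process M F T W" and T_pos: "0 < T"
begin

abbreviation "elem_incr j n \<tau> \<xi> s t \<equiv>
  \<lambda>\<omega>. elem_integral (W j) n \<tau> \<xi> t \<omega> - elem_integral (W j) n \<tau> \<xi> s \<omega>"

abbreviation "incr j c d \<equiv> \<lambda>\<omega>. W j d \<omega> - W j c \<omega>"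

lemma measurable_F_M: "t \<in> {0..T} \<Longrightarrow> X \<in> borel_measurable (F t) \<Longrightarrow> X \<in> borel_measurable M"
  using subalgebra_F measurable_from_subalg by blast

lemma space_F: "t \<in> {0..T} \<Longrightarrow> space (F t) = space M"
  using subalgebra_F by (auto simp: subalgebra_def)

lemma measurable_F_mono:
  assumes "0 \<le> s" "s \<le> t" "t \<le> T" "X \<in> borel_measurable (F s)"
  shows "X \<in> borel_measurable (F t)"
proof -
  have "subalgebra (F t) (F s)"
    using assms F_mono[of s t] space_F[of s] space_F[of t] by (auto simp: subalgebra_def)
  then show ?thesis using assms(4) measurable_from_subalg by blast
qed

lemma W_measurable_F: "t \<in> {0..T} \<Longrightarrow> W j t \<in> borel_measurable (F t)"
  using wiener by (auto simp: wiener_process_def)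

lemma W_measurable: "t \<in> {0..T} \<Longrightarrow> W j t \<in> borel_measurable M"
  using W_measurable_F measurable_F_M by blast

lemma incr_measurable_F: "0 \<le> a \<Longrightarrow> a \<le> b \<Longrightarrow> b \<le> T \<Longrightarrow> incr j a b \<in> borel_measurable (F b)"
  using W_measurable_F[of b j] measurable_F_mono[OF _ _ _ W_measurable_F[of a j], of b]
  by (auto intro!: borel_measurable_diff)

lemma incr_distributed:
  assumes "0 \<le> c" "c < d" "d \<le> T"
  shows "distributed M lborel (incr j c d) (normal_density 0 (sqrt (d - c)))"
  using wiener assms by (auto simp: wiener_process_def standard_wiener_def)

lemma incr_sq_integrable:
  assumes "0 \<le> c" "c \<le> d" "d \<le> T"
  shows "sq_integrable M (incr j c d)"
proof (cases "c = d")
  case True then show ?thesis by (simp add: sq_integrable_zero)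
next
  case False
  then have "c < d" using assms by simp
  note D = incr_distributed[OF assms(1) this assms(3), of j]
  have "integrable lborel (\<lambda>x. normal_density 0 (sqrt (d - c)) x * x\<^sup>2)"
    using integrable_normal_moment[of "sqrt (d - c)" 0 2] \<open>c < d\<close> by simp
  then have "integrable M (\<lambda>\<omega>. (incr j c d \<omega>)\<^sup>2)"
    by (subst (asm) distributed_integrable[OF D]) (auto simp: normal_density_nonneg)
  moreover have "incr j c d \<in> borel_measurable M"
    using W_measurable assms by auto
  ultimately show ?thesis by (simp add: sq_integrable_def)
qed

lemma incr_moments:
  assumes "0 \<le> c" "c \<le> d" "d \<le> T"
  shows "expectation (incr j c d) = 0" "expectation (\<lambda>\<omega>. (incr j c d \<omega>)\<^sup>2) = d - c"
proof -
  have "expectation (incr j c d) = 0 \<and> expectation (\<lambda>\<omega>. (incr j c d \<omega>)\<^sup>2) = d - c"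
  proof (cases "c = d")
    case False
    then have "c < d" using assms by simp
    note D = incr_distributed[OF assms(1) this assms(3), of j]
    have "expectation (incr j c d) = 0"
      by (rule normal_distributed_expectation[OF _ D]) (use \<open>c < d\<close> in auto)
    moreover have "variance (incr j c d) = (sqrt (d - c))\<^sup>2"
      by (rule normal_distributed_variance[OF _ D]) (use \<open>c < d\<close> in auto)
    ultimately show ?thesis using \<open>c < d\<close> by simp
  qed simp
  then show "expectation (incr j c d) = 0" "expectation (\<lambda>\<omega>. (incr j c d \<omega>)\<^sup>2) = d - c" by auto
qed

text \<open>
The definition of the Wiener process gives independence of two \<open>\<sigma>\<close>-algebras: the past up to \<open>c\<close> and the
one generated by the increments of all components over \<open>[c,d]\<close>. Measurable functions of one and of the
other are then independent random variables.
\<close>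

lemma indep_incr:
  assumes c: "0 \<le> c" "c \<le> d" "d \<le> T" and X: "X \<in> borel_measurable (F c)"
    and g: "g \<in> borel_measurable (Pi\<^sub>M UNIV (\<lambda>_::nat. borel :: real measure))"
  shows "indep_var borel X borel (\<lambda>\<omega>. g (\<lambda>j. incr j c d \<omega>))"
proof -
  let ?V = "vimage_algebra (space M) (\<lambda>\<omega> j. incr j c d \<omega>) (Pi\<^sub>M UNIV (\<lambda>_::nat. borel :: real measure))"
  have cd: "c \<in> {0..T}" "d \<in> {0..T}" using c by auto
  have "(\<lambda>\<omega> j. incr j c d \<omega>) \<in> M \<rightarrow>\<^sub>M Pi\<^sub>M UNIV (\<lambda>_. borel)"
    using W_measurable[OF cd(1)] W_measurable[OF cd(2)] by (intro measurable_PiM_single') auto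
  then have gm: "(\<lambda>\<omega>. g (\<lambda>j. incr j c d \<omega>)) \<in> borel_measurable M"
    using g by measurable
  have "(\<lambda>\<omega> j. incr j c d \<omega>) \<in> ?V \<rightarrow>\<^sub>M Pi\<^sub>M UNIV (\<lambda>_. borel)"
    by (rule measurable_vimage_algebra1) (auto simp: space_PiM)
  then have gV: "(\<lambda>\<omega>. g (\<lambda>j. incr j c d \<omega>)) \<in> borel_measurable ?V"
    using g by measurable
  have "indep_set (sets (F c)) (sets ?V)"
  proof -
    have "0 \<le> c \<and> 0 \<le> d - c \<and> c + (d - c) \<le> T \<longrightarrow> indep_set (sets (F c))
        (sets (vimage_algebra (space M) (\<lambda>\<omega> j. W j (c + (d - c)) \<omega> - W j c \<omega>) (Pi\<^sub>M UNIV (\<lambda>_. borel))))"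
      using wiener unfolding wiener_process_def by blast
    then show ?thesis using c by simp
  qed
  then have "indep_set
      (sigma_sets (space M) {X -` A \<inter> space M |A. A \<in> sets borel})
      (sigma_sets (space M) {(\<lambda>\<omega>. g (\<lambda>j. incr j c d \<omega>)) -` A \<inter> space M |A. A \<in> sets borel})"
    unfolding indep_set_def
  proof (rule indep_sets_mono_sets)
    fix i :: bool
    have 1: "sigma_sets (space M) {X -` A \<inter> space M |A. A \<in> sets borel} \<subseteq> sets (F c)"
    proof -
      have "{X -` A \<inter> space M |A. A \<in> sets borel} \<subseteq> sets (F c)"
        using measurable_sets[OF X] space_F[OF cd(1)] by auto
      from sets.sigma_sets_subset[OF this] show ?thesis by (simp add: space_F[OF cd(1)])
    qed
    have 2: "sigma_sets (space M) {(\<lambda>\<omega>. g (\<lambda>j. incr j c d \<omega>)) -` A \<inter> space M |A. A \<in> sets borel} \<subseteq> sets ?V"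
    proof -
      have "{(\<lambda>\<omega>. g (\<lambda>j. incr j c d \<omega>)) -` A \<inter> space M |A. A \<in> sets borel} \<subseteq> sets ?V"
        using measurable_sets[OF gV] by auto
      from sets.sigma_sets_subset[OF this] show ?thesis by simp
    qed
    show "(case i of True \<Rightarrow> sigma_sets (space M) {X -` A \<inter> space M |A. A \<in> sets borel}
        | False \<Rightarrow> sigma_sets (space M) {(\<lambda>\<omega>. g (\<lambda>j. incr j c d \<omega>)) -` A \<inter> space M |A. A \<in> sets borel})
       \<subseteq> (case i of True \<Rightarrow> sets (F c) | False \<Rightarrow> sets ?V)"
      using 1 2 by (auto split: bool.split)
  qed
  then show ?thesis
    unfolding indep_var_eq using gm measurable_F_M[OF cd(1) X] by auto
qed

lemma incr_orthogonal:
  assumes c: "0 \<le> c" "c \<le> d" "d \<le> T" and X: "X \<in> borel_measurable (F c)" "sq_integrable M X"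
  shows "expectation (\<lambda>\<omega>. X \<omega> * incr j c d \<omega>) = 0"
proof -
  have "indep_var borel X borel (incr j c d)"
    using indep_incr[OF c X(1), of "\<lambda>x. x j"] by simp
  moreover have "integrable M X" "integrable M (incr j c d)"
    using X(2) incr_sq_integrable[OF c, of j]
    by (auto simp: sq_integrable_def intro: square_integrable_imp_integrable)
  ultimately have "expectation (\<lambda>\<omega>. X \<omega> * incr j c d \<omega>) = expectation X * expectation (incr j c d)"
    by (intro indep_var_lebesgue_integral)
  then show ?thesis by (simp add: incr_moments[OF c])
qed

lemma incr_independent:
  assumes c: "0 \<le> c" "c \<le> d" "d \<le> T" and "j \<noteq> k"
  shows "expectation (\<lambda>\<omega>. incr j c d \<omega> * incr k c d \<omega>) = 0"
proof -
  have cd: "c \<in> {0..T}" "d \<in> {0..T}" using c by auto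
  have "indep_vars (\<lambda>_. Pi\<^sub>M {0..T} (\<lambda>_. borel)) (\<lambda>j \<omega>. \<lambda>t\<in>{0..T}. W j t \<omega>) UNIV"
    using wiener by (simp add: wiener_process_def)
  from indep_vars_compose[OF this, of "\<lambda>_ x. x d - x c" "\<lambda>_. borel"]
  have "indep_vars (\<lambda>_. borel) (\<lambda>i. (\<lambda>x. x d - x c) \<circ> (\<lambda>\<omega>. \<lambda>t\<in>{0..T}. W i t \<omega>)) UNIV"
    using cd by (auto intro!: borel_measurable_diff measurable_component_singleton)
  then have "indep_vars (\<lambda>_. borel) (\<lambda>i. incr i c d) {j, k}"
    using cd indep_vars_subset[of "\<lambda>_. borel" "\<lambda>i. incr i c d" UNIV "{j,k}"] by (simp add: comp_def)
  then have "expectation (\<lambda>\<omega>. \<Prod>i\<in>{j,k}. incr i c d \<omega>) = (\<Prod>i\<in>{j,k}. expectation (incr i c d))"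
    using incr_sq_integrable[OF c]
    by (intro indep_vars_lebesgue_integral)
       (auto simp: sq_integrable_def intro: square_integrable_imp_integrable)
  then show ?thesis using \<open>j \<noteq> k\<close> by (simp add: incr_moments[OF c])
qed

text \<open>
The factor \<open>X\<close> is independent of the increments of all components jointly, hence of the product of two of
them.
\<close>

lemma incr_product_expectation:
  assumes c: "0 \<le> c" "c \<le> d" "d \<le> T" and X: "X \<in> borel_measurable (F c)" "\<And>\<omega>. \<omega> \<in> space M \<Longrightarrow> \<bar>X \<omega>\<bar> \<le> b"
  shows "expectation (\<lambda>\<omega>. X \<omega> * (incr j c d \<omega> * incr k c d \<omega>)) = expectation X * (if j = k then d - c else 0)"
proof -
  have Xm: "X \<in> borel_measurable M" by (rule measurable_F_M[of c]) (use X(1) c in auto)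
  have "indep_var borel X borel (\<lambda>\<omega>. incr j c d \<omega> * incr k c d \<omega>)"
    using indep_incr[OF c X(1), of "\<lambda>x. x j * x k"] by simp
  moreover have "integrable M X"
    by (rule integrable_const_bound[of _ b]) (use X(2) Xm in auto)
  moreover have "integrable M (\<lambda>\<omega>. incr j c d \<omega> * incr k c d \<omega>)"
    by (intro sq_integrable_mult incr_sq_integrable[OF c])
  ultimately have "expectation (\<lambda>\<omega>. X \<omega> * (incr j c d \<omega> * incr k c d \<omega>)) =
      expectation X * expectation (\<lambda>\<omega>. incr j c d \<omega> * incr k c d \<omega>)"
    by (intro indep_var_lebesgue_integral)
  also have "expectation (\<lambda>\<omega>. incr j c d \<omega> * incr k c d \<omega>) = (if j = k then d - c else 0)"
    using incr_independent[OF c] incr_moments[OF c, of j] by (auto simp: power2_eq_square)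
  finally show ?thesis .
qed

lemma rectangle_sq_integrable:
  assumes "0 \<le> a" "a \<le> b" "b \<le> T" "\<xi> \<in> borel_measurable M" "\<And>\<omega>. \<omega> \<in> space M \<Longrightarrow> \<bar>\<xi> \<omega>\<bar> \<le> r"
  shows "sq_integrable M (\<lambda>\<omega>. \<xi> \<omega> * incr j a b \<omega>)"
  using assms by (intro sq_integrable_bounded_mult[of _ _ _ r] incr_sq_integrable) auto

text \<open>
The case of the Ito isometry for two processes \<open>\<xi>\<close> on \<open>(a,b]\<close> and \<open>\<eta>\<close> on \<open>(c,d]\<close>. Both increments are cut
at \<open>c\<close> and at \<open>min b d\<close>; only the product of the pieces over the common interval has a nonzero
mean. Working with pairs of intervals makes a common refinement of two partitions superfluous.
\<close>

lemma rectangle_covariance_ordered: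
  assumes ab: "0 \<le> a" "a < b" "b \<le> T" and cd: "a \<le> c" "c < d" "d \<le> T"
    and \<xi>: "\<xi> \<in> borel_measurable (F a)" "\<And>\<omega>. \<omega> \<in> space M \<Longrightarrow> \<bar>\<xi> \<omega>\<bar> \<le> r"
    and \<eta>: "\<eta> \<in> borel_measurable (F c)" "\<And>\<omega>. \<omega> \<in> space M \<Longrightarrow> \<bar>\<eta> \<omega>\<bar> \<le> r"
  shows "expectation (\<lambda>\<omega>. (\<xi> \<omega> * incr j a b \<omega>) * (\<eta> \<omega> * incr k c d \<omega>)) =
    (if j = k then expectation (\<lambda>\<omega>. \<xi> \<omega> * \<eta> \<omega>) * max 0 (min b d - max a c) else 0)"
proof -
  define X where "X \<omega> = \<xi> \<omega> * \<eta> \<omega>" for \<omega>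
  have c0: "0 \<le> c" "c \<le> T" using ab cd by auto
  have XF: "X \<in> borel_measurable (F t)" if "c \<le> t" "t \<le> T" for t
    unfolding X_def
    using measurable_F_mono[OF _ _ _ \<xi>(1), of t] measurable_F_mono[OF _ _ _ \<eta>(1), of t] that ab cd
    by (auto intro!: borel_measurable_times)
  have XM: "X \<in> borel_measurable M" using XF[of c] measurable_F_M[of c] c0 by auto
  have r: "\<bar>X \<omega>\<bar> \<le> r * r" if "\<omega> \<in> space M" for \<omega>
    unfolding X_def abs_mult using \<xi>(2)[OF that] \<eta>(2)[OF that]
    by (intro mult_mono) auto
  have sq: "sq_integrable M (\<lambda>\<omega>. X \<omega> * incr i u v \<omega>)" if "0 \<le> u" "u \<le> v" "v \<le> T" for i u v
    using that XM r by (rule rectangle_sq_integrable)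
  \<comment> \<open>an increment over a later interval is orthogonal to everything that is known at its start\<close>
  have orth: "expectation (\<lambda>\<omega>. (X \<omega> * incr i u v \<omega>) * incr i' x y \<omega>) = 0"
    if "0 \<le> u" "u \<le> v" "v \<le> x" "c \<le> x" "x \<le> y" "y \<le> T" for i i' u v x y
  proof (rule incr_orthogonal)
    show "(\<lambda>\<omega>. X \<omega> * incr i u v \<omega>) \<in> borel_measurable (F x)"
    proof (rule borel_measurable_times)
      show "X \<in> borel_measurable (F x)" using XF that by auto
      show "incr i u v \<in> borel_measurable (F x)"
        by (rule measurable_F_mono[OF _ \<open>v \<le> x\<close> _ incr_measurable_F]) (use that in auto)
    qed
  qed (use that c0 sq in auto)
  show ?thesis
  proof (cases "b \<le> c")
    case True
    have "expectation (\<lambda>\<omega>. (\<xi> \<omega> * incr j a b \<omega>) * (\<eta> \<omega> * incr k c d \<omega>)) =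
        expectation (\<lambda>\<omega>. (X \<omega> * incr j a b \<omega>) * incr k c d \<omega>)"
      by (intro Bochner_Integration.integral_cong) (auto simp: X_def)
    also have "\<dots> = 0" using True ab cd by (intro orth) auto
    finally show ?thesis using True by auto
  next
    case False
    define m where "m = min b d"
    have m: "c \<le> m" "m \<le> b" "m \<le> d" "0 \<le> m" "m \<le> T" using False cd ab c0 by (auto simp: m_def)
    let ?p1 = "\<lambda>\<omega>. (X \<omega> * incr j a c \<omega>) * incr k c d \<omega>"
    let ?p2 = "\<lambda>\<omega>. X \<omega> * (incr j c m \<omega> * incr k c m \<omega>)"
    let ?p3 = "\<lambda>\<omega>. (X \<omega> * incr j c m \<omega>) * incr k m d \<omega>"
    let ?p4 = "\<lambda>\<omega>. (X \<omega> * incr k c d \<omega>) * incr j m b \<omega>"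
    have i1: "integrable M ?p1" "integrable M ?p3" "integrable M ?p4"
      using m ab cd c0 by (auto intro!: sq_integrable_mult[OF sq] incr_sq_integrable simp del: mult_minus_left)
    \<comment> \<open>The increment of \<open>j\<close> is split at \<open>c\<close> and \<open>m\<close>, that of \<open>k\<close> at \<open>m\<close>. The products \<open>?p1\<close>, \<open>?p3\<close>
      and \<open>?p4\<close> contain an increment that starts after everything else in them is known; if \<open>m = b\<close>,
      then \<open>?p4\<close> is zero.\<close>
    have i2: "integrable M ?p2"
    proof -
      have "integrable M (\<lambda>\<omega>. (X \<omega> * incr j c m \<omega>) * incr k c m \<omega>)"
        by (rule sq_integrable_mult[OF sq incr_sq_integrable]) (use m c0 in auto)
      then show ?thesis by (simp only: mult.assoc)
    qed
    have z1: "expectation ?p1 = 0" "expectation ?p3 = 0"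
      using m ab cd c0 by (auto intro!: orth)
    have z4: "expectation ?p4 = 0"
    proof (cases "m = b")
      case False
      then have "d \<le> m" by (auto simp: m_def)
      then show ?thesis using m ab cd c0 by (intro orth) auto
    qed simp
    have "expectation (\<lambda>\<omega>. (\<xi> \<omega> * incr j a b \<omega>) * (\<eta> \<omega> * incr k c d \<omega>)) =
        expectation (\<lambda>\<omega>. ?p1 \<omega> + ?p2 \<omega> + ?p3 \<omega> + ?p4 \<omega>)"
      by (intro Bochner_Integration.integral_cong) (auto simp: X_def algebra_simps)
    also have "\<dots> = expectation ?p2"
      using i1 i2 z1 z4 by simp
    also have "\<dots> = expectation X * (if j = k then m - c else 0)"
      by (rule incr_product_expectation[OF _ _ _ XF r]) (use m c0 in auto)
    finally show ?thesis using m cd by (simp add: X_def[abs_def] m_def max_def)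
  qed
qed

text \<open>
If one of the intervals is empty, its coefficient need not be measurable with respect to the past. This
case arises when an elementary process is cut off at a time before its interval begins.
\<close>

lemma rectangle_covariance:
  assumes ab: "0 \<le> a" "a \<le> b" "b \<le> T" and cd: "0 \<le> c" "c \<le> d" "d \<le> T"
    and \<xi>: "a < b \<Longrightarrow> \<xi> \<in> borel_measurable (F a)" "\<And>\<omega>. \<omega> \<in> space M \<Longrightarrow> \<bar>\<xi> \<omega>\<bar> \<le> r"
    and \<eta>: "c < d \<Longrightarrow> \<eta> \<in> borel_measurable (F c)" "\<And>\<omega>. \<omega> \<in> space M \<Longrightarrow> \<bar>\<eta> \<omega>\<bar> \<le> r"
  shows "expectation (\<lambda>\<omega>. (\<xi> \<omega> * incr j a b \<omega>) * (\<eta> \<omega> * incr k c d \<omega>)) =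
    (if j = k then expectation (\<lambda>\<omega>. \<xi> \<omega> * \<eta> \<omega>) * max 0 (min b d - max a c) else 0)"
proof (cases "a < b \<and> c < d")
  case True
  show ?thesis
  proof (cases "a \<le> c")
    case True
    then show ?thesis using rectangle_covariance_ordered[of a b c d \<xi> r \<eta> j k] assms \<open>a < b \<and> c < d\<close> by auto
  next
    case False
    then have "expectation (\<lambda>\<omega>. (\<eta> \<omega> * incr k c d \<omega>) * (\<xi> \<omega> * incr j a b \<omega>)) =
    (if k = j then expectation (\<lambda>\<omega>. \<eta> \<omega> * \<xi> \<omega>) * max 0 (min d b - max c a) else 0)"
      using assms \<open>a < b \<and> c < d\<close> by (intro rectangle_covariance_ordered[of c d a b \<eta> r \<xi> k j]) auto
    then show ?thesis by (auto simp: mult.commute min.commute max.commute)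
  qed
next
  case False
  then have "a = b \<or> c = d" using ab cd by auto
  then show ?thesis by auto
qed

section \<open>Integrals of elementary processes\<close>

lemma finite_time_prob: "finite_measure (time_prob M T)"
proof -
  have "finite_measure (restrict_space lborel {0..T})"
    by (rule finite_measureI) (auto simp: emeasure_restrict_space space_restrict_space emeasure_lborel_Icc_eq)
  then show ?thesis unfolding time_prob_def
    by (intro finite_measure_pair_measure finite_measure_axioms)
qed

lemma time_prob_rectangle:
  assumes "A \<in> sets borel" "A \<subseteq> {0..T}" "X \<in> borel_measurable M" "\<And>\<omega>. \<omega> \<in> space M \<Longrightarrow> \<bar>X \<omega>\<bar> \<le> r"
  shows "integrable (time_prob M T) (\<lambda>(s, \<omega>). indicator A s * X \<omega>)"
    and "(\<integral>(s, \<omega>). indicator A s * X \<omega> \<partial>time_prob M T) = measure lborel A * expectation X"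
proof -
  interpret Q: finite_measure "time_prob M T" by (rule finite_time_prob)
  interpret L: finite_measure "restrict_space lborel {0..T}"
    by (rule finite_measureI) (auto simp: emeasure_restrict_space space_restrict_space emeasure_lborel_Icc_eq)
  interpret P: pair_sigma_finite "restrict_space lborel {0..T}" M
    by (simp add: pair_sigma_finite_def L.sigma_finite_measure sigma_finite_measure_axioms)
  have Am: "A \<in> sets (restrict_space lborel {0..T})"
    using assms by (auto simp: sets_restrict_space_iff)
  have ms: "(\<lambda>(s, \<omega>). indicator A s * X \<omega>) \<in> borel_measurable (time_prob M T)"
    unfolding time_prob_def using assms(3) Am by measurable
  show i: "integrable (time_prob M T) (\<lambda>(s, \<omega>). indicator A s * X \<omega>)"
  proof (rule Q.integrable_const_bound[OF _ ms, of "\<bar>r\<bar>"], intro AE_I2)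
    fix x assume "x \<in> space (time_prob M T)"
    then have "\<bar>X (snd x)\<bar> \<le> r" using assms(4) by (auto simp: time_prob_def space_pair_measure)
    then show "norm (case x of (s, \<omega>) \<Rightarrow> indicator A s * X \<omega>) \<le> \<bar>r\<bar>"
      by (auto simp: indicator_def split: prod.split)
  qed
  have "(\<integral>(s, \<omega>). indicator A s * X \<omega> \<partial>time_prob M T) =
      (\<integral>s. (\<integral>\<omega>. indicator A s * X \<omega> \<partial>M) \<partial>restrict_space lborel {0..T})"
    using P.integral_fst'[OF i[unfolded time_prob_def]] by (simp add: time_prob_def)
  also have "\<dots> = (\<integral>s. indicator A s * expectation X \<partial>restrict_space lborel {0..T})"
    by simp
  also have "\<dots> = measure (restrict_space lborel {0..T}) A * expectation X"
    using Am assms(2) by (simp add: space_restrict_space Int_absorb2)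
  also have "measure (restrict_space lborel {0..T}) A = measure lborel A"
    using assms by (simp add: measure_restrict_space)
  finally show "(\<integral>(s, \<omega>). indicator A s * X \<omega> \<partial>time_prob M T) = measure lborel A * expectation X" .
qed

text \<open>
The increment over \<open>[s,t]\<close> of an elementary integral is again elementary, with the partition points
projected onto \<open>[s,t]\<close>.
\<close>

definition clip :: "real \<Rightarrow> real \<Rightarrow> real \<Rightarrow> real" where "clip s t a = max s (min t a)"

lemma clip_mono: "s \<le> t \<Longrightarrow> a \<le> b \<Longrightarrow> clip s t a \<le> clip s t b"
  unfolding clip_def by (intro max.mono min.mono) auto

lemma clip_length:
  assumes "s \<le> t"
  shows "max 0 (min t (min b d) - max s (max a c)) =
    max 0 (min (clip s t b) (clip s t d) - max (clip s t a) (clip s t c))"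
proof -
  have m: "mono (clip s t)" using clip_mono[OF assms] by (auto intro: monoI)
  have *: "max 0 (min t x - max s y) = max 0 (clip s t x - clip s t y)" for x y
    using assms unfolding clip_def by (cases "x \<le> s"; cases "x \<le> t"; cases "y \<le> s"; cases "y \<le> t") auto
  show ?thesis
    unfolding * using min_of_mono[OF m] max_of_mono[OF m] by simp
qed

lemma elementary_mono: "elementary M F T n \<tau> \<xi> \<Longrightarrow> i < n \<Longrightarrow> \<tau> i \<le> \<tau> (Suc i)"
  by (simp add: elementary_def)

lemma elementary_measurable:
  assumes "elementary M F T n \<tau> \<xi>" "i < n"
  shows "\<xi> i \<in> borel_measurable M"
  by (rule measurable_F_M[of "\<tau> i"]) (use assms in \<open>auto simp: elementary_def\<close>)

lemma elem_integral_increment: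
  assumes "0 \<le> s" "s \<le> t" "elementary M F T n \<tau> \<xi>"
  shows "elem_incr j n \<tau> \<xi> s t \<omega> =
    (\<Sum>i<n. \<xi> i \<omega> * incr j (clip s t (\<tau> i)) (clip s t (\<tau> (Suc i))) \<omega>)"
proof -
  have "W j (min t b) \<omega> - W j (min t a) \<omega> - (W j (min s b) \<omega> - W j (min s a) \<omega>) =
      incr j (clip s t a) (clip s t b) \<omega>" if "a \<le> b" for a b
    using that assms(1,2) unfolding clip_def
    by (cases "a \<le> s"; cases "a \<le> t"; cases "b \<le> s"; cases "b \<le> t") auto
  then show ?thesis
    using elementary_mono[OF assms(3)] by (auto simp: elem_integral_def sum_subtractf[symmetric] right_diff_distrib[symmetric]
      intro!: sum.cong)
qed

lemma elementary_bound:
  assumes "elementary M F T n \<tau> \<xi>"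
  obtains r where "\<And>i \<omega>. i < n \<Longrightarrow> \<omega> \<in> space M \<Longrightarrow> \<bar>\<xi> i \<omega>\<bar> \<le> r"
proof -
  have "\<forall>i<n. \<exists>r. \<forall>\<omega>\<in>space M. \<bar>\<xi> i \<omega>\<bar> \<le> r"
    using assms by (auto simp: elementary_def bounded_iff)
  then obtain r where r: "\<And>i \<omega>. i < n \<Longrightarrow> \<omega> \<in> space M \<Longrightarrow> \<bar>\<xi> i \<omega>\<bar> \<le> r i" by metis
  have "\<bar>\<xi> i \<omega>\<bar> \<le> (\<Sum>i<n. \<bar>r i\<bar>)" if "i < n" "\<omega> \<in> space M" for i \<omega>
  proof -
    have "\<bar>r i\<bar> \<le> (\<Sum>i<n. \<bar>r i\<bar>)" using that by (intro member_le_sum) auto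
    then show ?thesis using r[OF that] by linarith
  qed
  then show thesis using that by blast
qed

lemma elem_process_sq_integrable:
  assumes e: "elementary M F T n \<tau> \<xi>"
  shows "sq_integrable (time_prob M T) (\<lambda>(s, \<omega>). elem_process n \<tau> \<xi> s \<omega>)"
proof -
  obtain r where r: "\<And>i \<omega>. i < n \<Longrightarrow> \<omega> \<in> space M \<Longrightarrow> \<bar>\<xi> i \<omega>\<bar> \<le> r"
    using elementary_bound[OF e] by blast
  have "sq_integrable (time_prob M T) (\<lambda>x. \<Sum>i<n. indicator {\<tau> i<..\<tau> (Suc i)} (fst x) * \<xi> i (snd x))"
  proof (intro sq_integrable_sum)
    fix i assume i: "i \<in> {..<n}"
    then have t: "\<tau> i \<in> {0..T}" "\<tau> (Suc i) \<in> {0..T}" using e by (auto simp: elementary_def)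
    have m: "\<xi> i \<in> borel_measurable M"
      using elementary_measurable[OF e] i by auto
    have "\<bar>(\<xi> i \<omega>)\<^sup>2\<bar> \<le> r\<^sup>2" if "\<omega> \<in> space M" for \<omega>
      using r[of i \<omega>] i that by (metis abs_power2 abs_ge_zero lessThan_iff power2_abs power_mono)
    then have *: "integrable (time_prob M T) (\<lambda>(s, \<omega>). indicator {\<tau> i<..\<tau> (Suc i)} s * (\<xi> i \<omega>)\<^sup>2)"
      using t m by (intro time_prob_rectangle[of _ _ "r\<^sup>2"]) auto
    have "integrable (time_prob M T) (\<lambda>x. (indicator {\<tau> i<..\<tau> (Suc i)} (fst x) * \<xi> i (snd x))\<^sup>2)"
      by (rule Bochner_Integration.integrable_cong[THEN iffD1, OF refl _ *])
         (auto simp: indicator_def power2_eq_square split: prod.split)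
    moreover have "(\<lambda>x. indicator {\<tau> i<..\<tau> (Suc i)} (fst x) * \<xi> i (snd x)) \<in> borel_measurable (time_prob M T)"
    proof -
      have "{\<tau> i<..\<tau> (Suc i)} \<in> sets (restrict_space lborel {0..T})"
        using t by (auto simp: sets_restrict_space_iff)
      then show ?thesis unfolding time_prob_def using m by measurable
    qed
    ultimately show "sq_integrable (time_prob M T) (\<lambda>x. indicator {\<tau> i<..\<tau> (Suc i)} (fst x) * \<xi> i (snd x))"
      by (simp add: sq_integrable_def)
  qed
  moreover have "(\<lambda>(s, \<omega>). elem_process n \<tau> \<xi> s \<omega>) =
      (\<lambda>x. \<Sum>i<n. indicator {\<tau> i<..\<tau> (Suc i)} (fst x) * \<xi> i (snd x))"
    unfolding elem_process_def case_prod_beta by (subst mult.commute) (rule refl)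
  ultimately show ?thesis by (simp only:)
qed

context
  fixes s t :: real
  assumes st: "0 \<le> s" "s \<le> t" "t \<le> T"
begin

lemma clip_range: "0 \<le> clip s t a" "clip s t a \<le> T"
  using st by (auto simp: clip_def)

lemma clipped_coefficient_measurable:
  assumes "elementary M F T n \<tau> \<xi>" "i < n" "clip s t (\<tau> i) < clip s t (\<tau> (Suc i))"
  shows "\<xi> i \<in> borel_measurable (F (clip s t (\<tau> i)))"
proof -
  have "\<tau> i < t" using assms(3) st by (auto simp: clip_def min_def max_def split: if_splits)
  then have "\<tau> i \<le> clip s t (\<tau> i)" by (auto simp: clip_def)
  then show ?thesis
    using assms clip_range[of "\<tau> i"]
    by (intro measurable_F_mono[of "\<tau> i" "clip s t (\<tau> i)"]) (auto simp: elementary_def)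
qed

lemma elem_increment_sq_integrable:
  assumes e: "elementary M F T n \<tau> \<xi>"
  shows "sq_integrable M (\<lambda>\<omega>. elem_incr j n \<tau> \<xi> s t \<omega>)"
proof -
  obtain r where r: "\<And>i \<omega>. i < n \<Longrightarrow> \<omega> \<in> space M \<Longrightarrow> \<bar>\<xi> i \<omega>\<bar> \<le> r"
    using elementary_bound[OF e] by blast
  have mono: "\<tau> i \<le> \<tau> (Suc i)" if "i < n" for i by (rule elementary_mono[OF e that])
  have m: "\<xi> i \<in> borel_measurable M" if "i < n" for i
    by (rule elementary_measurable[OF e that])
  show ?thesis
    unfolding elem_integral_increment[OF st(1,2) e]
    using clip_range clip_mono[OF st(2)] mono m r
    by (auto intro!: sq_integrable_sum rectangle_sq_integrable[of _ _ _ r])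
qed

lemma elem_increment_orthogonal:
  assumes e: "elementary M F T n \<tau> \<xi>" and X: "X \<in> borel_measurable (F s)" "sq_integrable M X"
  shows "expectation (\<lambda>\<omega>. X \<omega> * (elem_incr j n \<tau> \<xi> s t \<omega>)) = 0"
proof -
  obtain r where r: "\<And>i \<omega>. i < n \<Longrightarrow> \<omega> \<in> space M \<Longrightarrow> \<bar>\<xi> i \<omega>\<bar> \<le> r"
    using elementary_bound[OF e] by blast
  have mono: "\<tau> i \<le> \<tau> (Suc i)" if "i < n" for i by (rule elementary_mono[OF e that])
  have m: "\<xi> i \<in> borel_measurable M" if "i < n" for i
    by (rule elementary_measurable[OF e that])
  let ?a = "\<lambda>i. clip s t (\<tau> i)" and ?b = "\<lambda>i. clip s t (\<tau> (Suc i))"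
  have sq: "sq_integrable M (\<lambda>\<omega>. \<xi> i \<omega> * X \<omega>)" if "i < n" for i
    using X(2) m[OF that] r[OF that] by (intro sq_integrable_bounded_mult) auto
  have i: "integrable M (\<lambda>\<omega>. (\<xi> i \<omega> * X \<omega>) * incr j (?a i) (?b i) \<omega>)" if "i < n" for i
    using sq[OF that] clip_range clip_mono[OF st(2)] mono[OF that] by (intro sq_integrable_mult incr_sq_integrable) auto
  have z: "expectation (\<lambda>\<omega>. (\<xi> i \<omega> * X \<omega>) * incr j (?a i) (?b i) \<omega>) = 0" if "i < n" for i
  proof (cases "?a i < ?b i")
    case True
    have "X \<in> borel_measurable (F (?a i))"
      using st by (intro measurable_F_mono[OF _ _ _ X(1)]) (auto simp: clip_def)
    then show ?thesis
      using clipped_coefficient_measurable[OF e that True] clip_range True sq[OF that]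
      by (intro incr_orthogonal) auto
  next
    case False
    then have "?a i = ?b i" using clip_mono[OF st(2) mono[OF that]] by simp
    then show ?thesis by simp
  qed
  have "expectation (\<lambda>\<omega>. X \<omega> * (elem_incr j n \<tau> \<xi> s t \<omega>)) =
      expectation (\<lambda>\<omega>. \<Sum>i<n. (\<xi> i \<omega> * X \<omega>) * incr j (?a i) (?b i) \<omega>)"
    unfolding elem_integral_increment[OF st(1,2) e] sum_distrib_left
    by (intro Bochner_Integration.integral_cong sum.cong) (auto simp: mult_ac)
  also have "\<dots> = (\<Sum>i<n. expectation (\<lambda>\<omega>. (\<xi> i \<omega> * X \<omega>) * incr j (?a i) (?b i) \<omega>))"
    using i by (intro Bochner_Integration.integral_sum) auto
  finally show ?thesis using z by simp
qed

text \<open>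
The Ito isometry in its bilinear form, for two elementary processes on different partitions and for two
components of the Wiener process. The length of the intersection of two clipped intervals is the integral
of the product of the two indicators over \<open>(s,t]\<close>.
\<close>

lemma elem_increment_covariance:
  assumes e: "elementary M F T n \<tau> \<xi>" and e': "elementary M F T n' \<tau>' \<xi>'"
  shows "expectation (\<lambda>\<omega>. (elem_incr j n \<tau> \<xi> s t \<omega>) *
      (elem_incr k n' \<tau>' \<xi>' s t \<omega>)) =
    (if j = k then \<integral>(x, \<omega>). indicator {s<..t} x * elem_process n \<tau> \<xi> x \<omega> *
       (indicator {s<..t} x * elem_process n' \<tau>' \<xi>' x \<omega>) \<partial>time_prob M T else 0)"
proof -
  obtain r1 where r1: "\<And>i \<omega>. i < n \<Longrightarrow> \<omega> \<in> space M \<Longrightarrow> \<bar>\<xi> i \<omega>\<bar> \<le> r1"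
    using elementary_bound[OF e] by blast
  obtain r2 where r2: "\<And>i \<omega>. i < n' \<Longrightarrow> \<omega> \<in> space M \<Longrightarrow> \<bar>\<xi>' i \<omega>\<bar> \<le> r2"
    using elementary_bound[OF e'] by blast
  define r where "r = max r1 r2"
  have r: "\<And>i \<omega>. i < n \<Longrightarrow> \<omega> \<in> space M \<Longrightarrow> \<bar>\<xi> i \<omega>\<bar> \<le> r"
    "\<And>i \<omega>. i < n' \<Longrightarrow> \<omega> \<in> space M \<Longrightarrow> \<bar>\<xi>' i \<omega>\<bar> \<le> r"
    using r1 r2 unfolding r_def by (simp_all add: le_max_iff_disj)
  have mono: "\<tau> i \<le> \<tau> (Suc i)" if "i < n" for i by (rule elementary_mono[OF e that])
  have m: "\<xi> i \<in> borel_measurable M" if "i < n" for i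
    by (rule elementary_measurable[OF e that])
  have mono': "\<tau>' i \<le> \<tau>' (Suc i)" if "i < n'" for i by (rule elementary_mono[OF e' that])
  have m': "\<xi>' i \<in> borel_measurable M" if "i < n'" for i
    by (rule elementary_measurable[OF e' that])
  let ?a = "\<lambda>i. clip s t (\<tau> i)" and ?b = "\<lambda>i. clip s t (\<tau> (Suc i))"
  let ?c = "\<lambda>i. clip s t (\<tau>' i)" and ?d = "\<lambda>i. clip s t (\<tau>' (Suc i))"
  let ?l = "\<lambda>i l. max 0 (min (?b i) (?d l) - max (?a i) (?c l))"
  have ii: "integrable M (\<lambda>\<omega>. (\<xi> i \<omega> * incr j (?a i) (?b i) \<omega>) * (\<xi>' l \<omega> * incr k (?c l) (?d l) \<omega>))"
    if "i < n" "l < n'" for i l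
    using that clip_range clip_mono[OF st(2)] mono mono' m m' r
    by (intro sq_integrable_mult rectangle_sq_integrable[of _ _ _ r]) auto
  have "expectation (\<lambda>\<omega>. (elem_incr j n \<tau> \<xi> s t \<omega>) *
      (elem_incr k n' \<tau>' \<xi>' s t \<omega>)) =
     (\<Sum>i<n. \<Sum>l<n'. expectation (\<lambda>\<omega>. (\<xi> i \<omega> * incr j (?a i) (?b i) \<omega>) * (\<xi>' l \<omega> * incr k (?c l) (?d l) \<omega>)))"
    unfolding elem_integral_increment[OF st(1,2) e] elem_integral_increment[OF st(1,2) e']
    unfolding sum_product
    using ii by (subst Bochner_Integration.integral_sum; (intro sum.cong refl Bochner_Integration.integrable_sum
         Bochner_Integration.integral_sum)?) auto
  also have "\<dots> = (\<Sum>i<n. \<Sum>l<n'. if j = k then expectation (\<lambda>\<omega>. \<xi> i \<omega> * \<xi>' l \<omega>) * ?l i l else 0)"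
    using r clip_range clip_mono[OF st(2)] mono mono' clipped_coefficient_measurable[OF e] clipped_coefficient_measurable[OF e']
    by (intro sum.cong refl rectangle_covariance[of _ _ _ _ _ r]) auto
  also have "\<dots> = (if j = k then (\<Sum>i<n. \<Sum>l<n'. expectation (\<lambda>\<omega>. \<xi> i \<omega> * \<xi>' l \<omega>) * ?l i l) else 0)"
    by simp
  also have "(\<Sum>i<n. \<Sum>l<n'. expectation (\<lambda>\<omega>. \<xi> i \<omega> * \<xi>' l \<omega>) * ?l i l) =
    (\<integral>(x, \<omega>). indicator {s<..t} x * elem_process n \<tau> \<xi> x \<omega> *
       (indicator {s<..t} x * elem_process n' \<tau>' \<xi>' x \<omega>) \<partial>time_prob M T)"
  proof -
    let ?A = "\<lambda>i l. {s<..t} \<inter> ({\<tau> i<..\<tau> (Suc i)} \<inter> {\<tau>' l<..\<tau>' (Suc l)})"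
    have A: "?A i l \<in> sets borel" "?A i l \<subseteq> {0..T}" for i l using st by auto
    have len: "measure lborel (?A i l) = ?l i l" if "i < n" "l < n'" for i l
    proof -
      have "?A i l = {max s (max (\<tau> i) (\<tau>' l))<..min t (min (\<tau> (Suc i)) (\<tau>' (Suc l)))}" by auto
      then have "measure lborel (?A i l) = max 0 (min t (min (\<tau> (Suc i)) (\<tau>' (Suc l))) - max s (max (\<tau> i) (\<tau>' l)))"
        by (auto simp: max_def)
      also have "\<dots> = ?l i l"
        using clip_length[OF st(2)] by simp
      finally show ?thesis .
    qed
    have rr: "\<bar>\<xi> i \<omega> * \<xi>' l \<omega>\<bar> \<le> r * r" if "i < n" "l < n'" "\<omega> \<in> space M" for i l \<omega>
      unfolding abs_mult using r(1)[of i \<omega>] r(2)[of l \<omega>] that by (intro mult_mono) auto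
    have R: "integrable (time_prob M T) (\<lambda>(x, \<omega>). indicator (?A i l) x * (\<xi> i \<omega> * \<xi>' l \<omega>))"
       "(\<integral>(x, \<omega>). indicator (?A i l) x * (\<xi> i \<omega> * \<xi>' l \<omega>) \<partial>time_prob M T) = ?l i l * expectation (\<lambda>\<omega>. \<xi> i \<omega> * \<xi>' l \<omega>)"
      if "i < n" "l < n'" for i l
    proof -
      have mm: "(\<lambda>\<omega>. \<xi> i \<omega> * \<xi>' l \<omega>) \<in> borel_measurable M"
        by (intro borel_measurable_times m m' that)
      show "integrable (time_prob M T) (\<lambda>(x, \<omega>). indicator (?A i l) x * (\<xi> i \<omega> * \<xi>' l \<omega>))"
        by (rule time_prob_rectangle(1)[OF A mm rr[OF that]])
      show "(\<integral>(x, \<omega>). indicator (?A i l) x * (\<xi> i \<omega> * \<xi>' l \<omega>) \<partial>time_prob M T) = ?l i l * expectation (\<lambda>\<omega>. \<xi> i \<omega> * \<xi>' l \<omega>)"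
        unfolding len[OF that, symmetric] by (rule time_prob_rectangle(2)[OF A mm rr[OF that]])
    qed
    have "(\<integral>(x, \<omega>). indicator {s<..t} x * elem_process n \<tau> \<xi> x \<omega> *
       (indicator {s<..t} x * elem_process n' \<tau>' \<xi>' x \<omega>) \<partial>time_prob M T) =
       (\<integral>z. (\<Sum>i<n. \<Sum>l<n'. case z of (x, \<omega>) \<Rightarrow> indicator (?A i l) x * (\<xi> i \<omega> * \<xi>' l \<omega>)) \<partial>time_prob M T)"
    proof (intro Bochner_Integration.integral_cong refl)
      fix z :: "real \<times> 'w"
      obtain x :: real and \<omega> where z: "z = (x, \<omega>)" by (cases z)
      have "indicator {s<..t} x * elem_process n \<tau> \<xi> x \<omega> * (indicator {s<..t} x * elem_process n' \<tau>' \<xi>' x \<omega>) =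
        (\<Sum>i<n. indicator {s<..t} x * (\<xi> i \<omega> * indicator {\<tau> i<..\<tau> (Suc i)} x)) *
        (\<Sum>l<n'. indicator {s<..t} x * (\<xi>' l \<omega> * indicator {\<tau>' l<..\<tau>' (Suc l)} x))"
        unfolding elem_process_def by (simp only: sum_distrib_left)
      also have "\<dots> = (\<Sum>i<n. \<Sum>l<n'. indicator (?A i l) x * (\<xi> i \<omega> * \<xi>' l \<omega>))"
        unfolding sum_product by (intro sum.cong refl) (auto simp: indicator_def)
      finally show "(case z of (x, \<omega>) \<Rightarrow> indicator {s<..t} x * elem_process n \<tau> \<xi> x \<omega> *
          (indicator {s<..t} x * elem_process n' \<tau>' \<xi>' x \<omega>)) =
          (\<Sum>i<n. \<Sum>l<n'. case z of (x, \<omega>) \<Rightarrow> indicator (?A i l) x * (\<xi> i \<omega> * \<xi>' l \<omega>))"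
        by (simp only: z prod.case)
    qed
    also have "\<dots> = (\<Sum>i<n. \<Sum>l<n'. (\<integral>z. (case z of (x, \<omega>) \<Rightarrow> indicator (?A i l) x * (\<xi> i \<omega> * \<xi>' l \<omega>)) \<partial>time_prob M T))"
      using R(1) by (subst Bochner_Integration.integral_sum; (intro sum.cong refl Bochner_Integration.integrable_sum
         Bochner_Integration.integral_sum)?) auto
    also have "\<dots> = (\<Sum>i<n. \<Sum>l<n'. expectation (\<lambda>\<omega>. \<xi> i \<omega> * \<xi>' l \<omega>) * ?l i l)"
      using R(2) by (intro sum.cong refl) (auto simp: mult.commute)
    finally show ?thesis by simp
  qed
  finally show ?thesis .
qed

end

end

section \<open>Ito integrals and Ito series\<close>

lemma integral_diff_mult_diff:
  assumes "sq_integrable N a" "sq_integrable N b" "sq_integrable N c" "sq_integrable N d"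
  shows "(\<integral>x. (a x - b x) * (c x - d x) \<partial>N) =
    (\<integral>x. a x * c x \<partial>N) - (\<integral>x. a x * d x \<partial>N) - (\<integral>x. b x * c x \<partial>N) + (\<integral>x. b x * d x \<partial>N)"
proof -
  have "(\<lambda>x. (a x - b x) * (c x - d x)) = (\<lambda>x. a x * c x - a x * d x - b x * c x + b x * d x)"
    by (auto simp: algebra_simps)
  then show ?thesis
    using sq_integrable_mult[OF assms(1,3)] sq_integrable_mult[OF assms(1,4)]
      sq_integrable_mult[OF assms(2,3)] sq_integrable_mult[OF assms(2,4)] by simp
qed

context wiener_basis begin

text \<open>
The data behind an Ito integral: a progressive version of the integrand and the approximating
elementary processes. Keeping them explicit lets two integrals be compared along their approximations.
\<close>

definition ito_witness where
  "ito_witness j g I Y n \<tau> \<xi> \<longleftrightarrow> continuous_process M T I \<and> progressive F T Y \<and> versions M T g Y \<and>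
     (\<forall>k::nat. elementary M F T (n k) (\<tau> k) (\<xi> k)) \<and>
     L2_tendsto (time_prob M T) (\<lambda>k (s, \<omega>). elem_process (n k) (\<tau> k) (\<xi> k) s \<omega>) (\<lambda>(s, \<omega>). Y s \<omega>) \<and>
     (\<forall>t\<in>{0..T}. L2_tendsto M (\<lambda>k. elem_integral (W j) (n k) (\<tau> k) (\<xi> k) t) (I t))"

lemma ito_integral_witness:
  "ito_integral M F T (W j) g I \<longleftrightarrow> (\<exists>Y n \<tau> \<xi>. ito_witness j g I Y n \<tau> \<xi>)"
  unfolding ito_integral_def ito_witness_def L2_tendsto_def case_prod_beta by auto

lemma progressive_measurable_time_prob:
  assumes "progressive F T Y"
  shows "(\<lambda>(s, \<omega>). Y s \<omega>) \<in> borel_measurable (time_prob M T)"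
proof -
  have "(\<lambda>(s, \<omega>). Y s \<omega>) \<in> borel_measurable (restrict_space borel {0..T} \<Otimes>\<^sub>M F T)"
    using assms T_pos by (auto simp: progressive_def)
  moreover have "sets (F T) \<subseteq> sets M" "space (F T) = space M"
    using subalgebra_F[of T] T_pos by (auto simp: subalgebra_def)
  then have i: "(\<lambda>x. x) \<in> M \<rightarrow>\<^sub>M F T"
    using measurable_from_subalg[of M "F T" "\<lambda>x. x" "F T"] by (simp add: subalgebra_def)
  have i': "(\<lambda>x. x) \<in> restrict_space lborel {0..T} \<rightarrow>\<^sub>M restrict_space borel {0..T}"
    by (intro measurable_ident_sets sets_restrict_space_cong) simp
  have "(\<lambda>x. (fst x, snd x)) \<in> time_prob M T \<rightarrow>\<^sub>M restrict_space borel {0..T} \<Otimes>\<^sub>M F T"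
    unfolding time_prob_def
    by (rule measurable_Pair) (rule measurable_compose[OF measurable_fst i'], rule measurable_compose[OF measurable_snd i])
  ultimately show ?thesis
    by (auto dest: measurable_compose[rotated] simp: case_prod_beta')
qed

lemma elem_integral_0: "elementary M F T n \<tau> \<xi> \<Longrightarrow> elem_integral w n \<tau> \<xi> 0 \<omega> = 0"
  by (auto simp: elem_integral_def elementary_def min_def intro!: sum.neutral)

lemma elem_integral_sq_integrable:
  assumes "elementary M F T n \<tau> \<xi>" "0 \<le> t" "t \<le> T"
  shows "sq_integrable M (elem_integral (W j) n \<tau> \<xi> t)"
  using elem_increment_sq_integrable[OF order_refl assms(2,3,1), of j] elem_integral_0[OF assms(1)] by simp

lemma measurable_indicator_time:
  "A \<in> sets borel \<Longrightarrow> (\<lambda>x. indicator A (fst x) :: real) \<in> borel_measurable (time_prob M T)"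
proof -
  assume [measurable]: "A \<in> sets borel"
  have "(\<lambda>x. x) \<in> restrict_space lborel {0..T} \<rightarrow>\<^sub>M lborel"
    using measurable_restrict_space1[of "\<lambda>x. x" lborel lborel] by simp
  then have [measurable]: "fst \<in> time_prob M T \<rightarrow>\<^sub>M borel"
    unfolding time_prob_def using measurable_compose[OF measurable_fst] by auto
  show ?thesis by measurable
qed

context
  fixes s t :: real
  assumes st: "0 \<le> s" "s \<le> t" "t \<le> T"
begin

lemma
  assumes w: "ito_witness j g I Y n \<tau> \<xi>"
  shows witness_increment_tendsto: "L2_tendsto M (\<lambda>k \<omega>. elem_incr j (n k) (\<tau> k) (\<xi> k) s t \<omega>)
      (\<lambda>\<omega>. I t \<omega> - I s \<omega>)"
    and witness_increment_sq_integrable: "sq_integrable M (\<lambda>\<omega>. I t \<omega> - I s \<omega>)"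
    and witness_process_tendsto: "L2_tendsto (time_prob M T) (\<lambda>k (x, \<omega>). indicator {s<..t} x * elem_process (n k) (\<tau> k) (\<xi> k) x \<omega>)
       (\<lambda>(x, \<omega>). indicator {s<..t} x * Y x \<omega>)"
    and witness_process_sq_integrable: "sq_integrable (time_prob M T) (\<lambda>(x, \<omega>). indicator {s<..t} x * Y x \<omega>)"
    and witness_elem_sq_integrable: "\<And>k. sq_integrable (time_prob M T) (\<lambda>(x, \<omega>). indicator {s<..t} x * elem_process (n k) (\<tau> k) (\<xi> k) x \<omega>)"
proof -
  have tt: "t \<in> {0..T}" "s \<in> {0..T}" using st by auto
  have e: "elementary M F T (n k) (\<tau> k) (\<xi> k)" for k using w by (simp add: ito_witness_def)
  have I: "I r \<in> borel_measurable M" if "r \<in> {0..T}" for r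
    using w that by (simp add: ito_witness_def continuous_process_def)
  have eI: "sq_integrable M (elem_integral (W j) (n k) (\<tau> k) (\<xi> k) r)" if "r \<in> {0..T}" for r k
    using that by (intro elem_integral_sq_integrable e) auto
  have L: "L2_tendsto M (\<lambda>k. elem_integral (W j) (n k) (\<tau> k) (\<xi> k) r) (I r)" if "r \<in> {0..T}" for r
    using w that by (simp add: ito_witness_def)
  have sqI: "sq_integrable M (I r)" if "r \<in> {0..T}" for r
    by (rule L2_tendsto_sq_integrable[OF L I eI]) (use that in auto)
  show "L2_tendsto M (\<lambda>k \<omega>. elem_incr j (n k) (\<tau> k) (\<xi> k) s t \<omega>)
      (\<lambda>\<omega>. I t \<omega> - I s \<omega>)"
    using tt by (intro L2_tendsto_diff L sqI eI)
  show "sq_integrable M (\<lambda>\<omega>. I t \<omega> - I s \<omega>)" using tt by (intro sq_integrable_diff sqI)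
  let ?Q = "time_prob M T"
  have Ym: "(\<lambda>(x, \<omega>). Y x \<omega>) \<in> borel_measurable ?Q"
    using w by (intro progressive_measurable_time_prob) (simp add: ito_witness_def)
  have L': "L2_tendsto ?Q (\<lambda>k (s, \<omega>). elem_process (n k) (\<tau> k) (\<xi> k) s \<omega>) (\<lambda>(s, \<omega>). Y s \<omega>)"
    using w by (simp add: ito_witness_def)
  have sqY: "sq_integrable ?Q (\<lambda>(x, \<omega>). Y x \<omega>)"
    by (rule L2_tendsto_sq_integrable[OF L' Ym]) (rule elem_process_sq_integrable[OF e])
  have ind: "sq_integrable ?Q (\<lambda>(x, \<omega>). indicator {s<..t} x * Z x \<omega>)" if "sq_integrable ?Q (\<lambda>(x, \<omega>). Z x \<omega>)" for Z
    using sq_integrable_bounded_mult[OF that measurable_indicator_time[of "{s<..t}"], of 1]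
    by (simp add: case_prod_beta')
  show "sq_integrable ?Q (\<lambda>(x, \<omega>). indicator {s<..t} x * Y x \<omega>)" by (rule ind[OF sqY])
  show "sq_integrable ?Q (\<lambda>(x, \<omega>). indicator {s<..t} x * elem_process (n k) (\<tau> k) (\<xi> k) x \<omega>)" for k
    by (rule ind[OF elem_process_sq_integrable[OF e]])
  show "L2_tendsto ?Q (\<lambda>k (x, \<omega>). indicator {s<..t} x * elem_process (n k) (\<tau> k) (\<xi> k) x \<omega>)
       (\<lambda>(x, \<omega>). indicator {s<..t} x * Y x \<omega>)"
    unfolding L2_tendsto_def
  proof (rule tendsto_sandwich[where f="\<lambda>_. 0", OF _ _ tendsto_const L'[unfolded L2_tendsto_def]])
    show "\<forall>\<^sub>F k in sequentially. 0 \<le> (\<integral>\<^sup>+x. ennreal (((case x of (x, \<omega>) \<Rightarrow> indicator {s<..t} x * elem_process (n k) (\<tau> k) (\<xi> k) x \<omega>) -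
         (case x of (x, \<omega>) \<Rightarrow> indicator {s<..t} x * Y x \<omega>))\<^sup>2) \<partial>?Q)" by simp
  next
    show "\<forall>\<^sub>F k in sequentially. (\<integral>\<^sup>+x. ennreal (((case x of (x, \<omega>) \<Rightarrow> indicator {s<..t} x * elem_process (n k) (\<tau> k) (\<xi> k) x \<omega>) -
         (case x of (x, \<omega>) \<Rightarrow> indicator {s<..t} x * Y x \<omega>))\<^sup>2) \<partial>?Q)
      \<le> (\<integral>\<^sup>+x. ennreal (((case x of (x, \<omega>) \<Rightarrow> elem_process (n k) (\<tau> k) (\<xi> k) x \<omega>) -
         (case x of (x, \<omega>) \<Rightarrow> Y x \<omega>))\<^sup>2) \<partial>?Q)"
      by (intro always_eventually allI nn_integral_mono) (auto simp: indicator_def)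
  qed
qed

lemma witness_orthogonal:
  assumes w: "ito_witness j g I Y n \<tau> \<xi>" and X: "X \<in> borel_measurable (F s)" "sq_integrable M X"
  shows "expectation (\<lambda>\<omega>. X \<omega> * (I t \<omega> - I s \<omega>)) = 0"
proof -
  have e: "elementary M F T (n k) (\<tau> k) (\<xi> k)" for k using w by (simp add: ito_witness_def)
  have c: "L2_tendsto M (\<lambda>k. X) X" by (simp add: L2_tendsto_def)
  from L2_tendsto_integral_mult[OF c X(2) X(2) witness_increment_tendsto[OF w]
      witness_increment_sq_integrable[OF w] elem_increment_sq_integrable[OF st e]]
  show ?thesis
    using elem_increment_orthogonal[OF st e X] by (simp add: LIMSEQ_const_iff)
qed

lemma witness_covariance:
  assumes w: "ito_witness j g I Y n \<tau> \<xi>" and w': "ito_witness k g' I' Y' n' \<tau>' \<xi>'"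
  shows "expectation (\<lambda>\<omega>. (I t \<omega> - I s \<omega>) * (I' t \<omega> - I' s \<omega>)) =
    (if j = k then \<integral>(x, \<omega>). indicator {s<..t} x * Y x \<omega> * (indicator {s<..t} x * Y' x \<omega>) \<partial>time_prob M T else 0)"
proof -
  have e: "elementary M F T (n k) (\<tau> k) (\<xi> k)" for k using w by (simp add: ito_witness_def)
  have e': "elementary M F T (n' k) (\<tau>' k) (\<xi>' k)" for k using w' by (simp add: ito_witness_def)
  note l1 = L2_tendsto_integral_mult[OF witness_increment_tendsto[OF w] witness_increment_sq_integrable[OF w]
      elem_increment_sq_integrable[OF st e] witness_increment_tendsto[OF w'] witness_increment_sq_integrable[OF w']
      elem_increment_sq_integrable[OF st e']]
  note l2 = L2_tendsto_integral_mult[OF witness_process_tendsto[OF w] witness_process_sq_integrable[OF w]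
      witness_elem_sq_integrable[OF w] witness_process_tendsto[OF w'] witness_process_sq_integrable[OF w']
      witness_elem_sq_integrable[OF w']]
  have p: "(\<integral>z. (case z of (x, \<omega>) \<Rightarrow> indicator {s<..t} x * U x \<omega>) * (case z of (x, \<omega>) \<Rightarrow> indicator {s<..t} x * V x \<omega>) \<partial>time_prob M T) =
      (\<integral>(x, \<omega>). indicator {s<..t} x * U x \<omega> * (indicator {s<..t} x * V x \<omega>) \<partial>time_prob M T)"
    for U V :: "real \<Rightarrow> 'w \<Rightarrow> real"
    by (intro Bochner_Integration.integral_cong) auto
  note l1' = l1[unfolded elem_increment_covariance[OF st e e']] and l2' = l2[unfolded p]
  show ?thesis
  proof (cases "j = k")
    case True
    show ?thesis unfolding if_P[OF True] by (rule LIMSEQ_unique[OF l1'[unfolded if_P[OF True]] l2'])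
  next
    case False
    show ?thesis unfolding if_not_P[OF False] by (rule LIMSEQ_unique[OF l1'[unfolded if_not_P[OF False]] tendsto_const])
  qed
qed

text \<open>
The differences of the partial sums are orthogonal in \<open>j\<close>, hence the second moment of their limit is at
most the sum of the second moments. The bound is stated with nonnegative integrals because the sum on the right
may be infinite.
\<close>

lemma series_difference_increment:
  fixes J J' :: "real \<Rightarrow> 'w \<Rightarrow> real"
  assumes w: "\<And>j. ito_witness j (g j) (I j) (Y j) (n j) (\<tau> j) (\<xi> j)"
    and w': "\<And>j. ito_witness j (g' j) (I' j) (Y' j) (n' j) (\<tau>' j) (\<xi>' j)"
    and J: "continuous_process M T J" "\<forall>t\<in>{0..T}. (\<lambda>m. \<integral>\<^sup>+ \<omega>. ennreal (((\<Sum>j<m. I j t \<omega>) - J t \<omega>)\<^sup>2) \<partial>M) \<longlonglongrightarrow> 0"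
    and J': "continuous_process M T J'" "\<forall>t\<in>{0..T}. (\<lambda>m. \<integral>\<^sup>+ \<omega>. ennreal (((\<Sum>j<m. I' j t \<omega>) - J' t \<omega>)\<^sup>2) \<partial>M) \<longlonglongrightarrow> 0"
  defines "N \<equiv> \<lambda>\<omega>. (J t \<omega> - J' t \<omega>) - (J s \<omega> - J' s \<omega>)"
  shows "sq_integrable M N"
    and "\<And>X. X \<in> borel_measurable (F s) \<Longrightarrow> sq_integrable M X \<Longrightarrow> expectation (\<lambda>\<omega>. X \<omega> * N \<omega>) = 0"
    and "(\<integral>\<^sup>+\<omega>. ennreal ((N \<omega>)\<^sup>2) \<partial>M) \<le>
      (\<Sum>j. \<integral>\<^sup>+(x, \<omega>). ennreal (indicator {s<..t} x * (Y j x \<omega> - Y' j x \<omega>)\<^sup>2) \<partial>time_prob M T)"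
proof -
  let ?Q = "time_prob M T"
  define D where "D j \<omega> = (I j t \<omega> - I j s \<omega>) - (I' j t \<omega> - I' j s \<omega>)" for j \<omega>
  define S where "S m \<omega> = (\<Sum>j<m. D j \<omega>)" for m \<omega>
  have Dsq: "sq_integrable M (D j)" for j
    unfolding D_def by (intro sq_integrable_diff witness_increment_sq_integrable[OF w] witness_increment_sq_integrable[OF w'])
  have Ssq: "sq_integrable M (S m)" for m
    unfolding S_def by (intro sq_integrable_sum Dsq)
  have part: "sq_integrable M (J r) \<and> L2_tendsto M (\<lambda>m \<omega>. \<Sum>j<m. I j r \<omega>) (J r) \<and> (\<forall>m. sq_integrable M (\<lambda>\<omega>. \<Sum>j<m. I j r \<omega>))"
    if w: "\<And>j. ito_witness j (g j) (I j) (Y j) (n j) (\<tau> j) (\<xi> j)"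
    and J: "continuous_process M T J" "\<forall>t\<in>{0..T}. (\<lambda>m. \<integral>\<^sup>+ \<omega>. ennreal (((\<Sum>j<m. I j t \<omega>) - J t \<omega>)\<^sup>2) \<partial>M) \<longlonglongrightarrow> 0"
    and r: "r \<in> {0..T}" for g I Y n \<tau> \<xi> r and J :: "real \<Rightarrow> 'w \<Rightarrow> real"
  proof -
    have "sq_integrable M (I j r)" for j
    proof (rule L2_tendsto_sq_integrable)
      show "L2_tendsto M (\<lambda>k. elem_integral (W j) (n j k) (\<tau> j k) (\<xi> j k) r) (I j r)"
        using w[of j] r by (simp add: ito_witness_def)
      show "I j r \<in> borel_measurable M" using w[of j] r by (simp add: ito_witness_def continuous_process_def)
      show "sq_integrable M (elem_integral (W j) (n j k) (\<tau> j k) (\<xi> j k) r)" for k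
        using w[of j] r by (intro elem_integral_sq_integrable) (auto simp: ito_witness_def)
    qed
    then have a: "sq_integrable M (\<lambda>\<omega>. \<Sum>j<m. I j r \<omega>)" for m by (intro sq_integrable_sum)
    have b: "L2_tendsto M (\<lambda>m \<omega>. \<Sum>j<m. I j r \<omega>) (J r)" using J(2) r by (simp add: L2_tendsto_def)
    have "sq_integrable M (J r)"
      by (rule L2_tendsto_sq_integrable[OF b _ a]) (use J(1) r in \<open>simp add: continuous_process_def\<close>)
    then show ?thesis using a b by auto
  qed
  note p = part[OF w J] and p' = part[OF w' J']
  have tt: "t \<in> {0..T}" "s \<in> {0..T}" using st by auto
  show Nsq: "sq_integrable M N"
    unfolding N_def using p[OF tt(1)] p[OF tt(2)] p'[OF tt(1)] p'[OF tt(2)] by (intro sq_integrable_diff) auto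
  have SN: "L2_tendsto M S N"
  proof -
    have "L2_tendsto M (\<lambda>m \<omega>. ((\<Sum>j<m. I j t \<omega>) - (\<Sum>j<m. I' j t \<omega>)) - ((\<Sum>j<m. I j s \<omega>) - (\<Sum>j<m. I' j s \<omega>))) N"
      unfolding N_def
      using p[OF tt(1)] p[OF tt(2)] p'[OF tt(1)] p'[OF tt(2)]
      by (intro L2_tendsto_diff sq_integrable_diff) auto
    moreover have "(\<lambda>m \<omega>. ((\<Sum>j<m. I j t \<omega>) - (\<Sum>j<m. I' j t \<omega>)) - ((\<Sum>j<m. I j s \<omega>) - (\<Sum>j<m. I' j s \<omega>))) = S"
      by (auto simp: fun_eq_iff S_def D_def sum_subtractf)
    ultimately show ?thesis by simp
  qed
  have orth: "expectation (\<lambda>\<omega>. X \<omega> * D j \<omega>) = 0" if X: "X \<in> borel_measurable (F s)" "sq_integrable M X" for X j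
  proof -
    have "(\<lambda>\<omega>. X \<omega> * D j \<omega>) = (\<lambda>\<omega>. X \<omega> * (I j t \<omega> - I j s \<omega>) - X \<omega> * (I' j t \<omega> - I' j s \<omega>))"
      by (auto simp: D_def algebra_simps)
    then show ?thesis
      using witness_orthogonal[OF w X, of j] witness_orthogonal[OF w' X, of j]
        sq_integrable_mult[OF X(2) witness_increment_sq_integrable[OF w, of j]]
        sq_integrable_mult[OF X(2) witness_increment_sq_integrable[OF w', of j]]
      by (simp only: Bochner_Integration.integral_diff)
  qed
  show "expectation (\<lambda>\<omega>. X \<omega> * N \<omega>) = 0" if X: "X \<in> borel_measurable (F s)" "sq_integrable M X" for X
  proof -
    have c: "L2_tendsto M (\<lambda>k. X) X" by (simp add: L2_tendsto_def)
    have "expectation (\<lambda>\<omega>. X \<omega> * S m \<omega>) = 0" for m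
      unfolding S_def sum_distrib_left
      using sq_integrable_mult[OF X(2) Dsq] orth[OF X] by (subst Bochner_Integration.integral_sum) auto
    then show ?thesis
      using L2_tendsto_integral_mult[OF c X(2) X(2) SN Nsq Ssq] by (simp add: LIMSEQ_const_iff)
  qed
  let ?d = "\<lambda>j. \<lambda>(x, \<omega>). indicator {s<..t} x * (Y j x \<omega> - Y' j x \<omega>)\<^sup>2"
  let ?y = "\<lambda>j. \<lambda>(x, \<omega>). indicator {s<..t} x * Y j x \<omega>" and ?y' = "\<lambda>j. \<lambda>(x, \<omega>). indicator {s<..t} x * Y' j x \<omega>"
  have ysq: "sq_integrable ?Q (?y j)" "sq_integrable ?Q (?y' j)" for j
    by (rule witness_process_sq_integrable[OF w], rule witness_process_sq_integrable[OF w'])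
  have deq: "?d j = (\<lambda>z. (?y j z - ?y' j z)\<^sup>2)" for j
    by (auto simp: fun_eq_iff indicator_def)
  have di: "integrable ?Q (?d j)" for j
    unfolding deq using sq_integrable_diff[OF ysq] by (simp add: sq_integrable_def)
  have DD: "expectation (\<lambda>\<omega>. D j \<omega> * D k \<omega>) = (if j = k then \<integral>z. ?d j z \<partial>?Q else 0)" for j k
  proof -
    let ?i = "\<lambda>j \<omega>. I j t \<omega> - I j s \<omega>" and ?i' = "\<lambda>j \<omega>. I' j t \<omega> - I' j s \<omega>"
    have s1: "sq_integrable M (?i j)" "sq_integrable M (?i' j)" for j
      by (rule witness_increment_sq_integrable[OF w], rule witness_increment_sq_integrable[OF w'])
    have "expectation (\<lambda>\<omega>. D j \<omega> * D k \<omega>) =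
        expectation (\<lambda>\<omega>. ?i j \<omega> * ?i k \<omega>) - expectation (\<lambda>\<omega>. ?i j \<omega> * ?i' k \<omega>)
        - expectation (\<lambda>\<omega>. ?i' j \<omega> * ?i k \<omega>) + expectation (\<lambda>\<omega>. ?i' j \<omega> * ?i' k \<omega>)"
      unfolding D_def by (rule integral_diff_mult_diff[OF s1 s1])
    also have "\<dots> = (if j = k then (\<integral>z. ?y j z * ?y k z \<partial>?Q) - (\<integral>z. ?y j z * ?y' k z \<partial>?Q)
        - (\<integral>z. ?y' j z * ?y k z \<partial>?Q) + (\<integral>z. ?y' j z * ?y' k z \<partial>?Q) else 0)"
      unfolding witness_covariance[OF w w] witness_covariance[OF w w'] witness_covariance[OF w' w]
        witness_covariance[OF w' w'] by (simp add: case_prod_beta')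
    also have "\<dots> = (if j = k then (\<integral>z. (?y j z - ?y' j z) * (?y k z - ?y' k z) \<partial>?Q) else 0)"
      by (simp only: integral_diff_mult_diff[OF ysq ysq])
    also have "\<dots> = (if j = k then \<integral>z. ?d j z \<partial>?Q else 0)"
      by (auto intro!: Bochner_Integration.integral_cong simp: indicator_def power2_eq_square)
    finally show ?thesis .
  qed
  have SS: "expectation (\<lambda>\<omega>. S m \<omega> * S m \<omega>) = (\<Sum>j<m. \<integral>z. ?d j z \<partial>?Q)" for m
  proof -
    have "expectation (\<lambda>\<omega>. S m \<omega> * S m \<omega>) = (\<Sum>j<m. \<Sum>k<m. expectation (\<lambda>\<omega>. D j \<omega> * D k \<omega>))"
      unfolding S_def sum_product
      using sq_integrable_mult[OF Dsq Dsq]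
      by (subst Bochner_Integration.integral_sum; (intro sum.cong refl Bochner_Integration.integrable_sum
         Bochner_Integration.integral_sum)?) auto
    also have "\<dots> = (\<Sum>j<m. \<integral>z. ?d j z \<partial>?Q)"
      unfolding DD by (simp add: sum.delta)
    finally show ?thesis .
  qed
  have lim: "(\<lambda>m. ennreal (\<Sum>j<m. \<integral>z. ?d j z \<partial>?Q)) \<longlonglongrightarrow> ennreal (expectation (\<lambda>\<omega>. N \<omega> * N \<omega>))"
    using L2_tendsto_integral_mult[OF SN Nsq Ssq SN Nsq Ssq] unfolding SS by (rule tendsto_ennrealI)
  have "ennreal (expectation (\<lambda>\<omega>. N \<omega> * N \<omega>)) \<le> (\<Sum>j. \<integral>\<^sup>+z. ennreal (?d j z) \<partial>?Q)"
  proof (rule LIMSEQ_le_const2[OF lim], intro exI[of _ 0] allI impI)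
    fix m
    have "ennreal (\<Sum>j<m. \<integral>z. ?d j z \<partial>?Q) = (\<Sum>j<m. ennreal (\<integral>z. ?d j z \<partial>?Q))"
      by (intro sum_ennreal[symmetric] integral_nonneg_AE AE_I2) (auto split: prod.split)
    also have "\<dots> = (\<Sum>j<m. \<integral>\<^sup>+z. ennreal (?d j z) \<partial>?Q)"
      by (intro sum.cong refl nn_integral_eq_integral[symmetric] di AE_I2) (auto split: prod.split)
    also have "\<dots> \<le> (\<Sum>j. \<integral>\<^sup>+z. ennreal (?d j z) \<partial>?Q)"
      by (intro sum_le_suminf) auto
    finally show "ennreal (\<Sum>j<m. \<integral>z. ?d j z \<partial>?Q) \<le> (\<Sum>j. \<integral>\<^sup>+z. ennreal (?d j z) \<partial>?Q)" .
  qed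
  moreover have "(\<integral>\<^sup>+\<omega>. ennreal ((N \<omega>)\<^sup>2) \<partial>M) = ennreal (expectation (\<lambda>\<omega>. N \<omega> * N \<omega>))"
    using Nsq unfolding power2_eq_square[symmetric]
    by (intro nn_integral_eq_integral) (auto simp: sq_integrable_def)
  ultimately show "(\<integral>\<^sup>+\<omega>. ennreal ((N \<omega>)\<^sup>2) \<partial>M) \<le>
      (\<Sum>j. \<integral>\<^sup>+(x, \<omega>). ennreal (indicator {s<..t} x * (Y j x \<omega> - Y' j x \<omega>)\<^sup>2) \<partial>time_prob M T)"
    by (simp add: case_prod_beta')
qed

end

text \<open>
All that is needed about stochastic integration: the increments of the difference of two Ito series
are square integrable, are orthogonal to the past, and satisfy the inequality in the Ito isometry.
\<close>

lemma ito_series_difference: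
  assumes J: "ito_series M F T W g J" and J': "ito_series M F T W g' J'"
  obtains Y Y' where
    "\<And>j. progressive F T (Y j)" "\<And>j. versions M T (g j) (Y j)"
    "\<And>j. progressive F T (Y' j)" "\<And>j. versions M T (g' j) (Y' j)"
    "\<And>s t. 0 \<le> s \<Longrightarrow> s \<le> t \<Longrightarrow> t \<le> T \<Longrightarrow> sq_integrable M (\<lambda>\<omega>. (J t \<omega> - J' t \<omega>) - (J s \<omega> - J' s \<omega>))"
    "\<And>s t X. 0 \<le> s \<Longrightarrow> s \<le> t \<Longrightarrow> t \<le> T \<Longrightarrow> X \<in> borel_measurable (F s) \<Longrightarrow> sq_integrable M X \<Longrightarrow>
        expectation (\<lambda>\<omega>. X \<omega> * ((J t \<omega> - J' t \<omega>) - (J s \<omega> - J' s \<omega>))) = 0"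
    "\<And>s t. 0 \<le> s \<Longrightarrow> s \<le> t \<Longrightarrow> t \<le> T \<Longrightarrow>
       (\<integral>\<^sup>+\<omega>. ennreal (((J t \<omega> - J' t \<omega>) - (J s \<omega> - J' s \<omega>))\<^sup>2) \<partial>M) \<le>
      (\<Sum>j. \<integral>\<^sup>+(x, \<omega>). ennreal (indicator {s<..t} x * (Y j x \<omega> - Y' j x \<omega>)\<^sup>2) \<partial>time_prob M T)"
    "AE \<omega> in M. J 0 \<omega> = 0" "AE \<omega> in M. J' 0 \<omega> = 0"
proof -
  have zero: "AE \<omega> in M. J 0 \<omega> = 0" if J: "ito_series M F T W g J" for g J
  proof -
    obtain I where I: "\<And>j. ito_integral M F T (W j) (g j) (I j)"
      and lim: "\<And>t. t \<in> {0..T} \<Longrightarrow> (\<lambda>m. \<integral>\<^sup>+ \<omega>. ennreal (((\<Sum>j<m. I j t \<omega>) - J t \<omega>)\<^sup>2) \<partial>M) \<longlonglongrightarrow> 0"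
      using J unfolding ito_series_def by blast
    have z: "0 \<in> {0..T}" using T_pos by auto
    have "AE \<omega> in M. I j 0 \<omega> = 0" for j
    proof -
      obtain Y n \<tau> \<xi> where w: "ito_witness j (g j) (I j) Y n \<tau> \<xi>"
        using I[of j] by (auto simp: ito_integral_witness)
      have e: "elementary M F T (n k) (\<tau> k) (\<xi> k)" for k using w by (simp add: ito_witness_def)
      have "L2_tendsto M (\<lambda>k. elem_integral (W j) (n k) (\<tau> k) (\<xi> k) 0) (I j 0)"
        using w z by (simp add: ito_witness_def)
      then have "(\<integral>\<^sup>+ \<omega>. ennreal ((I j 0 \<omega>)\<^sup>2) \<partial>M) = 0"
        using elem_integral_0[OF e] by (simp add: L2_tendsto_def LIMSEQ_const_iff)
      moreover have "I j 0 \<in> borel_measurable M"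
        using w z by (simp add: ito_witness_def continuous_process_def)
      ultimately show ?thesis by (simp add: nn_integral_0_iff_AE)
    qed
    then have "AE \<omega> in M. \<forall>j. I j 0 \<omega> = 0" by (simp add: AE_all_countable)
    then have "(\<integral>\<^sup>+ \<omega>. ennreal (((\<Sum>j<m. I j 0 \<omega>) - J 0 \<omega>)\<^sup>2) \<partial>M) = (\<integral>\<^sup>+ \<omega>. ennreal ((J 0 \<omega>)\<^sup>2) \<partial>M)" for m
      by (intro nn_integral_cong_AE) auto
    then have "(\<integral>\<^sup>+ \<omega>. ennreal ((J 0 \<omega>)\<^sup>2) \<partial>M) = 0"
      using lim[OF z] by (simp add: LIMSEQ_const_iff)
    moreover have "J 0 \<in> borel_measurable M" using J z by (simp add: ito_series_def continuous_process_def)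
    ultimately show ?thesis by (simp add: nn_integral_0_iff_AE)
  qed
  have w: "\<exists>I Y n \<tau> \<xi>. (\<forall>j. ito_witness j (g j) (I j) (Y j) (n j) (\<tau> j) (\<xi> j)) \<and>
     (\<forall>t\<in>{0..T}. (\<lambda>m. \<integral>\<^sup>+ \<omega>. ennreal (((\<Sum>j<m. I j t \<omega>) - J t \<omega>)\<^sup>2) \<partial>M) \<longlonglongrightarrow> 0)"
    if J: "ito_series M F T W g J" for g J
  proof -
    obtain I where I: "\<And>j. ito_integral M F T (W j) (g j) (I j)"
      and lim: "\<And>t. t \<in> {0..T} \<Longrightarrow> (\<lambda>m. \<integral>\<^sup>+ \<omega>. ennreal (((\<Sum>j<m. I j t \<omega>) - J t \<omega>)\<^sup>2) \<partial>M) \<longlonglongrightarrow> 0"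
      using J unfolding ito_series_def by blast
    have "\<forall>j. \<exists>Y n \<tau> \<xi>. ito_witness j (g j) (I j) Y n \<tau> \<xi>"
      using I by (simp add: ito_integral_witness)
    then have "\<exists>Y n \<tau> \<xi>. \<forall>j. ito_witness j (g j) (I j) (Y j) (n j) (\<tau> j) (\<xi> j)" by metis
    then show ?thesis using lim by blast
  qed
  obtain I Y n \<tau> \<xi> where W: "\<And>j. ito_witness j (g j) (I j) (Y j) (n j) (\<tau> j) (\<xi> j)"
     "\<forall>t\<in>{0..T}. (\<lambda>m. \<integral>\<^sup>+ \<omega>. ennreal (((\<Sum>j<m. I j t \<omega>) - J t \<omega>)\<^sup>2) \<partial>M) \<longlonglongrightarrow> 0"
    using w[OF J] by blast
  obtain I' Y' n' \<tau>' \<xi>' where W': "\<And>j. ito_witness j (g' j) (I' j) (Y' j) (n' j) (\<tau>' j) (\<xi>' j)"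
     "\<forall>t\<in>{0..T}. (\<lambda>m. \<integral>\<^sup>+ \<omega>. ennreal (((\<Sum>j<m. I' j t \<omega>) - J' t \<omega>)\<^sup>2) \<partial>M) \<longlonglongrightarrow> 0"
    using w[OF J'] by blast
  have c: "continuous_process M T J" "continuous_process M T J'"
    using J J' by (auto simp: ito_series_def)
  note d = series_difference_increment[OF _ _ _ W(1) W'(1) c(1) W(2) c(2) W'(2)]
  show thesis
    by (rule that[of Y Y'])
       (use W(1) W'(1) d zero[OF J] zero[OF J'] in \<open>auto simp: ito_witness_def\<close>)
qed

end

section \<open>The Gram-Schmidt procedure in a continuously embedded space\<close>

text \<open>
The Gram-Schmidt procedure produces a zero vector whenever the next vector depends linearly on the
previous ones. Allowing zero vectors keeps the index set \<open>\<nat>\<close>, and Bessel's inequality still holds.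
\<close>

definition orthonormal_or_zero :: "(nat \<Rightarrow> 'h::real_inner) \<Rightarrow> bool" where
  "orthonormal_or_zero z \<longleftrightarrow> (\<forall>j k. j \<noteq> k \<longrightarrow> inner (z j) (z k) = 0) \<and> (\<forall>k. z k = 0 \<or> norm (z k) = 1)"

lemma orthonormal_or_zero_collapse:
  assumes "orthonormal_or_zero z"
  shows "inner x (z k) * (inner x (z l) * inner (z k) (z l)) = (if k = l then (inner x (z k))\<^sup>2 else 0)"
proof (cases "k = l")
  case True
  have "z l = 0 \<or> inner (z l) (z l) = 1" using assms by (auto simp: orthonormal_or_zero_def norm_eq_1)
  then show ?thesis using True by (auto simp: power2_eq_square)
qed (use assms in \<open>auto simp: orthonormal_or_zero_def\<close>)

lemma Bessel_inequality:
  assumes "orthonormal_or_zero z"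
  shows "(\<Sum>k<n. (inner x (z k))\<^sup>2) \<le> (norm x)\<^sup>2"
proof -
  define P where "P = (\<Sum>k<n. inner x (z k) *\<^sub>R z k)"
  have "inner P P = (\<Sum>k<n. \<Sum>l<n. inner x (z k) * (inner x (z l) * inner (z k) (z l)))"
    by (simp add: P_def inner_sum_left inner_sum_right sum_distrib_left mult_ac inner_commute)
  also have "\<dots> = (\<Sum>k<n. (inner x (z k))\<^sup>2)" unfolding orthonormal_or_zero_collapse[OF assms] by simp
  finally have 1: "inner P P = (\<Sum>k<n. (inner x (z k))\<^sup>2)" .
  have 2: "inner x P = (\<Sum>k<n. (inner x (z k))\<^sup>2)"
    by (simp add: P_def inner_sum_right power2_eq_square)
  have "0 \<le> inner (x - P) (x - P)" by simp
  also have "\<dots> = inner x x - (\<Sum>k<n. (inner x (z k))\<^sup>2)"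
    using 1 2 by (simp add: inner_diff_left inner_diff_right inner_commute)
  finally show ?thesis by (simp add: dot_square_norm)
qed

text \<open>
The procedure orthogonalises a sequence in \<open>'v\<close> with respect to the inner product of \<open>'h\<close> that is pulled
back along \<open>e\<close>. The vectors stay in \<open>'v\<close>, so that functionals defined on \<open>'v\<close> only can be applied to them.
A linearly dependent vector gives \<open>1 / 0 = 0\<close>.
\<close>

fun gram_schmidt :: "('v::real_vector \<Rightarrow> 'h::real_inner) \<Rightarrow> (nat \<Rightarrow> 'v) \<Rightarrow> nat \<Rightarrow> 'v" where
  "gram_schmidt e a n =
     (let y = a n - (\<Sum>k<n. inner (e (a n)) (e (gram_schmidt e a k)) *\<^sub>R gram_schmidt e a k)
      in (1 / norm (e y)) *\<^sub>R y)"

declare gram_schmidt.simps [simp del]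

context
  fixes e :: "'v::real_vector \<Rightarrow> 'h::real_inner" and a :: "nat \<Rightarrow> 'v"
  assumes e: "linear e" "inj e"
begin

interpretation e: linear e by (rule e)

lemma gram_schmidt_normed: "e (gram_schmidt e a n) = 0 \<or> norm (e (gram_schmidt e a n)) = 1"
  unfolding gram_schmidt.simps[of e a n] Let_def by (auto simp: e.scaleR)

lemma gram_schmidt_orthogonal_less: "j < n \<Longrightarrow> inner (e (gram_schmidt e a n)) (e (gram_schmidt e a j)) = 0"
proof (induction n arbitrary: j rule: less_induct)
  case (less n)
  let ?z = "gram_schmidt e a"
  have o: "inner (e (?z k)) (e (?z j)) = (if k = j then (norm (e (?z j)))\<^sup>2 else 0)" if "k < n" for k
    using less.IH[of k j] less.IH[of j k] that less.prems
    by (cases k j rule: linorder_cases) (auto simp: inner_commute dot_square_norm)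
  have "inner (e (a n - (\<Sum>k<n. inner (e (a n)) (e (?z k)) *\<^sub>R ?z k))) (e (?z j)) =
      inner (e (a n)) (e (?z j)) - (\<Sum>k<n. inner (e (a n)) (e (?z k)) * inner (e (?z k)) (e (?z j)))"
    by (simp add: e.diff e.sum e.scaleR inner_diff_left inner_sum_left)
  also have "(\<Sum>k<n. inner (e (a n)) (e (?z k)) * inner (e (?z k)) (e (?z j))) =
      (\<Sum>k<n. if k = j then inner (e (a n)) (e (?z j)) * (norm (e (?z j)))\<^sup>2 else 0)"
    by (intro sum.cong) (auto simp: o)
  also have "\<dots> = inner (e (a n)) (e (?z j))"
    using less.prems gram_schmidt_normed[of j] by auto
  finally show ?case
    by (subst gram_schmidt.simps) (simp add: Let_def e.scaleR)
qed

lemma gram_schmidt_orthonormal: "orthonormal_or_zero (\<lambda>k. e (gram_schmidt e a k))"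
  unfolding orthonormal_or_zero_def
  using gram_schmidt_orthogonal_less gram_schmidt_normed
  by (auto simp: inner_commute) (metis inner_commute linorder_neqE_nat)

text \<open>
The expansion holds in \<open>'v\<close> and not only after applying \<open>e\<close>, because \<open>e\<close> is injective.
\<close>

lemma gram_schmidt_expansion:
  assumes "n < m"
  shows "a n = (\<Sum>k<m. inner (e (a n)) (e (gram_schmidt e a k)) *\<^sub>R gram_schmidt e a k)"
proof -
  let ?z = "gram_schmidt e a"
  define y where "y = a n - (\<Sum>k<n. inner (e (a n)) (e (?z k)) *\<^sub>R ?z k)"
  have zn: "?z n = (1 / norm (e y)) *\<^sub>R y"
    unfolding y_def by (subst gram_schmidt.simps) (simp add: Let_def)
  have y: "y = norm (e y) *\<^sub>R ?z n"
  proof (cases "e y = 0")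
    case True
    then have "y = 0" using e(2) e.zero by (metis injD)
    then show ?thesis by simp
  qed (simp add: zn)
  have an: "a n = norm (e y) *\<^sub>R ?z n + (\<Sum>k<n. inner (e (a n)) (e (?z k)) *\<^sub>R ?z k)"
    unfolding y[symmetric] by (simp add: y_def)
  have on: "orthonormal_or_zero (\<lambda>k. e (?z k))" by (rule gram_schmidt_orthonormal)
  have ip: "inner (e (a n)) (e (?z i)) = norm (e y) * inner (e (?z n)) (e (?z i)) +
      (\<Sum>k<n. inner (e (a n)) (e (?z k)) * inner (e (?z k)) (e (?z i)))" for i
  proof -
    have "e (a n) = norm (e y) *\<^sub>R e (?z n) + (\<Sum>k<n. inner (e (a n)) (e (?z k)) *\<^sub>R e (?z k))"
      using arg_cong[OF an, of e] by (simp only: e.add e.scaleR e.sum)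
    then have "inner (e (a n)) (e (?z i)) = inner (norm (e y) *\<^sub>R e (?z n) + (\<Sum>k<n. inner (e (a n)) (e (?z k)) *\<^sub>R e (?z k))) (e (?z i))"
      by (rule arg_cong)
    then show ?thesis by (simp only: inner_add_left inner_scaleR_left inner_sum_left)
  qed
  have gt: "inner (e (a n)) (e (?z i)) = 0" if "n < i" for i
    using on that unfolding orthonormal_or_zero_def by (subst ip) simp
  have eq: "inner (e (a n)) (e (?z n)) *\<^sub>R ?z n = norm (e y) *\<^sub>R ?z n"
  proof (cases "e (?z n) = 0")
    case True
    then have "?z n = 0" using e(2) e.zero by (metis injD)
    then show ?thesis by simp
  next
    case False
    then have "inner (e (?z n)) (e (?z n)) = 1" using gram_schmidt_normed[of n] by (simp add: dot_square_norm)
    moreover have "(\<Sum>k<n. inner (e (a n)) (e (?z k)) * inner (e (?z k)) (e (?z n))) = 0"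
      using on unfolding orthonormal_or_zero_def by (intro sum.neutral) auto
    ultimately show ?thesis by (subst ip) simp
  qed
  have "(\<Sum>k<m. inner (e (a n)) (e (?z k)) *\<^sub>R ?z k) = (\<Sum>k<Suc n. inner (e (a n)) (e (?z k)) *\<^sub>R ?z k)"
    using assms gt by (intro sum.mono_neutral_right) auto
  also have "\<dots> = (\<Sum>k<n. inner (e (a n)) (e (?z k)) *\<^sub>R ?z k) + norm (e y) *\<^sub>R ?z n"
    by (simp only: sum.lessThan_Suc eq)
  also have "\<dots> = a n" by (subst add.commute) (rule an[symmetric])
  finally show ?thesis by simp
qed

end

text \<open>
A functional \<open>N\<close> that is continuous for the norm of \<open>'v\<close> is bounded in the weaker norm of \<open>'h\<close> as
soon as its values on the Gram-Schmidt vectors are square summable. On the dense sequence this is the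
Cauchy-Schwarz inequality in the expansion; the rest is density in \<open>'v\<close>. The martingale part of the equation is
such a functional: it is defined on \<open>'v\<close> only, and this lemma extends it to \<open>'h\<close>.
\<close>

lemma gram_schmidt_functional_bound:
  fixes e :: "'v::real_normed_vector \<Rightarrow> 'h::real_inner" and N :: "'v \<Rightarrow> real"
  assumes e: "bounded_linear e" "inj e" and a: "closure (range a) = UNIV"
    and N: "linear N" "continuous_on UNIV N"
    and S: "\<And>n. (\<Sum>k<n. (N (gram_schmidt e a k))\<^sup>2) \<le> S"
  shows "\<bar>N x\<bar> \<le> sqrt S * norm (e x)"
proof -
  interpret e: bounded_linear e by (rule e)
  interpret N: linear N by (rule N)
  let ?z = "gram_schmidt e a"
  have lin: "linear e" by (rule e.linear)
  have "\<bar>N (a n)\<bar> \<le> sqrt S * norm (e (a n))" for n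
  proof -
    have "N (a n) = (\<Sum>k<Suc n. inner (e (a n)) (e (?z k)) * N (?z k))"
      by (subst gram_schmidt_expansion[OF lin e(2), of n "Suc n" a]) (simp_all only: N.sum N.scaleR lessI real_scaleR_def)
    then have "(N (a n))\<^sup>2 \<le> (\<Sum>k<Suc n. (inner (e (a n)) (e (?z k)))\<^sup>2) * (\<Sum>k<Suc n. (N (?z k))\<^sup>2)"
      using Cauchy_Schwarz_ineq_sum by metis
    also have "\<dots> \<le> (norm (e (a n)))\<^sup>2 * S"
      by (intro mult_mono S Bessel_inequality gram_schmidt_orthonormal lin e(2)) (auto intro!: sum_nonneg add_nonneg_nonneg)
    finally have "sqrt ((N (a n))\<^sup>2) \<le> sqrt ((norm (e (a n)))\<^sup>2 * S)" by (rule real_sqrt_le_mono)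
    then show ?thesis by (simp add: real_sqrt_mult mult.commute)
  qed
  then have "range a \<subseteq> {x. \<bar>N x\<bar> \<le> sqrt S * norm (e x)}" by auto
  moreover have "closed {x. \<bar>N x\<bar> \<le> sqrt S * norm (e x)}"
    by (intro closed_Collect_le continuous_intros N(2) linear_continuous_on e)
  ultimately have "closure (range a) \<subseteq> {x. \<bar>N x\<bar> \<le> sqrt S * norm (e x)}"
    by (rule closure_minimal)
  then show ?thesis using a by auto
qed

text \<open>
On the dense sequence the projections are eventually the identity, and they do not increase the norm of
\<open>'h\<close>.
\<close>

lemma gram_schmidt_projection_tendsto:
  fixes e :: "'v::real_normed_vector \<Rightarrow> 'h::real_inner"
  assumes e: "bounded_linear e" "inj e" and a: "closure (range a) = UNIV"
  shows "(\<lambda>n. norm (e (x - (\<Sum>k<n. inner (e x) (e (gram_schmidt e a k)) *\<^sub>R gram_schmidt e a k)))) \<longlonglongrightarrow> 0"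
proof -
  interpret e: bounded_linear e by (rule e)
  let ?z = "gram_schmidt e a"
  define P where "P n x = (\<Sum>k<n. inner (e x) (e (?z k)) *\<^sub>R ?z k)" for n x
  have lin: "linear e" by (rule e.linear)
  have on: "orthonormal_or_zero (\<lambda>k. e (?z k))" by (rule gram_schmidt_orthonormal[OF lin e(2)])
  \<comment> \<open>the projections are non-expansive for the norm of \<open>'h\<close>\<close>
  have contr: "norm (e (x - P n x)) \<le> norm (e x)" for n x
  proof -
    note zz = orthonormal_or_zero_collapse[OF on]
    have eP: "e (P n x) = (\<Sum>k<n. inner (e x) (e (?z k)) *\<^sub>R e (?z k))" by (simp add: P_def e.sum e.scaleR)
    have "inner (e (P n x)) (e (P n x)) = (\<Sum>k<n. \<Sum>l<n. inner (e x) (e (?z k)) * (inner (e x) (e (?z l)) * inner (e (?z k)) (e (?z l))))"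
      by (simp add: eP inner_sum_left inner_sum_right sum_distrib_left mult_ac inner_commute)
    then have 1: "inner (e (P n x)) (e (P n x)) = (\<Sum>k<n. (inner (e x) (e (?z k)))\<^sup>2)"
      unfolding zz by simp
    have 2: "inner (e x) (e (P n x)) = (\<Sum>k<n. (inner (e x) (e (?z k)))\<^sup>2)"
      by (simp add: eP inner_sum_right power2_eq_square)
    have "(norm (e (x - P n x)))\<^sup>2 = inner (e x) (e x) - (\<Sum>k<n. (inner (e x) (e (?z k)))\<^sup>2)"
      using 1 2 by (simp add: e.diff inner_diff_left inner_diff_right inner_commute flip: dot_square_norm)
    also have "\<dots> \<le> (norm (e x))\<^sup>2" by (simp add: dot_square_norm sum_nonneg)
    finally show ?thesis by (simp add: power2_le_iff_abs_le)
  qed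
  have lP: "P n (x - y) = P n x - P n y" for n x y
    by (simp add: P_def e.diff inner_diff_left scaleR_diff_left sum_subtractf)
  obtain K where K: "K > 0" "\<And>x. norm (e x) \<le> norm x * K" using e.pos_bounded by blast
  show ?thesis
    unfolding P_def[symmetric]
  proof (rule LIMSEQ_I)
    fix r :: real assume "r > 0"
    have "x \<in> closure (range a)" using a by simp
    then obtain m where m: "dist (a m) x < r / K"
      using \<open>r > 0\<close> K(1) by (auto simp: closure_approachable dest!: spec[of _ "r / K"])
    show "\<exists>no. \<forall>n\<ge>no. norm (norm (e (x - P n x)) - 0) < r"
    proof (intro exI[of _ "Suc m"] allI impI)
      fix n assume "Suc m \<le> n"
      then have "P n (a m) = a m"
        using gram_schmidt_expansion[OF lin e(2), of m n a] by (simp add: P_def)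
      then have "x - P n x = (x - a m) - P n (x - a m)" by (simp add: lP)
      then have "norm (e (x - P n x)) \<le> norm (e (x - a m))" using contr by metis
      also have "\<dots> \<le> norm (x - a m) * K" by (rule K)
      also have "\<dots> < r" using m K(1) by (simp add: dist_norm norm_minus_commute field_simps)
      finally show "norm (norm (e (x - P n x)) - 0) < r" by simp
    qed
  qed
qed

section \<open>Demicontinuity and joint measurability\<close>

text \<open>
Minty's trick. The operator \<open>b x = a x + l * inner (E x) (E _)\<close> is monotone and bounded on bounded
sets. Monotonicity, tested at \<open>w0 + s *\<^sub>R y\<close>, bounds the upper limit of \<open>b (w n) y\<close> by
\<open>b (w0 + s *\<^sub>R y) y\<close> for every \<open>s > 0\<close>, and hemicontinuity sends \<open>s\<close> to \<open>0\<close>. Replacing \<open>y\<close> by \<open>- y\<close>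
gives the lower limit.
\<close>

lemma monotone_hemicontinuous_imp_demicontinuous:
  fixes a :: "'x::real_normed_vector \<Rightarrow> 'x \<Rightarrow>\<^sub>L real" and E :: "'x \<Rightarrow> 'h::real_inner"
  assumes hemi: "hemicontinuous a" and E: "bounded_linear E"
    and growth: "\<And>w. norm (a w) \<le> c * (1 + norm w) powr r" "0 \<le> r" "0 \<le> c"
    and mono: "\<And>w z. 0 \<le> blinfun_apply (a w - a z) (w - z) + l * (norm (E (w - z)))\<^sup>2"
    and lim: "w \<longlonglongrightarrow> w0"
  shows "(\<lambda>n. blinfun_apply (a (w n)) y) \<longlonglongrightarrow> blinfun_apply (a w0) y"
proof -
  interpret E: bounded_linear E by (rule E)
  define b where "b x y = blinfun_apply (a x) y + l * inner (E x) (E y)" for x y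
  have b_lin: "b x (s *\<^sub>R y) = s * b x y" "b x (y - z) = b x y - b x z" "b x (- y) = - b x y" for x y z s
    by (auto simp: b_def blinfun.scaleR_right blinfun.diff_right blinfun.minus_right E.scaleR E.diff E.neg
        inner_diff_right algebra_simps)
  have bmono: "0 \<le> b x (x - z) - b z (x - z)" for x z
    using mono[of x z]
    by (simp add: b_def blinfun.diff_left E.diff power2_norm_eq_inner inner_diff_left inner_diff_right algebra_simps)
  obtain KE where KE: "KE > 0" "\<And>x. norm (E x) \<le> norm x * KE" using E.pos_bounded by blast
  have "Bseq w" using lim convergent_def convergent_imp_Bseq by blast
  then obtain R where R: "R > 0" "\<And>n. norm (w n) \<le> R" by (auto elim: BseqE)
  define K where "K = c * (1 + R) powr r + \<bar>l\<bar> * (R * KE) * KE"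
  have bbound: "\<bar>b (w n) y\<bar> \<le> K * norm y" for n y
  proof -
    have "\<bar>blinfun_apply (a (w n)) y\<bar> \<le> norm (a (w n)) * norm y"
      using norm_blinfun[of "a (w n)" y] by simp
    also have "\<dots> \<le> (c * (1 + R) powr r) * norm y"
    proof (rule mult_right_mono)
      have "norm (a (w n)) \<le> c * (1 + norm (w n)) powr r" by (rule growth)
      also have "\<dots> \<le> c * (1 + R) powr r"
        using growth(2,3) R(2)[of n] by (intro mult_left_mono powr_mono2) auto
      finally show "norm (a (w n)) \<le> c * (1 + R) powr r" .
    qed simp
    finally have 1: "\<bar>blinfun_apply (a (w n)) y\<bar> \<le> (c * (1 + R) powr r) * norm y" .
    have "\<bar>inner (E (w n)) (E y)\<bar> \<le> norm (E (w n)) * norm (E y)" by (rule Cauchy_Schwarz_ineq2)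
    also have "\<dots> \<le> (R * KE) * (norm y * KE)"
    proof (rule mult_mono)
      show "norm (E (w n)) \<le> R * KE"
        using KE(2)[of "w n"] mult_right_mono[OF R(2)[of n], of KE] KE(1) by linarith
    qed (use KE R in auto)
    finally have "\<bar>l * inner (E (w n)) (E y)\<bar> \<le> \<bar>l\<bar> * ((R * KE) * (norm y * KE))"
      by (simp add: abs_mult mult_left_mono)
    moreover have "\<bar>b (w n) y\<bar> \<le> \<bar>blinfun_apply (a (w n)) y\<bar> + \<bar>l * inner (E (w n)) (E y)\<bar>"
      unfolding b_def by (rule abs_triangle_ineq)
    ultimately show ?thesis using 1 unfolding K_def by (simp add: algebra_simps)
  qed
  have w0: "(\<lambda>n. norm (w n - w0)) \<longlonglongrightarrow> 0" using lim by (simp add: LIM_zero tendsto_norm_zero)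
  have bw0: "(\<lambda>n. b x (w n - w0)) \<longlonglongrightarrow> 0" for x
  proof -
    have "(\<lambda>n. b x (w n - w0)) \<longlonglongrightarrow> b x 0"
      unfolding b_def using lim
      by (intro tendsto_intros E.tendsto) (auto intro: LIM_zero)
    then show ?thesis by (simp add: b_def E.zero blinfun.zero_right)
  qed
  have bn0: "(\<lambda>n. b (w n) (w n - w0)) \<longlonglongrightarrow> 0"
  proof (rule Lim_null_comparison)
    show "\<forall>\<^sub>F n in sequentially. norm (b (w n) (w n - w0)) \<le> K * norm (w n - w0)"
      using bbound by simp
    show "(\<lambda>n. K * norm (w n - w0)) \<longlonglongrightarrow> 0" using tendsto_mult_left[OF w0, of K] by simp
  qed
  \<comment> \<open>Half of \<open>\<delta>\<close> is spent on choosing \<open>s\<close> by hemicontinuity, the other half on \<open>n\<close>.\<close>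
  have upper: "\<forall>\<^sub>F n in sequentially. b (w n) y < b w0 y + \<delta>" if "\<delta> > 0" for y \<delta>
  proof -
    have ha: "continuous_on {0..1} (\<lambda>s. blinfun_apply (a (w0 + s *\<^sub>R y)) y)"
      using hemi by (simp add: hemicontinuous_def)
    have "continuous_on {0..1} (\<lambda>s. b (w0 + s *\<^sub>R y) y)"
      unfolding b_def by (intro continuous_intros ha bounded_linear.continuous_on[OF E])
    then have "((\<lambda>s. b (w0 + s *\<^sub>R y) y) \<longlongrightarrow> b (w0 + 0 *\<^sub>R y) y) (at 0 within {0..1})"
      unfolding continuous_on by (rule bspec) simp
    then have "\<forall>\<^sub>F s in at 0 within {0..1::real}. b (w0 + s *\<^sub>R y) y < b w0 y + \<delta> / 2"
      using that by (intro order_tendstoD) auto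
    moreover have "\<forall>\<^sub>F s in at 0 within {0..1::real}. s \<in> {0..1} \<and> s \<noteq> 0"
      by (simp add: eventually_at_filter)
    ultimately have "\<forall>\<^sub>F s in at 0 within {0..1::real}. b (w0 + s *\<^sub>R y) y < b w0 y + \<delta> / 2 \<and> s \<in> {0..1} \<and> s \<noteq> 0"
      by eventually_elim auto
    moreover have "at 0 within {0..1::real} \<noteq> bot" by (simp add: trivial_limit_within islimpt_Icc)
    ultimately obtain s where s: "b (w0 + s *\<^sub>R y) y < b w0 y + \<delta> / 2" "0 < s"
      using eventually_happens' by fastforce
    have "(\<lambda>n. (b (w n) (w n - w0) - b (w0 + s *\<^sub>R y) (w n - w0)) / s) \<longlonglongrightarrow> (0 - 0) / s"
      using s by (intro tendsto_intros bn0 bw0) auto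
    then have "\<forall>\<^sub>F n in sequentially. (b (w n) (w n - w0) - b (w0 + s *\<^sub>R y) (w n - w0)) / s < \<delta> / 2"
      using that by (intro order_tendstoD) auto
    then show ?thesis
    proof eventually_elim
      case (elim n)
      have "0 \<le> b (w n) (w n - (w0 + s *\<^sub>R y)) - b (w0 + s *\<^sub>R y) (w n - (w0 + s *\<^sub>R y))" by (rule bmono)
      also have "w n - (w0 + s *\<^sub>R y) = (w n - w0) - s *\<^sub>R y" by simp
      finally have "s * b (w n) y \<le> (b (w n) (w n - w0) - b (w0 + s *\<^sub>R y) (w n - w0)) + s * b (w0 + s *\<^sub>R y) y"
        by (simp only: b_lin)
      then have "b (w n) y \<le> (b (w n) (w n - w0) - b (w0 + s *\<^sub>R y) (w n - w0)) / s + b (w0 + s *\<^sub>R y) y"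
        using s(2) by (simp add: field_simps)
      then show ?case using elim s(1) by linarith
    qed
  qed
  have "(\<lambda>n. b (w n) y) \<longlonglongrightarrow> b w0 y"
  proof (rule order_tendstoI)
    fix t assume "t < b w0 y"
    then have "\<forall>\<^sub>F n in sequentially. b (w n) (- y) < b w0 (- y) + (b w0 y - t)" by (intro upper) auto
    then show "\<forall>\<^sub>F n in sequentially. t < b (w n) y" by (simp add: b_lin)
  next
    fix t assume "b w0 y < t"
    then have "\<forall>\<^sub>F n in sequentially. b (w n) y < b w0 y + (t - b w0 y)" by (intro upper) auto
    then show "\<forall>\<^sub>F n in sequentially. b (w n) y < t" by simp
  qed
  moreover have "(\<lambda>n. l * inner (E (w n)) (E y)) \<longlonglongrightarrow> l * inner (E w0) (E y)"
    by (intro tendsto_intros E.tendsto lim)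
  ultimately have "(\<lambda>n. b (w n) y - l * inner (E (w n)) (E y)) \<longlonglongrightarrow> b w0 y - l * inner (E w0) (E y)"
    by (rule tendsto_diff)
  then show ?thesis by (simp add: b_def)
qed

text \<open>
The point \<open>x\<close> is replaced by the first member of a countable dense set at distance less than \<open>1 / (m + 1)\<close>;
the resulting function is jointly measurable, and it converges as \<open>m\<close> grows.
\<close>

lemma Caratheodory_measurable:
  fixes \<phi> :: "'x::{metric_space, second_countable_topology} \<Rightarrow> 'w \<Rightarrow> real"
  assumes m: "\<And>x. \<phi> x \<in> borel_measurable M"
    and c: "\<And>\<omega> x w. \<omega> \<in> space M \<Longrightarrow> w \<longlonglongrightarrow> x \<Longrightarrow> (\<lambda>n. \<phi> (w n) \<omega>) \<longlonglongrightarrow> \<phi> x \<omega>"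
  shows "(\<lambda>(x, \<omega>). \<phi> x \<omega>) \<in> borel_measurable (borel \<Otimes>\<^sub>M M)"
proof -
  obtain D :: "'x set" where D: "countable D" "\<And>X. open X \<Longrightarrow> X \<noteq> {} \<Longrightarrow> \<exists>d\<in>D. d \<in> X"
    using countable_dense_setE by metis
  have "D \<noteq> {}" using D(2)[of UNIV] by auto
  define d where "d = from_nat_into D"
  have dense: "\<exists>n. dist x (d n) < 1 / real (Suc m)" for x m
  proof -
    obtain y where "y \<in> D" "y \<in> ball x (1 / real (Suc m))" using D(2)[of "ball x (1 / real (Suc m))"] by auto
    then show ?thesis
      using from_nat_into_surj[OF D(1)] by (metis d_def mem_ball)
  qed
  define i where "i m x = (LEAST n. dist x (d n) < 1 / real (Suc m))" for m x
  have i: "dist x (d (i m x)) < 1 / real (Suc m)" for x m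
    unfolding i_def using dense by (rule LeastI_ex)
  have im: "i m \<in> borel \<rightarrow>\<^sub>M count_space UNIV" for m
    unfolding i_def by measurable
  show ?thesis
  proof (rule borel_measurable_LIMSEQ_metric)
    fix m
    show "(\<lambda>z. \<phi> (d (i m (fst z))) (snd z)) \<in> borel_measurable (borel \<Otimes>\<^sub>M M)"
      by (rule measurable_compose_countable[where f="\<lambda>n z. \<phi> (d n) (snd z)"])
         (auto intro!: measurable_compose[OF measurable_snd m] measurable_compose[OF measurable_fst im])
  next
    fix z assume "z \<in> space ((borel :: 'x measure) \<Otimes>\<^sub>M M)"
    then have s: "snd z \<in> space M" by (auto simp: space_pair_measure)
    have "(\<lambda>m. d (i m (fst z))) \<longlonglongrightarrow> fst z"
    proof (rule metric_LIMSEQ_I)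
      fix r :: real assume "r > 0"
      then obtain N where N: "1 / real (Suc N) < r" using nat_approx_posE by metis
      show "\<exists>no. \<forall>n\<ge>no. dist (d (i n (fst z))) (fst z) < r"
      proof (intro exI[of _ N] allI impI)
        fix n assume "N \<le> n"
        then have "1 / real (Suc n) \<le> 1 / real (Suc N)" by (simp add: field_simps)
        then show "dist (d (i n (fst z))) (fst z) < r" using i[of "fst z" n] N by (simp add: dist_commute)
      qed
    qed
    from c[OF s this] show "(\<lambda>m. \<phi> (d (i m (fst z))) (snd z)) \<longlonglongrightarrow> (case z of (x, \<omega>) \<Rightarrow> \<phi> x \<omega>)"
      by (simp add: case_prod_beta)
  qed
qed

section \<open>Continuity of translations\<close>

lemma integrable_shift:
  fixes f :: "real \<Rightarrow> real"
  shows "integrable lborel f \<Longrightarrow> integrable lborel (\<lambda>t. f (t - \<theta>))"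
  using lborel_integrable_real_affine[of f 1 "- \<theta>"] by simp

lemma integral_shift:
  fixes f :: "real \<Rightarrow> real"
  shows "(\<integral>t. f (t - \<theta>) \<partial>lborel) = (\<integral>t. f t \<partial>lborel)"
  using lborel_integral_real_affine[of 1 f "- \<theta>"] by simp

definition translation_continuous :: "(real \<Rightarrow> real) \<Rightarrow> bool" where
  "translation_continuous f \<longleftrightarrow>
     (\<forall>\<theta>. \<theta> \<longlonglongrightarrow> 0 \<longrightarrow> (\<lambda>n. \<integral>t. \<bar>f (t - \<theta> n) - f t\<bar> \<partial>lborel) \<longlonglongrightarrow> 0)"

text \<open>
For a nonnegative integrable \<open>f\<close>, the positive and the negative part of \<open>f (t - h) - f t\<close> have the same
integral, so only \<open>max 0 (f t - f (t - h))\<close> matters. It is dominated by \<open>f\<close>, and for the indicator of an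
open set it vanishes at every point as soon as \<open>h\<close> is small enough there.
\<close>

lemma translation_continuous_open:
  assumes U: "open U" "emeasure lborel U < \<infinity>"
  shows "translation_continuous (indicator U)"
  unfolding translation_continuous_def
proof (intro allI impI)
  fix \<theta> :: "nat \<Rightarrow> real" assume \<theta>: "\<theta> \<longlonglongrightarrow> 0"
  let ?f = "indicator U :: real \<Rightarrow> real"
  have [measurable]: "U \<in> sets borel" using U by auto
  have i: "integrable lborel ?f" using U by (intro integrable_real_indicator) auto
  note i_s = integrable_shift[OF i]
  have eq: "(\<integral>t. \<bar>?f (t - h) - ?f t\<bar> \<partial>lborel) = 2 * (\<integral>t. max 0 (?f t - ?f (t - h)) \<partial>lborel)" for h
  proof -
    have "(\<integral>t. \<bar>?f (t - h) - ?f t\<bar> \<partial>lborel) = (\<integral>t. 2 * max 0 (?f t - ?f (t - h)) + (?f (t - h) - ?f t) \<partial>lborel)"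
      by (intro Bochner_Integration.integral_cong) (auto simp: abs_if max_def)
    also have "\<dots> = 2 * (\<integral>t. max 0 (?f t - ?f (t - h)) \<partial>lborel)"
      using i i_s[of h] integral_shift[of ?f h] by simp
    finally show ?thesis .
  qed
  have "(\<lambda>n. \<integral>t. max 0 (?f t - ?f (t - \<theta> n)) \<partial>lborel) \<longlonglongrightarrow> (\<integral>t. 0 \<partial>(lborel :: real measure))"
  proof (rule integral_dominated_convergence[where w="?f"])
    show "AE t in lborel. (\<lambda>n. max 0 (?f t - ?f (t - \<theta> n))) \<longlonglongrightarrow> 0"
    proof (intro AE_I2)
      fix t :: real
      show "(\<lambda>n. max 0 (?f t - ?f (t - \<theta> n))) \<longlonglongrightarrow> 0"
      proof (cases "t \<in> U")
        case True
        have "(\<lambda>n. t - \<theta> n) \<longlonglongrightarrow> t - 0" by (intro tendsto_intros \<theta>)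
        then have "\<forall>\<^sub>F n in sequentially. t - \<theta> n \<in> U" using U(1) True by (intro topological_tendstoD) auto
        then have "\<forall>\<^sub>F n in sequentially. max 0 (?f t - ?f (t - \<theta> n)) = 0" by eventually_elim auto
        then show ?thesis by (rule tendsto_eventually)
      qed simp
    qed
  qed (auto simp: i indicator_def)
  then have "(\<lambda>n. 2 * (\<integral>t. max 0 (?f t - ?f (t - \<theta> n)) \<partial>lborel)) \<longlonglongrightarrow> 2 * 0"
    by (intro tendsto_intros) simp
  then show "(\<lambda>n. \<integral>t. \<bar>?f (t - \<theta> n) - ?f t\<bar> \<partial>lborel) \<longlonglongrightarrow> 0" unfolding eq by simp
qed

lemma translation_continuous_approx:
  fixes f :: "real \<Rightarrow> real"
  assumes f: "integrable lborel f"
    and ap: "\<And>\<epsilon>. \<epsilon> > 0 \<Longrightarrow> \<exists>g. integrable lborel g \<and> translation_continuous g \<and> (\<integral>t. \<bar>f t - g t\<bar> \<partial>lborel) < \<epsilon>"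
  shows "translation_continuous f"
  unfolding translation_continuous_def
proof (intro allI impI LIMSEQ_I)
  fix \<theta> :: "nat \<Rightarrow> real" and \<epsilon> :: real assume \<theta>: "\<theta> \<longlonglongrightarrow> 0" and "\<epsilon> > 0"
  then obtain g where g: "integrable lborel g" "translation_continuous g" "(\<integral>t. \<bar>f t - g t\<bar> \<partial>lborel) < \<epsilon> / 3"
    using ap[of "\<epsilon> / 3"] by auto
  have "(\<lambda>n. \<integral>t. \<bar>g (t - \<theta> n) - g t\<bar> \<partial>lborel) \<longlonglongrightarrow> 0"
    using g(2) \<theta> by (simp add: translation_continuous_def)
  then have "\<forall>\<^sub>F n in sequentially. (\<integral>t. \<bar>g (t - \<theta> n) - g t\<bar> \<partial>lborel) < \<epsilon> / 3"
    using \<open>\<epsilon> > 0\<close> by (intro order_tendstoD) auto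
  then obtain N where N: "\<And>n. n \<ge> N \<Longrightarrow> (\<integral>t. \<bar>g (t - \<theta> n) - g t\<bar> \<partial>lborel) < \<epsilon> / 3"
    unfolding eventually_sequentially by blast
  have b: "(\<integral>t. \<bar>f (t - h) - f t\<bar> \<partial>lborel) \<le> 2 * (\<integral>t. \<bar>f t - g t\<bar> \<partial>lborel) + (\<integral>t. \<bar>g (t - h) - g t\<bar> \<partial>lborel)" for h
  proof -
    have ig: "integrable lborel (\<lambda>t. \<bar>f t - g t\<bar>)" using f g by auto
    have "(\<integral>t. \<bar>f (t - h) - f t\<bar> \<partial>lborel) \<le>
       (\<integral>t. \<bar>f (t - h) - g (t - h)\<bar> + \<bar>f t - g t\<bar> + \<bar>g (t - h) - g t\<bar> \<partial>lborel)"
      using f g integrable_shift[OF f, of h] integrable_shift[OF g(1), of h] integrable_shift[OF ig, of h]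
      by (intro integral_mono) auto
    also have "\<dots> = 2 * (\<integral>t. \<bar>f t - g t\<bar> \<partial>lborel) + (\<integral>t. \<bar>g (t - h) - g t\<bar> \<partial>lborel)"
      using f g integrable_shift[OF f, of h] integrable_shift[OF g(1), of h] integrable_shift[OF ig, of h]
        integral_shift[of "\<lambda>t. \<bar>f t - g t\<bar>" h] by simp
    finally show ?thesis .
  qed
  show "\<exists>no. \<forall>n\<ge>no. norm ((\<integral>t. \<bar>f (t - \<theta> n) - f t\<bar> \<partial>lborel) - 0) < \<epsilon>"
  proof (intro exI[of _ N] allI impI)
    fix n assume "N \<le> n"
    have "0 \<le> (\<integral>t. \<bar>f (t - \<theta> n) - f t\<bar> \<partial>lborel)" by simp
    then show "norm ((\<integral>t. \<bar>f (t - \<theta> n) - f t\<bar> \<partial>lborel) - 0) < \<epsilon>"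
      using b[of "\<theta> n"] N[OF \<open>N \<le> n\<close>] g(3) by simp
  qed
qed

text \<open>
The class of translation continuous functions is closed in \<open>L\<^sup>1\<close>. Outer regularity passes from open
sets to measurable ones.
\<close>

lemma integrable_translation_continuous:
  fixes f :: "real \<Rightarrow> real"
  assumes "integrable lborel f"
  shows "translation_continuous f"
  using assms
proof (induction rule: integrable_induct)
  case (base A c)
  have iA: "integrable lborel (indicator A :: real \<Rightarrow> real)" using base by (intro integrable_real_indicator)
  have "translation_continuous (indicator A)"
  proof (rule translation_continuous_approx[OF iA])
    fix \<epsilon> :: real assume "\<epsilon> > 0"
    obtain U where U: "open U" "A \<subseteq> U" "(U - A) \<in> lmeasurable" "emeasure lebesgue (U - A) < ennreal \<epsilon>"
      using sets_lebesgue_outer_open[of A \<epsilon>] base \<open>\<epsilon> > 0\<close> by (auto simp: sets_completionI_sets)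
    have m: "U - A \<in> sets lborel" "A \<in> sets lborel" using U(1) base by auto
    have e: "emeasure lborel (U - A) < ennreal \<epsilon>" using U(4) m by simp
    have "emeasure lborel U = emeasure lborel A + emeasure lborel (U - A)"
      using m U(2) by (subst plus_emeasure) (auto intro: arg_cong[where f="emeasure lborel"])
    then have fU: "emeasure lborel U < \<infinity>" using base e by (auto simp: less_top[symmetric])
    have "(\<integral>t. \<bar>indicator A t - indicator U t :: real\<bar> \<partial>lborel) = (\<integral>t. indicator (U - A) t \<partial>lborel)"
      using U(2) by (intro Bochner_Integration.integral_cong) (auto simp: indicator_def)
    also have "\<dots> = measure lborel (U - A)" by simp
    also have "\<dots> < \<epsilon>"
    proof -
      have "emeasure lborel (U - A) \<noteq> \<infinity>" using e by auto
      then have "emeasure lborel (U - A) = ennreal (measure lborel (U - A))"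
        by (rule emeasure_eq_ennreal_measure[unfolded infinity_ennreal_def[symmetric]])
      then show ?thesis using e by (simp add: ennreal_less_iff)
    qed
    finally show "\<exists>g. integrable lborel g \<and> translation_continuous g \<and> (\<integral>t. \<bar>indicator A t - g t\<bar> \<partial>lborel) < \<epsilon>"
      using translation_continuous_open[OF U(1) fU] fU U(1)
      by (intro exI[of _ "indicator U"]) (auto intro!: integrable_real_indicator)
  qed
  then show ?case
    unfolding translation_continuous_def
    by (auto simp: left_diff_distrib[symmetric] abs_mult intro!: tendsto_mult_left_zero)
next
  case (add f g)
  show ?case unfolding translation_continuous_def
  proof (intro allI impI)
    fix \<theta> :: "nat \<Rightarrow> real" assume \<theta>: "\<theta> \<longlonglongrightarrow> 0"
    have "(\<lambda>n. (\<integral>t. \<bar>f (t - \<theta> n) - f t\<bar> \<partial>lborel) + (\<integral>t. \<bar>g (t - \<theta> n) - g t\<bar> \<partial>lborel)) \<longlonglongrightarrow> 0 + 0"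
      using add \<theta> by (intro tendsto_add) (auto simp: translation_continuous_def)
    then have l: "(\<lambda>n. (\<integral>t. \<bar>f (t - \<theta> n) - f t\<bar> \<partial>lborel) + (\<integral>t. \<bar>g (t - \<theta> n) - g t\<bar> \<partial>lborel)) \<longlonglongrightarrow> 0" by simp
    show "(\<lambda>n. \<integral>t. \<bar>f (t - \<theta> n) + g (t - \<theta> n) - (f t + g t)\<bar> \<partial>lborel) \<longlonglongrightarrow> 0"
    proof (rule Lim_null_comparison[OF always_eventually l], intro allI)
      fix n
      have "(\<integral>t. \<bar>f (t - \<theta> n) + g (t - \<theta> n) - (f t + g t)\<bar> \<partial>lborel) \<le>
          (\<integral>t. \<bar>f (t - \<theta> n) - f t\<bar> + \<bar>g (t - \<theta> n) - g t\<bar> \<partial>lborel)"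
        using add.hyps integrable_shift[OF add.hyps(1), of "\<theta> n"] integrable_shift[OF add.hyps(2), of "\<theta> n"]
        by (intro integral_mono) auto
      then show "norm (\<integral>t. \<bar>f (t - \<theta> n) + g (t - \<theta> n) - (f t + g t)\<bar> \<partial>lborel) \<le>
          (\<integral>t. \<bar>f (t - \<theta> n) - f t\<bar> \<partial>lborel) + (\<integral>t. \<bar>g (t - \<theta> n) - g t\<bar> \<partial>lborel)"
        using add.hyps integrable_shift[OF add.hyps(1), of "\<theta> n"] integrable_shift[OF add.hyps(2), of "\<theta> n"]
        by simp
    qed
  qed
next
  case (lim f s)
  show ?case
  proof (rule translation_continuous_approx[OF \<open>integrable lborel f\<close>])
    fix \<epsilon> :: real assume "\<epsilon> > 0"
    have "(\<lambda>i. \<integral>t. \<bar>f t - s i t\<bar> \<partial>lborel) \<longlonglongrightarrow> (\<integral>t. 0 \<partial>(lborel :: real measure))"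
    proof (rule integral_dominated_convergence[where w="\<lambda>t. 3 * \<bar>f t\<bar>"])
      show "AE t in lborel. (\<lambda>i. \<bar>f t - s i t\<bar>) \<longlonglongrightarrow> 0"
      proof (intro AE_I2)
        fix t
        have "(\<lambda>i. \<bar>f t - s i t\<bar>) \<longlonglongrightarrow> \<bar>f t - f t\<bar>" using lim.hyps(2)[of t] by (intro tendsto_intros) auto
        then show "(\<lambda>i. \<bar>f t - s i t\<bar>) \<longlonglongrightarrow> 0" by simp
      qed
      show "AE t in lborel. norm \<bar>f t - s i t\<bar> \<le> 3 * \<bar>f t\<bar>" for i
      proof (intro AE_I2)
        fix t
        show "norm \<bar>f t - s i t\<bar> \<le> 3 * \<bar>f t\<bar>" using lim.hyps(3)[of t i] by auto
      qed
    qed (use lim in auto)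
    then have "\<forall>\<^sub>F i in sequentially. (\<integral>t. \<bar>f t - s i t\<bar> \<partial>lborel) < \<epsilon>"
      using \<open>\<epsilon> > 0\<close> by (intro order_tendstoD) auto
    then obtain i where "(\<integral>t. \<bar>f t - s i t\<bar> \<partial>lborel) < \<epsilon>" by (auto simp: eventually_sequentially)
    then show "\<exists>g. integrable lborel g \<and> translation_continuous g \<and> (\<integral>t. \<bar>f t - g t\<bar> \<partial>lborel) < \<epsilon>"
      using lim by blast
  qed
qed

lemma powr_add_le:
  assumes "0 \<le> (a::real)" "0 \<le> b" "0 \<le> r"
  shows "(a + b) powr r \<le> 2 powr r * (a powr r + b powr r)"
proof -
  have "(a + b) powr r \<le> (2 * max a b) powr r" using assms by (intro powr_mono2) auto
  also have "\<dots> = 2 powr r * max a b powr r" using assms by (simp add: powr_mult)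
  also have "\<dots> \<le> 2 powr r * (a powr r + b powr r)"
    using assms by (intro mult_left_mono) (auto simp: max_def)
  finally show ?thesis .
qed

lemma indicator_sq_integrable: "sq_integrable lborel (indicator {a..b} :: real \<Rightarrow> real)"
proof -
  have "(\<lambda>x. (indicator {a..b} x :: real)\<^sup>2) = indicator {a..b}" by (auto simp: indicator_def)
  then show ?thesis unfolding sq_integrable_def by (auto simp: emeasure_lborel_Icc_eq)
qed

lemma powr_two_norm: "norm (x::'z::real_normed_vector) powr 2 = (norm x)\<^sup>2"
  by (cases "x = 0") (auto simp: powr_numeral)

lemma integral_window:
  fixes f :: "real \<Rightarrow> real"
  shows "(\<integral>\<theta>. indicator {0..<h} \<theta> * f (t - \<theta>) \<partial>lborel) = (\<integral>r. indicator {t - h<..t} r * f r \<partial>lborel)"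
proof -
  have "(\<integral>r. indicator {t - h<..t} r * f r \<partial>lborel) = (\<integral>\<theta>. indicator {t - h<..t} (t + - 1 * \<theta>) * f (t + - 1 * \<theta>) \<partial>lborel)"
    using lborel_integral_real_affine[of "-1" "\<lambda>r. indicator {t - h<..t} r * f r" t] by simp
  also have "\<dots> = (\<integral>\<theta>. indicator {0..<h} \<theta> * f (t - \<theta>) \<partial>lborel)"
    by (intro Bochner_Integration.integral_cong) (auto simp: indicator_def)
  finally show ?thesis ..
qed

text \<open>
The weight \<open>\<eta>\<close> makes one of the two terms small at the expense of the other.
\<close>

lemma Young_weighted:
  fixes p q :: real
  assumes "1 < p" "q = p / (p - 1)" "0 \<le> a" "0 \<le> b" "0 < \<eta>"
  shows "a * b \<le> \<eta> powr q * a powr q + (1 / \<eta>) powr p * b powr p"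
proof -
  have q: "1 < q" using assms(1) unfolding assms(2) by (simp add: less_divide_eq)
  have "1 / q = (p - 1) / p" by (simp add: assms(2))
  then have q': "1 / q + 1 / p = 1" using assms(1) by (simp add: diff_divide_distrib)
  have "a * b = (\<eta> * a) * (b / \<eta>)" using assms by simp
  also have "\<dots> \<le> (\<eta> * a) powr q / q + (b / \<eta>) powr p / p"
    using assms q q' by (intro Youngs_inequality) auto
  also have "\<dots> \<le> (\<eta> * a) powr q + (b / \<eta>) powr p"
    using assms(1) q by (intro add_mono) (auto simp: divide_le_eq mult_left_le mult_le_cancel_left1)
  also have "\<dots> = \<eta> powr q * a powr q + (1 / \<eta>) powr p * b powr p"
    using assms by (simp add: powr_mult powr_divide)
  finally show ?thesis .
qed

context prob_space
begin

text \<open>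
Processes on \<open>[0,T]\<close> are extended by zero to the whole real line. On the product of the line
and the probability space, shifts in time preserve the measure.
\<close>

abbreviation "TM \<equiv> (lborel :: real measure) \<Otimes>\<^sub>M M"

definition shift :: "real \<Rightarrow> real \<times> 'a \<Rightarrow> real \<times> 'a" where
  "shift \<theta> = (\<lambda>(t, \<omega>). (t - \<theta>, \<omega>))"

lemma pair_sigma_finite_TM: "pair_sigma_finite (lborel :: real measure) M"
  by (simp add: pair_sigma_finite_def sigma_finite_lborel sigma_finite_measure_axioms)

lemma shift_measurable [measurable]: "shift \<theta> \<in> TM \<rightarrow>\<^sub>M TM"
  unfolding shift_def by measurable

lemma sigma_finite_TM: "sigma_finite_measure TM"
proof -
  interpret P: pair_sigma_finite "lborel :: real measure" M by (rule pair_sigma_finite_TM)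
  show ?thesis by (rule P.sigma_finite_measure_axioms)
qed

lemma pair_sigma_finite_lborel_TM: "pair_sigma_finite (lborel :: real measure) TM"
  by (simp add: pair_sigma_finite_def sigma_finite_lborel sigma_finite_TM)

lemma shift_0: "shift 0 z = z"
  by (simp add: shift_def split: prod.split)

lemma shift_cancel: "shift (- \<theta>) (shift \<theta> z) = z" "shift \<theta> (shift (- \<theta>) z) = z"
  by (simp_all add: shift_def split: prod.split)

lemma shift_measurable_pair: "(\<lambda>(\<theta>, z). shift \<theta> z) \<in> lborel \<Otimes>\<^sub>M TM \<rightarrow>\<^sub>M TM"
  unfolding shift_def case_prod_beta' by measurable

lemma shift_measurable_pair': "(\<lambda>x. shift (fst x) (snd x)) \<in> lborel \<Otimes>\<^sub>M TM \<rightarrow>\<^sub>M TM"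
  using shift_measurable_pair by (simp add: case_prod_beta')

lemma snd_shift [simp]: "snd (shift \<theta> z) = snd z" and fst_shift [simp]: "fst (shift \<theta> z) = fst z - \<theta>"
  by (simp_all add: shift_def split: prod.split)

lemma distr_shift: "distr TM TM (shift \<theta>) = TM"
proof -
  have a: "distr lborel lborel (\<lambda>t::real. t - \<theta>) = lborel"
  proof -
    have "distr lborel lborel (\<lambda>t::real. t - \<theta>) = distr lborel borel ((+) (- \<theta>))"
      by (rule distr_cong) auto
    then show ?thesis by (simp only: lborel_distr_plus)
  qed
  have "distr lborel lborel (\<lambda>t::real. t - \<theta>) \<Otimes>\<^sub>M distr M M (\<lambda>x. x) =
      distr TM TM (\<lambda>(t, \<omega>). (t - \<theta>, \<omega>))"
    by (rule pair_measure_distr) (auto simp: distr_id2 sigma_finite_measure_axioms)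
  then show ?thesis unfolding a shift_def by (simp add: distr_id2)
qed

lemma integrable_TM_shift:
  fixes f :: "real \<times> 'a \<Rightarrow> real"
  assumes "integrable TM f"
  shows "integrable TM (\<lambda>z. f (shift \<theta> z))"
  using assms integrable_distr[of "shift \<theta>" TM TM f] by (simp add: distr_shift)

lemma integral_TM_shift:
  fixes f :: "real \<times> 'a \<Rightarrow> real"
  assumes "integrable TM f"
  shows "(\<integral>z. f (shift \<theta> z) \<partial>TM) = (\<integral>z. f z \<partial>TM)"
  using integral_distr[of "shift \<theta>" TM TM f] borel_measurable_integrable[OF assms] by (simp add: distr_shift)

text \<open>
Path by path this is the continuity of translations on the line; twice the integral of the absolute value
dominates.
\<close>

lemma TM_translation_continuous:
  fixes \<phi> :: "real \<times> 'a \<Rightarrow> real"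
  assumes \<phi>: "integrable TM \<phi>" and \<theta>: "\<theta> \<longlonglongrightarrow> 0"
  shows "(\<lambda>n. \<integral>z. \<bar>\<phi> (shift (\<theta> n) z) - \<phi> z\<bar> \<partial>TM) \<longlonglongrightarrow> 0"
proof -
  interpret P: pair_sigma_finite "lborel :: real measure" M by (rule pair_sigma_finite_TM)
  have i: "integrable TM (\<lambda>z. \<bar>\<phi> (shift (\<theta> n) z) - \<phi> z\<bar>)" for n
    using integrable_TM_shift[OF \<phi>] \<phi> by auto
  let ?g = "\<lambda>n t \<omega>. \<bar>\<phi> (t - \<theta> n, \<omega>) - \<phi> (t, \<omega>)\<bar>"
  have i': "integrable TM (\<lambda>(t, \<omega>). ?g n t \<omega>)" for n
    using i[of n] by (simp add: shift_def case_prod_beta')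
  have \<phi>': "integrable TM (\<lambda>(t, \<omega>). \<phi> (t, \<omega>))" using \<phi> by (simp add: case_prod_beta')
  have eq: "(\<integral>z. \<bar>\<phi> (shift (\<theta> n) z) - \<phi> z\<bar> \<partial>TM) = (\<integral>\<omega>. (\<integral>t. ?g n t \<omega> \<partial>lborel) \<partial>M)" for n
    using P.integral_snd[OF i'[of n]] by (simp add: shift_def case_prod_beta')
  have ae: "AE \<omega> in M. integrable lborel (\<lambda>t. \<phi> (t, \<omega>))"
    by (rule P.AE_integrable_snd[OF \<phi>'])
  have "(\<lambda>n. \<integral>\<omega>. (\<integral>t. ?g n t \<omega> \<partial>lborel) \<partial>M) \<longlonglongrightarrow> (\<integral>\<omega>. 0 \<partial>M)"
  proof (rule integral_dominated_convergence[where w="\<lambda>\<omega>. 2 * (\<integral>t. \<bar>\<phi> (t, \<omega>)\<bar> \<partial>lborel)"])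
    show "(\<lambda>\<omega>. \<integral>t. ?g n t \<omega> \<partial>lborel) \<in> borel_measurable M" for n
      using P.integrable_snd[OF i'[of n]] by (rule borel_measurable_integrable)
    have "integrable TM (\<lambda>(t, \<omega>). \<bar>\<phi> (t, \<omega>)\<bar>)" using \<phi> by (auto simp: case_prod_beta')
    from P.integrable_snd[OF this] show "integrable M (\<lambda>\<omega>. 2 * (\<integral>t. \<bar>\<phi> (t, \<omega>)\<bar> \<partial>lborel))" by simp
    show "AE \<omega> in M. (\<lambda>n. \<integral>t. ?g n t \<omega> \<partial>lborel) \<longlonglongrightarrow> 0"
      using ae by eventually_elim
        (use integrable_translation_continuous \<theta> in \<open>auto simp: translation_continuous_def\<close>)
    show "AE \<omega> in M. norm (\<integral>t. ?g n t \<omega> \<partial>lborel) \<le> 2 * (\<integral>t. \<bar>\<phi> (t, \<omega>)\<bar> \<partial>lborel)" for n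
      using ae
    proof eventually_elim
      case (elim \<omega>)
      have "(\<integral>t. ?g n t \<omega> \<partial>lborel) \<le> (\<integral>t. \<bar>\<phi> (t - \<theta> n, \<omega>)\<bar> + \<bar>\<phi> (t, \<omega>)\<bar> \<partial>lborel)"
        using elim integrable_shift[OF elim, of "\<theta> n"] by (intro integral_mono) auto
      also have "\<dots> = 2 * (\<integral>t. \<bar>\<phi> (t, \<omega>)\<bar> \<partial>lborel)"
        using elim integrable_shift[OF elim, of "\<theta> n"] integral_shift[of "\<lambda>t. \<bar>\<phi> (t, \<omega>)\<bar>" "\<theta> n"] by simp
      finally show ?case by simp
    qed
  qed simp
  then show ?thesis unfolding eq by simp
qed

text \<open>
A quantity \<open>f \<theta> z\<close> that couples the present \<open>z\<close> with the time at distance \<open>\<theta>\<close> before it is integrated over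
all lags \<open>\<theta> \<in> [0,h)\<close>. Over a window \<open>(t - h, t]\<close> the substitution \<open>r = t - \<theta>\<close> yields exactly such integrals.
\<close>

definition lag_average :: "real \<Rightarrow> (real \<Rightarrow> real \<times> 'a \<Rightarrow> real) \<Rightarrow> real \<times> 'a \<Rightarrow> real" where
  "lag_average h f z = (\<integral>\<theta>. indicator {0..<h} \<theta> * f \<theta> z \<partial>lborel)"

lemma shift_average:
  fixes f :: "real \<Rightarrow> real \<times> 'a \<Rightarrow> real" and w :: "real \<times> 'a \<Rightarrow> real"
  assumes m: "(\<lambda>(\<theta>, z). f \<theta> z) \<in> borel_measurable (lborel \<Otimes>\<^sub>M TM)"
    and i: "\<And>\<theta>. integrable TM (f \<theta>)" and b: "\<And>\<theta>. (\<integral>z. \<bar>f \<theta> z\<bar> \<partial>TM) \<le> C"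
    and w: "w \<in> borel_measurable TM" "\<And>z. \<bar>w z\<bar> \<le> 1"
    and h: "0 \<le> h"
  shows "integrable TM (lag_average h f)" "integrable TM (\<lambda>z. w z * lag_average h f z)"
    "integrable lborel (\<lambda>\<theta>. indicator {0..<h} \<theta> * (\<integral>z. w z * f \<theta> z \<partial>TM))"
    "(\<integral>z. w z * lag_average h f z \<partial>TM) = (\<integral>\<theta>. indicator {0..<h} \<theta> * (\<integral>z. w z * f \<theta> z \<partial>TM) \<partial>lborel)"
proof -
  interpret L: pair_sigma_finite "lborel :: real measure" TM by (rule pair_sigma_finite_lborel_TM)
  have m1: "(\<lambda>(\<theta>, z). indicator {0..<h} \<theta> * f \<theta> z) \<in> borel_measurable (lborel \<Otimes>\<^sub>M TM)"
    using m unfolding case_prod_beta' by (intro borel_measurable_times) (measurable, auto)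
  have i1: "integrable (lborel \<Otimes>\<^sub>M TM) (\<lambda>(\<theta>, z). indicator {0..<h} \<theta> * f \<theta> z)"
  proof (rule integrableI_bounded[OF m1])
    have "(\<integral>\<^sup>+x. ennreal (norm (case x of (\<theta>, z) \<Rightarrow> indicator {0..<h} \<theta> * f \<theta> z)) \<partial>(lborel \<Otimes>\<^sub>M TM)) =
        (\<integral>\<^sup>+\<theta>. \<integral>\<^sup>+z. ennreal (norm (indicator {0..<h} \<theta> * f \<theta> z)) \<partial>TM \<partial>lborel)"
      using L.M2.nn_integral_fst[of "\<lambda>x. ennreal (norm (case x of (\<theta>, z) \<Rightarrow> indicator {0..<h} \<theta> * f \<theta> z))" lborel] m1
      by simp
    also have "\<dots> \<le> (\<integral>\<^sup>+\<theta>. ennreal C * indicator {0..<h} \<theta> \<partial>lborel)"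
    proof (rule nn_integral_mono)
      fix \<theta> :: real
      have "(\<integral>\<^sup>+z. ennreal (norm (f \<theta> z)) \<partial>TM) = ennreal (\<integral>z. \<bar>f \<theta> z\<bar> \<partial>TM)"
        using i[of \<theta>] by (subst nn_integral_eq_integral) auto
      also have "\<dots> \<le> ennreal C" using b by (intro ennreal_leI)
      finally show "(\<integral>\<^sup>+z. ennreal (norm (indicator {0..<h} \<theta> * f \<theta> z)) \<partial>TM) \<le> ennreal C * indicator {0..<h} \<theta>"
        by (auto simp: indicator_def)
    qed
    also have "\<dots> < \<infinity>" using h by (simp add: nn_integral_cmult_indicator ennreal_mult_less_top)
    finally show "(\<integral>\<^sup>+x. ennreal (norm (case x of (\<theta>, z) \<Rightarrow> indicator {0..<h} \<theta> * f \<theta> z)) \<partial>(lborel \<Otimes>\<^sub>M TM)) < \<infinity>" .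
  qed
  have i2: "integrable (lborel \<Otimes>\<^sub>M TM) (\<lambda>(\<theta>, z). indicator {0..<h} \<theta> * (w z * f \<theta> z))"
  proof (rule Bochner_Integration.integrable_bound[OF i1])
    have "(\<lambda>(\<theta>, z). w z * (indicator {0..<h} \<theta> * f \<theta> z)) \<in> borel_measurable (lborel \<Otimes>\<^sub>M TM)"
      using borel_measurable_times[OF measurable_compose[OF measurable_snd w(1), of lborel] m1]
      unfolding case_prod_beta' .
    then show "(\<lambda>(\<theta>, z). indicator {0..<h} \<theta> * (w z * f \<theta> z)) \<in> borel_measurable (lborel \<Otimes>\<^sub>M TM)"
      by (simp add: mult.left_commute)
    show "AE x in lborel \<Otimes>\<^sub>M TM. norm (case x of (\<theta>, z) \<Rightarrow> indicator {0..<h} \<theta> * (w z * f \<theta> z))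
        \<le> norm (case x of (\<theta>, z) \<Rightarrow> indicator {0..<h} \<theta> * f \<theta> z)"
      using w(2) by (intro AE_I2) (auto simp: indicator_def abs_mult intro!: mult_left_le_one_le)
  qed
  have wH: "w z * lag_average h f z = (\<integral>\<theta>. indicator {0..<h} \<theta> * (w z * f \<theta> z) \<partial>lborel)" for z
    unfolding lag_average_def by (subst integral_mult_right_zero[symmetric]) (simp add: mult.left_commute)
  show "integrable TM (lag_average h f)" unfolding lag_average_def[abs_def] by (rule L.integrable_snd[OF i1])
  show "integrable TM (\<lambda>z. w z * lag_average h f z)" unfolding wH by (rule L.integrable_snd[OF i2])
  show "integrable lborel (\<lambda>\<theta>. indicator {0..<h} \<theta> * (\<integral>z. w z * f \<theta> z \<partial>TM))"
    using L.integrable_fst[OF i2] by simp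
  show "(\<integral>z. w z * lag_average h f z \<partial>TM) = (\<integral>\<theta>. indicator {0..<h} \<theta> * (\<integral>z. w z * f \<theta> z \<partial>TM) \<partial>lborel)"
    unfolding wH using L.integral_snd[OF i2] L.integral_fst[OF i2] by simp
qed

text \<open>
For operators \<open>\<Phi>\<close> in \<open>L\<^sup>q\<close> and \<open>v\<close> in \<open>L\<^sup>p\<close>, the pairing of \<open>\<Phi>\<close> at the time \<open>t - h\<close> with \<open>v\<close> at the time \<open>t\<close> converges,
as \<open>h\<close> tends to \<open>0\<close>, to the pairing at equal times. If \<open>v\<close> is simple, this is the continuity of
translations for finitely many scalar functions \<open>\<Phi> z x\<close>. The weighted Young inequality makes the error
of replacing \<open>v\<close> by a simple function small uniformly in \<open>h\<close>, because the shift preserves the integral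
of \<open>\<Gamma> z powr q\<close>. Measurability of \<open>\<Phi>\<close> is meant weakly, as for
the operators of the equation.
\<close>

lemma TM_bilinear_translation:
  fixes \<Phi> :: "real \<times> 'a \<Rightarrow> 'v::{banach, second_countable_topology} \<Rightarrow> real" and v :: "real \<times> 'a \<Rightarrow> 'v"
  assumes p: "1 < p" "q = p / (p - 1)"
    and \<Phi>m: "(\<lambda>(z, x). \<Phi> z x) \<in> borel_measurable (TM \<Otimes>\<^sub>M borel)"
    and \<Phi>d: "\<And>z x y. \<Phi> z (x - y) = \<Phi> z x - \<Phi> z y"
    and \<Phi>b: "\<And>z x. \<bar>\<Phi> z x\<bar> \<le> \<Gamma> z * norm x"
    and \<Gamma>: "integrable TM \<Gamma>" "integrable TM (\<lambda>z. \<Gamma> z powr q)" "\<And>z. 0 \<le> \<Gamma> z"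
    and v: "v \<in> borel_measurable TM" "integrable TM (\<lambda>z. norm (v z) powr p)"
  shows TM_bilinear_integrable: "integrable TM (\<lambda>z. \<Phi> (shift \<theta> z) (v z))"
    and TM_bilinear_bound: "(\<integral>z. \<bar>\<Phi> (shift \<theta> z) (v z)\<bar> \<partial>TM) \<le> (\<integral>z. \<Gamma> z powr q \<partial>TM) + (\<integral>z. norm (v z) powr p \<partial>TM)"
    and TM_bilinear_tendsto: "h \<longlonglongrightarrow> 0 \<Longrightarrow>
      (\<lambda>n. \<integral>z. \<Phi> (shift (h n) z) (v z) \<partial>TM) \<longlonglongrightarrow> (\<integral>z. \<Phi> z (v z) \<partial>TM)"
proof -
  define G where "G = (\<integral>z. \<Gamma> z powr q \<partial>TM)"
  have G0: "0 \<le> G" unfolding G_def by simp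
  have int: "integrable TM (\<lambda>z. \<Phi> (shift \<theta> z) (w z))"
    and bound: "0 < \<eta> \<Longrightarrow> (\<integral>z. \<bar>\<Phi> (shift \<theta> z) (w z)\<bar> \<partial>TM) \<le>
        \<eta> powr q * G + (1 / \<eta>) powr p * (\<integral>z. norm (w z) powr p \<partial>TM)"
    if w: "w \<in> borel_measurable TM" "integrable TM (\<lambda>z. norm (w z) powr p)" for w \<theta> \<eta>
  proof -
    have pw: "\<bar>\<Phi> (shift \<theta> z) (w z)\<bar> \<le> \<eta> powr q * \<Gamma> (shift \<theta> z) powr q + (1 / \<eta>) powr p * norm (w z) powr p"
      if "0 < \<eta>" for z \<eta>
      using \<Phi>b[of "shift \<theta> z" "w z"] Young_weighted[OF p \<Gamma>(3)[of "shift \<theta> z"] norm_ge_zero[of "w z"] that] by linarith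
    have ig: "integrable TM (\<lambda>z. \<Gamma> (shift \<theta> z) powr q)"
      by (rule integrable_TM_shift[OF \<Gamma>(2)])
    have m: "(\<lambda>z. \<Phi> (shift \<theta> z) (w z)) \<in> borel_measurable TM"
    proof -
      have "(\<lambda>z. (shift \<theta> z, w z)) \<in> TM \<rightarrow>\<^sub>M TM \<Otimes>\<^sub>M borel" using w(1) by measurable
      from measurable_compose[OF this \<Phi>m] show ?thesis by simp
    qed
    show i: "integrable TM (\<lambda>z. \<Phi> (shift \<theta> z) (w z))"
      by (rule Bochner_Integration.integrable_bound[where f="\<lambda>z. 1 powr q * \<Gamma> (shift \<theta> z) powr q + (1 / 1) powr p * norm (w z) powr p"])
         (use ig w(2) m pw[of 1] in \<open>auto intro!: AE_I2\<close>)
    show "(\<integral>z. \<bar>\<Phi> (shift \<theta> z) (w z)\<bar> \<partial>TM) \<le>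
        \<eta> powr q * G + (1 / \<eta>) powr p * (\<integral>z. norm (w z) powr p \<partial>TM)" if "0 < \<eta>"
    proof -
      have "(\<integral>z. \<bar>\<Phi> (shift \<theta> z) (w z)\<bar> \<partial>TM) \<le> (\<integral>z. \<eta> powr q * \<Gamma> (shift \<theta> z) powr q + (1 / \<eta>) powr p * norm (w z) powr p \<partial>TM)"
        using i ig w(2) pw[OF that] by (intro integral_mono) auto
      also have "\<dots> = \<eta> powr q * G + (1 / \<eta>) powr p * (\<integral>z. norm (w z) powr p \<partial>TM)"
        using ig w(2) integral_TM_shift[OF \<Gamma>(2), of \<theta>] by (simp add: G_def)
      finally show ?thesis .
    qed
  qed
  show "integrable TM (\<lambda>z. \<Phi> (shift \<theta> z) (v z))" by (rule int[OF v])
  show "(\<integral>z. \<bar>\<Phi> (shift \<theta> z) (v z)\<bar> \<partial>TM) \<le> (\<integral>z. \<Gamma> z powr q \<partial>TM) + (\<integral>z. norm (v z) powr p \<partial>TM)"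
    using bound[OF v, of 1 \<theta>] by (simp add: G_def)
  assume h: "h \<longlonglongrightarrow> 0"
  have z0: "shift 0 z = z" for z by (simp add: shift_def split: prod.split)
  \<comment> \<open>Simple functions \<open>s i\<close> dominated by \<open>2 * norm (v z)\<close> converge to \<open>v\<close> in the \<open>p\<close>-th mean.\<close>
  obtain s where s: "\<And>i. simple_function TM (s i)" "\<And>z. z \<in> space TM \<Longrightarrow> (\<lambda>i. s i z) \<longlonglongrightarrow> v z"
    "\<And>i z. z \<in> space TM \<Longrightarrow> norm (s i z) \<le> 2 * norm (v z)"
    using borel_measurable_implies_sequence_metric[OF v(1), of 0] by simp metis
  have sm: "s i \<in> borel_measurable TM" for i using s(1) by (rule borel_measurable_simple_function)
  have sp: "integrable TM (\<lambda>z. norm (s i z) powr p)" for i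
  proof (rule Bochner_Integration.integrable_bound[where f="\<lambda>z. 2 powr p * norm (v z) powr p"])
    show "AE z in TM. norm (norm (s i z) powr p) \<le> norm (2 powr p * norm (v z) powr p)"
    proof (intro AE_I2)
      fix z assume "z \<in> space TM"
      then have "norm (s i z) powr p \<le> (2 * norm (v z)) powr p" using s(3) p(1) by (intro powr_mono2) auto
      then show "norm (norm (s i z) powr p) \<le> norm (2 powr p * norm (v z) powr p)" by (simp add: powr_mult)
    qed
  qed (use v(2) sm in auto)
  have dm: "(\<lambda>z. v z - s i z) \<in> borel_measurable TM" for i using sm v(1) by auto
  have dbound: "norm (v z - s i z) powr p \<le> 3 powr p * norm (v z) powr p" if "z \<in> space TM" for i z
  proof -
    have "norm (v z - s i z) \<le> 3 * norm (v z)" using s(3)[OF that, of i] norm_triangle_ineq4[of "v z" "s i z"] by linarith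
    then have "norm (v z - s i z) powr p \<le> (3 * norm (v z)) powr p" using p(1) by (intro powr_mono2) auto
    then show ?thesis by (simp add: powr_mult)
  qed
  have dp: "integrable TM (\<lambda>z. norm (v z - s i z) powr p)" for i
    by (rule Bochner_Integration.integrable_bound[where f="\<lambda>z. 3 powr p * norm (v z) powr p"])
       (use v(2) dm dbound in auto)
  have dlim: "(\<lambda>i. \<integral>z. norm (v z - s i z) powr p \<partial>TM) \<longlonglongrightarrow> (\<integral>z. 0 \<partial>TM)"
  proof (rule integral_dominated_convergence[where w="\<lambda>z. 3 powr p * norm (v z) powr p"])
    show "AE z in TM. (\<lambda>i. norm (v z - s i z) powr p) \<longlonglongrightarrow> 0"
    proof (intro AE_I2)
      fix z assume "z \<in> space TM"
      then have "(\<lambda>i. norm (v z - s i z)) \<longlonglongrightarrow> norm (v z - v z)" using s(2) by (intro tendsto_intros) auto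
      then have "(\<lambda>i. norm (v z - s i z)) \<longlonglongrightarrow> 0" by simp
      then show "(\<lambda>i. norm (v z - s i z) powr p) \<longlonglongrightarrow> 0"
        using p(1) by (intro tendsto_zero_powrI[where b=p]) auto
    qed
  qed (use v(2) dm dbound in auto)
  have simple: "(\<lambda>n. \<integral>z. \<Phi> (shift (h n) z) (s i z) \<partial>TM) \<longlonglongrightarrow> (\<integral>z. \<Phi> z (s i z) \<partial>TM)" for i
  proof -
    let ?R = "s i ` space TM"
    have fin: "finite ?R" using s(1)[of i] by (simp add: simple_function_def)
    have ix: "integrable TM (\<lambda>z. \<Phi> z x)" for x
    proof (rule Bochner_Integration.integrable_bound[where f="\<lambda>z. \<Gamma> z * norm x"])
      have "(\<lambda>z. (z, x)) \<in> TM \<rightarrow>\<^sub>M TM \<Otimes>\<^sub>M borel" by measurable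
      from measurable_compose[OF this \<Phi>m] show "(\<lambda>z. \<Phi> z x) \<in> borel_measurable TM" by simp
    qed (use \<Gamma> \<Phi>b in \<open>auto intro!: AE_I2\<close>)
    have l: "(\<lambda>n. \<Sum>x\<in>?R. \<integral>z. \<bar>\<Phi> (shift (h n) z) x - \<Phi> z x\<bar> \<partial>TM) \<longlonglongrightarrow> 0"
      using tendsto_sum[of ?R "\<lambda>x n. \<integral>z. \<bar>\<Phi> (shift (h n) z) x - \<Phi> z x\<bar> \<partial>TM" "\<lambda>_. 0" sequentially]
        TM_translation_continuous[OF ix h] by simp
    have "(\<lambda>n. (\<integral>z. \<Phi> (shift (h n) z) (s i z) \<partial>TM) - (\<integral>z. \<Phi> z (s i z) \<partial>TM)) \<longlonglongrightarrow> 0"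
    proof (rule Lim_null_comparison[OF always_eventually l], intro allI)
      fix n
      have i1: "integrable TM (\<lambda>z. \<Phi> (shift (h n) z) (s i z))" "integrable TM (\<lambda>z. \<Phi> z (s i z))"
        using int[OF sm sp, of "h n" i] int[OF sm sp, of 0 i] by (auto simp: z0)
      have i2: "integrable TM (\<lambda>z. \<bar>\<Phi> (shift (h n) z) x - \<Phi> z x\<bar>)" for x
        using integrable_TM_shift[OF ix, of "h n" x] ix[of x] by auto
      have "norm ((\<integral>z. \<Phi> (shift (h n) z) (s i z) \<partial>TM) - (\<integral>z. \<Phi> z (s i z) \<partial>TM)) =
          norm (\<integral>z. \<Phi> (shift (h n) z) (s i z) - \<Phi> z (s i z) \<partial>TM)"
        using i1 by simp
      also have "\<dots> \<le> (\<integral>z. norm (\<Phi> (shift (h n) z) (s i z) - \<Phi> z (s i z)) \<partial>TM)"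
        by (rule integral_norm_bound)
      also have "\<dots> \<le> (\<integral>z. (\<Sum>x\<in>?R. \<bar>\<Phi> (shift (h n) z) x - \<Phi> z x\<bar>) \<partial>TM)"
      proof (rule integral_mono)
        fix z assume "z \<in> space TM"
        then have "s i z \<in> ?R" by auto
        then show "norm (\<Phi> (shift (h n) z) (s i z) - \<Phi> z (s i z)) \<le> (\<Sum>x\<in>?R. \<bar>\<Phi> (shift (h n) z) x - \<Phi> z x\<bar>)"
          using member_le_sum[of "s i z" ?R "\<lambda>x. \<bar>\<Phi> (shift (h n) z) x - \<Phi> z x\<bar>"] fin by simp
      qed (use i1 i2 in auto)
      also have "\<dots> = (\<Sum>x\<in>?R. \<integral>z. \<bar>\<Phi> (shift (h n) z) x - \<Phi> z x\<bar> \<partial>TM)"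
        using i2 by (intro Bochner_Integration.integral_sum)
      finally show "norm ((\<integral>z. \<Phi> (shift (h n) z) (s i z) \<partial>TM) - (\<integral>z. \<Phi> z (s i z) \<partial>TM))
          \<le> (\<Sum>x\<in>?R. \<integral>z. \<bar>\<Phi> (shift (h n) z) x - \<Phi> z x\<bar> \<partial>TM)" .
    qed
    then show ?thesis by (simp add: LIM_zero_iff)
  qed
  show "(\<lambda>n. \<integral>z. \<Phi> (shift (h n) z) (v z) \<partial>TM) \<longlonglongrightarrow> (\<integral>z. \<Phi> z (v z) \<partial>TM)"
  proof (rule LIMSEQ_I)
    fix \<epsilon> :: real assume "\<epsilon> > 0"
    have "\<exists>\<eta>>0. \<eta> powr q * G < \<epsilon> / 5"
    proof -
      have q0: "0 < q" using p by simp
      have "((\<lambda>\<eta>. \<eta> powr q * G) \<longlongrightarrow> 0 * G) (at_right 0)"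
        using q0 by (intro tendsto_intros tendsto_zero_powrI[where b=q]) (auto simp: eventually_at_filter)
      then have "\<forall>\<^sub>F \<eta> in at_right 0. \<eta> powr q * G < \<epsilon> / 5"
        using \<open>\<epsilon> > 0\<close> by (intro order_tendstoD) auto
      then obtain b where "b > 0" "\<And>y. 0 < y \<Longrightarrow> y < b \<Longrightarrow> y powr q * G < \<epsilon> / 5"
        by (auto simp: eventually_at_right_field)
      then show ?thesis by (intro exI[of _ "b / 2"]) auto
    qed
    then obtain \<eta> where \<eta>: "\<eta> > 0" "\<eta> powr q * G < \<epsilon> / 5" by auto
    have "(\<lambda>i. (1 / \<eta>) powr p * (\<integral>z. norm (v z - s i z) powr p \<partial>TM)) \<longlonglongrightarrow> (1 / \<eta>) powr p * 0"
      using dlim by (intro tendsto_intros) simp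
    then have "\<forall>\<^sub>F i in sequentially. (1 / \<eta>) powr p * (\<integral>z. norm (v z - s i z) powr p \<partial>TM) < \<epsilon> / 5"
      using \<open>\<epsilon> > 0\<close> by (intro order_tendstoD) auto
    then obtain i where i: "(1 / \<eta>) powr p * (\<integral>z. norm (v z - s i z) powr p \<partial>TM) < \<epsilon> / 5"
      unfolding eventually_sequentially by blast
    \<comment> \<open>Uniformly in the shift: this bound is used at \<open>h n\<close> and at \<open>0\<close>.\<close>
  have close: "\<bar>(\<integral>z. \<Phi> (shift \<theta> z) (v z) \<partial>TM) - (\<integral>z. \<Phi> (shift \<theta> z) (s i z) \<partial>TM)\<bar> < 2 * (\<epsilon> / 5)" for \<theta>
    proof -
      have "\<bar>(\<integral>z. \<Phi> (shift \<theta> z) (v z) \<partial>TM) - (\<integral>z. \<Phi> (shift \<theta> z) (s i z) \<partial>TM)\<bar> =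
          \<bar>\<integral>z. \<Phi> (shift \<theta> z) (v z - s i z) \<partial>TM\<bar>"
        unfolding \<Phi>d using int[OF v, of \<theta>] int[OF sm sp, of \<theta> i] by simp
      also have "\<dots> \<le> (\<integral>z. \<bar>\<Phi> (shift \<theta> z) (v z - s i z)\<bar> \<partial>TM)"
        using integral_norm_bound[of TM "\<lambda>z. \<Phi> (shift \<theta> z) (v z - s i z)"] by simp
      also have "\<dots> \<le> \<eta> powr q * G + (1 / \<eta>) powr p * (\<integral>z. norm (v z - s i z) powr p \<partial>TM)"
        by (rule bound[OF dm dp \<eta>(1)])
      also have "\<dots> < 2 * (\<epsilon> / 5)" using \<eta>(2) i by simp
      finally show ?thesis .
    qed
    obtain N where N: "\<And>n. N \<le> n \<Longrightarrow> \<bar>(\<integral>z. \<Phi> (shift (h n) z) (s i z) \<partial>TM) - (\<integral>z. \<Phi> z (s i z) \<partial>TM)\<bar> < \<epsilon> / 5"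
      using LIMSEQ_D[OF simple[of i], of "\<epsilon> / 5"] \<open>\<epsilon> > 0\<close> unfolding real_norm_def by (metis divide_pos_pos zero_less_numeral)
    show "\<exists>no. \<forall>n\<ge>no. norm ((\<integral>z. \<Phi> (shift (h n) z) (v z) \<partial>TM) - (\<integral>z. \<Phi> z (v z) \<partial>TM)) < \<epsilon>"
    proof (intro exI[of _ N] allI impI)
      fix n assume "N \<le> n"
      then show "norm ((\<integral>z. \<Phi> (shift (h n) z) (v z) \<partial>TM) - (\<integral>z. \<Phi> z (v z) \<partial>TM)) < \<epsilon>"
        using N[of n] close[of "h n"] close[of 0] unfolding z0 real_norm_def by linarith
    qed
  qed
qed

end

section \<open>The operators along the difference of two velocities\<close>

text \<open>
The operators are assumed to have their properties for every \<open>\<omega>\<close>; in the application they are set to zero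
on a null set. The velocities \<open>y1\<close> and \<open>y2\<close> are jointly measurable and vanish outside \<open>[0,T]\<close>.
\<close>

locale energy_operators = wiener_basis M F T W
  for M :: "'w measure" and F T W +
  fixes p q lA lB cA cB :: real
    and eA :: "'va::{banach, second_countable_topology} \<Rightarrow>\<^sub>L 'vb::{banach, second_countable_topology}"
    and eB :: "'vb \<Rightarrow>\<^sub>L 'h::{real_inner, complete_space, second_countable_topology}"
    and A :: "'va \<Rightarrow> 'w \<Rightarrow> 'va \<Rightarrow>\<^sub>L real"
    and B :: "'vb \<Rightarrow> 'w \<Rightarrow> 'vb \<Rightarrow>\<^sub>L real"
    and y1 y2 :: "real \<times> 'w \<Rightarrow> 'va"
  assumes p: "2 \<le> p" "q = p / (p - 1)"
    and const: "0 \<le> lA" "0 \<le> lB" "0 \<le> cA" "0 \<le> cB"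
    and inj: "inj (blinfun_apply eA)" "inj (blinfun_apply eB)"
    and A_meas: "\<And>w x. (\<lambda>\<omega>. blinfun_apply (A w \<omega>) x) \<in> borel_measurable M"
    and A_hemi: "\<And>\<omega>. hemicontinuous (\<lambda>w. A w \<omega>)"
    and A_growth: "\<And>w \<omega>. norm (A w \<omega>) \<le> cA * (1 + norm w) powr (p - 1)"
    and A_mono: "\<And>w x \<omega>. 0 \<le> blinfun_apply (A w \<omega> - A x \<omega>) (w - x) + lA * (norm (eB (eA (w - x))))\<^sup>2"
    and B_meas: "\<And>w x. (\<lambda>\<omega>. blinfun_apply (B w \<omega>) x) \<in> borel_measurable M"
    and B_linear: "\<And>\<omega>. linear (\<lambda>w. B w \<omega>)"
    and B_sym: "\<And>w x \<omega>. blinfun_apply (B w \<omega>) x = blinfun_apply (B x \<omega>) w"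
    and B_pos: "\<And>w \<omega>. 0 \<le> blinfun_apply (B w \<omega>) w"
    and B_bound: "\<And>w \<omega>. norm (B w \<omega>) \<le> cB * norm w"
    and y_meas [measurable]: "y1 \<in> borel_measurable TM" "y2 \<in> borel_measurable TM"
    and y_supp: "\<And>t \<omega>. t \<notin> {0..T} \<Longrightarrow> y1 (t, \<omega>) = 0" "\<And>t \<omega>. t \<notin> {0..T} \<Longrightarrow> y2 (t, \<omega>) = 0"
    and y_int: "integrable TM (\<lambda>z. norm (y1 z) powr p)" "integrable TM (\<lambda>z. norm (y2 z) powr p)"
begin

abbreviation e :: "'va \<Rightarrow> 'h" where "e x \<equiv> eB (eA x)"

abbreviation ind :: "real \<times> 'w \<Rightarrow> real" where "ind z \<equiv> indicator {0..T} (fst z)"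

definition y :: "real \<times> 'w \<Rightarrow> 'va" where "y z = y1 z - y2 z"

text \<open>
\<open>U\<close> is the difference of the displacements, which is the integral of the difference \<open>y\<close> of the velocities.
\<close>

definition U :: "real \<times> 'w \<Rightarrow> 'vb" where
  "U z = ind z *\<^sub>R eA (\<integral>s. indicator {0..fst z} s *\<^sub>R y (s, snd z) \<partial>lborel)"

text \<open>
The drift of the equation for the difference, as a functional of the test vector \<open>x\<close>.
\<close>

definition G :: "real \<times> 'w \<Rightarrow> 'va \<Rightarrow> real" where
  "G z x = blinfun_apply (A (y1 z) (snd z)) x - blinfun_apply (A (y2 z) (snd z)) x + blinfun_apply (B (U z) (snd z)) (eA x)"

definition elastic_power :: "real \<times> 'w \<Rightarrow> real" where "elastic_power z = blinfun_apply (B (U z) (snd z)) (eA (y z))"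

definition elastic :: "real \<times> 'w \<Rightarrow> real" where "elastic z = blinfun_apply (B (U z) (snd z)) (U z)"

text \<open>
By the monotonicity of \<open>A\<close> jointly with \<open>C\<close>, \<open>R\<close> dominates the squared \<open>l\<^sup>2\<close>-norm of the difference of
the noise coefficients. The term \<open>G z (y z) - elastic_power z\<close> is \<open>\<langle>A y1 - A y2, y\<rangle>\<close>.
\<close>

definition R :: "real \<times> 'w \<Rightarrow> real" where
  "R z = 2 * (G z (y z) - elastic_power z) + 2 * lA * (norm (e (y z)))\<^sup>2 + 2 * lB * elastic z"

text \<open>
A bound for the operator norm of \<open>G z\<close> that is explicit enough to read off its integrability.
\<close>

definition \<Gamma> :: "real \<times> 'w \<Rightarrow> real" where
  "\<Gamma> z = ind z * (2 * cA * (1 + norm (y1 z) + norm (y2 z)) powr (p - 1) + cB * norm eA * norm (U z))"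

lemma p1: "1 < p" and q: "1 < q" "q \<le> 2" and qp: "q * (p - 1) = p"
  using p(1) unfolding p(2) by (simp_all add: divide_simps)

lemma B_diff: "B (u - v) \<omega> = B u \<omega> - B v \<omega>"
  using linear_diff[OF B_linear] .

lemma B_zero: "B 0 \<omega> = 0"
  using linear_0[OF B_linear] .

lemma B_apply_bound: "\<bar>blinfun_apply (B u \<omega>) w\<bar> \<le> cB * norm u * norm w"
  using norm_blinfun[of "B u \<omega>" w] mult_right_mono[OF B_bound[of u \<omega>] norm_ge_zero[of w]] by simp

lemma e_bounded_linear: "bounded_linear e"
  by (intro bounded_linear_compose[OF blinfun.bounded_linear_right] blinfun.bounded_linear_right)

lemma e_inj: "inj e"
  using inj by (auto simp: inj_def)

lemma A_tendsto:
  assumes "w \<longlonglongrightarrow> w0"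
  shows "(\<lambda>n. blinfun_apply (A (w n) \<omega>) x) \<longlonglongrightarrow> blinfun_apply (A w0 \<omega>) x"
  by (rule monotone_hemicontinuous_imp_demicontinuous[OF A_hemi e_bounded_linear A_growth _ const(3) A_mono assms])
     (use p in auto)

text \<open>
Demicontinuity and local boundedness make the pairing \<open>\<langle>A w, x\<rangle>\<close> continuous in \<open>(w, x)\<close> jointly.
\<close>

lemma A_measurable_pair:
  "(\<lambda>(z, \<omega>). blinfun_apply (A (fst z) \<omega>) (snd z)) \<in> borel_measurable (borel \<Otimes>\<^sub>M M)"
proof (rule Caratheodory_measurable)
  fix \<omega> and z :: "'va \<times> 'va" and w
  assume w: "w \<longlonglongrightarrow> z"
  have w1: "(\<lambda>n. fst (w n)) \<longlonglongrightarrow> fst z" and w2: "(\<lambda>n. snd (w n)) \<longlonglongrightarrow> snd z"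
    using w by (auto intro: tendsto_intros)
  have "Bseq (\<lambda>n. fst (w n))" using w1 convergent_def convergent_imp_Bseq by blast
  then obtain r where r: "\<And>n. norm (fst (w n)) \<le> r" unfolding Bseq_def by blast
  have "(\<lambda>n. blinfun_apply (A (fst (w n)) \<omega>) (snd (w n) - snd z)) \<longlonglongrightarrow> 0"
  proof (rule Lim_null_comparison[OF always_eventually], intro allI)
    fix n
    have "norm (blinfun_apply (A (fst (w n)) \<omega>) (snd (w n) - snd z)) \<le> norm (A (fst (w n)) \<omega>) * norm (snd (w n) - snd z)"
      by (rule norm_blinfun)
    also have "\<dots> \<le> (cA * (1 + r) powr (p - 1)) * norm (snd (w n) - snd z)"
    proof (rule mult_right_mono)
      have "norm (A (fst (w n)) \<omega>) \<le> cA * (1 + norm (fst (w n))) powr (p - 1)" by (rule A_growth)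
      also have "\<dots> \<le> cA * (1 + r) powr (p - 1)"
        using r[of n] p const by (intro mult_left_mono powr_mono2) auto
      finally show "norm (A (fst (w n)) \<omega>) \<le> cA * (1 + r) powr (p - 1)" .
    qed simp
    finally show "norm (blinfun_apply (A (fst (w n)) \<omega>) (snd (w n) - snd z)) \<le> (cA * (1 + r) powr (p - 1)) * norm (snd (w n) - snd z)" .
  next
    have "(\<lambda>n. (cA * (1 + r) powr (p - 1)) * norm (snd (w n) - snd z)) \<longlonglongrightarrow> (cA * (1 + r) powr (p - 1)) * norm (snd z - snd z)"
      by (intro tendsto_intros w2)
    then show "(\<lambda>n. (cA * (1 + r) powr (p - 1)) * norm (snd (w n) - snd z)) \<longlonglongrightarrow> 0" by simp
  qed
  from tendsto_add[OF this A_tendsto[OF w1, of \<omega> "snd z"]]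
  show "(\<lambda>n. blinfun_apply (A (fst (w n)) \<omega>) (snd (w n))) \<longlonglongrightarrow> blinfun_apply (A (fst z) \<omega>) (snd z)"
    by (simp add: blinfun.diff_right)
qed (rule A_meas)

lemma B_measurable_pair:
  "(\<lambda>(z, \<omega>). blinfun_apply (B (fst z) \<omega>) (snd z)) \<in> borel_measurable (borel \<Otimes>\<^sub>M M)"
proof (rule Caratheodory_measurable)
  fix \<omega> and z :: "'vb \<times> 'vb" and w
  assume w: "w \<longlonglongrightarrow> z"
  have w1: "(\<lambda>n. fst (w n)) \<longlonglongrightarrow> fst z" and w2: "(\<lambda>n. snd (w n)) \<longlonglongrightarrow> snd z"
    using w by (auto intro: tendsto_intros)
  have "bounded_linear (\<lambda>u. B u \<omega>)"
    by (rule bounded_linear_intro[where K=cB])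
       (use linear_add[OF B_linear] linear_scale[OF B_linear] B_bound in \<open>auto simp: mult.commute\<close>)
  then have "(\<lambda>n. B (fst (w n)) \<omega>) \<longlonglongrightarrow> B (fst z) \<omega>" using w1 by (rule bounded_linear.tendsto)
  then show "(\<lambda>n. blinfun_apply (B (fst (w n)) \<omega>) (snd (w n))) \<longlonglongrightarrow> blinfun_apply (B (fst z) \<omega>) (snd z)"
    by (intro tendsto_intros w2)
qed (rule B_meas)

lemma A_measurable_comp [measurable (raw)]:
  assumes [measurable]: "f \<in> K \<rightarrow>\<^sub>M borel" "k \<in> K \<rightarrow>\<^sub>M M" "g \<in> K \<rightarrow>\<^sub>M borel"
  shows "(\<lambda>x. blinfun_apply (A (f x) (k x)) (g x)) \<in> borel_measurable K"
proof -
  have "(\<lambda>x. ((f x, g x), k x)) \<in> K \<rightarrow>\<^sub>M borel \<Otimes>\<^sub>M M" by measurable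
  from measurable_compose[OF this A_measurable_pair] show ?thesis by simp
qed

lemma B_measurable_comp [measurable (raw)]:
  assumes [measurable]: "f \<in> K \<rightarrow>\<^sub>M borel" "k \<in> K \<rightarrow>\<^sub>M M" "g \<in> K \<rightarrow>\<^sub>M borel"
  shows "(\<lambda>x. blinfun_apply (B (f x) (k x)) (g x)) \<in> borel_measurable K"
proof -
  have "(\<lambda>x. ((f x, g x), k x)) \<in> K \<rightarrow>\<^sub>M borel \<Otimes>\<^sub>M M" by measurable
  from measurable_compose[OF this B_measurable_pair] show ?thesis by simp
qed

lemma eA_measurable_comp [measurable (raw)]: "f \<in> K \<rightarrow>\<^sub>M borel \<Longrightarrow> (\<lambda>x. eA (f x)) \<in> K \<rightarrow>\<^sub>M borel"
  by (rule borel_measurable_continuous_on[OF _ ]) (auto intro: blinfun.continuous_on continuous_intros)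

lemma eB_measurable_comp [measurable (raw)]: "f \<in> K \<rightarrow>\<^sub>M borel \<Longrightarrow> (\<lambda>x. eB (f x)) \<in> K \<rightarrow>\<^sub>M borel"
  by (rule borel_measurable_continuous_on[OF _ ]) (auto intro: blinfun.continuous_on continuous_intros)

lemma y_measurable [measurable]: "y \<in> borel_measurable TM"
  unfolding y_def[abs_def] by measurable

lemma U_measurable [measurable]: "U \<in> borel_measurable TM"
proof -
  have "(\<lambda>x. indicator {0..fst (fst x)} (snd x) *\<^sub>R y (snd x, snd (fst x))) \<in> borel_measurable (TM \<Otimes>\<^sub>M lborel)"
  proof (rule borel_measurable_scaleR)
    show "(\<lambda>x. y (snd x, snd (fst x))) \<in> borel_measurable (TM \<Otimes>\<^sub>M lborel)"
      by (rule measurable_compose[OF _ y_measurable]) measurable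
    have "{x \<in> space (TM \<Otimes>\<^sub>M lborel). 0 \<le> snd x \<and> snd x \<le> fst (fst x)} \<in> sets (TM \<Otimes>\<^sub>M lborel)"
      by measurable
    then have "(\<lambda>x. if 0 \<le> snd x \<and> snd x \<le> fst (fst x) then 1 else 0 :: real) \<in> borel_measurable (TM \<Otimes>\<^sub>M lborel)"
      by (intro measurable_If) auto
    moreover have "(\<lambda>x. if 0 \<le> snd x \<and> snd x \<le> fst (fst x) then 1 else 0 :: real) =
       (\<lambda>x :: (real \<times> 'w) \<times> real. indicator {0..fst (fst x)} (snd x))" by (auto simp: indicator_def)
    ultimately show "(\<lambda>x. indicator {0..fst (fst x)} (snd x) :: real) \<in> borel_measurable (TM \<Otimes>\<^sub>M lborel)" by simp
  qed
  then have [measurable]: "(\<lambda>z. \<integral>s. indicator {0..fst z} s *\<^sub>R y (s, snd z) \<partial>lborel) \<in> borel_measurable TM"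
    by (intro lborel.borel_measurable_lebesgue_integral) (simp add: case_prod_beta')
  show ?thesis unfolding U_def[abs_def] by measurable
qed

lemma ind_integrable: "integrable TM ind"
proof -
  interpret P: pair_sigma_finite "lborel :: real measure" M by (rule pair_sigma_finite_TM)
  have "integrable TM (indicator ({0..T} \<times> space M) :: _ \<Rightarrow> real)"
    by (intro integrable_real_indicator) (auto simp: emeasure_pair_measure_Times emeasure_space_1 emeasure_lborel_Icc_eq)
  then show ?thesis
    by (rule Bochner_Integration.integrable_cong[THEN iffD1, OF refl, rotated])
       (auto simp: indicator_def space_pair_measure)
qed

lemma y_outside: "t \<notin> {0..T} \<Longrightarrow> y (t, \<omega>) = 0"
  using y_supp by (simp add: y_def)

lemma y_powr_integrable: "integrable TM (\<lambda>z. norm (y z) powr p)"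
proof (rule Bochner_Integration.integrable_bound[where f="\<lambda>z. 2 powr p * (norm (y1 z) powr p + norm (y2 z) powr p)"])
  show "AE z in TM. norm (norm (y z) powr p) \<le> norm (2 powr p * (norm (y1 z) powr p + norm (y2 z) powr p))"
  proof (intro AE_I2)
    fix z
    have "norm (y z) powr p \<le> (norm (y1 z) + norm (y2 z)) powr p"
      unfolding y_def using p by (intro powr_mono2 norm_triangle_ineq4) auto
    also have "\<dots> \<le> 2 powr p * (norm (y1 z) powr p + norm (y2 z) powr p)"
      using p by (intro powr_add_le) auto
    finally show "norm (norm (y z) powr p) \<le> norm (2 powr p * (norm (y1 z) powr p + norm (y2 z) powr p))" by simp
  qed
qed (use y_int in auto)

lemma power2_le_powr: "0 \<le> (a::real) \<Longrightarrow> a\<^sup>2 \<le> 1 + a powr p"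
proof (cases "a \<le> 1")
  case True
  moreover assume "0 \<le> a"
  ultimately show ?thesis by (simp add: power_le_one add_increasing2)
next
  case False
  then have "a\<^sup>2 = a powr 2" by (simp add: powr_numeral)
  also have "\<dots> \<le> a powr p" using False p by (intro powr_mono) auto
  finally show ?thesis by simp
qed

lemma y_sq_bound: "(norm (y z))\<^sup>2 \<le> ind z + norm (y z) powr p"
proof (cases "fst z \<in> {0..T}")
  case True then show ?thesis using power2_le_powr[of "norm (y z)"] by simp
next
  case False then have "y z = 0" using y_outside[of "fst z" "snd z"] by simp
  then show ?thesis by simp
qed

lemma y_sq_integrable: "integrable TM (\<lambda>z. (norm (y z))\<^sup>2)"
  by (rule Bochner_Integration.integrable_bound[where f="\<lambda>z. ind z + norm (y z) powr p"])
     (use y_powr_integrable ind_integrable y_sq_bound in auto)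

lemma y_path_integrable: "AE \<omega> in M. integrable lborel (\<lambda>s. (norm (y (s, \<omega>)))\<^sup>2)"
proof -
  interpret P: pair_sigma_finite "lborel :: real measure" M by (rule pair_sigma_finite_TM)
  show ?thesis by (rule P.AE_integrable_snd) (use y_sq_integrable in \<open>simp add: case_prod_beta'\<close>)
qed

lemma y_section_measurable [measurable]: "\<omega> \<in> space M \<Longrightarrow> (\<lambda>s. y (s, \<omega>)) \<in> borel_measurable lborel"
  by (rule measurable_compose[OF _ y_measurable]) auto

lemma path_norm_integrable:
  assumes "\<omega> \<in> space M" "integrable lborel (\<lambda>s. (norm (y (s, \<omega>)))\<^sup>2)"
  shows "integrable lborel (\<lambda>s. norm (y (s, \<omega>)))"
proof -
  have "sq_integrable lborel (\<lambda>s. norm (y (s, \<omega>)))" using assms by (auto simp: sq_integrable_def)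
  from sq_integrable_mult[OF indicator_sq_integrable[of 0 T] this]
  have "integrable lborel (\<lambda>s. indicator {0..T} s * norm (y (s, \<omega>)))" .
  moreover have "indicator {0..T} s * norm (y (s, \<omega>)) = norm (y (s, \<omega>))" for s
    using y_outside[of s \<omega>] by (auto simp: indicator_def)
  ultimately show ?thesis by simp
qed

lemma y_path_integrable':
  assumes "\<omega> \<in> space M" "integrable lborel (\<lambda>s. (norm (y (s, \<omega>)))\<^sup>2)"
  shows "integrable lborel (\<lambda>s. y (s, \<omega>))"
  using path_norm_integrable[OF assms] y_section_measurable[OF assms(1)] by (simp add: integrable_norm_iff)

text \<open>
The Cauchy-Schwarz inequality in time: \<open>y\<close> is square integrable because \<open>p \<ge> 2\<close>, and it vanishes
outside an interval of length \<open>T\<close>.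
\<close>

lemma U_sq_bound:
  assumes \<omega>: "\<omega> \<in> space M" and i: "integrable lborel (\<lambda>s. (norm (y (s, \<omega>)))\<^sup>2)"
  shows "(norm (U (t, \<omega>)))\<^sup>2 \<le> (norm eA)\<^sup>2 * T * (\<integral>s. (norm (y (s, \<omega>)))\<^sup>2 \<partial>lborel)"
proof -
  note n = path_norm_integrable[OF assms]
  have sq: "sq_integrable lborel (\<lambda>s. norm (y (s, \<omega>)))" using assms by (auto simp: sq_integrable_def)
  let ?I = "\<integral>s. norm (y (s, \<omega>)) \<partial>lborel"
  have ieq: "indicator {0..T} s * norm (y (s, \<omega>)) = norm (y (s, \<omega>))" for s
    using y_outside[of s \<omega>] by (auto simp: indicator_def)
  have "?I \<le> sqrt (\<integral>s. (indicator {0..T} s)\<^sup>2 \<partial>lborel) * sqrt (\<integral>s. (norm (y (s, \<omega>)))\<^sup>2 \<partial>lborel)"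
    using integral_Cauchy_Schwarz[OF indicator_sq_integrable[of 0 T] sq] unfolding ieq by simp
  also have "(\<integral>s. (indicator {0..T} s :: real)\<^sup>2 \<partial>lborel) = (\<integral>s. indicator {0..T} s \<partial>lborel)"
    by (intro Bochner_Integration.integral_cong) (auto simp: indicator_def)
  also have "\<dots> = T" using T_pos by simp
  finally have I: "?I\<^sup>2 \<le> T * (\<integral>s. (norm (y (s, \<omega>)))\<^sup>2 \<partial>lborel)"
    using T_pos power_mono[of ?I "sqrt T * sqrt (\<integral>s. (norm (y (s, \<omega>)))\<^sup>2 \<partial>lborel)" 2]
    by (simp add: power_mult_distrib)
  have "norm (U (t, \<omega>)) \<le> norm eA * norm (\<integral>s. indicator {0..t} s *\<^sub>R y (s, \<omega>) \<partial>lborel)"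
    unfolding U_def using norm_blinfun[of eA "\<integral>s. indicator {0..t} s *\<^sub>R y (s, \<omega>) \<partial>lborel"]
    by (auto simp: indicator_def)
  also have "\<dots> \<le> norm eA * ?I"
  proof (rule mult_left_mono)
    have "norm (\<integral>s. indicator {0..t} s *\<^sub>R y (s, \<omega>) \<partial>lborel) \<le> (\<integral>s. norm (indicator {0..t} s *\<^sub>R y (s, \<omega>)) \<partial>lborel)"
      by (rule integral_norm_bound)
    also have "\<dots> \<le> ?I"
      using n \<omega> by (intro integral_mono Bochner_Integration.integrable_bound[OF n]) (auto simp: indicator_def)
    finally show "norm (\<integral>s. indicator {0..t} s *\<^sub>R y (s, \<omega>) \<partial>lborel) \<le> ?I" .
  qed simp
  finally have "(norm (U (t, \<omega>)))\<^sup>2 \<le> (norm eA * ?I)\<^sup>2" by (intro power_mono) auto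
  also have "\<dots> \<le> (norm eA)\<^sup>2 * (T * (\<integral>s. (norm (y (s, \<omega>)))\<^sup>2 \<partial>lborel))"
    unfolding power_mult_distrib using I by (intro mult_left_mono) auto
  finally show ?thesis by (simp add: mult.assoc)
qed

lemma U_sq_integrable: "integrable TM (\<lambda>z. (norm (U z))\<^sup>2)"
proof -
  interpret P: pair_sigma_finite "lborel :: real measure" M by (rule pair_sigma_finite_TM)
  let ?k = "\<lambda>\<omega>. (norm eA)\<^sup>2 * T * (\<integral>s. (norm (y (s, \<omega>)))\<^sup>2 \<partial>lborel)"
  have k: "integrable M ?k"
    using P.integrable_snd[of "\<lambda>s \<omega>. (norm (y (s, \<omega>)))\<^sup>2"] y_sq_integrable by (simp add: case_prod_beta')
  have k0: "0 \<le> ?k \<omega>" for \<omega> using T_pos by simp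
  have "(\<integral>\<^sup>+z. ennreal ((norm (U z))\<^sup>2) \<partial>TM) = (\<integral>\<^sup>+\<omega>. \<integral>\<^sup>+t. ennreal ((norm (U (t, \<omega>)))\<^sup>2) \<partial>lborel \<partial>M)"
    by (subst P.nn_integral_snd[symmetric]) (auto simp: case_prod_beta')
  also have "\<dots> \<le> (\<integral>\<^sup>+\<omega>. ennreal (T * ?k \<omega>) \<partial>M)"
  proof (rule nn_integral_mono_AE)
    show "AE \<omega> in M. (\<integral>\<^sup>+t. ennreal ((norm (U (t, \<omega>)))\<^sup>2) \<partial>lborel) \<le> ennreal (T * ?k \<omega>)"
      using y_path_integrable AE_space
    proof eventually_elim
      case (elim \<omega>)
      have "(\<integral>\<^sup>+t. ennreal ((norm (U (t, \<omega>)))\<^sup>2) \<partial>lborel) \<le> (\<integral>\<^sup>+t. ennreal (?k \<omega>) * indicator {0..T} t \<partial>lborel)"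
      proof (rule nn_integral_mono)
        fix t
        have "U (t, \<omega>) = 0" if "t \<notin> {0..T}" using that by (simp add: U_def)
        then show "ennreal ((norm (U (t, \<omega>)))\<^sup>2) \<le> ennreal (?k \<omega>) * indicator {0..T} t"
          using U_sq_bound[OF elim(2,1), of t] by (cases "t \<in> {0..T}") (auto intro!: ennreal_leI)
      qed
      also have "\<dots> = ennreal (?k \<omega>) * emeasure lborel {0..T}" by (simp add: nn_integral_cmult_indicator)
      also have "\<dots> = ennreal (T * ?k \<omega>)"
        using T_pos k0[of \<omega>] by (simp add: emeasure_lborel_Icc_eq ennreal_mult[symmetric] mult.commute)
      finally show ?case .
    qed
  qed
  also have "\<dots> < \<infinity>"
    using k k0 T_pos by (subst nn_integral_eq_integral) (auto simp del: mult_eq_0_iff)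
  finally show ?thesis by (simp add: integrable_iff_bounded)
qed

lemma \<Gamma>_nonneg: "0 \<le> \<Gamma> z"
  using const by (simp add: \<Gamma>_def)

lemma \<Gamma>_measurable [measurable]: "\<Gamma> \<in> borel_measurable TM"
  unfolding \<Gamma>_def[abs_def] by measurable

lemma G_measurable: "(\<lambda>(z, x). G z x) \<in> borel_measurable (TM \<Otimes>\<^sub>M borel)"
  unfolding G_def case_prod_beta' by measurable

lemma G_diff: "G z (x - x') = G z x - G z x'"
  by (simp add: G_def blinfun.diff_right)

lemma G_scaleR: "G z (c *\<^sub>R x) = c * G z x"
  by (simp add: G_def blinfun.scaleR_right algebra_simps)

lemma G_add: "G z (x + x') = G z x + G z x'"
  by (simp add: G_def blinfun.add_right)

lemma G_outside: "fst z \<notin> {0..T} \<Longrightarrow> G z x = 0"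
  using y_supp[of "fst z" "snd z"] by (simp add: G_def U_def B_zero blinfun.zero_left)

lemma G_bound: "\<bar>G z x\<bar> \<le> \<Gamma> z * norm x"
proof (cases "fst z \<in> {0..T}")
  case True
  let ?Q = "1 + norm (y1 z) + norm (y2 z)"
  have A_bound: "\<bar>blinfun_apply (A w (snd z)) x\<bar> \<le> cA * ?Q powr (p - 1) * norm x" if "norm w \<le> norm (y1 z) + norm (y2 z)" for w
  proof -
    have "\<bar>blinfun_apply (A w (snd z)) x\<bar> \<le> norm (A w (snd z)) * norm x"
      using norm_blinfun[of "A w (snd z)" x] by simp
    also have "\<dots> \<le> cA * ?Q powr (p - 1) * norm x"
      using p const that by (intro mult_right_mono order_trans[OF A_growth] mult_left_mono powr_mono2) auto
    finally show ?thesis .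
  qed
  have 1: "\<bar>blinfun_apply (A (y1 z) (snd z)) x\<bar> \<le> cA * ?Q powr (p - 1) * norm x"
    and 2: "\<bar>blinfun_apply (A (y2 z) (snd z)) x\<bar> \<le> cA * ?Q powr (p - 1) * norm x"
    by (auto intro: A_bound)
  have "\<bar>blinfun_apply (B (U z) (snd z)) (eA x)\<bar> \<le> cB * norm (U z) * norm (eA x)" by (rule B_apply_bound)
  also have "\<dots> \<le> cB * norm (U z) * (norm eA * norm x)"
    using const by (intro mult_left_mono norm_blinfun) auto
  finally have 3: "\<bar>blinfun_apply (B (U z) (snd z)) (eA x)\<bar> \<le> cB * norm (U z) * (norm eA * norm x)" .
  have "\<bar>G z x\<bar> \<le> cA * ?Q powr (p - 1) * norm x + cA * ?Q powr (p - 1) * norm x + cB * norm (U z) * (norm eA * norm x)"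
    unfolding G_def using 1 2 3 by linarith
  also have "\<dots> = \<Gamma> z * norm x" using True by (simp add: \<Gamma>_def algebra_simps)
  finally show ?thesis .
next
  case False
  then show ?thesis using \<Gamma>_nonneg by (simp add: G_outside)
qed

text \<open>
The part of \<open>\<Gamma>\<close> that comes from \<open>A\<close> is in \<open>L\<^sup>q\<close> because \<open>q * (p - 1) = p\<close>, the part from \<open>B\<close> because \<open>q \<le> 2\<close>.
\<close>

lemma \<Gamma>_powr_integrable: "integrable TM (\<lambda>z. \<Gamma> z powr q)"
proof (rule Bochner_Integration.integrable_bound)
  let ?f = "\<lambda>z. 2 powr q * ((2 * cA) powr q * (2 powr p * (2 powr p * (ind z + norm (y1 z) powr p) + norm (y2 z) powr p))
      + (ind z + (cB * norm eA)\<^sup>2 * (norm (U z))\<^sup>2))"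
  show "integrable TM ?f" using ind_integrable y_int U_sq_integrable by auto
  show "AE z in TM. norm (\<Gamma> z powr q) \<le> norm (?f z)"
  proof (intro AE_I2)
    fix z
    show "norm (\<Gamma> z powr q) \<le> norm (?f z)"
    proof (cases "fst z \<in> {0..T}")
      case True
      let ?Q = "1 + norm (y1 z) + norm (y2 z)"
      have a: "(2 * cA * ?Q powr (p - 1)) powr q = (2 * cA) powr q * ?Q powr p"
        using const qp by (simp add: powr_mult powr_powr mult.commute[of "p - 1"])
      have "?Q powr p \<le> 2 powr p * ((1 + norm (y1 z)) powr p + norm (y2 z) powr p)"
        using p by (intro powr_add_le) auto
      also have "\<dots> \<le> 2 powr p * (2 powr p * (1 powr p + norm (y1 z) powr p) + norm (y2 z) powr p)"
        using p by (intro mult_left_mono add_right_mono powr_add_le) auto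
      finally have b: "?Q powr p \<le> 2 powr p * (2 powr p * (1 + norm (y1 z) powr p) + norm (y2 z) powr p)" by simp
      let ?w = "cB * norm eA * norm (U z)"
      have w0: "0 \<le> ?w" using const by simp
      have c: "?w powr q \<le> 1 + ?w\<^sup>2"
      proof (cases "?w \<le> 1")
        case True
        then have "?w powr q \<le> 1 powr q" using w0 q by (intro powr_mono2) auto
        then show ?thesis using zero_le_power2[of ?w] unfolding powr_one_eq_one by linarith
      next
        case False
        then have "?w powr q \<le> ?w powr 2" using q by (intro powr_mono) auto
        also have "\<dots> = ?w\<^sup>2" using False by (simp add: powr_numeral)
        finally show ?thesis by simp
      qed
      have "\<Gamma> z powr q = (2 * cA * ?Q powr (p - 1) + ?w) powr q" using True by (simp add: \<Gamma>_def)
      also have "\<dots> \<le> 2 powr q * ((2 * cA * ?Q powr (p - 1)) powr q + ?w powr q)"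
        using const q w0 by (intro powr_add_le) auto
      also have "\<dots> \<le> ?f z"
        unfolding a using b c True
        by (intro mult_left_mono add_mono) (auto simp: power_mult_distrib)
      finally show ?thesis by simp
    next
      case False
      then show ?thesis by (simp add: \<Gamma>_def)
    qed
  qed
qed auto

lemma \<Gamma>_integrable: "integrable TM \<Gamma>"
proof (rule Bochner_Integration.integrable_bound[where f="\<lambda>z. ind z + \<Gamma> z powr q"])
  show "AE z in TM. norm (\<Gamma> z) \<le> norm (ind z + \<Gamma> z powr q)"
  proof (intro AE_I2)
    fix z
    show "norm (\<Gamma> z) \<le> norm (ind z + \<Gamma> z powr q)"
    proof (cases "fst z \<in> {0..T}")
      case True
      have "\<Gamma> z \<le> 1 + \<Gamma> z powr q"
      proof (cases "\<Gamma> z \<le> 1")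
        case False
        then have "\<Gamma> z powr 1 \<le> \<Gamma> z powr q" using q by (intro powr_mono) auto
        then show ?thesis using False by simp
      qed (simp add: add_increasing2)
      then show ?thesis using True \<Gamma>_nonneg[of z] by simp
    qed (simp add: \<Gamma>_def)
  qed
qed (use ind_integrable \<Gamma>_powr_integrable in auto)

lemmas G_translation = G_measurable G_diff G_bound \<Gamma>_integrable \<Gamma>_powr_integrable \<Gamma>_nonneg

lemma Gy_integrable: "integrable TM (\<lambda>z. G z (y z))"
  using TM_bilinear_integrable[OF p1 p(2) G_translation y_measurable y_powr_integrable, of 0] by (simp add: shift_0)

lemma elastic_power_integrable: "integrable TM elastic_power"
proof (rule Bochner_Integration.integrable_bound[where f="\<lambda>z. cB * norm eA * ((norm (U z))\<^sup>2 + (norm (y z))\<^sup>2)"])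
  show "AE z in TM. norm (elastic_power z) \<le> norm (cB * norm eA * ((norm (U z))\<^sup>2 + (norm (y z))\<^sup>2))"
  proof (intro AE_I2)
    fix z
    have "\<bar>elastic_power z\<bar> \<le> cB * norm (U z) * norm (eA (y z))" unfolding elastic_power_def by (rule B_apply_bound)
    also have "\<dots> \<le> cB * norm (U z) * (norm eA * norm (y z))"
      using const by (intro mult_left_mono norm_blinfun) auto
    also have "\<dots> = cB * norm eA * (norm (U z) * norm (y z))" by simp
    also have "\<dots> \<le> cB * norm eA * ((norm (U z))\<^sup>2 + (norm (y z))\<^sup>2)"
    proof (rule mult_left_mono)
      show "norm (U z) * norm (y z) \<le> (norm (U z))\<^sup>2 + (norm (y z))\<^sup>2"
      proof -
        have "0 \<le> norm (U z) * norm (y z)" by simp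
        moreover have "2 * (norm (U z) * norm (y z)) \<le> (norm (U z))\<^sup>2 + (norm (y z))\<^sup>2"
          using sum_squares_bound[of "norm (U z)" "norm (y z)"] by (simp only: mult.assoc)
        ultimately show ?thesis by linarith
      qed
    qed (use const in auto)
    finally show "norm (elastic_power z) \<le> norm (cB * norm eA * ((norm (U z))\<^sup>2 + (norm (y z))\<^sup>2))" by simp
  qed
  show "elastic_power \<in> borel_measurable TM" unfolding elastic_power_def[abs_def] by measurable
qed (use U_sq_integrable y_sq_integrable in auto)

lemma elastic_integrable: "integrable TM elastic"
proof (rule Bochner_Integration.integrable_bound[where f="\<lambda>z. cB * (norm (U z))\<^sup>2"])
  show "AE z in TM. norm (elastic z) \<le> norm (cB * (norm (U z))\<^sup>2)"
    using B_apply_bound const by (intro AE_I2) (auto simp: elastic_def power2_eq_square mult.assoc)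
  show "elastic \<in> borel_measurable TM" unfolding elastic_def[abs_def] by measurable
qed (use U_sq_integrable in auto)

lemma ey_sq_integrable: "integrable TM (\<lambda>z. (norm (e (y z)))\<^sup>2)"
proof (rule Bochner_Integration.integrable_bound[where f="\<lambda>z. (norm eB * norm eA)\<^sup>2 * (norm (y z))\<^sup>2"])
  show "AE z in TM. norm ((norm (e (y z)))\<^sup>2) \<le> norm ((norm eB * norm eA)\<^sup>2 * (norm (y z))\<^sup>2)"
  proof (intro AE_I2)
    fix z
    have "norm (e (y z)) \<le> norm eB * (norm eA * norm (y z))"
      by (intro order_trans[OF norm_blinfun] mult_left_mono norm_blinfun) auto
    then have "(norm (e (y z)))\<^sup>2 \<le> (norm eB * (norm eA * norm (y z)))\<^sup>2" by (intro power_mono) auto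
    then show "norm ((norm (e (y z)))\<^sup>2) \<le> norm ((norm eB * norm eA)\<^sup>2 * (norm (y z))\<^sup>2)"
      by (simp add: power_mult_distrib mult.assoc)
  qed
qed (use y_sq_integrable in auto)

lemma R_integrable: "integrable TM R"
  unfolding R_def[abs_def] using Gy_integrable elastic_power_integrable elastic_integrable ey_sq_integrable by auto

end

section \<open>The energy inequality over one time step\<close>

lemma ell2_partial_sum_le:
  assumes "h \<in> ell2"
  shows "(\<Sum>j<n. (norm (h j))\<^sup>2) \<le> (ell2_norm h)\<^sup>2"
proof -
  have s: "summable (\<lambda>j. (norm (h j))\<^sup>2)" using assms by (simp add: ell2_def)
  have "(ell2_norm h)\<^sup>2 = (\<Sum>j. (norm (h j))\<^sup>2)"
    unfolding ell2_norm_def using suminf_nonneg[OF s] by simp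
  then show ?thesis using sum_le_suminf[OF s, of "{..<n}"] by simp
qed

text \<open>
What remains of two solutions once stochastic integration has been used. \<open>X\<close> is the continuous
modification of the difference of the velocities and \<open>N x\<close> is the difference of the stochastic integrals
tested with \<open>x\<close>. \<open>DC\<close> is the difference of the noise coefficients; \<open>Z x j\<close> is a measurable version of its
component \<open>j\<close> tested with \<open>x\<close>, which is why the two agree almost everywhere for each \<open>x\<close> separately.
\<close>

locale energy_setting = energy_operators M F T W p q lA lB cA cB eA eB A B y1 y2
  for M :: "'w measure" and F T W p q lA lB cA cB
    and eA :: "'va::{banach, second_countable_topology} \<Rightarrow>\<^sub>L 'vb::{banach, second_countable_topology}"
    and eB :: "'vb \<Rightarrow>\<^sub>L 'h::{real_inner, complete_space, second_countable_topology}"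
    and A B y1 y2 +
  fixes X :: "real \<Rightarrow> 'w \<Rightarrow> 'h" and N :: "'va \<Rightarrow> real \<Rightarrow> 'w \<Rightarrow> real"
    and Z :: "'va \<Rightarrow> nat \<Rightarrow> real \<times> 'w \<Rightarrow> real" and DC :: "real \<times> 'w \<Rightarrow> nat \<Rightarrow> 'h"
  assumes y_adapted: "\<And>t. t \<in> {0..T} \<Longrightarrow> (\<lambda>\<omega>. y1 (t, \<omega>)) \<in> borel_measurable (F t)"
      "\<And>t. t \<in> {0..T} \<Longrightarrow> (\<lambda>\<omega>. y2 (t, \<omega>)) \<in> borel_measurable (F t)"
    and X_modification: "AE z in TM. fst z \<in> {0..T} \<longrightarrow> X (fst z) (snd z) = e (y z)"
    and X_zero: "AE \<omega> in M. X 0 \<omega> = 0"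
    and DC_ell2: "\<And>z. DC z \<in> ell2"
    and DC_bound: "AE z in TM. fst z \<in> {0..T} \<longrightarrow> (ell2_norm (DC z))\<^sup>2 \<le> R z"
    and Z_measurable [measurable]: "\<And>x j. Z x j \<in> borel_measurable TM"
    and Z_Dc: "\<And>x j. AE z in TM. fst z \<in> {0..T} \<longrightarrow> Z x j z = inner (e x) (DC z j)"
    and N_sq_integrable: "\<And>x s t. 0 \<le> s \<Longrightarrow> s \<le> t \<Longrightarrow> t \<le> T \<Longrightarrow> sq_integrable M (\<lambda>\<omega>. N x t \<omega> - N x s \<omega>)"
    and N_orthogonal: "\<And>x s t \<xi>. 0 \<le> s \<Longrightarrow> s \<le> t \<Longrightarrow> t \<le> T \<Longrightarrow> \<xi> \<in> borel_measurable (F s) \<Longrightarrow> sq_integrable M \<xi> \<Longrightarrow>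
        expectation (\<lambda>\<omega>. \<xi> \<omega> * (N x t \<omega> - N x s \<omega>)) = 0"
    and N_bound: "\<And>x s t. 0 \<le> s \<Longrightarrow> s \<le> t \<Longrightarrow> t \<le> T \<Longrightarrow>
        (\<integral>\<^sup>+\<omega>. ennreal ((N x t \<omega> - N x s \<omega>)\<^sup>2) \<partial>M) \<le> (\<Sum>j. \<integral>\<^sup>+z. ennreal (indicator {s<..t} (fst z) * (Z x j z)\<^sup>2) \<partial>TM)"
    and equation: "AE \<omega> in M. \<forall>t\<in>{0..T}. \<forall>x.
        inner (X t \<omega>) (e x) + (\<integral>s. indicator {0..t} s * G (s, \<omega>) x \<partial>lborel) = N x t \<omega>"
begin

lemma R_nonneg: "AE z in TM. fst z \<in> {0..T} \<longrightarrow> 0 \<le> R z"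
  using DC_bound by eventually_elim (auto intro: order_trans[OF zero_le_power2])

definition dense_seq :: "nat \<Rightarrow> 'va" where
  "dense_seq = (SOME a. closure (range a) = UNIV)"

lemma dense_seq: "closure (range dense_seq) = (UNIV :: 'va set)"
proof -
  obtain D :: "'va set" where D: "countable D" "\<And>V. open V \<Longrightarrow> V \<noteq> {} \<Longrightarrow> \<exists>d\<in>D. d \<in> V"
    using countable_dense_setE by metis
  have "D \<noteq> {}" using D(2)[of UNIV] by auto
  then have "range (from_nat_into D) = D" using D(1) by (rule range_from_nat_into)
  moreover have "closure D = UNIV"
  proof -
    have "UNIV - closure D = {}" using D(2)[of "UNIV - closure D"] closure_subset[of D] by auto
    then show ?thesis by auto
  qed
  ultimately have "\<exists>a :: nat \<Rightarrow> 'va. closure (range a) = UNIV" by metis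
  then show ?thesis unfolding dense_seq_def by (rule someI_ex)
qed

abbreviation onb :: "nat \<Rightarrow> 'va" where "onb \<equiv> gram_schmidt e dense_seq"

lemma onb_orthonormal: "orthonormal_or_zero (\<lambda>k. e (onb k))"
  by (rule gram_schmidt_orthonormal[OF bounded_linear.linear[OF e_bounded_linear] e_inj])

context
  fixes s t :: real
  assumes st: "0 \<le> s" "s \<le> t" "t \<le> T"
begin

abbreviation dN :: "'va \<Rightarrow> 'w \<Rightarrow> real" where "dN x \<omega> \<equiv> N x t \<omega> - N x s \<omega>"

text \<open>
The square of the norm of \<open>dN\<close> as a functional on \<open>'h\<close>. It is not known beforehand to be finite.
\<close>

definition S :: "'w \<Rightarrow> ennreal" where "S \<omega> = (\<Sum>k. ennreal ((dN (onb k) \<omega>)\<^sup>2))"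

lemma dN_measurable [measurable]: "dN x \<in> borel_measurable M"
  using N_sq_integrable[OF st] by (simp add: sq_integrable_def)

lemma S_measurable [measurable]: "S \<in> borel_measurable M"
  unfolding S_def[abs_def] by measurable

text \<open>
Summing the isometry over the vectors \<open>onb k\<close>, Bessel's inequality in each component of the noise and
the bound on the noise by \<open>R\<close> give the expected squared norm.
\<close>

lemma S_integral_le: "(\<integral>\<^sup>+\<omega>. S \<omega> \<partial>M) \<le> ennreal (\<integral>z. indicator {s<..t} (fst z) * R z \<partial>TM)"
proof -
  have [measurable]: "R \<in> borel_measurable TM" using R_integrable by (rule borel_measurable_integrable)
  let ?i = "\<lambda>z::real \<times> 'w. indicator {s<..t} (fst z) :: real"
  have "(\<integral>\<^sup>+\<omega>. S \<omega> \<partial>M) = (\<Sum>k. \<integral>\<^sup>+\<omega>. ennreal ((dN (onb k) \<omega>)\<^sup>2) \<partial>M)"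
    unfolding S_def by (rule nn_integral_suminf) measurable
  also have "\<dots> \<le> (\<Sum>k. \<Sum>j. \<integral>\<^sup>+z. ennreal (?i z * (Z (onb k) j z)\<^sup>2) \<partial>TM)"
    by (intro suminf_le N_bound[OF st]) auto
  also have "\<dots> = (\<Sum>k. \<integral>\<^sup>+z. (\<Sum>j. ennreal (?i z * (Z (onb k) j z)\<^sup>2)) \<partial>TM)"
    by (subst nn_integral_suminf) auto
  also have "\<dots> = (\<integral>\<^sup>+z. (\<Sum>k. \<Sum>j. ennreal (?i z * (Z (onb k) j z)\<^sup>2)) \<partial>TM)"
    by (subst nn_integral_suminf) auto
  also have "\<dots> \<le> (\<integral>\<^sup>+z. ennreal (?i z * R z) \<partial>TM)"
  proof (rule nn_integral_mono_AE)
    have "AE z in TM. \<forall>k j. fst z \<in> {0..T} \<longrightarrow> Z (onb k) j z = inner (e (onb k)) (DC z j)"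
      unfolding AE_all_countable using Z_Dc by blast
    then show "AE z in TM. (\<Sum>k. \<Sum>j. ennreal (?i z * (Z (onb k) j z)\<^sup>2)) \<le> ennreal (?i z * R z)"
      using DC_bound
    proof eventually_elim
      case (elim z)
      show ?case
      proof (cases "z \<in> {s<..t} \<times> UNIV")
        case True
        then have i: "?i z = 1" and z: "fst z \<in> {0..T}" using st by (auto simp: indicator_def)
        have Zeq: "Z (onb k) j z = inner (DC z j) (e (onb k))" for k j using elim(1) z by (simp add: inner_commute)
        show ?thesis unfolding i Zeq mult_1
        proof (intro suminf_le_const)
          fix K
          have "(\<Sum>k<K. \<Sum>j. ennreal ((inner (DC z j) (e (onb k)))\<^sup>2)) = (\<Sum>j. \<Sum>k<K. ennreal ((inner (DC z j) (e (onb k)))\<^sup>2))"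
            by (rule suminf_sum[symmetric]) auto
          also have "\<dots> \<le> ennreal (R z)"
          proof (intro suminf_le_const)
            fix J
            have "(\<Sum>j<J. \<Sum>k<K. ennreal ((inner (DC z j) (e (onb k)))\<^sup>2)) = ennreal (\<Sum>j<J. \<Sum>k<K. (inner (DC z j) (e (onb k)))\<^sup>2)"
              by (simp add: sum_nonneg)
            also have "\<dots> \<le> ennreal (\<Sum>j<J. (norm (DC z j))\<^sup>2)"
              by (intro ennreal_leI sum_mono Bessel_inequality onb_orthonormal)
            also have "\<dots> \<le> ennreal (R z)"
              using ell2_partial_sum_le[OF DC_ell2[of z], of J] elim(2) z by (intro ennreal_leI) auto
            finally show "(\<Sum>j<J. \<Sum>k<K. ennreal ((inner (DC z j) (e (onb k)))\<^sup>2)) \<le> ennreal (R z)" .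
          qed auto
          finally show "(\<Sum>k<K. \<Sum>j. ennreal ((inner (DC z j) (e (onb k)))\<^sup>2)) \<le> ennreal (R z)" .
        qed auto
      next
        case False
        then have "?i z = 0" by (auto simp: indicator_def mem_Times_iff)
        then show ?thesis by simp
      qed
    qed
  qed
  also have "\<dots> = ennreal (\<integral>z. ?i z * R z \<partial>TM)"
  proof (rule nn_integral_eq_integral)
    show "integrable TM (\<lambda>z. ?i z * R z)"
      by (rule Bochner_Integration.integrable_bound[OF R_integrable]) (auto simp: indicator_def)
    show "AE z in TM. 0 \<le> ?i z * R z"
      using R_nonneg by eventually_elim (use st in \<open>auto simp: indicator_def\<close>)
  qed
  finally show ?thesis .
qed

lemma S_finite: "AE \<omega> in M. S \<omega> \<noteq> \<infinity>"
  by (rule nn_integral_noteq_infinite) (use S_integral_le in \<open>auto simp: top_unique\<close>)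

definition Sr :: "'w \<Rightarrow> real" where "Sr \<omega> = enn2real (S \<omega>)"

lemma Sr_integrable: "integrable M Sr"
  and Sr_integral_le: "expectation Sr \<le> (\<integral>z. indicator {s<..t} (fst z) * R z \<partial>TM)"
proof -
  have eq: "(\<integral>\<^sup>+\<omega>. ennreal (Sr \<omega>) \<partial>M) = (\<integral>\<^sup>+\<omega>. S \<omega> \<partial>M)"
    by (rule nn_integral_cong_AE) (use S_finite in eventually_elim, auto simp: Sr_def less_top)
  have m: "Sr \<in> borel_measurable M" unfolding Sr_def[abs_def] by measurable
  have nn: "0 \<le> Sr \<omega>" for \<omega> by (simp add: Sr_def)
  show i: "integrable M Sr"
  proof (rule integrableI_bounded[OF m])
    have "(\<integral>\<^sup>+\<omega>. ennreal (norm (Sr \<omega>)) \<partial>M) = (\<integral>\<^sup>+\<omega>. S \<omega> \<partial>M)" using nn eq by simp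
    then show "(\<integral>\<^sup>+\<omega>. ennreal (norm (Sr \<omega>)) \<partial>M) < \<infinity>"
      using S_integral_le by (auto simp: less_top[symmetric] top_unique)
  qed
  have r0: "0 \<le> (\<integral>z. indicator {s<..t} (fst z) * R z \<partial>TM)"
  proof (rule integral_nonneg_AE)
    show "AE z in TM. 0 \<le> indicator {s<..t} (fst z) * R z"
      using R_nonneg by eventually_elim (use st in \<open>auto simp: indicator_def\<close>)
  qed
  have "ennreal (expectation Sr) = (\<integral>\<^sup>+\<omega>. ennreal (Sr \<omega>) \<partial>M)"
    by (rule nn_integral_eq_integral[symmetric, OF i]) (use nn in auto)
  also have "\<dots> \<le> ennreal (\<integral>z. indicator {s<..t} (fst z) * R z \<partial>TM)" using eq S_integral_le by simp
  finally show "expectation Sr \<le> (\<integral>z. indicator {s<..t} (fst z) * R z \<partial>TM)" using r0 by (simp add: ennreal_le_iff)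
qed

text \<open>
The equation holds for all test vectors outside one null set, so on a typical path \<open>dN\<close> is the sum of
an inner product and an integral over the drift, hence linear and continuous for the norm of \<open>'va\<close>. Since \<open>S\<close> is
finite, it is even bounded in the norm of \<open>'h\<close>.
\<close>

lemma dN_functional:
  "AE \<omega> in M. linear (\<lambda>x. dN x \<omega>) \<and> (\<forall>x. \<bar>dN x \<omega>\<bar> \<le> sqrt (Sr \<omega>) * norm (e x)) \<and>
     (\<forall>x. inner (X t \<omega> - X s \<omega>) (e x) = dN x \<omega> - (\<integral>r. indicator {s<..t} r * G (r, \<omega>) x \<partial>lborel))"
proof -
  interpret P: pair_sigma_finite "lborel :: real measure" M by (rule pair_sigma_finite_TM)
  interpret e: bounded_linear e by (rule e_bounded_linear)
  have "AE \<omega> in M. integrable lborel (\<lambda>r. \<Gamma> (r, \<omega>))"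
    by (rule P.AE_integrable_snd) (use \<Gamma>_integrable in \<open>simp add: case_prod_beta'\<close>)
  then show ?thesis using equation S_finite AE_space
  proof eventually_elim
    case (elim \<omega>)
    have Gm: "(\<lambda>r. G (r, \<omega>) x) \<in> borel_measurable lborel" for x
    proof -
      have "(\<lambda>r. ((r, \<omega>), x)) \<in> lborel \<rightarrow>\<^sub>M TM \<Otimes>\<^sub>M borel" using elim(4) by measurable
      from measurable_compose[OF this G_measurable] show ?thesis by simp
    qed
    have Gi: "integrable lborel (\<lambda>r. indicator K r * G (r, \<omega>) x)" if "K \<in> sets borel" for x and K :: "real set"
    proof (rule Bochner_Integration.integrable_bound[where f="\<lambda>r. \<Gamma> (r, \<omega>) * norm x"])
      show "AE r in lborel. norm (indicator K r * G (r, \<omega>) x) \<le> norm (\<Gamma> (r, \<omega>) * norm x)"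
        using G_bound \<Gamma>_nonneg by (intro AE_I2) (auto simp: indicator_def abs_mult)
      show "(\<lambda>r. indicator K r * G (r, \<omega>) x) \<in> borel_measurable lborel"
        using Gm[of x] that by (intro borel_measurable_times borel_measurable_indicator) auto
    qed (use elim in auto)
    define g where "g x = (\<integral>r. indicator {s<..t} r * G (r, \<omega>) x \<partial>lborel)" for x
    have st': "s \<in> {0..T}" "t \<in> {0..T}" using st by auto
    have eq: "inner (X t \<omega> - X s \<omega>) (e x) = dN x \<omega> - g x" for x
    proof -
      have "(\<integral>r. indicator {0..t} r * G (r, \<omega>) x \<partial>lborel) =
          (\<integral>r. indicator {0..s} r * G (r, \<omega>) x + indicator {s<..t} r * G (r, \<omega>) x \<partial>lborel)"
        using st by (intro Bochner_Integration.integral_cong) (auto simp: indicator_def)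
      also have "\<dots> = (\<integral>r. indicator {0..s} r * G (r, \<omega>) x \<partial>lborel) + g x"
        unfolding g_def by (intro Bochner_Integration.integral_add Gi) auto
      finally show ?thesis
        using elim(2)[rule_format, OF st'(1), of x] elim(2)[rule_format, OF st'(2), of x]
        by (simp add: inner_diff_left)
    qed
    have g_add: "g (x + x') = g x + g x'" for x x'
      unfolding g_def G_add distrib_left by (intro Bochner_Integration.integral_add Gi) auto
    have g_scale: "g (c *\<^sub>R x) = c * g x" for c x
      unfolding g_def G_scaleR by (simp add: mult.left_commute)
    have g_bound: "\<bar>g x\<bar> \<le> (\<integral>r. \<Gamma> (r, \<omega>) \<partial>lborel) * norm x" for x
    proof -
      have "\<bar>g x\<bar> \<le> (\<integral>r. norm (indicator {s<..t} r * G (r, \<omega>) x) \<partial>lborel)"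
        unfolding g_def using integral_norm_bound[of lborel "\<lambda>r. indicator {s<..t} r * G (r, \<omega>) x"] by simp
      also have "\<dots> \<le> (\<integral>r. \<Gamma> (r, \<omega>) * norm x \<partial>lborel)"
        using G_bound \<Gamma>_nonneg elim(1)
        by (intro integral_mono integrable_norm Gi) (auto simp: indicator_def)
      finally show ?thesis by simp
    qed
    have dN: "dN x \<omega> = inner (X t \<omega> - X s \<omega>) (e x) + g x" for x using eq[of x] by simp
    have bl: "bounded_linear (\<lambda>x. dN x \<omega>)"
    proof -
      have "bounded_linear g"
        by (rule bounded_linear_intro[where K="\<integral>r. \<Gamma> (r, \<omega>) \<partial>lborel"])
           (use g_add g_scale g_bound in \<open>auto simp: mult.commute\<close>)
      then show ?thesis unfolding dN
        by (intro bounded_linear_add bounded_linear_compose[OF bounded_linear_inner_right e_bounded_linear])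
    qed
    have "\<bar>dN x \<omega>\<bar> \<le> sqrt (Sr \<omega>) * norm (e x)" for x
    proof (rule gram_schmidt_functional_bound[OF e_bounded_linear e_inj dense_seq])
      show "linear (\<lambda>x. dN x \<omega>)" using bl by (rule bounded_linear.linear)
      show "continuous_on UNIV (\<lambda>x. dN x \<omega>)" using bl by (rule linear_continuous_on)
      fix n
      have "ennreal (\<Sum>k<n. (dN (onb k) \<omega>)\<^sup>2) = (\<Sum>k<n. ennreal ((dN (onb k) \<omega>)\<^sup>2))" by simp
      also have "\<dots> \<le> S \<omega>" unfolding S_def by (rule sum_le_suminf) auto
      also have "\<dots> = ennreal (Sr \<omega>)" using elim(3) by (simp add: Sr_def less_top)
      finally show "(\<Sum>k<n. (dN (onb k) \<omega>)\<^sup>2) \<le> Sr \<omega>" by (simp add: Sr_def ennreal_le_iff)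
    qed
    then show ?case using eq bounded_linear.linear[OF bl] by (auto simp: g_def)
  qed
qed

text \<open>
The martingale property, tested with a random vector \<open>x \<omega>\<close> that is known at time \<open>s\<close>. The projections of
\<open>x \<omega>\<close> onto finitely many \<open>onb k\<close> are combinations of fixed vectors with coefficients from the past, for
which the mean is zero; they converge with the dominating function \<open>(norm (e (x \<omega>)))\<^sup>2 + Sr \<omega>\<close>. The
integrand is identified up to a null set with its measurable version \<open>D\<close>.
\<close>

lemma dN_past_integral_zero:
  assumes x: "x \<in> borel_measurable (F s)" "integrable M (\<lambda>\<omega>. (norm (e (x \<omega>)))\<^sup>2)"
  shows "\<exists>D. (AE \<omega> in M. D \<omega> = dN (x \<omega>) \<omega>) \<and> integrable M D \<and> expectation D = 0"
proof -
  interpret e: bounded_linear e by (rule e_bounded_linear)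
  have s: "s \<in> {0..T}" using st by auto
  define c where "c k \<omega> = inner (e (x \<omega>)) (e (onb k))" for k \<omega>
  define P where "P n \<omega> = (\<Sum>k<n. c k \<omega> * dN (onb k) \<omega>)" for n \<omega>
  have cF: "c k \<in> borel_measurable (F s)" for k
    unfolding c_def[abs_def] by (intro borel_measurable_inner eA_measurable_comp eB_measurable_comp x borel_measurable_const)
  have c_sq: "sq_integrable M (c k)" for k
    unfolding sq_integrable_def
  proof
    show m: "c k \<in> borel_measurable M" by (rule measurable_F_M[OF s cF])
    show "integrable M (\<lambda>\<omega>. (c k \<omega>)\<^sup>2)"
    proof (rule Bochner_Integration.integrable_bound[OF x(2)])
      show "AE \<omega> in M. norm ((c k \<omega>)\<^sup>2) \<le> norm ((norm (e (x \<omega>)))\<^sup>2)"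
      proof (intro AE_I2)
        fix \<omega>
        have "(c k \<omega>)\<^sup>2 \<le> (\<Sum>i<Suc k. (c i \<omega>)\<^sup>2)" by (simp add: sum_nonneg)
        also have "\<dots> \<le> (norm (e (x \<omega>)))\<^sup>2" unfolding c_def by (rule Bessel_inequality[OF onb_orthonormal])
        finally show "norm ((c k \<omega>)\<^sup>2) \<le> norm ((norm (e (x \<omega>)))\<^sup>2)" by simp
      qed
    qed (use m in simp)
  qed
  have cN: "integrable M (\<lambda>\<omega>. c k \<omega> * dN (onb k) \<omega>)" for k
    by (rule sq_integrable_mult[OF c_sq N_sq_integrable[OF st]])
  have P_int: "integrable M (P n)" for n unfolding P_def[abs_def] using cN by auto
  have P_zero: "expectation (P n) = 0" for n
    unfolding P_def using cN N_orthogonal[OF st cF c_sq] by (subst Bochner_Integration.integral_sum) auto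
  have [measurable]: "P n \<in> borel_measurable M" for n using P_int by (rule borel_measurable_integrable)
  define D where "D \<omega> = lim (\<lambda>n. P n \<omega>)" for \<omega>
  have D_meas: "D \<in> borel_measurable M" unfolding D_def[abs_def] by (rule borel_measurable_lim_metric) measurable
  have lim: "AE \<omega> in M. (\<lambda>n. P n \<omega>) \<longlonglongrightarrow> dN (x \<omega>) \<omega>"
    using dN_functional
  proof eventually_elim
    case (elim \<omega>)
    then interpret L: linear "\<lambda>x. dN x \<omega>" by simp
    let ?p = "\<lambda>n. \<Sum>k<n. inner (e (x \<omega>)) (e (onb k)) *\<^sub>R onb k"
    have Pp: "P n \<omega> = dN (?p n) \<omega>" for n by (simp add: P_def c_def L.sum L.scaleR)
    have z: "(\<lambda>n. sqrt (Sr \<omega>) * norm (e (x \<omega> - ?p n))) \<longlonglongrightarrow> 0"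
      using tendsto_mult_left[OF gram_schmidt_projection_tendsto[OF e_bounded_linear e_inj dense_seq, of "x \<omega>"], of "sqrt (Sr \<omega>)"]
      by simp
    have "(\<lambda>n. dN (x \<omega>) \<omega> - P n \<omega>) \<longlonglongrightarrow> 0"
    proof (rule Lim_null_comparison[OF always_eventually z], intro allI)
      fix n
      have "dN (x \<omega>) \<omega> - P n \<omega> = dN (x \<omega> - ?p n) \<omega>" unfolding Pp by (rule L.diff[symmetric])
      moreover have "\<bar>dN (x \<omega> - ?p n) \<omega>\<bar> \<le> sqrt (Sr \<omega>) * norm (e (x \<omega> - ?p n))" using elim by blast
      ultimately show "norm (dN (x \<omega>) \<omega> - P n \<omega>) \<le> sqrt (Sr \<omega>) * norm (e (x \<omega> - ?p n))" by simp
    qed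
    from tendsto_diff[OF tendsto_const[of "dN (x \<omega>) \<omega>"] this] show ?case by simp
  qed
  then have D_eq: "AE \<omega> in M. D \<omega> = dN (x \<omega>) \<omega>"
    by eventually_elim (auto simp: D_def limI)
  have bound: "AE \<omega> in M. norm (P n \<omega>) \<le> (norm (e (x \<omega>)))\<^sup>2 + Sr \<omega>" for n
    using S_finite
  proof eventually_elim
    case (elim \<omega>)
    have "ennreal (\<Sum>k<n. (dN (onb k) \<omega>)\<^sup>2) = (\<Sum>k<n. ennreal ((dN (onb k) \<omega>)\<^sup>2))" by simp
    also have "\<dots> \<le> S \<omega>" unfolding S_def by (rule sum_le_suminf) auto
    also have "\<dots> = ennreal (Sr \<omega>)" using elim by (simp add: Sr_def less_top)
    finally have S: "(\<Sum>k<n. (dN (onb k) \<omega>)\<^sup>2) \<le> Sr \<omega>" by (simp add: Sr_def ennreal_le_iff)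
    have "(P n \<omega>)\<^sup>2 \<le> (\<Sum>k<n. (c k \<omega>)\<^sup>2) * (\<Sum>k<n. (dN (onb k) \<omega>)\<^sup>2)"
      unfolding P_def by (rule Cauchy_Schwarz_ineq_sum)
    also have "\<dots> \<le> (norm (e (x \<omega>)))\<^sup>2 * Sr \<omega>"
      unfolding c_def by (intro mult_mono S Bessel_inequality[OF onb_orthonormal]) (auto intro: sum_nonneg)
    also have "\<dots> \<le> ((norm (e (x \<omega>)))\<^sup>2 + Sr \<omega>)\<^sup>2"
    proof -
      have "0 \<le> Sr \<omega>" by (simp add: Sr_def)
      then show ?thesis by (simp add: power2_sum)
    qed
    finally show ?case by (simp add: abs_le_square_iff[symmetric] Sr_def)
  qed
  have w: "integrable M (\<lambda>\<omega>. (norm (e (x \<omega>)))\<^sup>2 + Sr \<omega>)" using x(2) Sr_integrable by simp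
  have limD: "AE \<omega> in M. (\<lambda>n. P n \<omega>) \<longlonglongrightarrow> D \<omega>" using lim D_eq by eventually_elim simp
  note dc = D_meas borel_measurable_integrable[OF P_int] w limD bound
  have "integrable M D" by (rule integrable_dominated_convergence[OF dc])
  moreover have "expectation D = 0"
    using integral_dominated_convergence[OF dc] unfolding P_zero by (simp add: LIMSEQ_const_iff)
  ultimately show ?thesis using D_eq by blast
qed

text \<open>
With \<open>\<Delta> = e (xt \<omega>) - e (xs \<omega>)\<close> the increment of the square of the norm is exactly
\<open>2 * inner \<Delta> (e (xt \<omega>)) - (norm \<Delta>)\<^sup>2\<close>. The equation turns the inner product into drift and \<open>dN (xt \<omega>) \<omega>\<close>,
which is the sum of \<open>dN (xs \<omega>) \<omega>\<close>, with mean zero, and of \<open>dN (xt \<omega> - xs \<omega>) \<omega> \<le> sqrt (Sr \<omega>) * norm \<Delta>\<close>. The negative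
square \<open>- (norm \<Delta>)\<^sup>2\<close> absorbs the latter at the price of \<open>Sr \<omega>\<close>, which the isometry bounds. Thus a single
step, of any size, replaces the Ito formula for the square of the norm.
\<close>

lemma energy_increment:
  assumes xs: "xs \<in> borel_measurable (F s)" "integrable M (\<lambda>\<omega>. (norm (e (xs \<omega>)))\<^sup>2)" "AE \<omega> in M. X s \<omega> = e (xs \<omega>)"
    and xt: "integrable M (\<lambda>\<omega>. (norm (e (xt \<omega>)))\<^sup>2)" "AE \<omega> in M. X t \<omega> = e (xt \<omega>)"
    and g: "integrable M (\<lambda>\<omega>. \<integral>r. indicator {s<..t} r * G (r, \<omega>) (xt \<omega>) \<partial>lborel)"
  shows "expectation (\<lambda>\<omega>. (norm (e (xt \<omega>)))\<^sup>2) - expectation (\<lambda>\<omega>. (norm (e (xs \<omega>)))\<^sup>2)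
     \<le> - 2 * expectation (\<lambda>\<omega>. \<integral>r. indicator {s<..t} r * G (r, \<omega>) (xt \<omega>) \<partial>lborel)
        + (\<integral>z. indicator {s<..t} (fst z) * R z \<partial>TM)"
proof -
  interpret e: bounded_linear e by (rule e_bounded_linear)
  obtain D where D: "AE \<omega> in M. D \<omega> = dN (xs \<omega>) \<omega>" "integrable M D" "expectation D = 0"
    using dN_past_integral_zero[OF xs(1,2)] by blast
  let ?g = "\<lambda>\<omega>. \<integral>r. indicator {s<..t} r * G (r, \<omega>) (xt \<omega>) \<partial>lborel"
  have "AE \<omega> in M. (norm (e (xt \<omega>)))\<^sup>2 - (norm (e (xs \<omega>)))\<^sup>2 \<le> - 2 * ?g \<omega> + 2 * D \<omega> + Sr \<omega>"
    using dN_functional D(1) xs(3) xt(2)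
  proof eventually_elim
    case (elim \<omega>)
    then interpret L: linear "\<lambda>x. dN x \<omega>" by simp
    define \<Delta> where "\<Delta> = e (xt \<omega>) - e (xs \<omega>)"
    have S0: "0 \<le> Sr \<omega>" by (simp add: Sr_def)
    have in1: "inner \<Delta> (e (xt \<omega>)) = dN (xt \<omega>) \<omega> - ?g \<omega>"
      using elim unfolding \<Delta>_def by auto
    have split: "dN (xt \<omega>) \<omega> = D \<omega> + dN (xt \<omega> - xs \<omega>) \<omega>"
      unfolding L.diff elim(2) by simp
    have le1: "dN (xt \<omega> - xs \<omega>) \<omega> \<le> sqrt (Sr \<omega>) * norm \<Delta>"
    proof -
      have "\<bar>dN (xt \<omega> - xs \<omega>) \<omega>\<bar> \<le> sqrt (Sr \<omega>) * norm (e (xt \<omega> - xs \<omega>))" using elim(1) by blast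
      then show ?thesis unfolding \<Delta>_def e.diff by linarith
    qed
    have le2: "2 * (sqrt (Sr \<omega>) * norm \<Delta>) \<le> Sr \<omega> + (norm \<Delta>)\<^sup>2"
      using sum_squares_bound[of "sqrt (Sr \<omega>)" "norm \<Delta>"] S0 by simp
    have "2 * dN (xt \<omega> - xs \<omega>) \<omega> \<le> 2 * (sqrt (Sr \<omega>) * norm \<Delta>)"
      by (rule mult_left_mono[OF le1]) simp
    from order_trans[OF this le2] have "2 * dN (xt \<omega> - xs \<omega>) \<omega> \<le> Sr \<omega> + (norm \<Delta>)\<^sup>2" .
    moreover have "(norm (e (xt \<omega>)))\<^sup>2 - (norm (e (xs \<omega>)))\<^sup>2 = 2 * inner \<Delta> (e (xt \<omega>)) - (norm \<Delta>)\<^sup>2"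
      unfolding \<Delta>_def power2_norm_eq_inner by (simp add: inner_diff_left inner_diff_right inner_commute)
    ultimately show ?case
    proof -
      have arith: "\<And>a b g i n m D S :: real. 2 * a \<le> S + n \<Longrightarrow> m = 2 * i - n \<Longrightarrow> i = b - g \<Longrightarrow> b = D + a \<Longrightarrow>
        m \<le> - 2 * g + 2 * D + S" by linarith
      show ?thesis by (rule arith[OF _ _ in1 split]) fact+
    qed
  qed
  then have "expectation (\<lambda>\<omega>. (norm (e (xt \<omega>)))\<^sup>2 - (norm (e (xs \<omega>)))\<^sup>2) \<le> expectation (\<lambda>\<omega>. - 2 * ?g \<omega> + 2 * D \<omega> + Sr \<omega>)"
    using xs(2) xt(1) g D(2) Sr_integrable by (intro integral_mono_AE) auto
  also have "\<dots> = - 2 * expectation ?g + expectation Sr"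
    using g D(2,3) Sr_integrable by simp
  also have "\<dots> \<le> - 2 * expectation ?g + (\<integral>z. indicator {s<..t} (fst z) * R z \<partial>TM)"
    using Sr_integral_le by simp
  finally show ?thesis using xs(2) xt(1) by simp
qed

end

end

section \<open>Time lags and exponential weights\<close>

context energy_operators begin

definition elastic_lag :: "real \<Rightarrow> real \<times> 'w \<Rightarrow> real" where
  "elastic_lag \<theta> z = blinfun_apply (B (U z) (snd z)) (eA (y (shift \<theta> z)))"

definition weight :: "real \<Rightarrow> real \<times> 'w \<Rightarrow> real" where "weight c z = ind z * exp (- c * fst z)"

lemma weight_measurable [measurable]: "weight c \<in> borel_measurable TM"
  unfolding weight_def[abs_def] by measurable

lemma weight_bounds: "0 \<le> c \<Longrightarrow> 0 \<le> weight c z" "0 \<le> c \<Longrightarrow> weight c z \<le> 1" "0 \<le> c \<Longrightarrow> \<bar>weight c z\<bar> \<le> 1"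
  by (auto simp: weight_def indicator_def)

lemma weight_shift: "0 \<le> c \<Longrightarrow> 0 \<le> \<theta> \<Longrightarrow> fst z \<in> {0..T} \<Longrightarrow> weight c (shift (- \<theta>) z) \<le> exp (- c * \<theta>) * weight c z"
  by (auto simp: weight_def indicator_def exp_add[symmetric] algebra_simps)

text \<open>
Shifting a nonnegative function forward in time by \<open>\<theta>\<close> lowers its exponentially weighted integral at least by
the factor \<open>exp (- c * \<theta>)\<close>; the mass that is pushed beyond \<open>T\<close> is lost.
\<close>

lemma weight_shift_integral_le:
  assumes f: "integrable TM f" "AE z in TM. fst z \<in> {0..T} \<longrightarrow> 0 \<le> f z" "\<And>z. fst z \<notin> {0..T} \<Longrightarrow> f z = 0"
    and c: "0 \<le> c" "0 \<le> \<theta>"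
  shows "(\<integral>z. weight c z * f (shift \<theta> z) \<partial>TM) \<le> exp (- c * \<theta>) * (\<integral>z. weight c z * f z \<partial>TM)"
    and "integrable TM (\<lambda>z. weight c z * f (shift \<theta> z))" "integrable TM (\<lambda>z. weight c z * f z)"
proof -
  have [measurable]: "f \<in> borel_measurable TM" using f(1) by (rule borel_measurable_integrable)
  have w: "norm (weight c z * x) \<le> norm x" for z x
    using weight_bounds[OF c(1), of z] by (simp add: abs_mult mult_left_le_one_le)
  show i1: "integrable TM (\<lambda>z. weight c z * f (shift \<theta> z))"
    by (rule Bochner_Integration.integrable_bound[OF integrable_TM_shift[OF f(1), of \<theta>]])
       (measurable, use w in auto)
  show i2: "integrable TM (\<lambda>z. weight c z * f z)"
    by (rule Bochner_Integration.integrable_bound[OF f(1)]) (measurable, use w in auto)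
  have i3: "integrable TM (\<lambda>z. weight c (shift (- \<theta>) z) * f z)"
    by (rule Bochner_Integration.integrable_bound[OF f(1)])
       (measurable, use weight_bounds[OF c(1)] in \<open>auto simp: abs_mult mult_left_le_one_le\<close>)
  have "(\<integral>z. weight c z * f (shift \<theta> z) \<partial>TM) = (\<integral>z. weight c (shift (- \<theta>) (shift \<theta> z)) * f (shift \<theta> z) \<partial>TM)"
    by (simp add: shift_cancel)
  also have "\<dots> = (\<integral>z. weight c (shift (- \<theta>) z) * f z \<partial>TM)"
    using integral_TM_shift[OF i3, of \<theta>] by simp
  also have "\<dots> \<le> (\<integral>z. exp (- c * \<theta>) * (weight c z * f z) \<partial>TM)"
  proof (rule integral_mono_AE[OF i3])
    show "integrable TM (\<lambda>z. exp (- c * \<theta>) * (weight c z * f z))" using i2 by simp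
    show "AE z in TM. weight c (shift (- \<theta>) z) * f z \<le> exp (- c * \<theta>) * (weight c z * f z)"
      using f(2)
    proof eventually_elim
      case (elim z)
      show ?case
      proof (cases "fst z \<in> {0..T}")
        case True
        then show ?thesis using mult_right_mono[OF weight_shift[OF c True], of "f z"] elim by (simp add: mult.assoc)
      next
        case False then show ?thesis using f(3) by simp
      qed
    qed
  qed
  finally show "(\<integral>z. weight c z * f (shift \<theta> z) \<partial>TM) \<le> exp (- c * \<theta>) * (\<integral>z. weight c z * f z \<partial>TM)" by simp
qed

lemma R_outside: "fst z \<notin> {0..T} \<Longrightarrow> R z = 0"
proof -
  assume z: "fst z \<notin> {0..T}"
  then have "y z = 0" using y_outside[of "fst z" "snd z"] by simp
  moreover have "U z = 0" using z by (simp add: U_def)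
  ultimately show ?thesis
    using z by (simp add: R_def elastic_power_def elastic_def G_outside B_zero blinfun.zero_right blinfun.zero_left)
qed

text \<open>
The integrand of the energy: \<open>\<bar>v\<bar>\<^sup>2 + \<bar>u\<bar>\<^sub>B\<^sup>2\<close> for the differences \<open>v\<close> of the velocities and \<open>u\<close> of the displacements.
\<close>

definition energy :: "real \<times> 'w \<Rightarrow> real" where "energy z = (norm (e (y z)))\<^sup>2 + elastic z"

lemma energy_integrable: "integrable TM energy"
  unfolding energy_def[abs_def] using ey_sq_integrable elastic_integrable by simp

lemma energy_nonneg: "0 \<le> energy z"
  using B_pos by (simp add: energy_def elastic_def)

lemma energy_outside: "fst z \<notin> {0..T} \<Longrightarrow> energy z = 0"
  using y_outside[of "fst z" "snd z"] by (simp add: energy_def elastic_def U_def blinfun.zero_right)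

lemma weighted_y_integrable:
  assumes "0 \<le> c"
  shows "integrable TM (\<lambda>z. norm (weight c z *\<^sub>R y z) powr p)"
proof (rule Bochner_Integration.integrable_bound[OF y_powr_integrable])
  show "AE z in TM. norm (norm (weight c z *\<^sub>R y z) powr p) \<le> norm (norm (y z) powr p)"
  proof (intro AE_I2)
    fix z
    have "norm (weight c z *\<^sub>R y z) \<le> norm (y z)" using weight_bounds[OF assms, of z] by (simp add: mult_left_le_one_le)
    then show "norm (norm (weight c z *\<^sub>R y z) powr p) \<le> norm (norm (y z) powr p)" using p by (simp add: powr_mono2)
  qed
qed auto

lemma
  shows G_shift_integrable: "integrable TM (\<lambda>z. G (shift \<theta> z) (y z))"
    and G_shift_bound: "(\<integral>z. \<bar>G (shift \<theta> z) (y z)\<bar> \<partial>TM) \<le> (\<integral>z. \<Gamma> z powr q \<partial>TM) + (\<integral>z. norm (y z) powr p \<partial>TM)"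
    and G_shift_tendsto: "0 \<le> c \<Longrightarrow> h \<longlonglongrightarrow> 0 \<Longrightarrow> (\<lambda>n. \<integral>z. weight c z * G (shift (h n) z) (y z) \<partial>TM) \<longlonglongrightarrow> (\<integral>z. weight c z * G z (y z) \<partial>TM)"
proof -
  show "integrable TM (\<lambda>z. G (shift \<theta> z) (y z))"
    by (rule TM_bilinear_integrable[OF p1 p(2) G_translation y_measurable y_powr_integrable])
  show "(\<integral>z. \<bar>G (shift \<theta> z) (y z)\<bar> \<partial>TM) \<le> (\<integral>z. \<Gamma> z powr q \<partial>TM) + (\<integral>z. norm (y z) powr p \<partial>TM)"
    by (rule TM_bilinear_bound[OF p1 p(2) G_translation y_measurable y_powr_integrable])
  assume c: "0 \<le> c" and h: "h \<longlonglongrightarrow> 0"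
  have m: "(\<lambda>z. weight c z *\<^sub>R y z) \<in> borel_measurable TM" by measurable
  show "(\<lambda>n. \<integral>z. weight c z * G (shift (h n) z) (y z) \<partial>TM) \<longlonglongrightarrow> (\<integral>z. weight c z * G z (y z) \<partial>TM)"
    using TM_bilinear_tendsto[OF p1 p(2) G_translation m weighted_y_integrable[OF c] h] by (simp add: G_scaleR)
qed

text \<open>
Here the roles are exchanged: the displacement \<open>U\<close> is taken at the present time and the velocity with a lag.
Both are square integrable, so the exponents are \<open>p = q = 2\<close>.
\<close>

lemma
  shows elastic_lag_integrable: "integrable TM (elastic_lag \<theta>)"
    and elastic_lag_bound: "(\<integral>z. \<bar>elastic_lag \<theta> z\<bar> \<partial>TM) \<le> (\<integral>z. (cB * norm eA * norm (y z))\<^sup>2 \<partial>TM) + (\<integral>z. (norm (U z))\<^sup>2 \<partial>TM)"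
    and elastic_lag_tendsto: "0 \<le> c \<Longrightarrow> h \<longlonglongrightarrow> 0 \<Longrightarrow> (\<lambda>n. \<integral>z. weight c z * elastic_lag (h n) z \<partial>TM) \<longlonglongrightarrow> (\<integral>z. weight c z * elastic_power z \<partial>TM)"
proof -
  let ?\<Phi> = "\<lambda>z x. blinfun_apply (B x (snd z)) (eA (y z))"
  let ?g = "\<lambda>z. cB * norm eA * norm (y z)"
  have pq: "1 < (2::real)" "(2::real) = 2 / (2 - 1)" by auto
  have m\<Phi>: "(\<lambda>(z, x). ?\<Phi> z x) \<in> borel_measurable (TM \<Otimes>\<^sub>M borel)"
    unfolding case_prod_beta' by measurable
  have d\<Phi>: "?\<Phi> z (x - x') = ?\<Phi> z x - ?\<Phi> z x'" for z x x' by (simp add: B_diff blinfun.diff_left)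
  have b\<Phi>: "\<bar>?\<Phi> z x\<bar> \<le> ?g z * norm x" for z x
  proof -
    have "\<bar>?\<Phi> z x\<bar> \<le> cB * norm x * norm (eA (y z))" by (rule B_apply_bound)
    also have "\<dots> \<le> cB * norm x * (norm eA * norm (y z))" using const by (intro mult_left_mono norm_blinfun) auto
    finally show ?thesis by (simp add: mult_ac)
  qed
  have g0: "0 \<le> ?g z" for z using const by simp
  have g2: "?g z powr 2 = (?g z)\<^sup>2" for z using g0[of z] by (cases "?g z = 0") (auto simp: powr_numeral)
  have ig2: "integrable TM (\<lambda>z. (?g z)\<^sup>2)" using y_sq_integrable by (simp add: power_mult_distrib)
  have ig: "integrable TM ?g"
  proof (rule Bochner_Integration.integrable_bound[where f="\<lambda>z. ind z + (?g z)\<^sup>2"])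
    show "AE z in TM. norm (?g z) \<le> norm (ind z + (?g z)\<^sup>2)"
    proof (intro AE_I2)
      fix z
      have "a \<le> 1 + a\<^sup>2" for a :: real using sum_squares_bound[of a 1] zero_le_power2[of a] by (smt (verit) mult_cancel_left2 power_one)
      then have "?g z \<le> ind z + (?g z)\<^sup>2"
        using y_outside[of "fst z" "snd z"] by (cases "fst z \<in> {0..T}") auto
      then show "norm (?g z) \<le> norm (ind z + (?g z)\<^sup>2)" using g0[of z] by simp
    qed
  qed (use ind_integrable ig2 in auto)
  have ig2': "integrable TM (\<lambda>z. ?g z powr 2)" unfolding g2 by (rule ig2)
  have iU: "integrable TM (\<lambda>z. norm (U z) powr 2)" unfolding powr_two_norm by (rule U_sq_integrable)
  note t = m\<Phi> d\<Phi> b\<Phi> ig ig2' g0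
  show "integrable TM (elastic_lag \<theta>)"
    using TM_bilinear_integrable[OF pq t U_measurable iU, of \<theta>] by (simp add: elastic_lag_def[abs_def])
  show "(\<integral>z. \<bar>elastic_lag \<theta> z\<bar> \<partial>TM) \<le> (\<integral>z. (?g z)\<^sup>2 \<partial>TM) + (\<integral>z. (norm (U z))\<^sup>2 \<partial>TM)"
    using TM_bilinear_bound[OF pq t U_measurable iU, of \<theta>] unfolding g2 powr_two_norm by (simp add: elastic_lag_def[abs_def])
  have sc: "B (k *\<^sub>R u) \<omega> = k *\<^sub>R B u \<omega>" for k u \<omega> using linear_scale[OF B_linear] .
  assume c: "0 \<le> c" and h: "h \<longlonglongrightarrow> 0"
  have mw: "(\<lambda>z. weight c z *\<^sub>R U z) \<in> borel_measurable TM" by measurable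
  have iw: "integrable TM (\<lambda>z. norm (weight c z *\<^sub>R U z) powr 2)"
    unfolding powr_two_norm
  proof (rule Bochner_Integration.integrable_bound[OF U_sq_integrable])
    show "AE z in TM. norm ((norm (weight c z *\<^sub>R U z))\<^sup>2) \<le> norm ((norm (U z))\<^sup>2)"
    proof (intro AE_I2)
      fix z
      have "norm (weight c z *\<^sub>R U z) \<le> norm (U z)" using weight_bounds[OF c, of z] by (simp add: mult_left_le_one_le)
      then have "(norm (weight c z *\<^sub>R U z))\<^sup>2 \<le> (norm (U z))\<^sup>2" by (rule power_mono) simp
      then show "norm ((norm (weight c z *\<^sub>R U z))\<^sup>2) \<le> norm ((norm (U z))\<^sup>2)" by simp
    qed
  qed measurable
  show "(\<lambda>n. \<integral>z. weight c z * elastic_lag (h n) z \<partial>TM) \<longlonglongrightarrow> (\<integral>z. weight c z * elastic_power z \<partial>TM)"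
    using TM_bilinear_tendsto[OF pq t mw iw h] by (simp add: elastic_lag_def elastic_power_def sc blinfun.scaleR_left)
qed

text \<open>
The window may start before time \<open>0\<close>, where the integrands vanish. The endpoint \<open>0\<close> itself is a null set.
\<close>

lemma integral_window_truncated:
  fixes f :: "real \<Rightarrow> real"
  assumes "\<And>r. r \<notin> {0..T} \<Longrightarrow> f r = 0"
  shows "(\<integral>r. indicator {max 0 (t - h)<..t} r * f r \<partial>lborel) = (\<integral>\<theta>. indicator {0..<h} \<theta> * f (t - \<theta>) \<partial>lborel)"
  unfolding integral_window
  by (rule integral_discrete_difference[where X="{0}"]) (use assms in \<open>auto simp: indicator_def\<close>)

lemma U_increment:
  assumes \<omega>: "\<omega> \<in> space M" and i: "integrable lborel (\<lambda>s. (norm (y (s, \<omega>)))\<^sup>2)" and t: "t \<in> {0..T}" and h: "0 < h"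
  shows "(\<integral>\<theta>. indicator {0..<h} \<theta> * elastic_lag \<theta> (t, \<omega>) \<partial>lborel) =
    blinfun_apply (B (U (t, \<omega>)) \<omega>) (U (t, \<omega>) - U (t - h, \<omega>))"
proof -
  note yi = y_path_integrable'[OF \<omega> i]
  have ii: "integrable lborel (\<lambda>s. indicator K s *\<^sub>R y (s, \<omega>))" if "K \<in> sets borel" for K
    using that yi by (intro integrable_mult_indicator) auto
  let ?I = "\<lambda>K. \<integral>s. indicator K s *\<^sub>R y (s, \<omega>) \<partial>lborel"
  have "U (t, \<omega>) - U (t - h, \<omega>) = eA (?I {t - h<..t})"
  proof (cases "0 \<le> t - h")
    case True
    then have th: "t - h \<in> {0..T}" using t h by auto
    have "?I {0..t} = (\<integral>s. indicator {0..t - h} s *\<^sub>R y (s, \<omega>) + indicator {t - h<..t} s *\<^sub>R y (s, \<omega>) \<partial>lborel)"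
      using True h by (intro Bochner_Integration.integral_cong) (auto simp: indicator_def)
    also have "\<dots> = ?I {0..t - h} + ?I {t - h<..t}" by (intro Bochner_Integration.integral_add ii) auto
    finally show ?thesis using t th by (simp add: U_def blinfun.add_right)
  next
    case False
    have "?I {0..t} = ?I {t - h<..t}"
      using False y_outside[of _ \<omega>] by (intro Bochner_Integration.integral_cong) (auto simp: indicator_def)
    then show ?thesis using t False by (simp add: U_def)
  qed
  then have "blinfun_apply (B (U (t, \<omega>)) \<omega>) (U (t, \<omega>) - U (t - h, \<omega>)) =
      blinfun_apply (B (U (t, \<omega>)) \<omega> o\<^sub>L eA) (?I {t - h<..t})" by simp
  also have "\<dots> = (\<integral>s. blinfun_apply (B (U (t, \<omega>)) \<omega> o\<^sub>L eA) (indicator {t - h<..t} s *\<^sub>R y (s, \<omega>)) \<partial>lborel)"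
    by (rule integral_bounded_linear[OF blinfun.bounded_linear_right ii, symmetric]) auto
  also have "\<dots> = (\<integral>s. indicator {t - h<..t} s * blinfun_apply (B (U (t, \<omega>)) \<omega>) (eA (y (s, \<omega>))) \<partial>lborel)"
    by (simp add: blinfun.scaleR_right)
  also have "\<dots> = (\<integral>\<theta>. indicator {0..<h} \<theta> * elastic_lag \<theta> (t, \<omega>) \<partial>lborel)"
    unfolding integral_window[symmetric] by (simp add: elastic_lag_def shift_def)
  finally show ?thesis ..
qed

text \<open>
The convexity inequality for the quadratic form of \<open>B\<close>.
\<close>

lemma elastic_increment: "elastic z - elastic z' \<le> 2 * blinfun_apply (B (U z) (snd z)) (U z - U z')" if "snd z = snd z'"
proof -
  let ?b = "\<lambda>u v. blinfun_apply (B u (snd z)) v"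
  have "0 \<le> ?b (U z - U z') (U z - U z')" by (rule B_pos)
  also have "\<dots> = ?b (U z) (U z) - 2 * ?b (U z) (U z') + ?b (U z') (U z')"
    using B_sym[of "U z'" "snd z" "U z"] by (simp add: B_diff blinfun.diff_left blinfun.diff_right)
  finally show ?thesis using that by (simp add: elastic_def blinfun.diff_right)
qed

end

section \<open>The exponentially weighted energy vanishes\<close>

context energy_setting begin

lemma R_measurable [measurable]: "R \<in> borel_measurable TM"
  using R_integrable by (rule borel_measurable_integrable)

lemma G_lag_measurable: "(\<lambda>(\<theta>, z). G (shift \<theta> z) (y z)) \<in> borel_measurable (lborel \<Otimes>\<^sub>M TM)"
proof -
  have "(\<lambda>x. (shift (fst x) (snd x), y (snd x))) \<in> lborel \<Otimes>\<^sub>M TM \<rightarrow>\<^sub>M TM \<Otimes>\<^sub>M borel"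
    by (intro measurable_Pair shift_measurable_pair' measurable_compose[OF measurable_snd y_measurable])
  from measurable_compose[OF this G_measurable] show ?thesis by (simp add: case_prod_beta')
qed

lemma R_lag_measurable: "(\<lambda>(\<theta>, z). R (shift \<theta> z)) \<in> borel_measurable (lborel \<Otimes>\<^sub>M TM)"
  using measurable_compose[OF shift_measurable_pair R_measurable] by (simp add: case_prod_beta')

lemma R_lag_bound: "(\<integral>z. \<bar>R (shift \<theta> z)\<bar> \<partial>TM) \<le> (\<integral>z. \<bar>R z\<bar> \<partial>TM)"
  using integral_TM_shift[of "\<lambda>z. \<bar>R z\<bar>" \<theta>] R_integrable by simp

lemma elastic_lag_measurable: "(\<lambda>(\<theta>, z). elastic_lag \<theta> z) \<in> borel_measurable (lborel \<Otimes>\<^sub>M TM)"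
proof -
  note [measurable] = measurable_compose[OF shift_measurable_pair' y_measurable]
  show ?thesis unfolding elastic_lag_def case_prod_beta' by measurable
qed

lemmas G_shift_average =
    shift_average[OF G_lag_measurable G_shift_integrable G_shift_bound weight_measurable weight_bounds(3)]
  and R_shift_average =
    shift_average[OF R_lag_measurable integrable_TM_shift[OF R_integrable] R_lag_bound weight_measurable weight_bounds(3)]
  and elastic_lag_shift_average =
    shift_average[OF elastic_lag_measurable elastic_lag_integrable elastic_lag_bound weight_measurable weight_bounds(3)]

abbreviation "G_average h \<equiv> lag_average h (\<lambda>\<theta> z. G (shift \<theta> z) (y z))"
abbreviation "R_average h \<equiv> lag_average h (\<lambda>\<theta> z. R (shift \<theta> z))"
abbreviation "elastic_average h \<equiv> lag_average h elastic_lag"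

text \<open>
For almost every \<open>t\<close>, both \<open>t\<close> and \<open>t - h\<close> are times at which the continuous modification agrees with
the velocity and all expectations are finite. Before time \<open>0\<close> the velocity is zero, and so is the initial
value \<open>X 0\<close>, so the step from \<open>max 0 (t - h)\<close> to \<open>t\<close> covers the case \<open>t < h\<close> as well.
\<close>

lemma energy_increment_average:
  assumes h: "0 < h"
  shows "AE t in lborel. t \<in> {0..T} \<longrightarrow>
    expectation (\<lambda>\<omega>. energy (t, \<omega>)) - expectation (\<lambda>\<omega>. energy (shift h (t, \<omega>)))
      \<le> expectation (\<lambda>\<omega>. - 2 * G_average h (t, \<omega>) + R_average h (t, \<omega>) + 2 * elastic_average h (t, \<omega>))"
proof -
  interpret P: pair_sigma_finite "lborel :: real measure" M by (rule pair_sigma_finite_TM)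
  have fst_ae: "AE t in lborel. integrable M (\<lambda>\<omega>. f (t, \<omega>))" if "integrable TM f" for f :: "real \<times> 'w \<Rightarrow> real"
    by (rule P.AE_integrable_fst) (use that in \<open>simp add: case_prod_beta'\<close>)
  have H: "integrable TM (G_average h)" "integrable TM (R_average h)" "integrable TM (elastic_average h)"
    using G_shift_average(1)[of 0 h] R_shift_average(1)[of 0 h] elastic_lag_shift_average(1)[of 0 h] h by auto
  have "AE z in distr TM TM (shift h). fst z \<in> {0..T} \<longrightarrow> X (fst z) (snd z) = e (y z)"
    unfolding distr_shift by (rule X_modification)
  then have Xs: "AE z in TM. fst (shift h z) \<in> {0..T} \<longrightarrow> X (fst (shift h z)) (snd (shift h z)) = e (y (shift h z))"
    by (rule AE_distrD[rotated]) measurable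
  note x1 = P.AE_pair[OF X_modification] and x2 = P.AE_pair[OF Xs]
  note a = fst_ae[OF H(1)] fst_ae[OF H(2)] fst_ae[OF H(3)] fst_ae[OF ey_sq_integrable] fst_ae[OF elastic_integrable]
    fst_ae[OF integrable_TM_shift[OF ey_sq_integrable, of h]] fst_ae[OF integrable_TM_shift[OF elastic_integrable, of h]]
  show ?thesis using a x1 x2
  proof eventually_elim
    case (elim t)
    show ?case
    proof
      assume t: "t \<in> {0..T}"
      define s where "s = max 0 (t - h)"
      have st: "0 \<le> s" "s \<le> t" "t \<le> T" using t h by (auto simp: s_def)
      have st': "s \<in> {0..T}" using st by auto
      \<comment> \<open>The value before time \<open>0\<close> is \<open>0\<close>, which matches the initial value \<open>X 0\<close>.\<close>
      define xs where "xs \<omega> = (if 0 \<le> t - h then y (t - h, \<omega>) else 0)" for \<omega>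
      have xs_shift: "xs \<omega> = y (shift h (t, \<omega>))" for \<omega>
        using y_outside[of "t - h" \<omega>] by (auto simp: xs_def shift_def)
      have xsF: "xs \<in> borel_measurable (F s)"
      proof (cases "0 \<le> t - h")
        case True
        then have "s = t - h" "t - h \<in> {0..T}" using t h by (auto simp: s_def)
        then show ?thesis using y_adapted[of "t - h"] True
          by (auto simp: xs_def[abs_def] y_def intro!: borel_measurable_diff)
      next
        case False then show ?thesis by (simp add: xs_def[abs_def])
      qed
      have xs_int: "integrable M (\<lambda>\<omega>. (norm (e (xs \<omega>)))\<^sup>2)" unfolding xs_shift by (rule elim(6))
      have Xs: "AE \<omega> in M. X s \<omega> = e (xs \<omega>)"
      proof (cases "0 \<le> t - h")
        case True
        then have sh: "s = t - h" using h by (simp add: s_def)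
        show ?thesis using elim(9)
          by eventually_elim (use st' in \<open>simp add: sh xs_shift\<close>)
      next
        case False
        then have "s = 0" by (simp add: s_def)
        then show ?thesis using X_zero False by (simp add: xs_def blinfun.zero_right)
      qed
      have Xt: "AE \<omega> in M. X t \<omega> = e (y (t, \<omega>))" using elim(8) t by simp
      have g: "(\<integral>r. indicator {s<..t} r * G (r, \<omega>) (y (t, \<omega>)) \<partial>lborel) = G_average h (t, \<omega>)" for \<omega>
        unfolding lag_average_def s_def using integral_window_truncated[of "\<lambda>r. G (r, \<omega>) (y (t, \<omega>))" t h] G_outside
        by (simp add: shift_def)
      have Rint: "integrable TM (\<lambda>(r, \<omega>). indicator {s<..t} r * R (r, \<omega>))"
        by (rule Bochner_Integration.integrable_bound[OF R_integrable])
           (auto simp: indicator_def case_prod_beta')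
      have "(\<integral>z. indicator {s<..t} (fst z) * R z \<partial>TM) = (\<integral>\<omega>. (\<integral>r. indicator {s<..t} r * R (r, \<omega>) \<partial>lborel) \<partial>M)"
        using P.integral_snd[OF Rint] by (simp add: case_prod_beta')
      also have "\<dots> = expectation (\<lambda>\<omega>. R_average h (t, \<omega>))"
        unfolding lag_average_def s_def using integral_window_truncated[of "\<lambda>r. R (r, _)" t h] R_outside
        by (simp add: shift_def)
      finally have r: "(\<integral>z. indicator {s<..t} (fst z) * R z \<partial>TM) = expectation (\<lambda>\<omega>. R_average h (t, \<omega>))" .
      have 1: "expectation (\<lambda>\<omega>. (norm (e (y (t, \<omega>))))\<^sup>2) - expectation (\<lambda>\<omega>. (norm (e (xs \<omega>)))\<^sup>2)
         \<le> - 2 * expectation (\<lambda>\<omega>. G_average h (t, \<omega>)) + expectation (\<lambda>\<omega>. R_average h (t, \<omega>))"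
        using energy_increment[OF st xsF xs_int Xs elim(4) Xt] unfolding g r using elim(1) by simp
      have "AE \<omega> in M. elastic (t, \<omega>) - elastic (shift h (t, \<omega>)) \<le> 2 * elastic_average h (t, \<omega>)"
        using y_path_integrable AE_space
      proof eventually_elim
        case (elim \<omega>)
        have "elastic_average h (t, \<omega>) = blinfun_apply (B (U (t, \<omega>)) \<omega>) (U (t, \<omega>) - U (t - h, \<omega>))"
          unfolding lag_average_def by (rule U_increment[OF elim(2,1) t h])
        then show ?case using elastic_increment[of "(t, \<omega>)" "(t - h, \<omega>)"] by (simp add: shift_def)
      qed
      then have 2: "expectation (\<lambda>\<omega>. elastic (t, \<omega>) - elastic (shift h (t, \<omega>))) \<le> expectation (\<lambda>\<omega>. 2 * elastic_average h (t, \<omega>))"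
        using elim(3,5,7) by (intro integral_mono_AE) auto
      have "expectation (\<lambda>\<omega>. energy (t, \<omega>)) - expectation (\<lambda>\<omega>. energy (shift h (t, \<omega>))) =
         (expectation (\<lambda>\<omega>. (norm (e (y (t, \<omega>))))\<^sup>2) - expectation (\<lambda>\<omega>. (norm (e (xs \<omega>)))\<^sup>2))
          + expectation (\<lambda>\<omega>. elastic (t, \<omega>) - elastic (shift h (t, \<omega>)))"
        unfolding energy_def xs_shift using elim(4-7) by simp
      also have "\<dots> \<le> - 2 * expectation (\<lambda>\<omega>. G_average h (t, \<omega>)) + expectation (\<lambda>\<omega>. R_average h (t, \<omega>)) + expectation (\<lambda>\<omega>. 2 * elastic_average h (t, \<omega>))"
        using 1 2 by simp
      also have "\<dots> = expectation (\<lambda>\<omega>. - 2 * G_average h (t, \<omega>) + R_average h (t, \<omega>) + 2 * elastic_average h (t, \<omega>))"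
        using elim(1-3) by simp
      finally show "expectation (\<lambda>\<omega>. energy (t, \<omega>)) - expectation (\<lambda>\<omega>. energy (shift h (t, \<omega>)))
        \<le> expectation (\<lambda>\<omega>. - 2 * G_average h (t, \<omega>) + R_average h (t, \<omega>) + 2 * elastic_average h (t, \<omega>))" .
    qed
  qed
qed

text \<open>
The previous inequality is multiplied by the weight and integrated in \<open>t\<close>. On the left, the
difference of the energies at \<open>t\<close> and \<open>t - h\<close> leaves at least the fraction \<open>1 - exp (- c * h)\<close> of the weighted energy;
on the right, the lags \<open>\<theta> \<in> [0,h)\<close> are integrated last.
\<close>

lemma weighted_energy_increment:
  assumes h: "0 < h" and c: "0 \<le> c"
  shows "(1 - exp (- c * h)) * (\<integral>z. weight c z * energy z \<partial>TM) \<le>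
    (\<integral>\<theta>. indicator {0..<h} \<theta> * (- 2 * (\<integral>z. weight c z * G (shift \<theta> z) (y z) \<partial>TM)
       + (\<integral>z. weight c z * R z \<partial>TM) + 2 * (\<integral>z. weight c z * elastic_lag \<theta> z \<partial>TM)) \<partial>lborel)"
proof -
  interpret P: pair_sigma_finite "lborel :: real measure" M by (rule pair_sigma_finite_TM)
  have h0: "0 \<le> h" using h by simp
  note g = G_shift_average[OF c h0] and r = R_shift_average[OF c h0] and b = elastic_lag_shift_average[OF c h0]
  have nn: "AE z in TM. fst z \<in> {0..T} \<longrightarrow> 0 \<le> energy z" using energy_nonneg by simp
  note es = weight_shift_integral_le[OF energy_integrable nn energy_outside c h0]
  have RR: "(\<integral>z. weight c z * R (shift \<theta> z) \<partial>TM) \<le> (\<integral>z. weight c z * R z \<partial>TM)" if "0 \<le> \<theta>" for \<theta>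
  proof -
    note w = weight_shift_integral_le[OF R_integrable R_nonneg R_outside c that]
    have "0 \<le> (\<integral>z. weight c z * R z \<partial>TM)"
      by (rule integral_nonneg_AE)
         (use R_nonneg in eventually_elim, use weight_bounds[OF c] in \<open>auto simp: weight_def indicator_def\<close>)
    then have "exp (- c * \<theta>) * (\<integral>z. weight c z * R z \<partial>TM) \<le> 1 * (\<integral>z. weight c z * R z \<partial>TM)"
      using c that by (intro mult_right_mono) auto
    then show ?thesis using w(1) by simp
  qed
  have "(1 - exp (- c * h)) * (\<integral>z. weight c z * energy z \<partial>TM) \<le> (\<integral>z. weight c z * energy z \<partial>TM) - (\<integral>z. weight c z * energy (shift h z) \<partial>TM)"
    using es(1) by (simp add: algebra_simps)
  also have "\<dots> = (\<integral>z. weight c z * (energy z - energy (shift h z)) \<partial>TM)"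
    using es(2,3) by (simp add: right_diff_distrib)
  also have "\<dots> \<le> (\<integral>z. weight c z * (- 2 * G_average h z + R_average h z + 2 * elastic_average h z) \<partial>TM)"
  proof -
    let ?f = "\<lambda>t \<omega>. weight c (t, \<omega>) * (energy (t, \<omega>) - energy (shift h (t, \<omega>)))"
    let ?g = "\<lambda>t \<omega>. weight c (t, \<omega>) * (- 2 * G_average h (t, \<omega>) + R_average h (t, \<omega>) + 2 * elastic_average h (t, \<omega>))"
    have fi: "integrable TM (\<lambda>(t, \<omega>). ?f t \<omega>)"
      using es(2,3) by (simp add: case_prod_beta' right_diff_distrib)
    have gi: "integrable TM (\<lambda>(t, \<omega>). ?g t \<omega>)"
    proof -
      have "integrable TM (\<lambda>z. - 2 * (weight c z * G_average h z) + weight c z * R_average h z + 2 * (weight c z * elastic_average h z))"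
        using g(2) r(2) b(2) by simp
      then show ?thesis by (simp add: case_prod_beta' algebra_simps)
    qed
    have "(\<integral>t. (\<integral>\<omega>. ?f t \<omega> \<partial>M) \<partial>lborel) \<le> (\<integral>t. (\<integral>\<omega>. ?g t \<omega> \<partial>M) \<partial>lborel)"
    proof (rule integral_mono_AE[OF P.integrable_fst[OF fi] P.integrable_fst[OF gi]])
      have ie: "AE t in lborel. integrable M (\<lambda>\<omega>. energy (t, \<omega>))"
        by (rule P.AE_integrable_fst) (use energy_integrable in \<open>simp add: case_prod_beta'\<close>)
      have ie': "AE t in lborel. integrable M (\<lambda>\<omega>. energy (shift h (t, \<omega>)))"
        by (rule P.AE_integrable_fst) (use integrable_TM_shift[OF energy_integrable, of h] in \<open>simp add: case_prod_beta'\<close>)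
      show "AE t in lborel. (\<integral>\<omega>. ?f t \<omega> \<partial>M) \<le> (\<integral>\<omega>. ?g t \<omega> \<partial>M)"
        using energy_increment_average[OF h] ie ie'
      proof eventually_elim
        case (elim t)
        show ?case
        proof (cases "t \<in> {0..T}")
          case True
          have w: "weight c (t, \<omega>) = exp (- c * t)" for \<omega> using True by (simp add: weight_def)
          show ?thesis unfolding w
            using elim True by (simp add: mult_left_mono)
        next
          case False
          then have w: "weight c (t, \<omega>) = 0" for \<omega> by (simp add: weight_def)
          show ?thesis unfolding w by simp
        qed
      qed
    qed
    then show ?thesis using P.integral_fst[OF fi] P.integral_fst[OF gi] by (simp add: case_prod_beta')
  qed
  also have "\<dots> = - 2 * (\<integral>z. weight c z * G_average h z \<partial>TM) + (\<integral>z. weight c z * R_average h z \<partial>TM) + 2 * (\<integral>z. weight c z * elastic_average h z \<partial>TM)"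
  proof -
    have "(\<integral>z. weight c z * (- 2 * G_average h z + R_average h z + 2 * elastic_average h z) \<partial>TM) =
        (\<integral>z. - 2 * (weight c z * G_average h z) + weight c z * R_average h z + 2 * (weight c z * elastic_average h z) \<partial>TM)"
      by (intro Bochner_Integration.integral_cong) (auto simp: algebra_simps)
    then show ?thesis using g(2) r(2) b(2) by simp
  qed
  also have "\<dots> = (\<integral>\<theta>. - 2 * (indicator {0..<h} \<theta> * (\<integral>z. weight c z * G (shift \<theta> z) (y z) \<partial>TM))
       + indicator {0..<h} \<theta> * (\<integral>z. weight c z * R (shift \<theta> z) \<partial>TM)
       + 2 * (indicator {0..<h} \<theta> * (\<integral>z. weight c z * elastic_lag \<theta> z \<partial>TM)) \<partial>lborel)"
    unfolding g(4) r(4) b(4) using g(3) r(3) b(3) by simp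
  also have "\<dots> \<le> (\<integral>\<theta>. indicator {0..<h} \<theta> * (- 2 * (\<integral>z. weight c z * G (shift \<theta> z) (y z) \<partial>TM)
       + (\<integral>z. weight c z * R z \<partial>TM) + 2 * (\<integral>z. weight c z * elastic_lag \<theta> z \<partial>TM)) \<partial>lborel)"
  proof (rule integral_mono)
    have "integrable lborel (\<lambda>\<theta>. indicator {0..<h} \<theta> * (\<integral>z. weight c z * R z \<partial>TM))"
      using h by (intro integrable_mult_left integrable_real_indicator) auto
    then have "integrable lborel (\<lambda>\<theta>. - 2 * (indicator {0..<h} \<theta> * (\<integral>z. weight c z * G (shift \<theta> z) (y z) \<partial>TM))
       + indicator {0..<h} \<theta> * (\<integral>z. weight c z * R z \<partial>TM)
       + 2 * (indicator {0..<h} \<theta> * (\<integral>z. weight c z * elastic_lag \<theta> z \<partial>TM)))"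
      using g(3) b(3) by simp
    then show "integrable lborel (\<lambda>\<theta>. indicator {0..<h} \<theta> * (- 2 * (\<integral>z. weight c z * G (shift \<theta> z) (y z) \<partial>TM)
       + (\<integral>z. weight c z * R z \<partial>TM) + 2 * (\<integral>z. weight c z * elastic_lag \<theta> z \<partial>TM)))"
      by (simp add: algebra_simps)
  qed (use g(3) r(3) b(3) RR in \<open>auto simp: indicator_def\<close>)
  finally show ?thesis .
qed

text \<open>
Divide by \<open>h\<close> and let \<open>h\<close> tend to \<open>0\<close>: the lagged pairings converge to the pairings at equal times.
The bound \<open>exp (- c * h) \<le> 1 / (1 + c * h)\<close> takes the place of the derivative of the exponential function.
\<close>

lemma limit_energy_inequality:
  assumes c: "0 \<le> c"
  shows "c * (\<integral>z. weight c z * energy z \<partial>TM) \<le>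
    - 2 * (\<integral>z. weight c z * G z (y z) \<partial>TM) + (\<integral>z. weight c z * R z \<partial>TM) + 2 * (\<integral>z. weight c z * elastic_power z \<partial>TM)"
    (is "c * ?\<Psi> \<le> ?L")
proof (rule field_le_epsilon)
  fix \<epsilon> :: real assume "\<epsilon> > 0"
  define k where "k \<theta> = - 2 * (\<integral>z. weight c z * G (shift \<theta> z) (y z) \<partial>TM)
       + (\<integral>z. weight c z * R z \<partial>TM) + 2 * (\<integral>z. weight c z * elastic_lag \<theta> z \<partial>TM)" for \<theta>
  have k0: "k 0 = ?L" by (simp add: k_def elastic_lag_def elastic_power_def shift_0)
  have "(k \<longlongrightarrow> k 0) (at 0)"
    unfolding tendsto_at_iff_sequentially comp_def
  proof (intro allI impI)
    fix h :: "nat \<Rightarrow> real" assume h: "h \<longlonglongrightarrow> 0"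
    show "(\<lambda>i. k (h i)) \<longlonglongrightarrow> k 0"
      unfolding k0 unfolding k_def by (intro tendsto_intros G_shift_tendsto[OF c h] elastic_lag_tendsto[OF c h])
  qed
  then have "\<forall>\<^sub>F \<theta> in at 0. k \<theta> < k 0 + \<epsilon>" using \<open>\<epsilon> > 0\<close> by (intro order_tendstoD) auto
  then obtain d where d: "0 < d" "\<And>\<theta>. \<theta> \<noteq> 0 \<Longrightarrow> \<bar>\<theta>\<bar> < d \<Longrightarrow> k \<theta> < k 0 + \<epsilon>"
    by (auto simp: eventually_at dist_real_def)
  have kd: "k \<theta> \<le> k 0 + \<epsilon>" if "0 \<le> \<theta>" "\<theta> < d" for \<theta>
    using d(2)[of \<theta>] that \<open>\<epsilon> > 0\<close> by (cases "\<theta> = 0") (auto intro: less_imp_le)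
  have \<Psi>0: "0 \<le> ?\<Psi>" using weight_bounds[OF c] energy_nonneg by (intro integral_nonneg_AE AE_I2) auto
  have step: "c * ?\<Psi> \<le> (1 + c * h) * (k 0 + \<epsilon>)" if h: "0 < h" "h < d" for h
  proof -
    have "(1 - exp (- c * h)) * ?\<Psi> \<le> (\<integral>\<theta>. indicator {0..<h} \<theta> * k \<theta> \<partial>lborel)"
      unfolding k_def by (rule weighted_energy_increment[OF h(1) c])
    also have "\<dots> \<le> (\<integral>\<theta>. indicator {0..<h} \<theta> * (k 0 + \<epsilon>) \<partial>lborel)"
    proof (rule integral_mono)
      have i0: "integrable lborel (\<lambda>\<theta>. indicator {0..<h} \<theta> * x)" for x :: real
        using h by (intro integrable_mult_left integrable_real_indicator) auto
      show "integrable lborel (\<lambda>\<theta>. indicator {0..<h} \<theta> * (k 0 + \<epsilon>))" by (rule i0)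
      have "integrable lborel (\<lambda>\<theta>. - 2 * (indicator {0..<h} \<theta> * (\<integral>z. weight c z * G (shift \<theta> z) (y z) \<partial>TM))
       + indicator {0..<h} \<theta> * (\<integral>z. weight c z * R z \<partial>TM)
       + 2 * (indicator {0..<h} \<theta> * (\<integral>z. weight c z * elastic_lag \<theta> z \<partial>TM)))"
        using G_shift_average(3)[of c h] elastic_lag_shift_average(3)[of c h] i0 h c by simp
      then show "integrable lborel (\<lambda>\<theta>. indicator {0..<h} \<theta> * k \<theta>)" by (simp add: k_def algebra_simps)
      show "indicator {0..<h} \<theta> * k \<theta> \<le> indicator {0..<h} \<theta> * (k 0 + \<epsilon>)" for \<theta>
        using kd[of \<theta>] h by (auto simp: indicator_def)
    qed
    also have "\<dots> = h * (k 0 + \<epsilon>)" using h by simp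
    finally have a: "(1 - exp (- c * h)) * ?\<Psi> \<le> h * (k 0 + \<epsilon>)" .
    have ch: "0 < 1 + c * h" using c h by (simp add: add_pos_nonneg)
    have "exp (- c * h) \<le> 1 / (1 + c * h)"
      using exp_ge_add_one_self[of "c * h"] ch by (simp add: exp_minus inverse_eq_divide frac_le)
    then have "c * h \<le> (1 + c * h) * (1 - exp (- c * h))" using ch by (simp add: field_simps)
    then have "c * h * ?\<Psi> \<le> (1 + c * h) * (1 - exp (- c * h)) * ?\<Psi>" using \<Psi>0 by (rule mult_right_mono)
    also have "\<dots> \<le> (1 + c * h) * (h * (k 0 + \<epsilon>))"
      using mult_left_mono[OF a, of "1 + c * h"] ch by (simp add: mult.assoc)
    finally have "h * (c * ?\<Psi>) \<le> h * ((1 + c * h) * (k 0 + \<epsilon>))" by (simp add: mult_ac)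
    then show ?thesis using h by simp
  qed
  have "((\<lambda>h. (1 + c * h) * (k 0 + \<epsilon>)) \<longlongrightarrow> (1 + c * 0) * (k 0 + \<epsilon>)) (at_right 0)"
    by (intro tendsto_intros)
  then have "c * ?\<Psi> \<le> (1 + c * 0) * (k 0 + \<epsilon>)"
    by (rule tendsto_lowerbound) (use step d(1) in \<open>auto simp: eventually_at_right_field\<close>)
  then show "c * ?\<Psi> \<le> ?L + \<epsilon>" by (simp add: k0)
qed

text \<open>
In the limit inequality \<open>elastic_power\<close> cancels against the \<open>B\<close>-part of \<open>G\<close>, and the \<open>A\<close>-part of \<open>G\<close> against the
one of \<open>R\<close>. What remains on the right is at most \<open>2 * lA + 2 * lB\<close> times the weighted energy, which is
smaller than the left side if \<open>c\<close> exceeds that number. This is Gronwall's lemma in integrated form.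
\<close>

lemma y_zero: "AE z in TM. y z = 0"
proof -
  \<comment> \<open>Any \<open>c\<close> larger than \<open>2 * lA + 2 * lB\<close> works.\<close>
  define c where "c = 2 * lA + 2 * lB + 1"
  have c: "0 \<le> c" using const by (simp add: c_def)
  have w: "integrable TM (\<lambda>z. weight c z * f z)" if "integrable TM f" for f :: "real \<times> 'w \<Rightarrow> real"
  proof (rule Bochner_Integration.integrable_bound[OF that])
    have [measurable]: "f \<in> borel_measurable TM" using that by (rule borel_measurable_integrable)
    show "(\<lambda>z. weight c z * f z) \<in> borel_measurable TM" by measurable
    show "AE z in TM. norm (weight c z * f z) \<le> norm (f z)"
      using weight_bounds[OF c] by (intro AE_I2) (auto simp: abs_mult mult_left_le_one_le)
  qed
  let ?\<Psi> = "\<integral>z. weight c z * energy z \<partial>TM"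
  have "c * ?\<Psi> \<le> - 2 * (\<integral>z. weight c z * G z (y z) \<partial>TM) + (\<integral>z. weight c z * R z \<partial>TM) + 2 * (\<integral>z. weight c z * elastic_power z \<partial>TM)"
    by (rule limit_energy_inequality[OF c])
  also have "\<dots> = (\<integral>z. - 2 * (weight c z * G z (y z)) + weight c z * R z + 2 * (weight c z * elastic_power z) \<partial>TM)"
    using w[OF Gy_integrable] w[OF R_integrable] w[OF elastic_power_integrable] by simp
  also have "\<dots> = (\<integral>z. weight c z * (2 * lA * (norm (e (y z)))\<^sup>2 + 2 * lB * elastic z) \<partial>TM)"
    by (intro Bochner_Integration.integral_cong) (auto simp: R_def algebra_simps)
  also have "\<dots> \<le> (\<integral>z. (2 * lA + 2 * lB) * (weight c z * energy z) \<partial>TM)"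
  proof (rule integral_mono)
    show "integrable TM (\<lambda>z. weight c z * (2 * lA * (norm (e (y z)))\<^sup>2 + 2 * lB * elastic z))"
      using ey_sq_integrable elastic_integrable by (intro w) simp
    show "integrable TM (\<lambda>z. (2 * lA + 2 * lB) * (weight c z * energy z))" using w[OF energy_integrable] by simp
    fix z
    have "0 \<le> elastic z" using B_pos by (simp add: elastic_def)
    then have "2 * lA * (norm (e (y z)))\<^sup>2 + 2 * lB * elastic z \<le> (2 * lA + 2 * lB) * energy z"
      using const by (simp add: energy_def algebra_simps)
    from mult_left_mono[OF this weight_bounds(1)[OF c, of z]]
    show "weight c z * (2 * lA * (norm (e (y z)))\<^sup>2 + 2 * lB * elastic z) \<le> (2 * lA + 2 * lB) * (weight c z * energy z)"
      by (simp add: mult_ac)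
  qed
  also have "\<dots> = (2 * lA + 2 * lB) * ?\<Psi>" by simp
  finally have "?\<Psi> \<le> 0" by (simp add: c_def algebra_simps)
  moreover have nn: "0 \<le> weight c z * energy z" for z using weight_bounds[OF c] energy_nonneg by simp
  then have "0 \<le> ?\<Psi>" by simp
  ultimately have "?\<Psi> = 0" by simp
  then have "AE z in TM. weight c z * energy z = 0"
    using integral_nonneg_eq_0_iff_AE[OF w[OF energy_integrable]] nn by simp
  then show ?thesis
  proof eventually_elim
    case (elim z)
    show ?case
    proof (cases "fst z \<in> {0..T}")
      case True
      then have "energy z = 0" using elim by (simp add: weight_def)
      then have "(norm (e (y z)))\<^sup>2 = 0"
        using B_pos[of "U z" "snd z"] unfolding energy_def elastic_def by (simp add: add_nonneg_eq_0_iff)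
      then have "e (y z) = e 0" by (simp add: blinfun.zero_right)
      then show ?thesis by (rule injD[OF e_inj])
    next
      case False then show ?thesis using y_outside[of "fst z" "snd z"] by simp
    qed
  qed
qed

end

section \<open>Null sets, completions and extension in time\<close>

lemma measurable_completion_AE:
  fixes f g :: "'a \<Rightarrow> 'b::topological_space"
  assumes g: "g \<in> borel_measurable N" and eq: "AE x in N. f x = g x"
  shows "f \<in> borel_measurable (completion N)"
proof -
  obtain K where K: "K \<in> null_sets N" "{x \<in> space N. f x \<noteq> g x} \<subseteq> K"
    using eq by (auto elim!: AE_E simp: null_sets_def)
  show ?thesis
  proof (rule measurableI)
    fix S :: "'b set" assume "S \<in> sets borel"
    then have "g -` S \<inter> space N \<in> sets N" using g by (rule measurable_sets[rotated])
    then have S: "g -` S \<inter> space N - K \<in> sets N" using K(1) by auto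
    have "f -` S \<inter> space N = (g -` S \<inter> space N - K) \<union> (f -` S \<inter> space N \<inter> K)" using K(2) by auto
    from sets_completionI[OF this _ K(1) S]
    show "f -` S \<inter> space (completion N) \<in> sets (completion N)" by simp
  qed simp
qed

lemma integral_lebesgue_eq_lborel:
  fixes f g :: "real \<Rightarrow> 'b::{banach, second_countable_topology}"
  assumes g: "g \<in> borel_measurable lborel" and eq: "AE x in lborel. f x = g x"
  shows "integral\<^sup>L lebesgue f = integral\<^sup>L lborel g"
proof -
  have "integral\<^sup>L lebesgue f = integral\<^sup>L lebesgue g"
    by (intro integral_cong_AE measurable_completion_AE[OF g eq] measurable_completion[OF g] AE_completion eq)
  then show ?thesis using g by (simp add: integral_completion)
qed

lemma continuous_zero_on_dense:
  fixes f :: "'a::topological_space \<Rightarrow> real"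
  assumes "continuous_on UNIV f" "\<And>x. x \<in> S \<Longrightarrow> f x = 0" "closure S = UNIV"
  shows "f x = 0"
proof -
  have "closed {x. f x = 0}" by (intro closed_Collect_eq assms(1) continuous_on_const)
  then have "closure S \<subseteq> {x. f x = 0}" using assms(2) by (intro closure_minimal) auto
  then show ?thesis using assms(3) by auto
qed

lemma continuous_AE_zero:
  fixes X :: "real \<Rightarrow> 'b::real_normed_vector"
  assumes c: "continuous_on {0..T} X" and T: "0 < T" and ae: "AE t in lborel. t \<in> {0..T} \<longrightarrow> X t = 0" and t: "t \<in> {0..T}"
  shows "X t = 0"
proof (rule ccontr)
  assume "X t \<noteq> 0"
  then have "norm (X t) > 0" by simp
  then obtain d where d: "d > 0" "\<And>s. s \<in> {0..T} \<Longrightarrow> dist s t < d \<Longrightarrow> dist (X s) (X t) < norm (X t)"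
    using c t unfolding continuous_on_iff by metis
  define a where "a = max 0 (t - d)"
  define b where "b = min T (t + d)"
  have ab: "a < b" using t d T by (auto simp: a_def b_def)
  obtain K where K: "K \<in> null_sets lborel" "{s \<in> space lborel. \<not> (s \<in> {0..T} \<longrightarrow> X s = 0)} \<subseteq> K"
    using ae by (auto elim!: AE_E simp: null_sets_def)
  have "{a<..<b} \<subseteq> K"
  proof
    fix s assume s: "s \<in> {a<..<b}"
    then have s': "s \<in> {0..T}" "dist s t < d" by (auto simp: a_def b_def dist_real_def)
    then have "X s \<noteq> 0" using d(2)[OF s'] by auto
    then show "s \<in> K" using s' K(2) by auto
  qed
  then have "{a<..<b} \<in> null_sets lborel" using K(1) by (rule null_sets_subset[rotated 2]) simp
  then show False using ab by (simp add: null_sets_def)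
qed

lemma ell2_diff:
  fixes g h :: "nat \<Rightarrow> 'h::real_inner"
  assumes "g \<in> ell2" "h \<in> ell2"
  shows "(\<lambda>j. g j - h j) \<in> ell2"
  unfolding ell2_def
proof (rule CollectI, rule summable_comparison_test')
  show "summable (\<lambda>j. 2 * (norm (g j))\<^sup>2 + 2 * (norm (h j))\<^sup>2)"
    using assms by (auto simp: ell2_def intro!: summable_add summable_mult)
  fix j
  have "norm (g j - h j) \<le> norm (g j) + norm (h j)" by (rule norm_triangle_ineq4)
  then have "(norm (g j - h j))\<^sup>2 \<le> (norm (g j) + norm (h j))\<^sup>2" by (intro power_mono) auto
  also have "\<dots> \<le> 2 * (norm (g j))\<^sup>2 + 2 * (norm (h j))\<^sup>2"
    using sum_squares_bound[of "norm (g j)" "norm (h j)"] by (simp add: power2_sum)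
  finally show "norm ((norm (g j - h j))\<^sup>2) \<le> 2 * (norm (g j))\<^sup>2 + 2 * (norm (h j))\<^sup>2" by simp
qed

text \<open>
Properties that hold almost surely define events because the probability space is complete.
\<close>

lemma (in complete_measure) AE_measurable:
  assumes "AE x in M. P x"
  shows "{x \<in> space M. P x} \<in> sets M"
proof -
  obtain N where N: "N \<in> null_sets M" "{x \<in> space M. \<not> P x} \<subseteq> N"
    using assms by (auto elim!: AE_E simp: null_sets_def)
  then have "{x \<in> space M. \<not> P x} \<in> sets M" using complete[OF N(2,1)] by auto
  then have "space M - {x \<in> space M. \<not> P x} \<in> sets M" by auto
  moreover have "space M - {x \<in> space M. \<not> P x} = {x \<in> space M. P x}" by auto
  ultimately show ?thesis by simp
qed

context wiener_basis begin

definition extend :: "(real \<times> 'w \<Rightarrow> 'x::zero) \<Rightarrow> real \<times> 'w \<Rightarrow> 'x" where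
  "extend f z = (if fst z \<in> {0..T} then f z else 0)"

lemma extend_measurable:
  fixes f :: "real \<times> 'w \<Rightarrow> 'x::{zero, topological_space}"
  assumes "f \<in> borel_measurable (time_prob M T)"
  shows "extend f \<in> borel_measurable TM"
proof -
  let ?k = "\<lambda>z::real \<times> 'a. (max 0 (min T (fst z)), snd z)"
  have "(\<lambda>t. max 0 (min T t)) \<in> lborel \<rightarrow>\<^sub>M restrict_space lborel {0..T}"
    using T_pos by (intro measurable_restrict_space2) auto
  then have "?k \<in> TM \<rightarrow>\<^sub>M time_prob M T"
    unfolding time_prob_def by (intro measurable_Pair measurable_compose[OF measurable_fst] measurable_snd)
  from measurable_compose[OF this assms] have "(\<lambda>z. f (?k z)) \<in> borel_measurable TM" .
  moreover have "{z \<in> space TM. fst z \<in> {0..T}} \<in> sets TM" by measurable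
  ultimately have "(\<lambda>z. if fst z \<in> {0..T} then f (?k z) else 0) \<in> borel_measurable TM"
    by (intro measurable_If) auto
  moreover have "(\<lambda>z. if fst z \<in> {0..T} then f (?k z) else 0) = extend f"
    by (auto simp: extend_def fun_eq_iff max_def min_def)
  ultimately show ?thesis by simp
qed

lemma nn_integral_time_prob:
  assumes f: "f \<in> borel_measurable (time_prob M T)"
  shows "(\<integral>\<^sup>+z. f z \<partial>time_prob M T) = (\<integral>\<^sup>+z. extend f z \<partial>TM)"
proof -
  have "(\<integral>\<^sup>+z. f z \<partial>time_prob M T) = (\<integral>\<^sup>+t. \<integral>\<^sup>+\<omega>. f (t, \<omega>) \<partial>M \<partial>restrict_space lborel {0..T})"
    using nn_integral_fst[of f "restrict_space lborel {0..T}"] f by (simp add: time_prob_def)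
  also have "\<dots> = (\<integral>\<^sup>+t. (\<integral>\<^sup>+\<omega>. f (t, \<omega>) \<partial>M) * indicator {0..T} t \<partial>lborel)"
    by (rule nn_integral_restrict_space) auto
  also have "\<dots> = (\<integral>\<^sup>+t. \<integral>\<^sup>+\<omega>. extend f (t, \<omega>) \<partial>M \<partial>lborel)"
    by (intro nn_integral_cong) (auto simp: extend_def indicator_def)
  also have "\<dots> = (\<integral>\<^sup>+z. extend f z \<partial>TM)"
    by (rule nn_integral_fst) (rule extend_measurable[OF f])
  finally show ?thesis .
qed

lemma AE_time_prob:
  assumes "AE z in time_prob M T. P z"
  shows "AE z in TM. fst z \<in> {0..T} \<longrightarrow> P z"
proof -
  obtain K where K: "K \<in> null_sets (time_prob M T)" "{z \<in> space (time_prob M T). \<not> P z} \<subseteq> K"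
    using assms by (auto elim!: AE_E simp: null_sets_def)
  have m: "(indicator K :: _ \<Rightarrow> ennreal) \<in> borel_measurable (time_prob M T)" using K by auto
  have "(\<integral>\<^sup>+z. extend (indicator K :: _ \<Rightarrow> ennreal) z \<partial>TM) = 0"
    using nn_integral_indicator[OF null_setsD2[OF K(1)]] null_setsD1[OF K(1)] nn_integral_time_prob[OF m] by simp
  then have "AE z in TM. extend (indicator K :: _ \<Rightarrow> ennreal) z = 0"
    by (subst (asm) nn_integral_0_iff_AE) (use extend_measurable[OF m] in auto)
  then show ?thesis using AE_space
  proof eventually_elim
    case (elim z)
    show ?case
    proof
      assume z: "fst z \<in> {0..T}"
      then have "z \<in> space (time_prob M T)"
        using elim(2) by (auto simp: time_prob_def space_pair_measure space_restrict_space)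
      moreover have "z \<notin> K" using elim(1) z by (auto simp: extend_def indicator_def split: if_splits)
      ultimately show "P z" using K(2) by auto
    qed
  qed
qed

text \<open>
Fubini's theorem for null sets, in the order in which the path is fixed first.
\<close>

lemma AE_TM_path:
  assumes "AE z in TM. P z"
  shows "AE \<omega> in M. AE t in lborel. P (t, \<omega>)"
proof -
  interpret P: pair_sigma_finite "lborel :: real measure" M by (rule pair_sigma_finite_TM)
  obtain K where K: "K \<in> null_sets TM" "{z \<in> space TM. \<not> P z} \<subseteq> K"
    using assms by (auto elim!: AE_E simp: null_sets_def)
  have "K \<in> sets TM" using K by auto
  moreover have "{z \<in> space TM. (fst z, snd z) \<notin> K} = space TM - K" by auto
  ultimately have s: "{z \<in> space TM. (fst z, snd z) \<notin> K} \<in> sets TM" by (simp only: sets.compl_sets)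
  have "AE z in TM. (fst z, snd z) \<notin> K" using AE_not_in[OF K(1)] by simp
  then have "AE t in lborel. AE \<omega> in M. (t, \<omega>) \<notin> K"
    using P.AE_pair[of "\<lambda>z. z \<notin> K"] by simp
  then have "AE \<omega> in M. AE t in lborel. (t, \<omega>) \<notin> K"
    by (subst (asm) P.AE_commute[of "\<lambda>t \<omega>. (t, \<omega>) \<notin> K"]) (use s in auto)
  then show ?thesis using AE_space
  proof eventually_elim
    case (elim \<omega>)
    show ?case using elim(1) by eventually_elim (use elim(2) K(2) in \<open>auto simp: space_pair_measure\<close>)
  qed
qed

lemma AE_TM_snd:
  assumes "AE \<omega> in M. Q \<omega>"
  shows "AE z in TM. Q (snd z)"
proof -
  interpret P: pair_sigma_finite "lborel :: real measure" M by (rule pair_sigma_finite_TM)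
  obtain K where K: "K \<in> null_sets M" "{\<omega> \<in> space M. \<not> Q \<omega>} \<subseteq> K"
    using assms by (auto elim!: AE_E simp: null_sets_def)
  have [measurable]: "K \<in> sets M" using K by auto
  have "{z \<in> space TM. snd z \<notin> K} = space TM - (snd -` K \<inter> space TM)" by auto
  then have s: "{z \<in> space TM. snd z \<notin> K} \<in> sets TM"
    using measurable_sets[OF measurable_snd[of "lborel :: real measure" M] \<open>K \<in> sets M\<close>] by (simp only: sets.compl_sets)
  have "AE z in TM. snd z \<notin> K"
    by (rule P.AE_pair_measure[OF s]) (use AE_not_in[OF K(1)] in auto)
  then show ?thesis using AE_space
    by eventually_elim (use K(2) in \<open>auto simp: space_pair_measure\<close>)
qed

end

section \<open>From two solutions to the energy setting\<close>

text \<open>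
Two solutions together with the constants and an almost sure set \<open>Good\<close> on which the assumptions on the
operators hold, with the progressive versions \<open>Y1\<close>, \<open>Y2\<close> of the velocities and with the versions
\<open>J1\<close>, \<open>J2\<close> of the stochastic integrals. The coefficient \<open>C\<close> appears only through its inequality with \<open>A\<close> and
inside the stochastic integrals.
\<close>

locale solution_pair = wiener_basis M F T W
  for M :: "'w measure" and F T W +
  fixes p cA lA lB cB :: real
    and eA :: "'va::{banach, second_countable_topology} \<Rightarrow>\<^sub>L 'vb::{banach, second_countable_topology}"
    and eB :: "'vb \<Rightarrow>\<^sub>L 'h::{real_inner, complete_space, second_countable_topology}"
    and A :: "'va \<Rightarrow> 'w \<Rightarrow> 'va \<Rightarrow>\<^sub>L real"
    and B :: "'vb \<Rightarrow> 'w \<Rightarrow> 'vb \<Rightarrow>\<^sub>L real"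
    and C :: "'vb \<Rightarrow> 'va \<Rightarrow> 'w \<Rightarrow> nat \<Rightarrow> 'h"
    and u0 :: "'w \<Rightarrow> 'vb" and v0 :: "'w \<Rightarrow> 'h" and f :: "real \<Rightarrow> 'w \<Rightarrow> 'va \<Rightarrow>\<^sub>L real"
    and v1 v2 Y1 Y2 :: "real \<Rightarrow> 'w \<Rightarrow> 'va" and v1t v2t :: "real \<Rightarrow> 'w \<Rightarrow> 'h"
    and J1 J2 :: "'va \<Rightarrow> real \<Rightarrow> 'w \<Rightarrow> real" and Good :: "'w set"
  assumes p: "2 \<le> p"
    and const: "0 \<le> lA" "0 \<le> lB" "0 \<le> cA" "0 \<le> cB"
    and emb: "dense_embedding (blinfun_apply eA)" "dense_embedding (blinfun_apply eB)"
    and A_weak: "weakly_measurable (F 0) A" and B_weak: "weakly_measurable (F 0) B"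
    and C_ell2: "\<And>u w \<omega>. \<omega> \<in> space M \<Longrightarrow> C u w \<omega> \<in> ell2"
    and Good: "Good \<in> sets M" "AE \<omega> in M. \<omega> \<in> Good"
    and A_hemi: "\<And>\<omega>. \<omega> \<in> Good \<Longrightarrow> hemicontinuous (\<lambda>w. A w \<omega>)"
    and A_growth: "\<And>\<omega> w. \<omega> \<in> Good \<Longrightarrow> norm (A w \<omega>) \<le> cA * (1 + norm w) powr (p - 1)"
    and A_C: "\<And>\<omega> w z u v. \<omega> \<in> Good \<Longrightarrow> blinfun_apply (A w \<omega> - A z \<omega>) (w - z) + lA * (norm (eB (eA (w - z))))\<^sup>2
          \<ge> 1/2 * (ell2_norm (\<lambda>j. C u w \<omega> j - C v z \<omega> j))\<^sup>2 - lB * (B_norm B \<omega> (u - v))\<^sup>2"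
    and B_linear: "\<And>\<omega>. \<omega> \<in> Good \<Longrightarrow> linear (\<lambda>w. B w \<omega>)"
    and B_sym: "\<And>\<omega> w z. \<omega> \<in> Good \<Longrightarrow> blinfun_apply (B w \<omega>) z = blinfun_apply (B z \<omega>) w"
    and B_pos: "\<And>\<omega> w. \<omega> \<in> Good \<Longrightarrow> 0 \<le> blinfun_apply (B w \<omega>) w"
    and B_bound: "\<And>\<omega> w. \<omega> \<in> Good \<Longrightarrow> norm (B w \<omega>) \<le> cB * norm w"
    and Y1: "progressive F T Y1" "versions M T v1 Y1" "(\<integral>\<^sup>+ (s, \<omega>). ennreal (norm (Y1 s \<omega>) powr p) \<partial>time_prob M T) < \<infinity>"
    and Y2: "progressive F T Y2" "versions M T v2 Y2" "(\<integral>\<^sup>+ (s, \<omega>). ennreal (norm (Y2 s \<omega>) powr p) \<partial>time_prob M T) < \<infinity>"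
    and v1t: "continuous_process M T v1t" "versions M T v1t (\<lambda>t \<omega>. eB (eA (v1 t \<omega>)))"
    and v2t: "continuous_process M T v2t" "versions M T v2t (\<lambda>t \<omega>. eB (eA (v2 t \<omega>)))"
    and J1: "\<And>z. ito_series M F T W (\<lambda>j s \<omega>. inner (eB (eA z)) (C (u_of eA u0 v1 s \<omega>) (v1 s \<omega>) \<omega> j)) (J1 z)"
    and J2: "\<And>z. ito_series M F T W (\<lambda>j s \<omega>. inner (eB (eA z)) (C (u_of eA u0 v2 s \<omega>) (v2 s \<omega>) \<omega> j)) (J2 z)"
    and eq1: "AE \<omega> in M. \<forall>t\<in>{0..T}. \<forall>z.
           inner (v1t t \<omega>) (eB (eA z))
             + (LINT s:{0..t}|lebesgue. blinfun_apply (A (v1 s \<omega>) \<omega>) z + blinfun_apply (B (u_of eA u0 v1 s \<omega>) \<omega>) (eA z))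
           = inner (v0 \<omega>) (eB (eA z)) + (LINT s:{0..t}|lebesgue. blinfun_apply (f s \<omega>) z) + J1 z t \<omega>"
    and eq2: "AE \<omega> in M. \<forall>t\<in>{0..T}. \<forall>z.
           inner (v2t t \<omega>) (eB (eA z))
             + (LINT s:{0..t}|lebesgue. blinfun_apply (A (v2 s \<omega>) \<omega>) z + blinfun_apply (B (u_of eA u0 v2 s \<omega>) \<omega>) (eA z))
           = inner (v0 \<omega>) (eB (eA z)) + (LINT s:{0..t}|lebesgue. blinfun_apply (f s \<omega>) z) + J2 z t \<omega>"
begin

definition A' :: "'va \<Rightarrow> 'w \<Rightarrow> 'va \<Rightarrow>\<^sub>L real" where "A' w \<omega> = (if \<omega> \<in> Good then A w \<omega> else 0)"
definition B' :: "'vb \<Rightarrow> 'w \<Rightarrow> 'vb \<Rightarrow>\<^sub>L real" where "B' w \<omega> = (if \<omega> \<in> Good then B w \<omega> else 0)"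
definition y1 :: "real \<times> 'w \<Rightarrow> 'va" where "y1 = extend (\<lambda>(s, \<omega>). Y1 s \<omega>)"
definition y2 :: "real \<times> 'w \<Rightarrow> 'va" where "y2 = extend (\<lambda>(s, \<omega>). Y2 s \<omega>)"

lemma inj_embeddings: "inj (blinfun_apply eA)" "inj (blinfun_apply eB)"
  using emb by (auto simp: dense_embedding_def)

lemma operators:
  assumes "x1 \<in> borel_measurable TM" "x2 \<in> borel_measurable TM"
    and "\<And>t \<omega>. t \<notin> {0..T} \<Longrightarrow> x1 (t, \<omega>) = 0" "\<And>t \<omega>. t \<notin> {0..T} \<Longrightarrow> x2 (t, \<omega>) = 0"
    and "integrable TM (\<lambda>z. norm (x1 z) powr p)" "integrable TM (\<lambda>z. norm (x2 z) powr p)"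
  shows "energy_operators M F T W p (p / (p - 1)) lA lB cA cB eA eB A' B' x1 x2"
proof (rule energy_operators.intro[OF wiener_basis_axioms], rule energy_operators_axioms.intro)
  have z: "0 \<in> {0..T}" using T_pos by simp
  have restr: "(\<lambda>\<omega>. if \<omega> \<in> Good then g \<omega> else 0) \<in> borel_measurable M" if "g \<in> borel_measurable (F 0)" for g :: "'w \<Rightarrow> real"
    using Good(1) measurable_F_M[OF z that] by (intro measurable_If_set) auto
  have "(\<lambda>\<omega>. blinfun_apply (A' w \<omega>) x) = (\<lambda>\<omega>. if \<omega> \<in> Good then blinfun_apply (A w \<omega>) x else 0)"
    "(\<lambda>\<omega>. blinfun_apply (B' u \<omega>) v) = (\<lambda>\<omega>. if \<omega> \<in> Good then blinfun_apply (B u \<omega>) v else 0)" for w x u v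
    by (auto simp: A'_def B'_def)
  then show "(\<lambda>\<omega>. blinfun_apply (A' w \<omega>) x) \<in> borel_measurable M"
    "(\<lambda>\<omega>. blinfun_apply (B' u \<omega>) v) \<in> borel_measurable M" for w x u v
    using A_weak B_weak by (simp_all add: weakly_measurable_def restr)
  show "hemicontinuous (\<lambda>w. A' w \<omega>)" for \<omega>
    using A_hemi by (cases "\<omega> \<in> Good") (auto simp: A'_def hemicontinuous_def)
  show "norm (A' w \<omega>) \<le> cA * (1 + norm w) powr (p - 1)" for w \<omega>
    using A_growth const by (auto simp: A'_def)
  show "0 \<le> blinfun_apply (A' w \<omega> - A' x \<omega>) (w - x) + lA * (norm (eB (eA (w - x))))\<^sup>2" for w x \<omega>
  proof (cases "\<omega> \<in> Good")
    case True
    have "B_norm B \<omega> (0 - 0) = 0" by (simp add: B_norm_def blinfun.zero_right)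
    then have "1/2 * (ell2_norm (\<lambda>j. C 0 w \<omega> j - C 0 x \<omega> j))\<^sup>2 \<le>
        blinfun_apply (A w \<omega> - A x \<omega>) (w - x) + lA * (norm (eB (eA (w - x))))\<^sup>2"
      using A_C[OF True, where w=w and z=x and u=0 and v=0] by simp
    moreover have "0 \<le> 1/2 * (ell2_norm (\<lambda>j. C 0 w \<omega> j - C 0 x \<omega> j))\<^sup>2" by simp
    ultimately show ?thesis using True unfolding A'_def by (simp only: if_True)
  next
    case False
    then show ?thesis using const by (simp add: A'_def blinfun.zero_left)
  qed
  show "linear (\<lambda>w. B' w \<omega>)" for \<omega>
    using B_linear by (cases "\<omega> \<in> Good") (auto simp: B'_def intro: linearI)
  show "blinfun_apply (B' w \<omega>) x = blinfun_apply (B' x \<omega>) w" for w x \<omega>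
    using B_sym by (auto simp: B'_def blinfun.zero_left)
  show "0 \<le> blinfun_apply (B' w \<omega>) w" for w \<omega>
    using B_pos by (auto simp: B'_def blinfun.zero_left)
  show "norm (B' w \<omega>) \<le> cB * norm w" for w \<omega>
    using B_bound const by (auto simp: B'_def)
qed (use assms p const inj_embeddings in auto)

lemma extended_integrable:
  fixes Y :: "real \<Rightarrow> 'w \<Rightarrow> 'va"
  assumes Y: "progressive F T Y" "(\<integral>\<^sup>+ (s, \<omega>). ennreal (norm (Y s \<omega>) powr p) \<partial>time_prob M T) < \<infinity>"
  shows "extend (\<lambda>(s, \<omega>). Y s \<omega>) \<in> borel_measurable TM"
    and "integrable TM (\<lambda>z. norm (extend (\<lambda>(s, \<omega>). Y s \<omega>) z) powr p)"
proof -
  have m: "(\<lambda>(s, \<omega>). Y s \<omega>) \<in> borel_measurable (time_prob M T)" by (rule progressive_measurable_time_prob[OF Y(1)])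
  then have m': "(\<lambda>(s, \<omega>). ennreal (norm (Y s \<omega>) powr p)) \<in> borel_measurable (time_prob M T)"
    unfolding case_prod_beta' by measurable
  show em: "extend (\<lambda>(s, \<omega>). Y s \<omega>) \<in> borel_measurable TM" by (rule extend_measurable[OF m])
  have "(\<integral>\<^sup>+z. ennreal (norm (norm (extend (\<lambda>(s, \<omega>). Y s \<omega>) z) powr p)) \<partial>TM) = (\<integral>\<^sup>+z. extend (\<lambda>(s, \<omega>). ennreal (norm (Y s \<omega>) powr p)) z \<partial>TM)"
    by (intro nn_integral_cong) (auto simp: extend_def)
  also have "\<dots> < \<infinity>" using Y(2) nn_integral_time_prob[OF m'] by simp
  finally show "integrable TM (\<lambda>z. norm (extend (\<lambda>(s, \<omega>). Y s \<omega>) z) powr p)"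
    using em by (intro integrableI_bounded) auto
qed

lemma y_properties:
  "y1 \<in> borel_measurable TM" "y2 \<in> borel_measurable TM"
  "\<And>t \<omega>. t \<notin> {0..T} \<Longrightarrow> y1 (t, \<omega>) = 0" "\<And>t \<omega>. t \<notin> {0..T} \<Longrightarrow> y2 (t, \<omega>) = 0"
  "integrable TM (\<lambda>z. norm (y1 z) powr p)" "integrable TM (\<lambda>z. norm (y2 z) powr p)"
  using extended_integrable[OF Y1(1,3)] extended_integrable[OF Y2(1,3)]
  by (auto simp: y1_def y2_def extend_def)

text \<open>
Besides the pair \<open>(y1, y2)\<close>, each velocity is paired with \<open>0\<close>. Then \<open>E1.G\<close> and \<open>E2.G\<close> are, up to terms that
depend on \<open>\<omega>\<close> and the test vector only, the drifts of the two equations, and the integrability proved for \<open>E\<close> is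
available for each equation separately.
\<close>

sublocale E: energy_operators M F T W p "p / (p - 1)" lA lB cA cB eA eB A' B' y1 y2
  by (intro operators y_properties)

sublocale E1: energy_operators M F T W p "p / (p - 1)" lA lB cA cB eA eB A' B' y1 "\<lambda>_. 0"
  using p by (intro operators y_properties) auto

sublocale E2: energy_operators M F T W p "p / (p - 1)" lA lB cA cB eA eB A' B' y2 "\<lambda>_. 0"
  using p by (intro operators y_properties) auto

lemma y_adapted:
  assumes Y: "progressive F T Y" and t: "t \<in> {0..T}"
  shows "(\<lambda>\<omega>. extend (\<lambda>(s, \<omega>). Y s \<omega>) (t, \<omega>)) \<in> borel_measurable (F t)"
proof -
  have m: "(\<lambda>(s, \<omega>). Y s \<omega>) \<in> borel_measurable (restrict_space borel {0..t} \<Otimes>\<^sub>M F t)"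
    using Y t by (auto simp: progressive_def)
  have "(\<lambda>\<omega>. (t, \<omega>)) \<in> F t \<rightarrow>\<^sub>M restrict_space borel {0..t} \<Otimes>\<^sub>M F t"
    using t by (intro measurable_Pair measurable_const) (auto simp: space_restrict_space)
  from measurable_compose[OF this m] show ?thesis using t by (simp add: extend_def)
qed

text \<open>
The paths on which the time integrals in the definition of a solution may be computed with the
measurable versions of the velocities, and converge.
\<close>

definition regular :: "'w \<Rightarrow> bool" where
  "regular \<omega> \<longleftrightarrow> \<omega> \<in> Good \<and> \<omega> \<in> space M \<and>
     (AE s in lborel. s \<in> {0..T} \<longrightarrow> v1 s \<omega> = y1 (s, \<omega>)) \<and> (AE s in lborel. s \<in> {0..T} \<longrightarrow> v2 s \<omega> = y2 (s, \<omega>)) \<and>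
     integrable lborel (\<lambda>s. y1 (s, \<omega>)) \<and> integrable lborel (\<lambda>s. y2 (s, \<omega>)) \<and>
     integrable lborel (\<lambda>s. E1.\<Gamma> (s, \<omega>)) \<and> integrable lborel (\<lambda>s. E2.\<Gamma> (s, \<omega>))"

lemma version_AE:
  assumes "versions M T v Y"
  shows "AE z in TM. fst z \<in> {0..T} \<longrightarrow> v (fst z) (snd z) = extend (\<lambda>(s, \<omega>). Y s \<omega>) z"
  using AE_time_prob[OF assms[unfolded versions_def case_prod_beta]]
  by eventually_elim (auto simp: extend_def split: prod.split)

lemma AE_regular: "AE \<omega> in M. regular \<omega>"
proof -
  interpret P: pair_sigma_finite "lborel :: real measure" M by (rule pair_sigma_finite_TM)
  have a: "AE \<omega> in M. integrable lborel (\<lambda>s. E1.\<Gamma> (s, \<omega>))"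
    by (rule P.AE_integrable_snd) (use E1.\<Gamma>_integrable in \<open>simp add: case_prod_beta'\<close>)
  have b: "AE \<omega> in M. integrable lborel (\<lambda>s. E2.\<Gamma> (s, \<omega>))"
    by (rule P.AE_integrable_snd) (use E2.\<Gamma>_integrable in \<open>simp add: case_prod_beta'\<close>)
  have "E1.y = y1" "E2.y = y2" by (auto simp: E1.y_def E2.y_def)
  note yi = E1.y_path_integrable'[unfolded this] E2.y_path_integrable'[unfolded this]
    E1.y_path_integrable[unfolded this] E2.y_path_integrable[unfolded this]
  show ?thesis
    using Good(2) AE_space AE_TM_path[OF version_AE[OF Y1(2)]] AE_TM_path[OF version_AE[OF Y2(2)]]
      yi(3,4) a b
    by eventually_elim (auto simp: regular_def y1_def[symmetric] y2_def[symmetric] yi(1,2))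
qed

lemma u_of_eq:
  assumes "regular \<omega>" "t \<in> {0..T}"
  shows "u_of eA u0 v1 t \<omega> = u0 \<omega> + E1.U (t, \<omega>)" "u_of eA u0 v2 t \<omega> = u0 \<omega> + E2.U (t, \<omega>)"
proof -
  have K: "Kop (\<lambda>s. v s \<omega>) t = (\<integral>s. indicator {0..t} s *\<^sub>R x (s, \<omega>) \<partial>lborel)"
    if "integrable lborel (\<lambda>s. x (s, \<omega>))" "AE s in lborel. s \<in> {0..T} \<longrightarrow> v s \<omega> = x (s, \<omega>)"
    for v :: "real \<Rightarrow> 'w \<Rightarrow> 'va" and x :: "real \<times> 'w \<Rightarrow> 'va"
    unfolding Kop_def set_lebesgue_integral_def
  proof (rule integral_lebesgue_eq_lborel)
    show "(\<lambda>s. indicator {0..t} s *\<^sub>R x (s, \<omega>)) \<in> borel_measurable lborel"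
      using that(1) by (auto intro!: borel_measurable_scaleR)
    show "AE s in lborel. indicator {0..t} s *\<^sub>R v s \<omega> = indicator {0..t} s *\<^sub>R x (s, \<omega>)"
      using that(2) by eventually_elim (use assms(2) in \<open>auto simp: indicator_def\<close>)
  qed
  have "Kop (\<lambda>s. v1 s \<omega>) t = (\<integral>s. indicator {0..t} s *\<^sub>R y1 (s, \<omega>) \<partial>lborel)"
    "Kop (\<lambda>s. v2 s \<omega>) t = (\<integral>s. indicator {0..t} s *\<^sub>R y2 (s, \<omega>) \<partial>lborel)"
    by (rule K; use assms(1) in \<open>simp add: regular_def\<close>)+
  then show "u_of eA u0 v1 t \<omega> = u0 \<omega> + E1.U (t, \<omega>)" "u_of eA u0 v2 t \<omega> = u0 \<omega> + E2.U (t, \<omega>)"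
    using assms(2) by (simp_all add: u_of_def E1.U_def E1.y_def E2.U_def E2.y_def)
qed

lemma U_difference:
  assumes "regular \<omega>"
  shows "E.U (t, \<omega>) = E1.U (t, \<omega>) - E2.U (t, \<omega>)"
proof -
  have i: "integrable lborel (\<lambda>s. indicator {0..t} s *\<^sub>R y1 (s, \<omega>))" "integrable lborel (\<lambda>s. indicator {0..t} s *\<^sub>R y2 (s, \<omega>))"
    using assms by (auto simp: regular_def intro!: integrable_mult_indicator)
  show ?thesis
    using i by (simp add: E.U_def E1.U_def E2.U_def E.y_def E1.y_def E2.y_def scaleR_diff_right blinfun.diff_right)
qed

lemma G_difference:
  assumes "regular \<omega>"
  shows "E.G (t, \<omega>) x = E1.G (t, \<omega>) x - E2.G (t, \<omega>) x"
  using U_difference[OF assms, of t] by (simp add: E.G_def E1.G_def E2.G_def E.B_diff blinfun.diff_left)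

text \<open>
The drift of one equation differs from \<open>G\<close> for the pair \<open>(y0, 0)\<close> by \<open>A 0\<close> and \<open>B u0\<close>, which are constant in
time. These terms are common to both equations and cancel in the difference.
\<close>

lemma drift_integral:
  fixes x :: 'va
  assumes O: "energy_operators M F T W p (p / (p - 1)) lA lB cA cB eA eB A' B' y0 (\<lambda>_. 0)"
    and \<omega>: "\<omega> \<in> Good" "\<omega> \<in> space M" "AE s in lborel. s \<in> {0..T} \<longrightarrow> v s \<omega> = y0 (s, \<omega>)"
      "integrable lborel (\<lambda>s. energy_operators.\<Gamma> T p cA cB eA y0 (\<lambda>_. 0) (s, \<omega>))"
    and u: "\<And>s. s \<in> {0..T} \<Longrightarrow> u_of eA u0 v s \<omega> = u0 \<omega> + energy_operators.U T eA y0 (\<lambda>_. 0) (s, \<omega>)"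
    and t: "t \<in> {0..T}"
  defines "g \<equiv> \<lambda>s. energy_operators.G T eA A' B' y0 (\<lambda>_. 0) (s, \<omega>) x"
  shows "integrable lborel (\<lambda>s. indicator {0..t} s * g s)"
    "(LINT s:{0..t}|lebesgue. blinfun_apply (A (v s \<omega>) \<omega>) x + blinfun_apply (B (u_of eA u0 v s \<omega>) \<omega>) (eA x)) =
       (\<integral>s. indicator {0..t} s * g s \<partial>lborel) + t * (blinfun_apply (A 0 \<omega>) x + blinfun_apply (B (u0 \<omega>) \<omega>) (eA x))"
proof -
  interpret O: energy_operators M F T W p "p / (p - 1)" lA lB cA cB eA eB A' B' y0 "\<lambda>_. 0" by (rule O)
  let ?k = "blinfun_apply (A 0 \<omega>) x + blinfun_apply (B (u0 \<omega>) \<omega>) (eA x)"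
  have gm: "g \<in> borel_measurable lborel"
  proof -
    have "(\<lambda>s. ((s, \<omega>), x)) \<in> lborel \<rightarrow>\<^sub>M TM \<Otimes>\<^sub>M borel" using \<omega>(2) by measurable
    from measurable_compose[OF this O.G_measurable] show ?thesis by (simp add: g_def)
  qed
  then have m: "(\<lambda>s. indicator {0..t} s * g s) \<in> borel_measurable lborel" by (intro borel_measurable_times) auto
  show i: "integrable lborel (\<lambda>s. indicator {0..t} s * g s)"
  proof (rule Bochner_Integration.integrable_bound[OF _ m])
    show "integrable lborel (\<lambda>s. O.\<Gamma> (s, \<omega>) * norm x)" using \<omega>(4) by simp
    show "AE s in lborel. norm (indicator {0..t} s * g s) \<le> norm (O.\<Gamma> (s, \<omega>) * norm x)"
      using O.G_bound O.\<Gamma>_nonneg by (intro AE_I2) (auto simp: indicator_def g_def abs_mult)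
  qed
  have ik: "integrable lborel (\<lambda>s. indicator {0..t} s * ?k)"
    by (intro integrable_mult_left integrable_real_indicator) (auto simp: emeasure_lborel_Icc_eq)
  have "(LINT s:{0..t}|lebesgue. blinfun_apply (A (v s \<omega>) \<omega>) x + blinfun_apply (B (u_of eA u0 v s \<omega>) \<omega>) (eA x)) =
      (\<integral>s. indicator {0..t} s * g s + indicator {0..t} s * ?k \<partial>lborel)"
    unfolding set_lebesgue_integral_def
  proof (rule integral_lebesgue_eq_lborel)
    show "(\<lambda>s. indicator {0..t} s * g s + indicator {0..t} s * ?k) \<in> borel_measurable lborel"
      using i ik by (intro borel_measurable_integrable) auto
    show "AE s in lborel. indicator {0..t} s *\<^sub>R (blinfun_apply (A (v s \<omega>) \<omega>) x + blinfun_apply (B (u_of eA u0 v s \<omega>) \<omega>) (eA x)) =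
        indicator {0..t} s * g s + indicator {0..t} s * ?k"
      using \<omega>(3)
    proof eventually_elim
      case (elim s)
      show ?case
      proof (cases "s \<in> {0..t}")
        case True
        then have s: "s \<in> {0..T}" using t by auto
        have "B (u0 \<omega> + O.U (s, \<omega>)) \<omega> = B (u0 \<omega>) \<omega> + B (O.U (s, \<omega>)) \<omega>"
          using linear_add[OF B_linear[OF \<omega>(1)]] .
        then show ?thesis
          using True elim s u[OF s] \<omega>(1)
          by (simp add: g_def O.G_def A'_def B'_def blinfun.add_left)
      qed simp
    qed
  qed
  also have "\<dots> = (\<integral>s. indicator {0..t} s * g s \<partial>lborel) + t * ?k"
    using i ik t by simp
  finally show "(LINT s:{0..t}|lebesgue. blinfun_apply (A (v s \<omega>) \<omega>) x + blinfun_apply (B (u_of eA u0 v s \<omega>) \<omega>) (eA x)) =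
       (\<integral>s. indicator {0..t} s * g s \<partial>lborel) + t * ?k" .
qed

definition X :: "real \<Rightarrow> 'w \<Rightarrow> 'h" where "X t \<omega> = v1t t \<omega> - v2t t \<omega>"
definition N :: "'va \<Rightarrow> real \<Rightarrow> 'w \<Rightarrow> real" where "N x t \<omega> = J1 x t \<omega> - J2 x t \<omega>"

text \<open>
In the difference of the two equations the initial value \<open>v0\<close> and the force \<open>f\<close> cancel.
\<close>

lemma difference_equation:
  "AE \<omega> in M. \<forall>t\<in>{0..T}. \<forall>x.
     inner (X t \<omega>) (eB (eA x)) + (\<integral>s. indicator {0..t} s * E.G (s, \<omega>) x \<partial>lborel) = N x t \<omega>"
  using eq1 eq2 AE_regular
proof eventually_elim
  case (elim \<omega>)
  show ?case
  proof (intro ballI allI)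
    fix t x assume t: "t \<in> {0..T}"
    note d1 = drift_integral[OF E1.energy_operators_axioms, where \<omega>=\<omega> and v=v1 and t=t and x=x]
    note d2 = drift_integral[OF E2.energy_operators_axioms, where \<omega>=\<omega> and v=v2 and t=t and x=x]
    have i: "integrable lborel (\<lambda>s. indicator {0..t} s * E1.G (s, \<omega>) x)" "integrable lborel (\<lambda>s. indicator {0..t} s * E2.G (s, \<omega>) x)"
      using d1(1) d2(1) elim(3) t u_of_eq[OF elim(3)] by (auto simp: regular_def)
    have e: "(LINT s:{0..t}|lebesgue. blinfun_apply (A (v1 s \<omega>) \<omega>) x + blinfun_apply (B (u_of eA u0 v1 s \<omega>) \<omega>) (eA x)) =
       (\<integral>s. indicator {0..t} s * E1.G (s, \<omega>) x \<partial>lborel) + t * (blinfun_apply (A 0 \<omega>) x + blinfun_apply (B (u0 \<omega>) \<omega>) (eA x))"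
      "(LINT s:{0..t}|lebesgue. blinfun_apply (A (v2 s \<omega>) \<omega>) x + blinfun_apply (B (u_of eA u0 v2 s \<omega>) \<omega>) (eA x)) =
       (\<integral>s. indicator {0..t} s * E2.G (s, \<omega>) x \<partial>lborel) + t * (blinfun_apply (A 0 \<omega>) x + blinfun_apply (B (u0 \<omega>) \<omega>) (eA x))"
      using d1(2) d2(2) elim(3) t u_of_eq[OF elim(3)] by (auto simp: regular_def)
    have "(\<integral>s. indicator {0..t} s * E.G (s, \<omega>) x \<partial>lborel) =
        (\<integral>s. indicator {0..t} s * E1.G (s, \<omega>) x \<partial>lborel) - (\<integral>s. indicator {0..t} s * E2.G (s, \<omega>) x \<partial>lborel)"
      unfolding G_difference[OF elim(3)] right_diff_distrib using i by simp
    then show "inner (X t \<omega>) (eB (eA x)) + (\<integral>s. indicator {0..t} s * E.G (s, \<omega>) x \<partial>lborel) = N x t \<omega>"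
      using elim(1)[rule_format, OF t, of x] elim(2)[rule_format, OF t, of x] e
      by (simp add: X_def N_def inner_diff_left)
  qed
qed

lemma modification_difference:
  "AE z in TM. fst z \<in> {0..T} \<longrightarrow> X (fst z) (snd z) = eB (eA (E.y z))"
proof -
  have a: "AE z in TM. fst z \<in> {0..T} \<longrightarrow> v1t (fst z) (snd z) = eB (eA (v1 (fst z) (snd z)))"
    using AE_time_prob[OF v1t(2)[unfolded versions_def case_prod_beta]] by simp
  have b: "AE z in TM. fst z \<in> {0..T} \<longrightarrow> v2t (fst z) (snd z) = eB (eA (v2 (fst z) (snd z)))"
    using AE_time_prob[OF v2t(2)[unfolded versions_def case_prod_beta]] by simp
  show ?thesis
    using a b version_AE[OF Y1(2)] version_AE[OF Y2(2)]
    by eventually_elim (auto simp: X_def E.y_def y1_def[symmetric] y2_def[symmetric] blinfun.diff_right)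
qed

text \<open>
Off the set \<open>Good\<close> the value is zero, so that the sequence is square summable for every argument.
\<close>

definition \<Delta>C :: "real \<times> 'w \<Rightarrow> nat \<Rightarrow> 'h" where
  "\<Delta>C z j = (if snd z \<in> Good
     then C (u_of eA u0 v1 (fst z) (snd z)) (v1 (fst z) (snd z)) (snd z) j - C (u_of eA u0 v2 (fst z) (snd z)) (v2 (fst z) (snd z)) (snd z) j
     else 0)"

lemma \<Delta>C_ell2: "\<Delta>C z \<in> ell2"
proof (cases "snd z \<in> Good")
  case True
  then have "snd z \<in> space M" using Good(1) sets.sets_into_space by auto
  then show ?thesis using True ell2_diff[OF C_ell2 C_ell2] by (simp add: \<Delta>C_def[abs_def])
next
  case False then show ?thesis by (simp add: \<Delta>C_def[abs_def] ell2_def)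
qed

lemma \<Delta>C_bound: "AE z in TM. fst z \<in> {0..T} \<longrightarrow> (ell2_norm (\<Delta>C z))\<^sup>2 \<le> E.R z"
  using AE_TM_snd[OF AE_regular] version_AE[OF Y1(2)] version_AE[OF Y2(2)]
proof eventually_elim
  case (elim z)
  show ?case
  proof
    assume z: "fst z \<in> {0..T}"
    have g: "snd z \<in> Good" using elim(1) by (simp add: regular_def)
    have v: "v1 (fst z) (snd z) = y1 z" "v2 (fst z) (snd z) = y2 z" using elim(2,3) z by (auto simp: y1_def y2_def)
    have u: "u_of eA u0 v1 (fst z) (snd z) - u_of eA u0 v2 (fst z) (snd z) = E.U z"
      using u_of_eq[OF elim(1) z] U_difference[OF elim(1), of "fst z"] by simp
    have Bn: "(B_norm B (snd z) (E.U z))\<^sup>2 = E.elastic z"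
      using B_pos[OF g, of "E.U z"] g by (simp add: B_norm_def E.elastic_def B'_def)
    have "1/2 * (ell2_norm (\<Delta>C z))\<^sup>2 - lB * E.elastic z
        \<le> blinfun_apply (A (y1 z) (snd z) - A (y2 z) (snd z)) (E.y z) + lA * (norm (eB (eA (E.y z))))\<^sup>2"
      using A_C[OF g, where w="y1 z" and z="y2 z" and u="u_of eA u0 v1 (fst z) (snd z)" and v="u_of eA u0 v2 (fst z) (snd z)"]
      unfolding u Bn using g by (simp add: \<Delta>C_def[abs_def] v E.y_def)
    then show "(ell2_norm (\<Delta>C z))\<^sup>2 \<le> E.R z"
      using g by (simp add: E.R_def E.G_def E.elastic_power_def A'_def blinfun.diff_left)
  qed
qed

text \<open>
At time \<open>0\<close> the equation reads \<open>(X 0, x) = N x 0\<close>, which is zero almost surely for each \<open>x\<close>. Countably many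
\<open>x\<close> from a dense set determine the functional, and the range of \<open>V\<^sub>A\<close> is dense in \<open>H\<close>.
\<close>

lemma difference_zero_initially: "AE \<omega> in M. X 0 \<omega> = 0"
proof -
  have z: "0 \<in> {0..T}" using T_pos by simp
  obtain D :: "'va set" where D: "countable D" "\<And>V. open V \<Longrightarrow> V \<noteq> {} \<Longrightarrow> \<exists>d\<in>D. d \<in> V"
    using countable_dense_setE by metis
  have cD: "closure D = UNIV"
  proof -
    have "UNIV - closure D = {}" using D(2)[of "UNIV - closure D"] closure_subset[of D] by auto
    then show ?thesis by auto
  qed
  have n0: "AE \<omega> in M. N x 0 \<omega> = 0" for x
  proof (rule ito_series_difference[OF J1[of x] J2[of x]])
    assume "AE \<omega> in M. J1 x 0 \<omega> = 0" "AE \<omega> in M. J2 x 0 \<omega> = 0"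
    then show ?thesis by eventually_elim (simp add: N_def)
  qed
  have "AE \<omega> in M. \<forall>x\<in>D. N x 0 \<omega> = 0" using n0 D(1) by (simp add: AE_ball_countable)
  then show ?thesis using difference_equation
  proof eventually_elim
    case (elim \<omega>)
    have i0: "(\<integral>s. indicator {0..0} s * E.G (s, \<omega>) x \<partial>lborel) = 0" for x
    proof -
      have "(\<integral>s. indicator {0..0} s * E.G (s, \<omega>) x \<partial>lborel) = (\<integral>s. 0 \<partial>(lborel :: real measure))"
        by (rule integral_discrete_difference[where X="{0}"]) auto
      then show ?thesis by simp
    qed
    have D0: "inner (X 0 \<omega>) (eB (eA x)) = 0" if "x \<in> D" for x
      using elim(2)[rule_format, OF z, of x] elim(1) that i0 by simp
    have cA: "continuous_on UNIV (\<lambda>x. inner (X 0 \<omega>) (eB (eA x)))"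
      and cB: "continuous_on UNIV (\<lambda>w. inner (X 0 \<omega>) (eB w))"
      and cH: "continuous_on UNIV (\<lambda>h. inner (X 0 \<omega>) h)"
      by (intro continuous_intros)+
    have A0: "inner (X 0 \<omega>) (eB (eA x)) = 0" for x
      by (rule continuous_zero_on_dense[OF cA D0 cD])
    have rA: "closure (range (blinfun_apply eA)) = UNIV" and rB: "closure (range (blinfun_apply eB)) = UNIV"
      using emb by (auto simp: dense_embedding_def)
    have B0: "inner (X 0 \<omega>) (eB w) = 0" for w
      by (rule continuous_zero_on_dense[OF cB _ rA]) (use A0 in auto)
    have "inner (X 0 \<omega>) h = 0" for h
      by (rule continuous_zero_on_dense[OF cH _ rB]) (use B0 in auto)
    then show "X 0 \<omega> = 0" using inner_eq_zero_iff by blast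
  qed
qed

lemma velocities_agree: "AE z in TM. E.y z = 0"
proof -
  define P where "P x Y Y' \<longleftrightarrow> (\<forall>j. progressive F T (Y j)) \<and> (\<forall>j. progressive F T (Y' j)) \<and>
     (\<forall>j. versions M T (\<lambda>s \<omega>. inner (eB (eA x)) (C (u_of eA u0 v1 s \<omega>) (v1 s \<omega>) \<omega> j)) (Y j)) \<and>
     (\<forall>j. versions M T (\<lambda>s \<omega>. inner (eB (eA x)) (C (u_of eA u0 v2 s \<omega>) (v2 s \<omega>) \<omega> j)) (Y' j)) \<and>
     (\<forall>s t. 0 \<le> s \<longrightarrow> s \<le> t \<longrightarrow> t \<le> T \<longrightarrow> sq_integrable M (\<lambda>\<omega>. N x t \<omega> - N x s \<omega>) \<and>
        (\<forall>\<xi>. \<xi> \<in> borel_measurable (F s) \<longrightarrow> sq_integrable M \<xi> \<longrightarrow> expectation (\<lambda>\<omega>. \<xi> \<omega> * (N x t \<omega> - N x s \<omega>)) = 0) \<and>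
        (\<integral>\<^sup>+\<omega>. ennreal ((N x t \<omega> - N x s \<omega>)\<^sup>2) \<partial>M) \<le>
          (\<Sum>j. \<integral>\<^sup>+(r, \<omega>). ennreal (indicator {s<..t} r * (Y j r \<omega> - Y' j r \<omega>)\<^sup>2) \<partial>time_prob M T))" for x Y Y'
  have ex: "\<exists>Y Y'. P x Y Y'" for x
    by (rule ito_series_difference[OF J1[of x] J2[of x]]) (unfold P_def N_def, blast)
  obtain Y Y' where "\<And>x. P x (Y x) (Y' x)" using ex by metis
  then have Y: "\<And>x j. progressive F T (Y x j)" "\<And>x j. progressive F T (Y' x j)"
    "\<And>x j. versions M T (\<lambda>s \<omega>. inner (eB (eA x)) (C (u_of eA u0 v1 s \<omega>) (v1 s \<omega>) \<omega> j)) (Y x j)"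
    "\<And>x j. versions M T (\<lambda>s \<omega>. inner (eB (eA x)) (C (u_of eA u0 v2 s \<omega>) (v2 s \<omega>) \<omega> j)) (Y' x j)"
    and Nx: "\<And>x s t. 0 \<le> s \<Longrightarrow> s \<le> t \<Longrightarrow> t \<le> T \<Longrightarrow> sq_integrable M (\<lambda>\<omega>. N x t \<omega> - N x s \<omega>)"
     "\<And>x s t \<xi>. 0 \<le> s \<Longrightarrow> s \<le> t \<Longrightarrow> t \<le> T \<Longrightarrow> \<xi> \<in> borel_measurable (F s) \<Longrightarrow> sq_integrable M \<xi> \<Longrightarrow>
         expectation (\<lambda>\<omega>. \<xi> \<omega> * (N x t \<omega> - N x s \<omega>)) = 0"
     "\<And>x s t. 0 \<le> s \<Longrightarrow> s \<le> t \<Longrightarrow> t \<le> T \<Longrightarrow> (\<integral>\<^sup>+\<omega>. ennreal ((N x t \<omega> - N x s \<omega>)\<^sup>2) \<partial>M) \<le>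
          (\<Sum>j. \<integral>\<^sup>+(r, \<omega>). ennreal (indicator {s<..t} r * (Y x j r \<omega> - Y' x j r \<omega>)\<^sup>2) \<partial>time_prob M T)"
    unfolding P_def by blast+
  have Ym: "(\<lambda>(s, \<omega>). Y x j s \<omega> - Y' x j s \<omega>) \<in> borel_measurable (time_prob M T)" for x j
    using progressive_measurable_time_prob[OF Y(1)[of x j]] progressive_measurable_time_prob[OF Y(2)[of x j]]
    by (auto simp: case_prod_beta' intro!: borel_measurable_diff)
  define Z where "Z x j = extend (\<lambda>(s, \<omega>). Y x j s \<omega> - Y' x j s \<omega>)" for x j
  have Zint: "(\<integral>\<^sup>+(r, \<omega>). ennreal (indicator {s<..t} r * (Y x j r \<omega> - Y' x j r \<omega>)\<^sup>2) \<partial>time_prob M T) =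
      (\<integral>\<^sup>+z. ennreal (indicator {s<..t} (fst z) * (Z x j z)\<^sup>2) \<partial>TM)" for x j s t
  proof -
    have "(\<lambda>(r, \<omega>). ennreal (indicator {s<..t} r * (Y x j r \<omega> - Y' x j r \<omega>)\<^sup>2)) \<in> borel_measurable (time_prob M T)"
      using Ym[of x j] measurable_indicator_time[of "{s<..t}"] by (simp add: case_prod_beta')
    from nn_integral_time_prob[OF this] show ?thesis
      by (auto simp: extend_def Z_def intro!: nn_integral_cong)
  qed
  interpret S: energy_setting M F T W p "p / (p - 1)" lA lB cA cB eA eB A' B' y1 y2 X N Z \<Delta>C
  proof unfold_locales
    show "(\<lambda>\<omega>. y1 (t, \<omega>)) \<in> borel_measurable (F t)" if "t \<in> {0..T}" for t
      unfolding y1_def by (rule y_adapted[OF Y1(1) that])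
    show "(\<lambda>\<omega>. y2 (t, \<omega>)) \<in> borel_measurable (F t)" if "t \<in> {0..T}" for t
      unfolding y2_def by (rule y_adapted[OF Y2(1) that])
    show "AE z in TM. fst z \<in> {0..T} \<longrightarrow> X (fst z) (snd z) = eB (eA (E.y z))" by (rule modification_difference)
    show "AE \<omega> in M. X 0 \<omega> = 0" by (rule difference_zero_initially)
    show "\<Delta>C z \<in> ell2" for z by (rule \<Delta>C_ell2)
    show "AE z in TM. fst z \<in> {0..T} \<longrightarrow> (ell2_norm (\<Delta>C z))\<^sup>2 \<le> E.R z" by (rule \<Delta>C_bound)
    show "Z x j \<in> borel_measurable TM" for x j unfolding Z_def by (rule extend_measurable[OF Ym])
    show "AE z in TM. fst z \<in> {0..T} \<longrightarrow> Z x j z = inner (eB (eA x)) (\<Delta>C z j)" for x j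
      using AE_TM_snd[OF Good(2)] AE_time_prob[OF Y(3)[of x j, unfolded versions_def case_prod_beta]]
        AE_time_prob[OF Y(4)[of x j, unfolded versions_def case_prod_beta]]
      by eventually_elim (auto simp: Z_def extend_def \<Delta>C_def inner_diff_right split: prod.split)
    show "sq_integrable M (\<lambda>\<omega>. N x t \<omega> - N x s \<omega>)" if "0 \<le> s" "s \<le> t" "t \<le> T" for x s t
      by (rule Nx(1)[OF that])
    show "expectation (\<lambda>\<omega>. \<xi> \<omega> * (N x t \<omega> - N x s \<omega>)) = 0"
      if "0 \<le> s" "s \<le> t" "t \<le> T" "\<xi> \<in> borel_measurable (F s)" "sq_integrable M \<xi>" for x s t \<xi>
      by (rule Nx(2)[OF that])
    show "(\<integral>\<^sup>+\<omega>. ennreal ((N x t \<omega> - N x s \<omega>)\<^sup>2) \<partial>M) \<le> (\<Sum>j. \<integral>\<^sup>+z. ennreal (indicator {s<..t} (fst z) * (Z x j z)\<^sup>2) \<partial>TM)"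
      if "0 \<le> s" "s \<le> t" "t \<le> T" for x s t
      using Nx(3)[OF that, of x] unfolding Zint .
    show "AE \<omega> in M. \<forall>t\<in>{0..T}. \<forall>x. inner (X t \<omega>) (eB (eA x)) + (\<integral>s. indicator {0..t} s * E.G (s, \<omega>) x \<partial>lborel) = N x t \<omega>"
      by (rule difference_equation)
  qed
  show ?thesis by (rule S.y_zero)
qed

text \<open>
The difference of the velocities vanishes almost everywhere, so its integral \<open>U\<close> vanishes at all times,
and so does the continuous modification.
\<close>

lemma indistinguishable:
  "AE \<omega> in M. \<forall>t\<in>{0..T}. v1t t \<omega> = v2t t \<omega>"
  "AE \<omega> in M. \<forall>t\<in>{0..T}. u_of eA u0 v1 t \<omega> = u_of eA u0 v2 t \<omega>"
proof -
  have c: "AE \<omega> in M. continuous_on {0..T} (\<lambda>t. X t \<omega>)"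
  proof -
    have "AE \<omega> in M. continuous_on {0..T} (\<lambda>t. v1t t \<omega>)" "AE \<omega> in M. continuous_on {0..T} (\<lambda>t. v2t t \<omega>)"
      using v1t(1) v2t(1) by (auto simp: continuous_process_def)
    then show ?thesis unfolding X_def by eventually_elim (rule continuous_on_diff)
  qed
  have "AE z in TM. fst z \<in> {0..T} \<longrightarrow> X (fst z) (snd z) = 0"
    using modification_difference velocities_agree by eventually_elim (simp add: blinfun.zero_right)
  from AE_TM_path[OF this] c show "AE \<omega> in M. \<forall>t\<in>{0..T}. v1t t \<omega> = v2t t \<omega>"
  proof eventually_elim
    case (elim \<omega>)
    show ?case
    proof
      fix t assume "t \<in> {0..T}"
      with continuous_AE_zero[OF elim(2) T_pos, of t] elim(1) have "X t \<omega> = 0" by simp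
      then show "v1t t \<omega> = v2t t \<omega>" by (simp add: X_def)
    qed
  qed
  show "AE \<omega> in M. \<forall>t\<in>{0..T}. u_of eA u0 v1 t \<omega> = u_of eA u0 v2 t \<omega>"
    using AE_TM_path[OF velocities_agree] AE_regular
  proof eventually_elim
    case (elim \<omega>)
    have "E.U (t, \<omega>) = 0" for t
    proof -
      have "(\<integral>s. indicator {0..t} s *\<^sub>R E.y (s, \<omega>) \<partial>lborel) = 0"
        by (rule integral_eq_zero_AE) (use elim(1) in eventually_elim, simp)
      then show ?thesis by (simp add: E.U_def blinfun.zero_right)
    qed
    then show ?case using u_of_eq[OF elim(2)] U_difference[OF elim(2)] by auto
  qed
qed

end

section \<open>Uniqueness\<close>

theorem theorem2p3:
  fixes M :: "'w measure"
    and F :: "real \<Rightarrow> 'w measure"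
    and W :: "nat \<Rightarrow> real \<Rightarrow> 'w \<Rightarrow> real"
    and T p q :: real
    and eA :: "'va::{banach, second_countable_topology} \<Rightarrow>\<^sub>L 'vb::{banach, second_countable_topology}"
    and eB :: "'vb \<Rightarrow>\<^sub>L 'h::{real_inner, complete_space, second_countable_topology}"
    and A :: "'va \<Rightarrow> 'w \<Rightarrow> 'va \<Rightarrow>\<^sub>L real"
    and B :: "'vb \<Rightarrow> 'w \<Rightarrow> 'vb \<Rightarrow>\<^sub>L real"
    and C :: "'vb \<Rightarrow> 'va \<Rightarrow> 'w \<Rightarrow> nat \<Rightarrow> 'h"
    and u0 :: "'w \<Rightarrow> 'vb"
    and v0 :: "'w \<Rightarrow> 'h"
    and f :: "real \<Rightarrow> 'w \<Rightarrow> 'va \<Rightarrow>\<^sub>L real"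
    and v1 v2 :: "real \<Rightarrow> 'w \<Rightarrow> 'va"
    and v1t v2t :: "real \<Rightarrow> 'w \<Rightarrow> 'h"
  assumes "T > 0" and "p \<ge> 2" and "q = p / (p - 1)"
    and "reflexive_space TYPE('va)" and "reflexive_space TYPE('vb)"
    and "embedding_chain eA eB"
    and "stochastic_basis M F T"
    and "wiener_process M F T W"
    and "assumption_B M (F 0) B"
    and "assumption_AC M (F 0) p eA eB A B C"
    and "u0 \<in> borel_measurable (F 0)" and "integrable M (\<lambda>\<omega>. (norm (u0 \<omega>))\<^sup>2)"
    and "v0 \<in> borel_measurable (F 0)" and "integrable M (\<lambda>\<omega>. (norm (v0 \<omega>))\<^sup>2)"
    and "f \<in> Lproc M F T q"
    and "solution M F T W p eA eB A B C u0 v0 f v1 v1t"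
    and "solution M F T W p eA eB A B C u0 v0 f v2 v2t"
  shows "measure M {\<omega> \<in> space M. (SUP t\<in>{0..T}. ennreal (norm (v1t t \<omega> - v2t t \<omega>))) = 0} = 1 \<and>
         measure M {\<omega> \<in> space M.
           (SUP t\<in>{0..T}. ennreal (norm (u_of eA u0 v1 t \<omega> - u_of eA u0 v2 t \<omega>))) = 0} = 1"
proof -
  interpret stochastic_basis M F T by fact
  interpret wiener_basis M F T W by unfold_locales fact+
  have sub0: "subalgebra M (F 0)" using subalgebra_F[of 0] \<open>T > 0\<close> by simp
  obtain cA where cA: "cA > 0" "AE \<omega> in M. \<forall>w. norm (A w \<omega>) \<le> cA * (1 + norm w) powr (p - 1)"
    using assms(10) unfolding assumption_AC_def by blast
  obtain \<mu>A lA lB \<kappa> where AC: "lA \<ge> 0" "lB \<ge> 0" "AE \<omega> in M. \<forall>w z u v.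
        blinfun_apply (A w \<omega> - A z \<omega>) (w - z) + lA * (norm (eB (eA (w - z))))\<^sup>2
          \<ge> 1/2 * (ell2_norm (\<lambda>j. C u w \<omega> j - C v z \<omega> j))\<^sup>2 - lB * (B_norm B \<omega> (u - v))\<^sup>2 \<and>
        blinfun_apply (A w \<omega>) w + lA * (norm (eB (eA w)))\<^sup>2
          \<ge> \<mu>A * norm w powr p + 1/2 * (ell2_norm (C u w \<omega>))\<^sup>2
             - lB * (B_norm B \<omega> u)\<^sup>2 - \<kappa>"
    using assms(10) unfolding assumption_AC_def by blast
  have hemi: "AE \<omega> in M. hemicontinuous (\<lambda>w. A w \<omega>)"
    using assms(10) unfolding assumption_AC_def by blast
  have C_ell2: "\<forall>u w. \<forall>\<omega>\<in>space M. C u w \<omega> \<in> ell2"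
    using assms(10) unfolding assumption_AC_def by blast
  have weak: "weakly_measurable (F 0) A" "weakly_measurable (F 0) B"
    using assms(9,10) unfolding assumption_AC_def assumption_B_def by blast+
  have Blin: "AE \<omega> in M. linear (\<lambda>w. B w \<omega>) \<and> (\<forall>w z. blinfun_apply (B w \<omega>) z = blinfun_apply (B z \<omega>) w)"
    using assms(9) unfolding assumption_B_def by blast
  obtain \<mu>B cB where B: "\<mu>B > 0" "cB > 0" "AE \<omega> in M. \<forall>w.
        blinfun_apply (B w \<omega>) w \<ge> \<mu>B * (norm w)\<^sup>2 \<and> norm (B w \<omega>) \<le> cB * norm w"
    using assms(9) unfolding assumption_B_def by blast
  define good where "good \<omega> \<longleftrightarrow> hemicontinuous (\<lambda>w. A w \<omega>) \<and> (\<forall>w. norm (A w \<omega>) \<le> cA * (1 + norm w) powr (p - 1)) \<and>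
      (\<forall>w z u v. blinfun_apply (A w \<omega> - A z \<omega>) (w - z) + lA * (norm (eB (eA (w - z))))\<^sup>2
          \<ge> 1/2 * (ell2_norm (\<lambda>j. C u w \<omega> j - C v z \<omega> j))\<^sup>2 - lB * (B_norm B \<omega> (u - v))\<^sup>2) \<and>
      linear (\<lambda>w. B w \<omega>) \<and> (\<forall>w z. blinfun_apply (B w \<omega>) z = blinfun_apply (B z \<omega>) w) \<and>
      (\<forall>w. 0 \<le> blinfun_apply (B w \<omega>) w) \<and> (\<forall>w. norm (B w \<omega>) \<le> cB * norm w)" for \<omega>
  have good_AE: "AE \<omega> in M. good \<omega>"
    using cA(2) AC(3) hemi Blin B(3)
  proof eventually_elim
    case (elim \<omega>)
    have "0 \<le> blinfun_apply (B w \<omega>) w" for w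
    proof -
      have "0 \<le> \<mu>B * (norm w)\<^sup>2" using B(1) by simp
      then show ?thesis using elim(5) order_trans by blast
    qed
    then show ?case using elim unfolding good_def by blast
  qed
  define Good where "Good = {\<omega> \<in> space M. good \<omega>}"
  have Good: "Good \<in> sets M" unfolding Good_def by (rule AE_measurable[OF good_AE])
  have Good_AE: "AE \<omega> in M. \<omega> \<in> Good"
    using good_AE AE_space by eventually_elim (simp add: Good_def)
  obtain Y1 where Y1: "progressive F T Y1" "versions M T v1 Y1"
      "(\<integral>\<^sup>+ (s, \<omega>). ennreal (norm (Y1 s \<omega>) powr p) \<partial>time_prob M T) < \<infinity>"
    using assms(16) unfolding solution_def Lproc_def by blast
  obtain Y2 where Y2: "progressive F T Y2" "versions M T v2 Y2"
      "(\<integral>\<^sup>+ (s, \<omega>). ennreal (norm (Y2 s \<omega>) powr p) \<partial>time_prob M T) < \<infinity>"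
    using assms(17) unfolding solution_def Lproc_def by blast
  have v1t: "continuous_process M T v1t" "versions M T v1t (\<lambda>t \<omega>. eB (eA (v1 t \<omega>)))"
    and v2t: "continuous_process M T v2t" "versions M T v2t (\<lambda>t \<omega>. eB (eA (v2 t \<omega>)))"
    using assms(16,17) unfolding solution_def by blast+
  obtain J1 where J1: "\<And>z. ito_series M F T W (\<lambda>j s \<omega>. inner (eB (eA z)) (C (u_of eA u0 v1 s \<omega>) (v1 s \<omega>) \<omega> j)) (J1 z)"
    "AE \<omega> in M. \<forall>t\<in>{0..T}. \<forall>z.
           inner (v1t t \<omega>) (eB (eA z))
             + (LINT s:{0..t}|lebesgue. blinfun_apply (A (v1 s \<omega>) \<omega>) z + blinfun_apply (B (u_of eA u0 v1 s \<omega>) \<omega>) (eA z))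
           = inner (v0 \<omega>) (eB (eA z)) + (LINT s:{0..t}|lebesgue. blinfun_apply (f s \<omega>) z) + J1 z t \<omega>"
    using assms(16) unfolding solution_def by blast
  obtain J2 where J2: "\<And>z. ito_series M F T W (\<lambda>j s \<omega>. inner (eB (eA z)) (C (u_of eA u0 v2 s \<omega>) (v2 s \<omega>) \<omega> j)) (J2 z)"
    "AE \<omega> in M. \<forall>t\<in>{0..T}. \<forall>z.
           inner (v2t t \<omega>) (eB (eA z))
             + (LINT s:{0..t}|lebesgue. blinfun_apply (A (v2 s \<omega>) \<omega>) z + blinfun_apply (B (u_of eA u0 v2 s \<omega>) \<omega>) (eA z))
           = inner (v0 \<omega>) (eB (eA z)) + (LINT s:{0..t}|lebesgue. blinfun_apply (f s \<omega>) z) + J2 z t \<omega>"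
    using assms(17) unfolding solution_def by blast
  have emb: "dense_embedding (blinfun_apply eA)" "dense_embedding (blinfun_apply eB)"
    using assms(6) unfolding embedding_chain_def by blast+
  have goodD: "\<omega> \<in> Good \<Longrightarrow> good \<omega>" for \<omega> by (simp add: Good_def)
  have pair: "solution_pair M F T W p cA lA lB cB eA eB A B C u0 v0 f v1 v2 Y1 Y2 v1t v2t J1 J2 Good"
    by (rule solution_pair.intro[OF wiener_basis_axioms], rule solution_pair_axioms.intro)
       (fact assms AC emb weak Good Good_AE Y1 Y2 v1t v2t J1 J2
         cA(1)[THEN less_imp_le] B(2)[THEN less_imp_le]
        | use C_ell2 in blast | (drule goodD, unfold good_def, blast))+
  have v_eq: "AE \<omega> in M. \<forall>t\<in>{0..T}. v1t t \<omega> = v2t t \<omega>"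
    and u_eq: "AE \<omega> in M. \<forall>t\<in>{0..T}. u_of eA u0 v1 t \<omega> = u_of eA u0 v2 t \<omega>"
    by (rule solution_pair.indistinguishable[OF pair])+
  have prob_1: "measure M {\<omega> \<in> space M. P \<omega>} = 1" if "AE \<omega> in M. P \<omega>" for P
    using prob_Collect_eq_1[OF AE_measurable[OF that]] that by simp
  show ?thesis
  proof
    show "measure M {\<omega> \<in> space M. (SUP t\<in>{0..T}. ennreal (norm (v1t t \<omega> - v2t t \<omega>))) = 0} = 1"
    proof (rule prob_1)
      show "AE \<omega> in M. (SUP t\<in>{0..T}. ennreal (norm (v1t t \<omega> - v2t t \<omega>))) = 0"
        using v_eq by eventually_elim (use \<open>T > 0\<close> in \<open>simp cong: SUP_cong_simp\<close>)
    qed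
    show "measure M {\<omega> \<in> space M. (SUP t\<in>{0..T}. ennreal (norm (u_of eA u0 v1 t \<omega> - u_of eA u0 v2 t \<omega>))) = 0} = 1"
    proof (rule prob_1)
      show "AE \<omega> in M. (SUP t\<in>{0..T}. ennreal (norm (u_of eA u0 v1 t \<omega> - u_of eA u0 v2 t \<omega>))) = 0"
        using u_eq by eventually_elim (use \<open>T > 0\<close> in \<open>simp cong: SUP_cong_simp\<close>)
    qed
  qed
qed

end
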